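(* For the life-like freezing cellular automaton $S22$ on the square grid, the problem \textsc{AsyncUnstability} is $\mathbf{NP}$-complete.
   Context: Cells have two states, $0$ (inactive) and $1$ (active). $G(n)$ is the $n\times n$ torus of cells, each cell $u$ having the 4 neighbors $N(u)$ of the von Neumann neighborhood (excluding $u$). Rule $S22$: $F(x)_u=1$ if $x_u=1$ or exactly two cells of $N(u)$ are active, and $F(x)_u=0$ otherwise. A sequential update scheme is a map $\sigma:\mathbb{N}\to G(n)$ such that each consecutive block of $|G(n)|$ steps is a permutation of the cells; $F^{\sigma(0)}(x)=x$ and at time $t$ only cell $\sigma(t)$ is updated by the local rule, all other cells keeping their state. \textsc{AsyncUnstability}: given $n$, a configuration $x\in\{0,1\}^{G(n)}$ and a cell $u$, decide whether there exist a sequential update scheme $\sigma$ and $T>0$ with $F^{\sigma(T)}(x)_u\neq x_u$. *)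

theory Defs
  imports "HOL-Computational_Algebra.Polynomial"
begin

section \<open>Deterministic multi-tape Turing machines\<close>

text \<open>
  States are \<open>0, \<dots>, states M\<close>, where \<open>0\<close> is initial and \<open>states M\<close> is the unique halting state.
  The tape alphabet is \<open>{..<symbols M}\<close>, with blank \<open>0\<close> and the two input symbols \<open>1\<close> and \<open>2\<close>.
  Only the values of \<open>delta M\<close> on non-halting states and on lists of \<open>tapes M\<close> tape symbols are
  relevant, so a well-formed machine is a finite object.
\<close>

datatype move = Left | Stay | Right

record tm =
  tapes :: nat
  symbols :: nat
  states :: nat
  delta :: "nat \<Rightarrow> nat list \<Rightarrow> nat \<times> (nat \<times> move) list"

definition wf_tm :: "tm \<Rightarrow> bool" where
  "wf_tm M \<longleftrightarrow> 3 \<le> symbols M \<and>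
     (\<forall>q < states M. \<forall>s. length s = tapes M \<and> set s \<subseteq> {..<symbols M} \<longrightarrow>
        (case delta M q s of (q', acts) \<Rightarrow>
           q' \<le> states M \<and> length acts = tapes M \<and> (\<forall>(a, d) \<in> set acts. a < symbols M)))"

text \<open>A tape is infinite in both directions and is given by its contents and its head position.\<close>

type_synonym tape = "(int \<Rightarrow> nat) \<times> int"

type_synonym tm_config = "nat \<times> tape list"

definition read :: "tape \<Rightarrow> nat" where
  "read tp = fst tp (snd tp)"

fun offset :: "move \<Rightarrow> int" where
  "offset Left = - 1"
| "offset Stay = 0"
| "offset Right = 1"

fun act :: "nat \<times> move \<Rightarrow> tape \<Rightarrow> tape" where
  "act (a, d) (f, h) = (f(h := a), h + offset d)"

fun step :: "tm \<Rightarrow> tm_config \<Rightarrow> tm_config" where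
  "step M (q, ts) =
     (if q = states M then (q, ts)
      else case delta M q (map read ts) of (q', acts) \<Rightarrow> (q', map2 act acts ts))"

definition bit_symbol :: "bool \<Rightarrow> nat" where
  "bit_symbol b = (if b then 2 else 1)"

definition input_tape :: "bool list \<Rightarrow> tape" where
  "input_tape w =
     ((\<lambda>i. if 0 \<le> i \<and> i < int (length w) then bit_symbol (w ! nat i) else 0), 0)"

text \<open>The \<open>i\<close>-th input word is written on tape \<open>i\<close>; all further tapes are blank.\<close>

definition init_config :: "tm \<Rightarrow> bool list list \<Rightarrow> tm_config" where
  "init_config M ws =
     (0, map input_tape ws @ replicate (tapes M - length ws) (input_tape []))"

text \<open>
  The output is the word on tape \<open>0\<close> that starts at cell \<open>0\<close> and ends before the next blank.
\<close>

definition outputs :: "tape list \<Rightarrow> bool list \<Rightarrow> bool" where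
  "outputs ts w \<longleftrightarrow>
     (\<forall>i < length w. fst (ts ! 0) (int i) = bit_symbol (w ! i)) \<and>
     fst (ts ! 0) (int (length w)) = 0"

text \<open>
  Halting configurations are fixed points of \<open>step M\<close>, so the following says that \<open>M\<close>
  halts within at most \<open>t\<close> steps.
\<close>

definition computes_within :: "tm \<Rightarrow> bool list list \<Rightarrow> bool list \<Rightarrow> nat \<Rightarrow> bool" where
  "computes_within M ws out t \<longleftrightarrow> length ws \<le> tapes M \<and>
     (case (step M ^^ t) (init_config M ws) of (q, ts) \<Rightarrow> q = states M \<and> outputs ts out)"


section \<open>NP-completeness\<close>

type_synonym language = "bool list set"

definition poly_time_computable :: "(bool list \<Rightarrow> bool list) \<Rightarrow> bool" where
  "poly_time_computable f \<longleftrightarrow>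
     (\<exists>M (p :: nat poly). wf_tm M \<and>
        (\<forall>x. computes_within M [x] (f x) (poly p (length x))))"

definition poly_time_decidable2 :: "(bool list \<Rightarrow> bool list \<Rightarrow> bool) \<Rightarrow> bool" where
  "poly_time_decidable2 V \<longleftrightarrow>
     (\<exists>M (p :: nat poly). wf_tm M \<and>
        (\<forall>x c. computes_within M [x, c] [V x c] (poly p (length x + length c))))"

definition NP :: "language set" where
  "NP = {L. \<exists>V (q :: nat poly). poly_time_decidable2 V \<and>
            (\<forall>x. x \<in> L \<longleftrightarrow> (\<exists>c. length c \<le> poly q (length x) \<and> V x c))}"

definition poly_time_reducible :: "language \<Rightarrow> language \<Rightarrow> bool" where
  "poly_time_reducible L L' \<longleftrightarrow>
     (\<exists>f. poly_time_computable f \<and> (\<forall>x. x \<in> L \<longleftrightarrow> f x \<in> L'))"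

definition NP_complete :: "language \<Rightarrow> bool" where
  "NP_complete L \<longleftrightarrow> L \<in> NP \<and> (\<forall>L' \<in> NP. poly_time_reducible L' L)"


section \<open>Cellular automata on the square torus\<close>

type_synonym cell = "nat \<times> nat"

text \<open>Only the values of a configuration on the cells of the torus at hand are relevant.\<close>

type_synonym configuration = "cell \<Rightarrow> bool"

definition torus :: "nat \<Rightarrow> cell set" where
  "torus n = {..<n} \<times> {..<n}"

text \<open>These are four distinct cells if \<open>n \<ge> 3\<close>, two if \<open>n = 2\<close>, and none if \<open>n = 1\<close>.\<close>

fun neighbors :: "nat \<Rightarrow> cell \<Rightarrow> cell set" where
  "neighbors n (i, j) =
     {((i + 1) mod n, j), ((i + n - 1) mod n, j),
      (i, (j + 1) mod n), (i, (j + n - 1) mod n)} - {(i, j)}"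

definition S22 :: "nat \<Rightarrow> configuration \<Rightarrow> configuration" where
  "S22 n x u \<longleftrightarrow> x u \<or> card {v \<in> neighbors n u. x v} = 2"

text \<open>
  Updates happen at the times \<open>t \<ge> 1\<close>, time \<open>0\<close> being the initial configuration; the blocks
  therefore start at \<open>1\<close>, and the value \<open>\<sigma> 0\<close> is never used.
\<close>

definition sequential_update_scheme :: "nat \<Rightarrow> (nat \<Rightarrow> cell) \<Rightarrow> bool" where
  "sequential_update_scheme n \<sigma> \<longleftrightarrow>
     (\<forall>t. \<sigma> t \<in> torus n) \<and>
     (\<forall>k. bij_betw \<sigma> {k * card (torus n) + 1 .. (k + 1) * card (torus n)} (torus n))"

fun async_orbit ::
    "(configuration \<Rightarrow> configuration) \<Rightarrow> (nat \<Rightarrow> cell) \<Rightarrow> configuration \<Rightarrow> nat \<Rightarrow> configuration" where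
  "async_orbit F \<sigma> x 0 = x"
| "async_orbit F \<sigma> x (Suc t) =
     (async_orbit F \<sigma> x t)(\<sigma> (Suc t) := F (async_orbit F \<sigma> x t) (\<sigma> (Suc t)))"

definition async_unstable ::
    "(nat \<Rightarrow> configuration \<Rightarrow> configuration) \<Rightarrow> nat \<Rightarrow> configuration \<Rightarrow> cell \<Rightarrow> bool" where
  "async_unstable F n x u \<longleftrightarrow>
     (\<exists>\<sigma> T. sequential_update_scheme n \<sigma> \<and> T > 0 \<and> async_orbit (F n) \<sigma> x T u \<noteq> x u)"

text \<open>
  Instances are written as bit strings: \<open>n\<close> in unary, the \<open>n\<^sup>2\<close> states in row-major order, and
  the two coordinates of the cell in unary. The states already take \<open>n\<^sup>2\<close> bits, so unary
  notation changes the length of an instance by a polynomial factor only.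
\<close>

definition unary :: "nat \<Rightarrow> bool list" where
  "unary n = replicate n True @ [False]"

fun encode_instance :: "nat \<Rightarrow> configuration \<Rightarrow> cell \<Rightarrow> bool list" where
  "encode_instance n x (i, j) =
     unary n @ concat (map (\<lambda>r. map (\<lambda>c. x (r, c)) [0..<n]) [0..<n]) @ unary i @ unary j"

definition AsyncUnstability :: "(nat \<Rightarrow> configuration \<Rightarrow> configuration) \<Rightarrow> language" where
  "AsyncUnstability F = {encode_instance n x u | n x u. u \<in> torus n \<and> async_unstable F n x u}"

end

(*
  Cells never become inactive again, so only the order of the activations matters: an instance is positive
  iff the cell can be activated by a sequence of activations of inactive cells that have exactly two active
  neighbours. Such a sequence visits a cell at most once; this gives short certificates.

  Hardness. A computation of a verifier is a tiling of a helical strip, and a tiling problem is a set of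
  clauses. Clauses are built from cells as a matrix whose columns carry the literals downwards and whose
  rows collect the literals of a clause from left to right; a last column forms the conjunction. The
  only source of nondeterminism are two adjacent cells with two active neighbours each: whichever is activated
  first blocks the other one. Such choices give the truth values, and they also make it
  possible that two signals cross. That no pattern of cells lets signals leak is certified by sets that are
  closed under activation. The pattern of a matrix entry only depends on local data of the tiling, so a
  Turing machine can write the instance in polynomial time with a few nested loops.
*)
theory Submission imports Defs begin

section \<open>Asynchronous activation\<close>

text \<open>The rule asks for exactly two active neighbours, so it is not monotone: one activation
  too many blocks a cell forever. The two directions treat this differently. For soundness, "exactly
  two" is weakened to "at least two"; what the weakening loses is put back by the cells that are
  dead from the start and, once a run has fixed its choices, by one excluded cell per choice. For
  completeness the activations are scheduled explicitly: a rank on the gates ensures that signals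
  arrive before a gate is worked on and that nothing has come back through its outputs.
  \<open>And\<close> and \<open>Or\<close> are monotone and the layout is planar, so signals cross
  by guessing permissions. Hence soundness is needed for every choice, completeness only for one.
  The strip of sites is helical because then both neighbours of a site \<open>s\<close> have a
  constant offset, \<open>s + 1\<close> and \<open>s + N\<close>, also at the end of a row: one word
  shifted along the sites tells the machine which pattern to write. The torus would allow cyclic
  dependencies between signals. An empty top row of blocks and a last column that emits nothing cut
  it open.\<close>

inductive reach :: "nat \<Rightarrow> configuration \<Rightarrow> configuration \<Rightarrow> bool" for n x where
  reach_refl: "reach n x x"
| reach_step: "reach n x y \<Longrightarrow> u \<in> torus n \<Longrightarrow> \<not> y u \<Longrightarrow> card {v \<in> neighbors n u. y v} = 2
    \<Longrightarrow> reach n x (y(u := True))"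

lemma reach_mono: "reach n x y \<Longrightarrow> x u \<Longrightarrow> y u"
  by (induction rule: reach.induct) auto

lemma reach_trans: "reach n y z \<Longrightarrow> reach n x y \<Longrightarrow> reach n x z"
  by (induction rule: reach.induct) (auto intro: reach.intros)

lemma reach_of_orbit:
  assumes "sequential_update_scheme n \<sigma>"
  shows "reach n x (async_orbit (S22 n) \<sigma> x t)"
proof (induction t)
  case 0
  show ?case by (simp add: reach_refl)
next
  case (Suc t)
  let ?y = "async_orbit (S22 n) \<sigma> x t" and ?u = "\<sigma> (Suc t)"
  have u: "?u \<in> torus n"
    using assms by (simp add: sequential_update_scheme_def)
  show ?case
  proof (cases "\<not> ?y ?u \<and> S22 n ?y ?u")
    case True
    then have "reach n x (?y(?u := True))"
      using reach_step[OF Suc u] S22_def[of n ?y ?u] by blast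
    moreover have "S22 n ?y ?u = True"
      using True by simp
    ultimately show ?thesis
      by (simp only: async_orbit.simps)
  next
    case False
    then have "?y(?u := S22 n ?y ?u) = ?y"
      using S22_def[of n ?y ?u] by (auto simp: fun_upd_idem_iff)
    then show ?thesis
      using Suc by simp
  qed
qed

text \<open>Every step activates a cell that is still inactive, so the activations form a list
  without repetitions. This list becomes the beginning of an update scheme here and a short
  certificate in the membership proof.\<close>

lemma reach_listE:
  assumes "reach n x y"
  obtains us where "distinct us" "set us \<subseteq> torus n" "\<And>u. y u \<longleftrightarrow> x u \<or> u \<in> set us"
    "\<And>u. u \<in> set us \<Longrightarrow> \<not> x u"
    "\<And>k. k < length us \<Longrightarrow>
       card {v \<in> neighbors n (us ! k). x v \<or> v \<in> set (take k us)} = 2"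
  using assms
proof (induction arbitrary: thesis rule: reach.induct)
  case reach_refl
  show ?case by (rule reach_refl[of "[]"]) auto
next
  case (reach_step y u)
  obtain us where us: "distinct us" "set us \<subseteq> torus n" "\<And>u. y u \<longleftrightarrow> x u \<or> u \<in> set us"
    "\<And>u. u \<in> set us \<Longrightarrow> \<not> x u"
    "\<And>k. k < length us \<Longrightarrow>
       card {v \<in> neighbors n (us ! k). x v \<or> v \<in> set (take k us)} = 2"
    using reach_step.IH by blast
  show ?case
  proof (rule reach_step.prems[of "us @ [u]"])
    fix k assume "k < length (us @ [u])"
    then show "card {v \<in> neighbors n ((us @ [u]) ! k). x v \<or> v \<in> set (take k (us @ [u]))} = 2"
      using us(5)[of k] reach_step.hyps(4) us(3)
      by (cases "k = length us") (auto simp: nth_append)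
  qed (use us reach_step.hyps in auto)
qed

text \<open>
  Freezing makes every cell change at most once, so any sequence of activations fits
  into the first block of an update scheme.
\<close>

lemma orbit_of_list:
  assumes us: "distinct us" "set us \<subseteq> torus n" "\<And>u. u \<in> set us \<Longrightarrow> \<not> x u"
    "\<And>k. k < length us \<Longrightarrow>
       card {v \<in> neighbors n (us ! k). x v \<or> v \<in> set (take k us)} = 2"
    and \<sigma>: "\<And>k. k < length us \<Longrightarrow> \<sigma> (Suc k) = us ! k" and "k \<le> length us"
  shows "async_orbit (S22 n) \<sigma> x k = (\<lambda>u. x u \<or> u \<in> set (take k us))"
  using \<open>k \<le> length us\<close>
proof (induction k)
  case 0
  show ?case by simp
next
  case (Suc k)
  then have k: "k < length us" by simp
  have "S22 n (\<lambda>u. x u \<or> u \<in> set (take k us)) (us ! k)"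
    using us(4)[OF k] S22_def by blast
  moreover have "async_orbit (S22 n) \<sigma> x k = (\<lambda>u. x u \<or> u \<in> set (take k us))"
    using Suc by simp
  ultimately have "async_orbit (S22 n) \<sigma> x (Suc k) =
      (\<lambda>u. x u \<or> u \<in> set (take k us))(us ! k := True)"
    using \<sigma>[OF k] by simp
  then show ?case
    using k by (auto simp: take_Suc_conv_app_nth fun_eq_iff)
qed

lemma finite_torus [simp]: "finite (torus n)"
  by (simp add: torus_def)

lemma finite_neighbors [simp]: "finite (neighbors n u)"
  by (cases u) simp

lemma not_neighbor_self [simp]: "u \<notin> neighbors n u"
  by (cases u) simp

lemma scheme_exists:
  assumes us: "distinct us" "set us \<subseteq> torus n" and n: "torus n \<noteq> {}"
  obtains \<sigma> where "sequential_update_scheme n \<sigma>" "\<And>k. k < length us \<Longrightarrow> \<sigma> (Suc k) = us ! k"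
proof -
  obtain vs where vs: "set vs = torus n - set us" "distinct vs"
    using finite_distinct_list[of "torus n - set us"] by auto
  define ws where "ws = us @ vs"
  have ws: "distinct ws" "set ws = torus n"
    using us vs by (auto simp: ws_def)
  define N where "N = card (torus n)"
  have N: "length ws = N"
    using ws distinct_card N_def by metis
  have N0: "N > 0"
    using n by (simp add: N_def card_gt_0_iff)
  \<comment> \<open>The index is \<open>t - 1\<close> modulo \<open>N\<close>, as the blocks start
    at time 1. The scheme repeats a single enumeration of the torus that begins with
    \<open>us\<close>.\<close>
  define \<sigma> where "\<sigma> = (\<lambda>t. ws ! ((t + (N - 1)) mod N))"
  have \<sigma>_block: "bij_betw \<sigma> {k * N + 1..(k + 1) * N} (torus n)" for k
  proof -
    have "bij_betw (\<lambda>t. t - (k * N + 1)) {k * N + 1..(k + 1) * N} {..<N}"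
      by (rule bij_betw_byWitness[where f' = "\<lambda>i. i + (k * N + 1)"]) (use N0 in auto)
    moreover have "bij_betw ((!) ws) {..<N} (torus n)"
      using bij_betw_nth[OF ws(1)] N ws(2) by auto
    ultimately have "bij_betw ((!) ws \<circ> (\<lambda>t. t - (k * N + 1))) {k * N + 1..(k + 1) * N} (torus n)"
      by (rule bij_betw_trans)
    moreover have "\<sigma> t = ((!) ws \<circ> (\<lambda>t. t - (k * N + 1))) t" if "t \<in> {k * N + 1..(k + 1) * N}" for t
    proof -
      have "t + (N - 1) = (t - (k * N + 1)) + (k + 1) * N"
        using that N0 by (auto simp: algebra_simps)
      moreover have "t - (k * N + 1) < N"
        using that N0 by auto
      ultimately have "(t + (N - 1)) mod N = t - (k * N + 1)"
        by (metis mod_less mod_mult_self1)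
      then show ?thesis
        by (simp add: \<sigma>_def)
    qed
    ultimately show ?thesis
      using bij_betw_cong[of "{k * N + 1..(k + 1) * N}" \<sigma> "(!) ws \<circ> (\<lambda>t. t - (k * N + 1))"]
      by blast
  qed
  have "\<sigma> t \<in> torus n" for t
    using N N0 ws(2) by (metis \<sigma>_def mod_less_divisor nth_mem)
  then have "sequential_update_scheme n \<sigma>"
    using \<sigma>_block by (auto simp: sequential_update_scheme_def N_def)
  moreover have "\<sigma> (Suc k) = us ! k" if "k < length us" for k
  proof -
    have "k < N" using that N by (simp add: ws_def)
    moreover have "Suc k + (N - 1) = k + N" using N0 by simp
    ultimately have "(Suc k + (N - 1)) mod N = k" by simp
    then show ?thesis
      using that by (simp add: \<sigma>_def ws_def nth_append del: add_Suc)
  qed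
  ultimately show ?thesis
    using that by blast
qed

lemma async_unstable_iff_reach:
  assumes "u \<in> torus n"
  shows "async_unstable S22 n x u \<longleftrightarrow> \<not> x u \<and> (\<exists>y. reach n x y \<and> y u)"
proof
  assume "async_unstable S22 n x u"
  then obtain \<sigma> T where \<sigma>: "sequential_update_scheme n \<sigma>"
    and ne: "async_orbit (S22 n) \<sigma> x T u \<noteq> x u"
    by (auto simp: async_unstable_def)
  then show "\<not> x u \<and> (\<exists>y. reach n x y \<and> y u)"
    using reach_of_orbit[OF \<sigma>, of x T] reach_mono by blast
next
  assume *: "\<not> x u \<and> (\<exists>y. reach n x y \<and> y u)"
  then obtain y where "reach n x y" and y: "y u" by blast
  then obtain us where us: "distinct us" "set us \<subseteq> torus n" "\<And>u. y u \<longleftrightarrow> x u \<or> u \<in> set us"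
    "\<And>u. u \<in> set us \<Longrightarrow> \<not> x u"
    "\<And>k. k < length us \<Longrightarrow>
       card {v \<in> neighbors n (us ! k). x v \<or> v \<in> set (take k us)} = 2"
    using reach_listE by blast
  obtain \<sigma> where \<sigma>: "sequential_update_scheme n \<sigma>" "\<And>k. k < length us \<Longrightarrow> \<sigma> (Suc k) = us ! k"
    using scheme_exists[OF us(1,2)] assms by blast
  have "async_orbit (S22 n) \<sigma> x (length us) = y"
    using orbit_of_list[OF us(1,2,4,5) \<sigma>(2), of "length us"] us(3) by (auto simp: fun_eq_iff)
  moreover have "length us > 0"
    using us(3)[of u] y * by auto
  ultimately show "async_unstable S22 n x u"
    unfolding async_unstable_def using \<sigma>(1) y * by blast
qed

text \<open>Closedness is relative to one run that ends in \<open>y\<close>: cells that are inactive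
  in \<open>y\<close> impose no condition, so \<open>S\<close> may depend on the choices made by the
  run. The set \<open>S\<close> bounds \<open>z\<close> from above, so at most one neighbour in
  \<open>S\<close> excludes an activation; three neighbours active in \<open>x\<close> stay active
  and exclude it as well.\<close>

lemma reach_closed:
  assumes "reach n x z" and "reach n z y"
    and base: "\<And>u. u \<in> torus n \<Longrightarrow> x u \<Longrightarrow> u \<in> S"
    and closed: "\<And>u. u \<in> torus n \<Longrightarrow> u \<notin> S \<Longrightarrow> \<not> y u \<or>
       card {v \<in> neighbors n u. v \<in> S} \<le> 1 \<or> card {v \<in> neighbors n u. x v} \<ge> 3"
    and "u \<in> torus n" "z u"
  shows "u \<in> S"
  using assms(1,2,5,6)
proof (induction arbitrary: u rule: reach.induct)
  case reach_refl
  then show ?case using base by blast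
next
  case (reach_step z v)
  have zy: "reach n z y"
    by (rule reach_trans[OF reach_step.prems(1) reach.reach_step[OF reach_refl reach_step.hyps(2-4)]])
  have IH: "w \<in> S" if "w \<in> torus n" "z w" for w
    using reach_step.IH[OF zy] that by blast
  show ?case
  proof (cases "u = v")
    case False
    then show ?thesis using reach_step.prems IH by auto
  next
    case True
    have fin: "finite (neighbors n v)"
      by (cases v) simp
    have nb: "neighbors n v \<subseteq> torus n"
      using \<open>v \<in> torus n\<close> by (cases v) (auto simp: torus_def)
    have "y v"
      using reach_mono[OF reach_step.prems(1), of v] by simp
    have "card {w \<in> neighbors n v. z w} \<le> card {w \<in> neighbors n v. w \<in> S}"
      using IH nb fin by (intro card_mono) auto
    moreover have "card {w \<in> neighbors n v. x w} \<le> card {w \<in> neighbors n v. z w}"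
      using reach_mono[OF reach_step.hyps(1)] fin by (intro card_mono) auto
    ultimately show ?thesis
      using closed[of v] \<open>y v\<close> reach_step.hyps(2,4) True
      by (metis (no_types, lifting) le_trans not_less_eq_eq numeral_2_eq_2 numeral_3_eq_3 One_nat_def)
  qed
qed

text \<open>Two adjacent cells with two active neighbours each: the first one to be activated
  leaves the other one with at least three active neighbours forever.\<close>

lemma reach_exclusive:
  assumes "reach n x y" and adj: "p \<in> neighbors n q" "q \<in> neighbors n p" and np: "\<not> x p" "\<not> x q"
    and c: "card {v \<in> neighbors n p. x v} \<ge> 2" "card {v \<in> neighbors n q. x v} \<ge> 2"
  shows "\<not> (y p \<and> y q)"
  using assms(1)
proof (induction rule: reach.induct)
  case reach_refl
  then show ?case using np by simp
next
  case (reach_step y u)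
  have *: "card {v \<in> neighbors n a. y v} \<ge> 3"
    if "y b" "b \<in> neighbors n a" "\<not> x b" "card {v \<in> neighbors n a. x v} \<ge> 2" for a b
  proof -
    have fin: "finite (neighbors n a)" by (cases a) simp
    have "card (insert b {v \<in> neighbors n a. x v}) \<le> card {v \<in> neighbors n a. y v}"
      using that reach_mono[OF reach_step.hyps(1)] fin by (intro card_mono) auto
    then show ?thesis
      using that fin by simp
  qed
  show ?case
    using reach_step *[of q p] *[of p q] adj np c not_neighbor_self[of q n] by (auto split: if_splits)
qed

lemma card_neighbors:
  assumes "n \<ge> 3" "i < n" "j < n"
  shows "card {v \<in> neighbors n (i, j). P v} =
    of_bool (P ((i + 1) mod n, j)) + of_bool (P ((i + n - 1) mod n, j)) +
    of_bool (P (i, (j + 1) mod n)) + of_bool (P (i, (j + n - 1) mod n))"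
proof -
  have s: "(k + 1) mod n \<noteq> k" "(k + n - 1) mod n \<noteq> k" "(k + 1) mod n \<noteq> (k + n - 1) mod n"
    if "k < n" for k
  proof -
    have "(k + 1) mod n = (if k = n - 1 then 0 else k + 1)"
      using that by auto
    moreover have "(k + n - 1) mod n = (if k = 0 then n - 1 else k - 1)"
      using that by (cases k) (auto simp: mod_Suc)
    ultimately show "(k + 1) mod n \<noteq> k" "(k + n - 1) mod n \<noteq> k" "(k + 1) mod n \<noteq> (k + n - 1) mod n"
      using that assms(1) by auto
  qed
  let ?a = "((i + 1) mod n, j)" and ?b = "((i + n - 1) mod n, j)"
    and ?c = "(i, (j + 1) mod n)" and ?d = "(i, (j + n - 1) mod n)"
  have nb: "neighbors n (i, j) = {?a, ?b, ?c, ?d}"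
    using s[OF assms(2)] s[OF assms(3)] by auto
  have dist: "?a \<noteq> ?b" "?a \<noteq> ?c" "?a \<noteq> ?d" "?b \<noteq> ?c" "?b \<noteq> ?d" "?c \<noteq> ?d"
    using s[OF assms(2)] s[OF assms(3)] by auto
  have "card {v \<in> neighbors n (i, j). P v} = (\<Sum>v\<in>{?a, ?b, ?c, ?d}. of_bool (P v))"
    unfolding nb by (simp add: Int_def)
  also have "\<dots> = of_bool (P ?a) + (of_bool (P ?b) + (of_bool (P ?c) + of_bool (P ?d)))"
    using dist by (simp del: sum_of_bool_eq)
  finally show ?thesis
    by simp
qed

section \<open>Gates as patterns of 24 by 24 cells\<close>

datatype gate = Blank | Or | And | Choice | Node

datatype side = L_side | T_side | R_side | B_side

datatype kind = Or_Left | Or_Top | And_Both | Choose_Right | Choose_Bottom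
  | Node_Left | Node_Bottom | Node_Top | Node_Right

text \<open>
  Row \<open>r\<close> of a pattern is a number whose bit \<open>c\<close> is the state of cell \<open>(r, c)\<close>. The ports are the
  border cells in row and column 17; they are supported by active cells in row and column 16.

  All patterns rely on bootstrap percolation: as long as no cell has three active neighbours,
  the active set grows by merging rectangles at distance at most 2 into their bounding box.
  A signal is a growing rectangle. A growing rectangle stops at a concave corner only because of
  cells with three initially active neighbours, which never become active.

  \<open>closed_rows g l t c\<close> is a set of cells that is closed under activation if \<open>l\<close> and \<open>t\<close> tell
  whether signals arrive from the left and from the top, and \<open>c\<close> is the choice made by a
  \<open>Choice\<close> gate. \<open>activation k\<close> is a sequence of activations that carries signals through a gate.
\<close>

fun active_rows :: "gate \<Rightarrow> nat list" where
  "active_rows Blank = replicate 24 0"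
| "active_rows Or =
     [65536, 5505024, 2621440, 4456448, 1048576, 524288, 1048576, 131072, 0, 65536, 65536,
     0, 131072, 0, 5324800, 2129920, 12600833, 4224, 262154, 36, 4210770, 2129924, 5324810,
     65536]"
| "active_rows And =
     [65536, 65536, 65536, 65536, 65536, 65536, 65536, 589824, 65536, 65536, 65536, 0,
     131072, 0, 5324800, 2129920, 12601343, 4096, 0, 128, 4210688, 2129920, 5324800, 65536]"
| "active_rows Choice =
     [0, 0, 0, 0, 0, 0, 0, 0, 0, 0, 0, 0, 0, 0, 0, 0, 12648448, 131072, 655360, 655360,
     1048576, 0, 65536, 65536]"
| "active_rows Node =
     [65536, 65536, 65536, 65536, 65536, 65536, 65536, 65536, 65536, 65536, 65536, 65536,
     65536, 65536, 5324800, 2129920, 12615679, 262144, 262144, 262144, 4210688, 2129920,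
     5324800, 65536]"

fun closed_rows :: "gate \<Rightarrow> bool \<Rightarrow> bool \<Rightarrow> bool \<Rightarrow> nat list" where
  "closed_rows Blank l t c = replicate 24 0"
| "closed_rows Or False False c =
     [65536, 5505024, 2621440, 8257536, 8257536, 917504, 1966080, 1966080, 0, 65536, 65536,
     0, 131072, 0, 5324800, 3244032, 15844865, 4344, 262394, 252, 7454938, 3244060, 5324826,
     65536]"
| "closed_rows Or False True c =
     [2031616, 5701632, 2818048, 8323072, 8323072, 983040, 2031616, 2031616, 2031616,
     2031616, 2031616, 2031616, 2031616, 2031616, 6242304, 4161536, 16777209, 16777208,
     16777210, 16777212, 16777178, 4161564, 6242330, 2031616]"
| "closed_rows Or True False c =
     [65536, 5505024, 2621440, 8323072, 8323072, 983040, 2031616, 2031616, 2031616, 2031616,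
     2031616, 2031616, 2031616, 2031616, 6242304, 4161536, 16777215, 16777215, 16777211,
     16777213, 16777179, 4161564, 6242330, 2031616]"
| "closed_rows Or True True c =
     [2031616, 5701632, 2818048, 8323072, 8323072, 983040, 2031616, 2031616, 2031616,
     2031616, 2031616, 2031616, 2031616, 2031616, 6242304, 4161536, 16777215, 16777215,
     16777211, 16777213, 16777179, 4161564, 6242330, 2031616]"
| "closed_rows And False False c =
     [65536, 65536, 65536, 65536, 65536, 65536, 65536, 589824, 65536, 65536, 65536, 0,
     131072, 0, 5324800, 3244032, 15845375, 4096, 0, 128, 7454720, 3244032, 5324800, 65536]"
| "closed_rows And False True c =
     [2031616, 2031616, 2031616, 2031616, 2031616, 2031616, 2031616, 2031616, 2031616,
     2031616, 2031616, 2031616, 2031616, 2031616, 6242304, 4161536, 16762879, 4096, 0, 128,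
     7454720, 3244032, 5324800, 65536]"
| "closed_rows And True False c =
     [65536, 65536, 65536, 65536, 65536, 65536, 65536, 589824, 65536, 65536, 65536, 0,
     131072, 0, 5324800, 3244032, 15859711, 131071, 131071, 131071, 7471103, 3244032,
     5324800, 65536]"
| "closed_rows And True True c =
     [2031616, 2031616, 2031616, 2031616, 2031616, 2031616, 2031616, 2031616, 2031616,
     2031616, 2031616, 2031616, 2031616, 2031616, 6242304, 4161536, 16777215, 16777215,
     16777215, 16777215, 16777215, 4161536, 6242304, 2031616]"
| "closed_rows Choice l t True =
     [0, 0, 0, 0, 0, 0, 0, 0, 0, 0, 0, 0, 0, 0, 0, 0, 16711680, 16711680, 16711680,
     16449536, 16252928, 0, 65536, 65536]"
| "closed_rows Choice l t False =
     [0, 0, 0, 0, 0, 0, 0, 0, 0, 0, 0, 0, 0, 0, 0, 0, 12779520, 196608, 1769472, 2031616,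
     2031616, 2031616, 2031616, 2031616]"
| "closed_rows Node False t c =
     [65536, 65536, 65536, 65536, 65536, 65536, 65536, 65536, 65536, 65536, 65536, 65536,
     65536, 65536, 5324800, 3244032, 15859711, 262144, 262144, 262144, 7454720, 3244032,
     5324800, 65536]"
| "closed_rows Node True t c =
     [2031616, 2031616, 2031616, 2031616, 2031616, 2031616, 2031616, 2031616, 2031616,
     2031616, 2031616, 2031616, 2031616, 2031616, 6242304, 4161536, 16777215, 16777215,
     16777215, 16777215, 16777215, 4161536, 6242304, 2031616]"

fun activation :: "kind \<Rightarrow> (nat \<times> nat) list" where
  "activation Or_Left =
     [(15, 20), (21, 16), (19, 4), (19, 6), (17, 0), (16, 21), (20, 15), (18, 4), (16, 15),
     (18, 5), (15, 16), (17, 1), (20, 16), (16, 1), (16, 16), (16, 20), (18, 6), (18, 7),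
     (17, 6), (17, 5), (17, 4), (17, 3), (17, 2), (16, 2), (16, 3), (16, 4), (16, 5), (16,
     6), (16, 7), (16, 8), (17, 8), (18, 8), (17, 9), (17, 10), (17, 11), (18, 9), (18, 10),
     (16, 11), (16, 12), (18, 11), (18, 12), (16, 13), (17, 13), (17, 14), (18, 13), (17,
     15), (17, 16), (18, 14), (18, 15), (18, 16), (18, 17), (17, 17), (19, 16), (17, 18),
     (19, 17), (16, 17), (16, 18), (16, 19), (17, 19), (17, 20), (20, 17), (21, 17), (17,
     21), (22, 17), (17, 22), (17, 23), (23, 17)]"
| "activation Or_Top =
     [(20, 15), (16, 21), (4, 19), (6, 19), (0, 17), (21, 16), (15, 20), (4, 18), (15, 16),
     (5, 18), (16, 15), (1, 17), (16, 20), (1, 16), (16, 16), (20, 16), (6, 18), (7, 18),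
     (6, 17), (5, 17), (4, 17), (3, 17), (2, 17), (2, 16), (3, 16), (4, 16), (5, 16), (6,
     16), (7, 16), (8, 16), (8, 17), (8, 18), (9, 17), (10, 17), (11, 17), (9, 18), (10,
     18), (11, 16), (12, 16), (11, 18), (12, 18), (13, 16), (13, 17), (14, 17), (13, 18),
     (15, 17), (16, 17), (14, 18), (15, 18), (16, 18), (17, 18), (17, 17), (16, 19), (18,
     17), (17, 19), (17, 16), (18, 16), (19, 16), (19, 17), (20, 17), (17, 20), (17, 21),
     (21, 17), (17, 22), (22, 17), (23, 17), (17, 23)]"
| "activation And_Both =
     [(15, 20), (16, 15), (20, 15), (15, 16), (0, 17), (17, 0), (17, 1), (16, 21), (1, 17),
     (2, 17), (16, 20), (16, 16), (3, 17), (4, 17), (17, 2), (21, 16), (17, 3), (5, 17), (6,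
     17), (20, 16), (7, 17), (17, 4), (7, 18), (17, 5), (8, 17), (9, 17), (8, 18), (10, 17),
     (9, 18), (10, 18), (11, 17), (11, 16), (17, 6), (17, 7), (17, 8), (12, 16), (13, 16),
     (11, 18), (13, 17), (14, 17), (17, 9), (15, 17), (12, 18), (13, 18), (14, 18), (17,
     10), (18, 7), (18, 8), (15, 18), (17, 11), (16, 17), (16, 11), (16, 18), (16, 12), (16,
     13), (18, 9), (16, 19), (17, 13), (18, 10), (17, 14), (17, 15), (18, 11), (18, 12),
     (17, 16), (17, 17), (18, 13), (18, 14), (17, 18), (18, 15), (18, 16), (17, 19), (18,
     17), (17, 20), (19, 16), (19, 17), (20, 17), (21, 17), (17, 21), (17, 22), (22, 17),
     (23, 17), (17, 23)]"
| "activation Choose_Right =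
     [(16, 17), (19, 20), (18, 20), (18, 18), (17, 18), (16, 18), (17, 19), (16, 19), (17,
     20), (16, 20), (16, 21), (17, 21), (17, 22), (17, 23)]"
| "activation Choose_Bottom =
     [(17, 16), (19, 18), (20, 19), (20, 18), (20, 17), (18, 16), (19, 16), (20, 16), (21,
     16), (21, 17), (22, 17), (23, 17)]"
| "activation Node_Left =
     [(16, 15), (17, 0), (17, 1), (15, 16), (16, 16), (17, 2), (17, 3), (17, 4), (17, 5),
     (17, 6), (17, 7), (17, 8), (17, 9), (17, 10), (17, 11), (17, 12), (17, 13), (17, 14),
     (17, 15), (17, 16), (17, 17), (16, 17), (15, 17), (14, 17), (13, 17), (12, 17), (11,
     17), (10, 17), (9, 17), (8, 17), (7, 17), (6, 17), (5, 17), (4, 17), (3, 17), (2, 17),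
     (1, 17), (0, 17)]"
| "activation Node_Bottom =
     [(23, 17), (22, 17), (16, 15), (21, 16), (16, 21), (15, 20), (21, 17), (15, 16), (16,
     20), (20, 15), (16, 16), (20, 16), (20, 17), (19, 17), (18, 17), (17, 17), (16, 17),
     (16, 18), (16, 19), (17, 19), (15, 17), (17, 20), (17, 21), (17, 22), (14, 17), (17,
     23), (13, 17), (12, 17), (11, 17), (10, 17), (9, 17), (8, 17), (7, 17), (6, 17), (5,
     17), (4, 17), (3, 17), (2, 17), (1, 17), (0, 17)]"
| "activation Node_Top =
     [(16, 15), (15, 16), (16, 16), (0, 17), (1, 17), (2, 17), (3, 17), (4, 17), (5, 17),
     (6, 17), (7, 17), (8, 17), (9, 17), (10, 17), (11, 17), (12, 17), (13, 17), (14, 17),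
     (15, 17), (16, 17), (17, 17), (17, 16), (17, 15), (17, 14), (17, 13), (17, 12), (17,
     11), (17, 10), (17, 9), (17, 8), (17, 7), (17, 6), (17, 5), (17, 4), (17, 3), (17, 2),
     (17, 1), (17, 0)]"
| "activation Node_Right =
     [(15, 16), (15, 20), (16, 15), (16, 21), (16, 20), (17, 23), (16, 16), (20, 15), (17,
     22), (17, 21), (21, 16), (20, 16), (17, 20), (17, 19), (16, 19), (16, 18), (16, 17),
     (17, 17), (17, 16), (18, 17), (17, 15), (17, 14), (17, 13), (19, 17), (20, 17), (17,
     12), (21, 17), (22, 17), (23, 17), (17, 11), (17, 10), (17, 9), (17, 8), (17, 7), (17,
     6), (17, 5), (17, 4), (17, 3), (17, 2), (17, 1), (17, 0)]"

unbundle bit_operations_syntax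

fun gate_of :: "kind \<Rightarrow> gate" where
  "gate_of Or_Left = Or" | "gate_of Or_Top = Or" | "gate_of And_Both = And"
| "gate_of Choose_Right = Choice" | "gate_of Choose_Bottom = Choice"
| "gate_of Node_Left = Node" | "gate_of Node_Bottom = Node"
| "gate_of Node_Top = Node" | "gate_of Node_Right = Node"

fun ins :: "kind \<Rightarrow> side set" where
  "ins Or_Left = {L_side}" | "ins Or_Top = {T_side}" | "ins And_Both = {L_side, T_side}"
| "ins Choose_Right = {}" | "ins Choose_Bottom = {}"
| "ins Node_Left = {L_side}" | "ins Node_Bottom = {B_side}"
| "ins Node_Top = {T_side}" | "ins Node_Right = {R_side}"

fun outs :: "kind \<Rightarrow> side set" where
  "outs Or_Left = {R_side, B_side}" | "outs Or_Top = {R_side, B_side}"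
| "outs And_Both = {R_side, B_side}"
| "outs Choose_Right = {R_side}" | "outs Choose_Bottom = {B_side}"
| "outs Node_Left = {T_side}" | "outs Node_Bottom = {T_side, R_side}"
| "outs Node_Top = {L_side}" | "outs Node_Right = {L_side, B_side}"

text \<open>Bitwise thresholds treat all 24 cells of a row at once, so that closedness of a pattern
  becomes arithmetic on numerals that the simplifier can evaluate.\<close>

definition two_of :: "nat \<Rightarrow> nat \<Rightarrow> nat \<Rightarrow> nat \<Rightarrow> nat" where
  "two_of a b c d = (a AND b) OR ((a OR b) AND (c OR d)) OR (c AND d)"

definition three_of :: "nat \<Rightarrow> nat \<Rightarrow> nat \<Rightarrow> nat \<Rightarrow> nat" where
  "three_of a b c d = ((a AND b) AND (c OR d)) OR ((a OR b) AND (c AND d))"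

lemma bit_two_of: "bit (two_of a b c d) i \<longleftrightarrow>
    of_bool (bit a i) + of_bool (bit b i) + of_bool (bit c i) + of_bool (bit d i) \<ge> (2 :: nat)"
  by (auto simp: two_of_def bit_or_iff bit_and_iff)

lemma bit_three_of: "bit (three_of a b c d) i \<longleftrightarrow>
    of_bool (bit a i) + of_bool (bit b i) + of_bool (bit c i) + of_bool (bit d i) \<ge> (3 :: nat)"
  by (auto simp: three_of_def bit_or_iff bit_and_iff)

text \<open>Bit 16 is the support of a port. If a signal may cross the border, bits 17 to 20 are added: the port and
  three cells that are activated along with it. The exempt cell is the one that is not chosen.\<close>

definition border :: "bool \<Rightarrow> nat" where
  "border e = (if e then 2031616 else 65536)"

definition exempt :: "gate \<Rightarrow> bool \<Rightarrow> nat \<Rightarrow> nat" where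
  "exempt g c i = (if g = Choice \<and> i = (if c then 19 else 18) then 262144 else 0)"

definition row_above :: "nat list \<Rightarrow> nat \<Rightarrow> nat \<Rightarrow> nat" where
  "row_above S x i = (if i = 0 then x else S ! (i - 1))"

definition row_below :: "nat list \<Rightarrow> nat \<Rightarrow> nat \<Rightarrow> nat" where
  "row_below S x i = (if i = 23 then x else S ! (i + 1))"

definition row_left :: "nat list \<Rightarrow> bool \<Rightarrow> nat \<Rightarrow> nat" where
  "row_left S e i = 2 * S ! i + (if bit (border e) i then 1 else 0)"

definition row_right :: "nat list \<Rightarrow> bool \<Rightarrow> nat \<Rightarrow> nat" where
  "row_right S e i = S ! i div 2 + (if bit (border e) i then 8388608 else 0)"

text \<open>Adjacent patterns enter only through their worst case, the cells of
  \<open>border\<close> on the four sides. The conditions on bits 0 and 23, like those on rows 0 and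
  23 in \<open>gate_closed\<close>, ensure that every pattern itself stays within this worst case.
  For \<open>dead\<close>, cells outside the pattern count as inactive: an underestimate is on the
  safe side there.\<close>

definition row_closed :: "gate \<Rightarrow> bool \<Rightarrow> bool \<Rightarrow> bool \<Rightarrow> bool \<Rightarrow> bool \<Rightarrow> nat list \<Rightarrow> nat list \<Rightarrow> nat \<Rightarrow> bool"
  where "row_closed g l t r b c C S i \<longleftrightarrow>
    (let m = S ! i;
         two = two_of (row_above S (border t) i) (row_below S (border b) i)
                 (row_left S l i) (row_right S r i);
         dead = three_of (row_above C 0 i) (row_below C 0 i) (2 * C ! i) (C ! i div 2)
     in two AND 16777215 AND (m OR dead OR exempt g c i) = two AND 16777215 \<and>
        m < 16777216 \<and> C ! i AND m = C ! i \<and>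
        (bit m 0 \<longrightarrow> bit (border l) i) \<and> (bit m 23 \<longrightarrow> bit (border r) i))"

definition gate_closed :: "gate \<Rightarrow> bool \<Rightarrow> bool \<Rightarrow> bool \<Rightarrow> bool \<Rightarrow> bool \<Rightarrow> bool" where
  "gate_closed g l t r b c \<longleftrightarrow>
     (let C = active_rows g; S = closed_rows g l t c
      in S ! 0 AND border t = S ! 0 \<and> S ! 23 AND border b = S ! 23 \<and>
         list_all (row_closed g l t r b c C S) [0..<24])"

text \<open>Signals that reach a \<open>Blank\<close> or a \<open>Choice\<close> gate die at its
  border, so these gates accept any input. A \<open>Node\<close> has no direction: its four edges
  carry one common signal.\<close>

fun gate_ok :: "gate \<Rightarrow> bool \<Rightarrow> bool \<Rightarrow> bool \<Rightarrow> bool \<Rightarrow> bool \<Rightarrow> bool" where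
  "gate_ok Blank l t r b c \<longleftrightarrow> True"
| "gate_ok Or l t r b c \<longleftrightarrow> r = (l \<or> t) \<and> b = (l \<or> t)"
| "gate_ok And l t r b c \<longleftrightarrow> r = (l \<and> t) \<and> b = (l \<and> t)"
| "gate_ok Choice l t r b c \<longleftrightarrow> r = c \<and> b = (\<not> c)"
| "gate_ok Node l t r b c \<longleftrightarrow> t = l \<and> r = l \<and> b = l"

lemmas gate_closed_simps = gate_closed_def row_closed_def two_of_def three_of_def border_def
  exempt_def row_above_def row_below_def row_left_def row_right_def Let_def

lemma upt_24: "[0..<24] = [0, 1, 2, 3, 4, 5, 6, 7, 8, 9, 10, 11, 12, 13, 14, 15, 16, 17, 18, 19,
    20, 21, 22, 23 :: nat]"
  by (simp add: upt_rec)

text \<open>A finite computation for each gate and each combination of edge signals; this is where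
  the drawn patterns are shown not to leak.\<close>

lemma gate_closed:
  assumes "gate_ok g l t r b c"
  shows "gate_closed g l t r b c"
proof (cases g)
  case Blank
  then show ?thesis
    by (cases l; cases t; cases r; cases b; simp add: gate_closed_simps upt_24 bit_0)
next
  case Or
  then show ?thesis
    using assms by (cases l; cases t; simp add: gate_closed_simps upt_24 bit_0)
next
  case And
  then show ?thesis
    using assms by (cases l; cases t; simp add: gate_closed_simps upt_24 bit_0)
next
  case Choice
  then show ?thesis
    using assms by (cases l; cases t; cases c; simp add: gate_closed_simps upt_24 bit_0)
next
  case Node
  then show ?thesis
    using assms by (cases l; simp add: gate_closed_simps upt_24 bit_0)
qed

lemma
  shows row_closed_cell: "gate_closed g l t r b c \<Longrightarrow> i < 24 \<Longrightarrow> row_closed g l t r b c (active_rows g) (closed_rows g l t c) i"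
  by (auto simp: gate_closed_def Let_def list_all_iff)

section \<open>Grids of gates\<close>

definition paint :: "(nat \<Rightarrow> nat \<Rightarrow> nat list) \<Rightarrow> cell \<Rightarrow> bool" where
  "paint R u = (case u of (r, c) \<Rightarrow> bit (R (r div 24) (c div 24) ! (r mod 24)) (c mod 24))"

definition prv :: "nat \<Rightarrow> nat \<Rightarrow> nat" where
  "prv g k = (k + g - 1) mod g"

definition nxt :: "nat \<Rightarrow> nat \<Rightarrow> nat" where
  "nxt g k = (k + 1) mod g"

lemma prv_less [simp]: "k < g \<Longrightarrow> prv g k < g" and nxt_less [simp]: "k < g \<Longrightarrow> nxt g k < g"
  by (auto simp: prv_def nxt_def intro!: mod_less_divisor)

lemma prv_eq: "k < g \<Longrightarrow> prv g k = (if k = 0 then g - 1 else k - 1)"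
  by (cases k) (auto simp: prv_def)

lemma nxt_eq: "k < g \<Longrightarrow> nxt g k = (if k = g - 1 then 0 else k + 1)"
  by (auto simp: nxt_def)

lemma prv_nxt [simp]: "k < g \<Longrightarrow> prv g (nxt g k) = k" and nxt_prv [simp]: "k < g \<Longrightarrow> nxt g (prv g k) = k"
  by (auto simp: prv_eq nxt_eq)

lemma cell_nxt:
  assumes "i < g" "a < 24"
  shows "(24 * i + a + 1) mod (24 * g) = (if a = 23 then 24 * nxt g i else 24 * i + (a + 1))"
proof (cases "a = 23")
  case True
  then have "24 * i + a + 1 = 24 * (i + 1)" by simp
  then show ?thesis
    using True by (simp add: nxt_def mod_mult_mult1 del: mult_Suc_right)
next
  case False
  then show ?thesis using assms by simp
qed

lemma cell_prv:
  assumes "i < g" "a < 24"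
  shows "(24 * i + a + 24 * g - 1) mod (24 * g) =
    (if a = 0 then 24 * prv g i + 23 else 24 * i + (a - 1))"
proof (cases "a = 0")
  case True
  show ?thesis
  proof (cases "i = 0")
    case True
    then show ?thesis using \<open>a = 0\<close> assms by (simp add: prv_eq)
  next
    case False
    then have "24 * i + a + 24 * g - 1 = 24 * (i - 1) + 23 + 24 * g"
      using \<open>a = 0\<close> by (cases i) simp_all
    moreover have "24 * (i - 1) + 23 < 24 * g"
      using assms by simp
    ultimately show ?thesis using \<open>a = 0\<close> assms False by (simp add: prv_eq)
  qed
next
  case False
  then have "24 * i + a + 24 * g - 1 = (24 * i + (a - 1)) + 24 * g"
    by simp
  moreover have "24 * i + (a - 1) < 24 * g"
    using assms by simp
  ultimately show ?thesis using False by (simp only: mod_add_self2 mod_less if_False)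
qed

lemma paint_cell: "a < 24 \<Longrightarrow> b < 24 \<Longrightarrow> paint R (24 * i + a, 24 * j + b) = bit (R i j ! a) b"
  by (simp add: paint_def)

lemma paint_up:
  assumes "i < g" "a < 24" "b < 24"
  shows "paint R ((24 * i + a + 24 * g - 1) mod (24 * g), 24 * j + b) =
    bit (row_above (R i j) (R (prv g i) j ! 23) a) b"
  unfolding cell_prv[OF assms(1,2)]
  using assms paint_cell[of 23 b R "prv g i" j] paint_cell[of "a - 1" b R i j]
  by (cases "a = 0") (simp_all add: row_above_def)

lemma paint_down:
  assumes "i < g" "a < 24" "b < 24"
  shows "paint R ((24 * i + a + 1) mod (24 * g), 24 * j + b) =
    bit (row_below (R i j) (R (nxt g i) j ! 0) a) b"
  unfolding cell_nxt[OF assms(1,2)]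
  using assms paint_cell[of 0 b R "nxt g i" j] paint_cell[of "a + 1" b R i j]
  by (cases "a = 23") (simp_all add: row_below_def)

lemma paint_left:
  assumes "j < g" "a < 24" "b < 24"
  shows "paint R (24 * i + a, (24 * j + b + 24 * g - 1) mod (24 * g)) =
    (if b = 0 then bit (R i (prv g j) ! a) 23 else bit (R i j ! a) (b - 1))"
  unfolding cell_prv[OF assms(1,3)]
  using assms paint_cell[of a 23 R i "prv g j"] paint_cell[of a "b - 1" R i j]
  by (cases "b = 0") simp_all

lemma paint_right:
  assumes "j < g" "a < 24" "b < 24"
  shows "paint R (24 * i + a, (24 * j + b + 1) mod (24 * g)) =
    (if b = 23 then bit (R i (nxt g j) ! a) 0 else bit (R i j ! a) (b + 1))"
  unfolding cell_nxt[OF assms(1,3)]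
  using assms paint_cell[of a 0 R i "nxt g j"] paint_cell[of a "b + 1" R i j]
  by (cases "b = 23") simp_all

lemma bit_row_left: "bit (row_left S e i) b \<longleftrightarrow> (if b = 0 then bit (border e) i else bit (S ! i) (b - 1))"
  by (cases b) (auto simp: row_left_def bit_0 bit_Suc)

lemma bit_row_right:
  assumes "S ! i < 16777216" "b < 24"
  shows "bit (row_right S e i) b \<longleftrightarrow> (if b = 23 then bit (border e) i else bit (S ! i) (b + 1))"
proof -
  let ?k = "S ! i div 2"
  have k: "?k < 2 ^ 23" using assms(1) by simp
  have *: "bit (?k + 2 ^ 23) b = (if b = 23 then True else bit ?k b)"
  proof (cases "b = 23")
    case True
    then show ?thesis
      using k by (simp add: bit_iff_odd)
  next
    case False
    define d where "d = 22 - b"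
    have d: "23 = b + Suc d"
      using assms(2) False by (simp add: d_def)
    have "?k + 2 ^ 23 = ?k + 2 ^ b * (2 * 2 ^ d)"
      unfolding d power_add power_Suc by simp
    then have "(?k + 2 ^ 23) div 2 ^ b = 2 * 2 ^ d + ?k div 2 ^ b"
      by (simp only: div_mult_self2 power_not_zero zero_neq_numeral not_False_eq_True)
    then show ?thesis
      using False by (simp add: bit_iff_odd)
  qed
  have "bit ?k b = (if b = 23 then False else bit (S ! i) (b + 1))"
    using k by (simp add: bit_Suc) (simp add: bit_iff_odd)
  then show ?thesis
    using * by (auto simp: row_right_def)
qed

lemma bit_row_mask: "b < 24 \<Longrightarrow> bit (16777215 :: nat) b"
proof -
  assume "b < 24"
  then have "bit (mask 24 :: nat) b" by (simp add: bit_mask_iff)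
  then show ?thesis by (simp add: mask_eq_exp_minus_1)
qed

lemma and_absorb_bit: "x AND y = x \<Longrightarrow> bit x b \<Longrightarrow> bit y b"
  for x y :: nat
  by (metis bit_and_iff)

definition consistent ::
    "nat \<Rightarrow> (nat \<Rightarrow> nat \<Rightarrow> gate) \<Rightarrow> (nat \<Rightarrow> nat \<Rightarrow> bool) \<Rightarrow> (nat \<Rightarrow> nat \<Rightarrow> bool) \<Rightarrow> (nat \<Rightarrow> nat \<Rightarrow> bool) \<Rightarrow> bool"
  where "consistent g G h v ch \<longleftrightarrow>
    (\<forall>i < g. \<forall>j < g. gate_ok (G i j) (h i (prv g j)) (v (prv g i) j) (h i j) (v i j) (ch i j))"

definition pattern :: "(nat \<Rightarrow> nat \<Rightarrow> gate) \<Rightarrow> configuration" where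
  "pattern G = paint (\<lambda>i j. active_rows (G i j))"

text \<open>Columns 17 and 19 are active in rows 18 and 19 of the \<open>Choice\<close> pattern, so
  the two cells of column 18 between them start with two active neighbours each.\<close>

lemma choice_cells:
  assumes "i < g" "j < g" "G i j = Choice"
    and r: "reach (24 * g) (pattern G) y"
  shows "\<not> (y (24 * i + 18, 24 * j + 18) \<and> y (24 * i + 19, 24 * j + 18))"
proof (rule reach_exclusive[OF r])
  have n: "24 * g \<ge> 3" "24 * i + 18 < 24 * g" "24 * i + 19 < 24 * g" "24 * j + 18 < 24 * g"
    using assms by auto
  have s: "(24 * i + 18 + 1) mod (24 * g) = 24 * i + 19" "(24 * i + 19 + 24 * g - 1) mod (24 * g) = 24 * i + 18"
    using cell_nxt[of i g 18] cell_prv[of i g 19] assms by simp_all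
  show "(24 * i + 18, 24 * j + 18) \<in> neighbors (24 * g) (24 * i + 19, 24 * j + 18)"
    "(24 * i + 19, 24 * j + 18) \<in> neighbors (24 * g) (24 * i + 18, 24 * j + 18)"
    unfolding neighbors.simps s by simp_all
  show "\<not> pattern G (24 * i + 18, 24 * j + 18)" "\<not> pattern G (24 * i + 19, 24 * j + 18)"
    using assms(3) paint_cell[of 18 18 "\<lambda>i j. active_rows (G i j)" i j]
      paint_cell[of 19 18 "\<lambda>i j. active_rows (G i j)" i j] by (simp_all add: pattern_def)
  have *: "pattern G (24 * i + a, (24 * j + 18 + 24 * g - 1) mod (24 * g))"
    "pattern G (24 * i + a, (24 * j + 18 + 1) mod (24 * g))" if "a = 18 \<or> a = 19" for a
    using that assms(2) unfolding pattern_def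
    by (auto simp only: paint_left paint_right) (simp_all add: assms(3) bit_0)
  show "2 \<le> card {w \<in> neighbors (24 * g) (24 * i + 18, 24 * j + 18). pattern G w}"
    "2 \<le> card {w \<in> neighbors (24 * g) (24 * i + 19, 24 * j + 18). pattern G w}"
    unfolding card_neighbors[OF n(1,2,4)] card_neighbors[OF n(1,3,4)]
    using *[of 18] *[of 19] by simp_all
qed

text \<open>The choices are read off the run before a labelling is given, because labellings are
  computed from the choices afterwards. The union of the sets \<open>closed_rows\<close> over all
  gates is closed for this run, so a port becomes active only where the labelling has a
  signal.\<close>

theorem gates_sound:
  assumes r: "reach (24 * g) (pattern G) y"
  obtains ch where "\<And>h v i j. consistent g G h v ch \<Longrightarrow> i < g \<Longrightarrow> j < g \<Longrightarrow>
    y (24 * i + 23, 24 * j + 17) \<Longrightarrow> v i j"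
proof -
  \<comment> \<open>\<open>True\<close> means that the cell (19, 18) stays inactive during the whole
    run; otherwise (18, 18) does, by \<open>choice_cells\<close>. This is the cell that
    \<open>exempt\<close> leaves out.\<close>
  define ch where "ch = (\<lambda>i j. \<not> y (24 * i + 19, 24 * j + 18))"
  have "v i0 j0"
    if cons: "consistent g G h v ch" and "i0 < g" "j0 < g" and y0: "y (24 * i0 + 23, 24 * j0 + 17)"
    for h v i0 j0
  proof -
    define S where "S = (\<lambda>i j. closed_rows (G i j) (h i (prv g j)) (v (prv g i) j) (ch i j))"
    have gc: "gate_closed (G i j) (h i (prv g j)) (v (prv g i) j) (h i j) (v i j) (ch i j)"
      if "i < g" "j < g" for i j
      using cons that by (intro gate_closed) (simp add: consistent_def)
    have rc: "row_closed (G i j) (h i (prv g j)) (v (prv g i) j) (h i j) (v i j) (ch i j)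
        (active_rows (G i j)) (S i j) a" if "i < g" "j < g" "a < 24" for i j a
      using row_closed_cell[OF gc] that by (simp add: S_def)
    have lt: "S i j ! a < 16777216"
      and lb: "bit (S i j ! a) 0 \<Longrightarrow> bit (border (h i (prv g j))) a"
      and rb: "bit (S i j ! a) 23 \<Longrightarrow> bit (border (h i j)) a"
      and act: "bit (active_rows (G i j) ! a) b \<Longrightarrow> bit (S i j ! a) b"
      if "i < g" "j < g" "a < 24" for i j a b
      using rc[OF that] by (auto simp: row_closed_def Let_def dest: and_absorb_bit)
    have tb: "bit (S i j ! 0) b \<Longrightarrow> bit (border (v (prv g i) j)) b"
      and bb: "bit (S i j ! 23) b \<Longrightarrow> bit (border (v i j)) b"
      if "i < g" "j < g" for i j b
      using gc[OF that] by (auto simp: gate_closed_def Let_def S_def dest: and_absorb_bit)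
    have "(24 * i0 + 23, 24 * j0 + 17) \<in> {u. paint S u}"
    proof (rule reach_closed[OF r reach_refl _ _ _ y0])
      show "(24 * i0 + 23, 24 * j0 + 17) \<in> torus (24 * g)"
        using \<open>i0 < g\<close> \<open>j0 < g\<close> by (simp add: torus_def)
    next
      fix u assume u: "u \<in> torus (24 * g)" "pattern G u"
      obtain r c where rc: "u = (r, c)" by (cases u)
      then show "u \<in> {u. paint S u}"
        using u act[of "r div 24" "c div 24" "r mod 24" "c mod 24"]
        by (auto simp: pattern_def paint_def torus_def less_mult_imp_div_less mult.commute)
    next
      fix u assume u: "u \<in> torus (24 * g)" "u \<notin> {u. paint S u}"
      obtain r c where rcu: "u = (r, c)" by (cases u)
      define i a j b where "i = r div 24" and "a = r mod 24" and "j = c div 24" and "b = c mod 24"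
      have ij: "i < g" "j < g" and ab: "a < 24" "b < 24" and ue: "u = (24 * i + a, 24 * j + b)"
        using u rcu by (auto simp: i_def j_def a_def b_def torus_def less_mult_imp_div_less mult.commute)
      let ?n = "24 * g"
      have n: "?n \<ge> 3" "24 * i + a < ?n" "24 * j + b < ?n"
        using ij ab by auto
      have notS: "\<not> bit (S i j ! a) b"
        using u(2) ab by (simp add: ue paint_cell)
      \<comment> \<open>From here on the four neighbours of \<open>u\<close> are overestimated by
        masks that depend only on this gate and the labels of its edges. This reduces the claim for
        the whole grid to \<open>row_closed\<close> of a single gate.\<close>
      define U where "U = row_above (S i j) (border (v (prv g i) j)) a"
      define D where "D = row_below (S i j) (border (v i j)) a"
      define L where "L = row_left (S i j) (h i (prv g j)) a"
      define R where "R = row_right (S i j) (h i j) a"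
      have up: "paint S ((24 * i + a + ?n - 1) mod ?n, 24 * j + b) \<Longrightarrow> bit U b"
        unfolding paint_up[OF ij(1) ab] U_def row_above_def
        using bb[of "prv g i" j b] ij by (auto split: if_splits)
      have down: "paint S ((24 * i + a + 1) mod ?n, 24 * j + b) \<Longrightarrow> bit D b"
        unfolding paint_down[OF ij(1) ab] D_def row_below_def
        using tb[of "nxt g i" j b] ij by (auto split: if_splits)
      have left: "paint S (24 * i + a, (24 * j + b + ?n - 1) mod ?n) \<Longrightarrow> bit L b"
        unfolding paint_left[OF ij(2) ab] L_def bit_row_left
        using rb[of i "prv g j" a] ij ab by (auto split: if_splits)
      have right: "paint S (24 * i + a, (24 * j + b + 1) mod ?n) \<Longrightarrow> bit R b"
        unfolding paint_right[OF ij(2) ab] R_def bit_row_right[OF lt[OF ij ab(1)] ab(2)]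
        using lb[of i "nxt g j" a] ij ab by (auto split: if_splits)
      have cardS: "card {w \<in> neighbors ?n u. w \<in> {u. paint S u}} \<le>
          of_bool (bit D b) + of_bool (bit U b) + of_bool (bit R b) + of_bool (bit L b)"
        unfolding ue mem_Collect_eq card_neighbors[OF n]
        by (intro add_mono; unfold of_bool_less_eq_iff; blast intro: up down left right)
      let ?C = "active_rows (G i j)"
      have cardC: "card {w \<in> neighbors ?n u. pattern G w} \<ge>
          of_bool (bit (row_below ?C 0 a) b) + of_bool (bit (row_above ?C 0 a) b)
          + of_bool (bit (?C ! a div 2) b) + of_bool (bit (2 * ?C ! a) b)"
      proof -
        have 1: "bit (row_above ?C 0 a) b \<Longrightarrow> pattern G ((24 * i + a + ?n - 1) mod ?n, 24 * j + b)"
          unfolding pattern_def paint_up[OF ij(1) ab] by (auto simp: row_above_def split: if_splits)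
        have 2: "bit (row_below ?C 0 a) b \<Longrightarrow> pattern G ((24 * i + a + 1) mod ?n, 24 * j + b)"
          unfolding pattern_def paint_down[OF ij(1) ab] by (auto simp: row_below_def split: if_splits)
        have 3: "bit (2 * ?C ! a) b \<Longrightarrow> pattern G (24 * i + a, (24 * j + b + ?n - 1) mod ?n)"
          unfolding pattern_def paint_left[OF ij(2) ab] by (cases b) (auto simp: bit_0 bit_Suc)
        have "\<not> bit (S i j ! a) 24"
          using lt[OF ij ab(1)] by (simp add: bit_iff_odd)
        then have "\<not> bit (?C ! a) 24"
          using act[OF ij ab(1)] by blast
        then have "\<not> bit (?C ! a div 2) 23"
          using bit_Suc[of "?C ! a" 23] by simp
        then have 4: "bit (?C ! a div 2) b \<Longrightarrow> pattern G (24 * i + a, (24 * j + b + 1) mod ?n)"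
          unfolding pattern_def paint_right[OF ij(2) ab] by (auto simp: bit_Suc)
        show ?thesis
          unfolding ue card_neighbors[OF n]
          by (intro add_mono; unfold of_bool_less_eq_iff; blast intro: 1 2 3 4)
      qed
      have "bit (two_of U D L R) b \<Longrightarrow> bit (S i j ! a) b \<or>
          bit (three_of (row_above ?C 0 a) (row_below ?C 0 a) (2 * ?C ! a) (?C ! a div 2)) b \<or>
          bit (exempt (G i j) (ch i j) a) b"
        using rc[OF ij ab(1)] bit_row_mask[OF ab(2)]
        unfolding row_closed_def Let_def U_def[symmetric] D_def[symmetric] L_def[symmetric] R_def[symmetric]
        by (metis bit_and_iff bit_or_iff)
      moreover have "\<not> y u" if "bit (exempt (G i j) (ch i j) a) b"
      proof -
        have "bit (262144 :: nat) b \<Longrightarrow> b = 18"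
          using bit_exp_iff[where 'a = nat, of 18 b] by (simp add: possible_bit_def)
        then have *: "G i j = Choice" "b = 18" "a = (if ch i j then 19 else 18)"
          using that by (auto simp: exempt_def split: if_splits)
        then show ?thesis
          using choice_cells[OF ij *(1) r] by (auto simp: ue ch_def)
      qed
      moreover have "card {w \<in> neighbors ?n u. w \<in> {u. paint S u}} \<le> 1"
        if "\<not> bit (two_of U D L R) b"
        using that cardS unfolding bit_two_of by linarith
      moreover have "3 \<le> card {w \<in> neighbors ?n u. pattern G w}"
        if "bit (three_of (row_above ?C 0 a) (row_below ?C 0 a) (2 * ?C ! a) (?C ! a div 2)) b"
        using that cardC unfolding bit_three_of by linarith
      ultimately show "\<not> y u \<or> card {w \<in> neighbors ?n u. w \<in> {u. paint S u}} \<le> 1 \<or>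
          3 \<le> card {w \<in> neighbors ?n u. pattern G w}"
        using notS by blast
    qed
    then have "bit (S i0 j0 ! 23) 17"
      using paint_cell[of 23 17 S i0 j0] by simp
    then have "bit (border (v i0 j0)) 17"
      using bb \<open>i0 < g\<close> \<open>j0 < g\<close> by blast
    then show "v i0 j0"
      by (auto simp: border_def split: if_splits)
  qed
  then show ?thesis
    by (rule that)
qed

section \<open>Carrying signals through a grid of gates\<close>

fun port :: "side \<Rightarrow> nat \<times> nat" where
  "port L_side = (17, 0)" | "port T_side = (0, 17)" | "port R_side = (17, 23)" | "port B_side = (23, 17)"

fun opposite :: "side \<Rightarrow> side" where
  "opposite L_side = R_side" | "opposite T_side = B_side"
| "opposite R_side = L_side" | "opposite B_side = T_side"

fun adjacent :: "nat \<Rightarrow> side \<Rightarrow> nat \<times> nat \<Rightarrow> nat \<times> nat" where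
  "adjacent g L_side (i, j) = (i, prv g j)" | "adjacent g T_side (i, j) = (prv g i, j)"
| "adjacent g R_side (i, j) = (i, nxt g j)" | "adjacent g B_side (i, j) = (nxt g i, j)"

fun cell_at :: "nat \<times> nat \<Rightarrow> nat \<times> nat \<Rightarrow> cell" where
  "cell_at (i, j) (a, b) = (24 * i + a, 24 * j + b)"

abbreviation ports :: "kind \<Rightarrow> side set" where
  "ports k \<equiv> ins k \<union> outs k"

text \<open>Symbolic execution of an activation sequence inside one pattern \<open>A\<close>. Border
  cells may be activated only at ports in \<open>P\<close>; the one neighbour of a port that lies
  outside is active iff its side belongs to \<open>I\<close>.\<close>

fun active_ok :: "side set \<Rightarrow> side set \<Rightarrow> nat list \<Rightarrow> (nat \<times> nat) list \<Rightarrow> bool" where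
  "active_ok I P A [] \<longleftrightarrow> True"
| "active_ok I P A ((a, b) # us) \<longleftrightarrow> a < 24 \<and> b < 24 \<and> \<not> bit (A ! a) b \<and>
     (a = 0 \<longrightarrow> b = 17 \<and> T_side \<in> P) \<and> (a = 23 \<longrightarrow> b = 17 \<and> B_side \<in> P) \<and>
     (b = 0 \<longrightarrow> a = 17 \<and> L_side \<in> P) \<and> (b = 23 \<longrightarrow> a = 17 \<and> R_side \<in> P) \<and>
     of_bool (if a = 23 then B_side \<in> I else bit (A ! (a + 1)) b) +
     of_bool (if a = 0 then T_side \<in> I else bit (A ! (a - 1)) b) +
     of_bool (if b = 23 then R_side \<in> I else bit (A ! a) (b + 1)) +
     of_bool (if b = 0 then L_side \<in> I else bit (A ! a) (b - 1)) = (2 :: nat) \<and>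
     active_ok I P (A[a := A ! a OR 2 ^ b]) us"

lemma list_update_numeral: "(x # xs)[numeral n := y] = x # xs[pred_numeral n := y]"
  by (simp add: numeral_eq_Suc)

lemma activation_ok: "active_ok (ins k) (ports k) (active_rows (gate_of k)) (activation k)"
  by (cases k; simp add: list_update_numeral bit_0)

lemma port_activation: "port p \<in> set (activation k) \<longleftrightarrow> p \<in> ports k"
  by (cases k; cases p; simp)

lemma length_active_rows [simp]: "length (active_rows g) = 24"
  by (cases g) simp_all

lemma port_inactive: "port p = (a, b) \<Longrightarrow> \<not> bit (active_rows g ! a) b"
  by (cases g; cases p; auto simp: bit_0)

declare active_ok.simps(2) [simp del]

lemma active_ok_cells: "active_ok I P A us \<Longrightarrow> (a, b) \<in> set us \<Longrightarrow> a < 24 \<and> b < 24"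
proof (induction us arbitrary: A)
  case Nil
  then show ?case by simp
next
  case (Cons u us)
  obtain a' b' where u: "u = (a', b')" by (cases u)
  then have "a' < 24" "b' < 24" "active_ok I P (A[a' := A ! a' OR 2 ^ b']) us"
    using Cons.prems(1) unfolding u active_ok.simps by blast+
  then show ?case
    using Cons.IH Cons.prems(2) u by auto
qed

lemma prv_neq: "2 \<le> g \<Longrightarrow> i < g \<Longrightarrow> prv g i \<noteq> i" and nxt_neq: "2 \<le> g \<Longrightarrow> i < g \<Longrightarrow> nxt g i \<noteq> i"
  by (auto simp: prv_eq nxt_eq)

lemma cell_at_eq_iff:
  assumes "a < 24" "b < 24" "a' < 24" "b' < 24"
  shows "cell_at (i, j) (a, b) = cell_at (i', j') (a', b') \<longleftrightarrow> i = i' \<and> j = j' \<and> a = a' \<and> b = b'"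
proof -
  have "24 * i + a = 24 * i' + a' \<longleftrightarrow> i = i' \<and> a = a'" if "a < 24" "a' < 24" for i i' a a' :: nat
    using that by (metis div_mult_self4 mod_mult_self4 div_less mod_less add_0_right zero_neq_numeral)
  then show ?thesis using assms by auto
qed

text \<open>Ports across the border must be active on the sides \<open>I\<close> and inactive on the
  remaining sides of \<open>P\<close>: the rule wants exactly two active neighbours, so an early
  signal at an output would spoil the sequence.\<close>

lemma exec_activation:
  assumes g: "2 \<le> g" "i < g" "j < g" and "length A = 24"
    and "reach (24 * g) x y"
    and tile: "\<And>a b. a < 24 \<Longrightarrow> b < 24 \<Longrightarrow> y (cell_at (i, j) (a, b)) = bit (A ! a) b"
    and outside: "\<And>p. p \<in> P \<Longrightarrow> y (cell_at (adjacent g p (i, j)) (port (opposite p))) \<longleftrightarrow> p \<in> I"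
    and "active_ok I P A us"
  shows "reach (24 * g) x (\<lambda>u. y u \<or> u \<in> cell_at (i, j) ` set us)"
  using assms(4-)
proof (induction us arbitrary: A y)
  case Nil
  then show ?case by simp
next
  case (Cons u us)
  obtain a b where u: "u = (a, b)" by (cases u)
  let ?n = "24 * g" and ?u = "cell_at (i, j) (a, b)" and ?A = "A[a := A ! a OR 2 ^ b]"
  have ok: "active_ok I P A ((a, b) # us)"
    using Cons.prems(5) unfolding u .
  then have ab: "a < 24" "b < 24" and new: "\<not> bit (A ! a) b"
    and border: "a = 0 \<longrightarrow> b = 17 \<and> T_side \<in> P" "a = 23 \<longrightarrow> b = 17 \<and> B_side \<in> P"
      "b = 0 \<longrightarrow> a = 17 \<and> L_side \<in> P" "b = 23 \<longrightarrow> a = 17 \<and> R_side \<in> P"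
    and two: "of_bool (if a = 23 then B_side \<in> I else bit (A ! (a + 1)) b) +
      of_bool (if a = 0 then T_side \<in> I else bit (A ! (a - 1)) b) +
      of_bool (if b = 23 then R_side \<in> I else bit (A ! a) (b + 1)) +
      of_bool (if b = 0 then L_side \<in> I else bit (A ! a) (b - 1)) = (2 :: nat)"
    and rest: "active_ok I P ?A us"
    unfolding active_ok.simps by blast+
  have n: "?n \<ge> 3" "24 * i + a < ?n" "24 * j + b < ?n"
    using g ab by auto
  have cell: "y (24 * i + a, 24 * j + b) = bit (A ! a) b" if "a < 24" "b < 24" for a b
    using Cons.prems(3)[OF that] by simp
  have D: "y ((24 * i + a + 1) mod ?n, 24 * j + b) = (if a = 23 then B_side \<in> I else bit (A ! (a + 1)) b)"
  proof (cases "a = 23")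
    case True
    then have "b = 17" "B_side \<in> P"
      using border(2) by blast+
    then show ?thesis
      using Cons.prems(4)[OF \<open>B_side \<in> P\<close>] unfolding cell_nxt[OF g(2) ab(1)]
      by (simp only: True if_True adjacent.simps opposite.simps port.simps cell_at.simps add_0_right simp_thms)
  next
    case False
    then have "a + 1 < 24"
      using ab by linarith
    then show ?thesis
      using False cell[of "a + 1" b] ab unfolding cell_nxt[OF g(2) ab(1)] by (simp only: if_False simp_thms)
  qed
  have U: "y ((24 * i + a + ?n - 1) mod ?n, 24 * j + b) = (if a = 0 then T_side \<in> I else bit (A ! (a - 1)) b)"
  proof (cases "a = 0")
    case True
    then have "b = 17" "T_side \<in> P"
      using border(1) by blast+
    then show ?thesis
      using Cons.prems(4)[OF \<open>T_side \<in> P\<close>] unfolding cell_prv[OF g(2) ab(1)]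
      by (simp only: True if_True adjacent.simps opposite.simps port.simps cell_at.simps add_0_right simp_thms)
  next
    case False
    then have "a - 1 < 24"
      using ab by linarith
    then show ?thesis
      using False cell[of "a - 1" b] ab unfolding cell_prv[OF g(2) ab(1)] by (simp only: if_False simp_thms)
  qed
  have R: "y (24 * i + a, (24 * j + b + 1) mod ?n) = (if b = 23 then R_side \<in> I else bit (A ! a) (b + 1))"
  proof (cases "b = 23")
    case True
    then have "a = 17" "R_side \<in> P"
      using border(4) by blast+
    then show ?thesis
      using Cons.prems(4)[OF \<open>R_side \<in> P\<close>] unfolding cell_nxt[OF g(3) ab(2)]
      by (simp only: True if_True adjacent.simps opposite.simps port.simps cell_at.simps add_0_right simp_thms)
  next
    case False
    then have "b + 1 < 24"
      using ab by linarith
    then show ?thesis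
      using False cell[of a "b + 1"] ab unfolding cell_nxt[OF g(3) ab(2)] by (simp only: if_False simp_thms)
  qed
  have L: "y (24 * i + a, (24 * j + b + ?n - 1) mod ?n) = (if b = 0 then L_side \<in> I else bit (A ! a) (b - 1))"
  proof (cases "b = 0")
    case True
    then have "a = 17" "L_side \<in> P"
      using border(3) by blast+
    then show ?thesis
      using Cons.prems(4)[OF \<open>L_side \<in> P\<close>] unfolding cell_prv[OF g(3) ab(2)]
      by (simp only: True if_True adjacent.simps opposite.simps port.simps cell_at.simps add_0_right simp_thms)
  next
    case False
    then have "b - 1 < 24"
      using ab by linarith
    then show ?thesis
      using False cell[of a "b - 1"] ab unfolding cell_prv[OF g(3) ab(2)] by (simp only: if_False simp_thms)
  qed
  have "card {v \<in> neighbors ?n ?u. y v} = 2"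
    unfolding cell_at.simps card_neighbors[OF n] U D L R by (rule two)
  moreover have "?u \<in> torus ?n" "\<not> y ?u"
    using n new Cons.prems(3)[OF ab] by (simp_all add: torus_def)
  ultimately have r: "reach ?n x (y(?u := True))"
    using reach_step[OF Cons.prems(2)] by blast
  have "reach ?n x (\<lambda>v. (y(?u := True)) v \<or> v \<in> cell_at (i, j) ` set us)"
  proof (rule Cons.IH[of ?A])
    show "length ?A = 24" using Cons.prems(1) by simp
    show "reach ?n x (y(?u := True))" by (rule r)
    show "active_ok I P ?A us" by (rule rest)
  next
    fix a' b' :: nat assume ab': "a' < 24" "b' < 24"
    show "(y(?u := True)) (cell_at (i, j) (a', b')) = bit (?A ! a') b'"
      unfolding fun_upd_apply cell_at_eq_iff[OF ab' ab] Cons.prems(3)[OF ab']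
      using Cons.prems(1) ab ab' by (auto simp: nth_list_update bit_or_iff bit_exp_iff)
  next
    fix p assume "p \<in> P"
    have "cell_at (adjacent g p (i, j)) (port (opposite p)) \<noteq> ?u"
      using prv_neq[OF g(1)] nxt_neq[OF g(1)] g ab
      by (cases p) (auto simp del: cell_at.simps simp: cell_at_eq_iff)
    then show "(y(?u := True)) (cell_at (adjacent g p (i, j)) (port (opposite p))) \<longleftrightarrow> p \<in> I"
      using Cons.prems(4)[OF \<open>p \<in> P\<close>] by simp
  qed
  moreover have "(\<lambda>v. (y(?u := True)) v \<or> v \<in> cell_at (i, j) ` set us) =
      (\<lambda>v. y v \<or> v \<in> cell_at (i, j) ` set (u # us))"
    by (auto simp: u)
  ultimately show ?case by simp
qed

lemma adjacent_less: "i < g \<Longrightarrow> j < g \<Longrightarrow> adjacent g p (i, j) = (i', j') \<Longrightarrow> i' < g \<and> j' < g"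
  by (cases p) auto

text \<open>The gates are worked on in the order of \<open>rk\<close>, each by the sequence for its
  kind. By \<open>arrive\<close> the inputs are there in time; by \<open>leave\<close> the gates
  behind the outputs come later, so that their ports are still inactive. Injectivity of
  \<open>rk\<close> makes each stage concern one gate.\<close>

theorem gates_complete:
  fixes \<kappa> :: "nat \<Rightarrow> nat \<Rightarrow> kind option" and rk :: "nat \<Rightarrow> nat \<Rightarrow> nat"
  assumes g: "2 \<le> g"
    and gate: "\<And>i j k. i < g \<Longrightarrow> j < g \<Longrightarrow> \<kappa> i j = Some k \<Longrightarrow> G i j = gate_of k"
    and arrive: "\<And>i j k p i' j'. i < g \<Longrightarrow> j < g \<Longrightarrow> \<kappa> i j = Some k \<Longrightarrow> p \<in> ins k \<Longrightarrow>
      adjacent g p (i, j) = (i', j') \<Longrightarrow>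
      \<exists>k'. \<kappa> i' j' = Some k' \<and> opposite p \<in> ports k' \<and> rk i' j' < rk i j"
    and leave: "\<And>i j k p i' j' k'. i < g \<Longrightarrow> j < g \<Longrightarrow> \<kappa> i j = Some k \<Longrightarrow> p \<in> outs k - ins k \<Longrightarrow>
      adjacent g p (i, j) = (i', j') \<Longrightarrow> \<kappa> i' j' = Some k' \<Longrightarrow> opposite p \<in> ports k' \<Longrightarrow>
      rk i j < rk i' j'"
    and inj: "\<And>i j i' j' k k'. i < g \<Longrightarrow> j < g \<Longrightarrow> i' < g \<Longrightarrow> j' < g \<Longrightarrow>
      \<kappa> i j = Some k \<Longrightarrow> \<kappa> i' j' = Some k' \<Longrightarrow> rk i j = rk i' j' \<Longrightarrow> i = i' \<and> j = j'"
  shows "\<exists>y. reach (24 * g) (pattern G) y \<and>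
    (\<forall>i < g. \<forall>j < g. \<forall>k. \<kappa> i j = Some k \<longrightarrow> (\<forall>p \<in> ports k. y (cell_at (i, j) (port p))))"
proof -
  \<comment> \<open>The configuration after all gates of rank less than \<open>m\<close> have been
    worked on.\<close>
  define Y where "Y = (\<lambda>m u. pattern G u \<or> (\<exists>i j k. i < g \<and> j < g \<and> \<kappa> i j = Some k \<and> rk i j < m \<and>
    u \<in> cell_at (i, j) ` set (activation k)))"
  have cells: "a < 24 \<and> b < 24" if "(a, b) \<in> set (activation k)" for a b k
    using active_ok_cells[OF activation_ok that] .
  have Y_cell: "Y m (cell_at (i, j) (a, b)) \<longleftrightarrow> bit (active_rows (G i j) ! a) b \<or>
      (\<exists>k. \<kappa> i j = Some k \<and> rk i j < m \<and> (a, b) \<in> set (activation k))"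
    if "i < g" "j < g" "a < 24" "b < 24" for m i j a b
  proof -
    have "cell_at (i, j) (a, b) \<in> cell_at (i', j') ` set (activation k) \<longleftrightarrow>
        i = i' \<and> j = j' \<and> (a, b) \<in> set (activation k)" for i' j' k
      using cells[of _ _ k] cell_at_eq_iff[OF that(3,4)] by (auto simp del: cell_at.simps)
    moreover have "pattern G (cell_at (i, j) (a, b)) \<longleftrightarrow> bit (active_rows (G i j) ! a) b"
      using that by (simp add: pattern_def paint_cell)
    ultimately show ?thesis
      using that by (auto simp: Y_def simp del: cell_at.simps)
  qed
  have port_less: "port p = (a, b) \<Longrightarrow> a < 24 \<and> b < 24" for p a b
    by (cases p) auto
  have Y_port: "Y m (cell_at (i, j) (port p)) \<longleftrightarrow> (\<exists>k. \<kappa> i j = Some k \<and> rk i j < m \<and> p \<in> ports k)"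
    if ij: "i < g" "j < g" for m i j p
  proof -
    obtain a b where p: "port p = (a, b)" by (cases "port p")
    then show ?thesis
      using Y_cell[OF ij, of a b m] port_less[OF p] port_inactive[OF p] port_activation[of p] by simp
  qed
  have "reach (24 * g) (pattern G) (Y m)" for m
  proof (induction m)
    case 0
    then show ?case by (simp add: Y_def reach_refl)
  next
    case (Suc m)
    show ?case
    proof (cases "\<exists>i j k. i < g \<and> j < g \<and> \<kappa> i j = Some k \<and> rk i j = m")
      case False
      then have *: "rk i j < Suc m \<longleftrightarrow> rk i j < m" if "i < g" "j < g" "\<kappa> i j = Some k" for i j k
        using that False unfolding less_Suc_eq by blast
      have "Y (Suc m) = Y m"
        unfolding Y_def by (intro ext disj_cong refl ex_cong1) (use * in blast)
      then show ?thesis using Suc by simp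
    next
      case True
      then obtain i j k where ijk: "i < g" "j < g" "\<kappa> i j = Some k" "rk i j = m" by blast
      have "reach (24 * g) (pattern G) (\<lambda>u. Y m u \<or> u \<in> cell_at (i, j) ` set (activation k))"
      proof (rule exec_activation[OF g ijk(1,2) length_active_rows Suc _ _ activation_ok])
        fix a b :: nat assume ab: "a < 24" "b < 24"
        show "Y m (cell_at (i, j) (a, b)) = bit (active_rows (gate_of k) ! a) b"
          unfolding Y_cell[OF ijk(1,2) ab] ijk(4) gate[OF ijk(1-3), symmetric] using ijk(4) by blast
      next
        fix p assume p: "p \<in> ports k"
        obtain i' j' where ij': "adjacent g p (i, j) = (i', j')"
          by (cases "adjacent g p (i, j)")
        then have less: "i' < g" "j' < g"
          using adjacent_less ijk by blast+
        show "Y m (cell_at (adjacent g p (i, j)) (port (opposite p))) \<longleftrightarrow> p \<in> ins k"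
          unfolding ij' Y_port[OF less]
        proof (cases "p \<in> ins k")
          case True
          then show "(\<exists>k'. \<kappa> i' j' = Some k' \<and> rk i' j' < m \<and> opposite p \<in> ports k') = (p \<in> ins k)"
            using arrive[OF ijk(1-3) True ij'] ijk(4) by blast
        next
          case False
          then have "p \<in> outs k - ins k" using p by blast
          then show "(\<exists>k'. \<kappa> i' j' = Some k' \<and> rk i' j' < m \<and> opposite p \<in> ports k') = (p \<in> ins k)"
            using leave[OF ijk(1-3) _ ij'] ijk(4) False by (meson less_asym)
        qed
      qed
      moreover have "(\<lambda>u. Y m u \<or> u \<in> cell_at (i, j) ` set (activation k)) = Y (Suc m)"
      proof (rule ext)
        fix u
        have "(\<exists>i' j' k'. i' < g \<and> j' < g \<and> \<kappa> i' j' = Some k' \<and> rk i' j' = m \<and>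
            u \<in> cell_at (i', j') ` set (activation k')) \<longleftrightarrow> u \<in> cell_at (i, j) ` set (activation k)"
          using ijk inj[OF ijk(1,2) _ _ ijk(3)] by (metis option.inject)
        then show "(Y m u \<or> u \<in> cell_at (i, j) ` set (activation k)) = Y (Suc m) u"
          unfolding Y_def less_Suc_eq by blast
      qed
      ultimately show ?thesis by simp
    qed
  qed
  moreover define M where "M = Suc (Max ((\<lambda>(i, j). rk i j) ` ({..<g} \<times> {..<g})))"
  have "rk i j < M" if "i < g" "j < g" for i j
    unfolding M_def less_Suc_eq_le by (rule Max_ge) (use that in auto)
  ultimately show ?thesis
    using Y_port by (intro exI[of _ "Y M"]) blast
qed

section \<open>Blocks of 13 by 13 gates\<close>

text \<open>
  A block has an input on the left and an output on the right in row 3, and an input at the top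
  and an output at the bottom in column 3. In \<open>Cross\<close>, the signals \<open>l\<close> and \<open>t\<close> of the inputs meet
  in the hub \<open>(6, 6)\<close>, which gets \<open>l \<and> w\<close>, \<open>t \<and> n\<close> and \<open>l \<and> t\<close>. From the hub, the right output is
  guarded by \<open>e\<close> and the bottom output by \<open>s\<close>. The choices \<open>w\<close> or \<open>s\<close>, and \<open>n\<close> or \<open>e\<close>, make sure that
  no signal leaves through the wrong output; if both inputs are active, one chooses \<open>s\<close> and \<open>e\<close>.
  \<open>Join\<close> is the same with \<open>n\<close> and \<open>e\<close> both granted, so that \<open>t\<close> can reach the right output.
\<close>

datatype block = Empty | Cross | Join | Source | Turn | Meet | Start

datatype sig = Sig_L | Sig_T | Sig_S | Sig_E | Sig_LW | Sig_TN | Sig_LT | Sig_X | Sig_Hub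
  | Sig_R | Sig_B | Sig_C


text \<open>\<open>Or_Left\<close> stands for any \<open>Or\<close> gate and
  \<open>Choose_Right\<close> for any \<open>Choice\<close> gate, with \<open>Sig_C\<close> as a
  placeholder; \<open>block_kind\<close> selects the actual activation. Wires are chains of
  \<open>Or\<close> gates. \<open>Or\<close> and \<open>And\<close> pass signals only to the right
  and down, so chains of \<open>Node\<close> gates lead the results of the hub back up to row 3 and
  back left to column 3.\<close>

fun board :: "block \<Rightarrow> nat \<times> nat \<Rightarrow> (kind \<times> sig) option" where
  "board Empty (a, b) = None"
| "board Source (a, b) =
    (if a = 3 then
       if b < 3 then None else if b = 3 then Some (Choose_Right, Sig_C) else Some (Or_Left, Sig_E)
     else if b = 3 \<and> 3 < a then Some (Or_Left, Sig_S) else None)"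
| "board Turn (a, b) =
    (if a = 3 \<and> b \<le> 3 \<or> b = 3 \<and> 3 < a then Some (Or_Left, Sig_L) else None)"
| "board Meet (a, b) =
    (if a = 3 \<and> b < 3 then Some (Or_Left, Sig_L)
     else if b = 3 then
       if a < 3 then Some (Or_Left, Sig_T) else if a = 3 then Some (And_Both, Sig_LT)
       else Some (Or_Left, Sig_LT)
     else None)"
| "board Start (a, b) =
    (if b = 3 then
       if a < 3 then None else if a = 3 then Some (Choose_Right, Sig_C) else Some (Or_Left, Sig_S)
     else None)"
| "board B (a, b) =
    (if a = 0 then
       if b = 3 then Some (Or_Left, Sig_T)
       else if b = 6 then Some (Choose_Right, Sig_C)
       else if b = 7 then if B = Join then None else Some (Or_Left, Sig_E)
       else if b = 8 then if B = Join then Some (Choose_Right, Sig_C) else Some (Or_Left, Sig_E)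
       else if b = 9 then Some (Or_Left, Sig_E) else None
     else if a < 3 then
       if b = 3 \<or> a = 1 \<and> (b = 4 \<or> b = 5) then Some (Or_Left, Sig_T)
       else if b = 6 then if a = 1 then Some (And_Both, Sig_TN) else Some (Or_Left, Sig_TN)
       else if b = 9 then Some (Or_Left, Sig_E) else None
     else if a < 6 then
       if a = 3 \<and> b < 3 \<or> 3 < a \<and> b = 1 then Some (Or_Left, Sig_L)
       else if a = 3 \<and> b = 3 then Some (And_Both, Sig_LT)
       else if a = 3 \<and> (b = 4 \<or> b = 5) then Some (Or_Left, Sig_LT)
       else if b = 6 then Some (Or_Left, Sig_X)
       else if b = 9 then Some (Or_Left, Sig_E)
       else if b = 11 then Some (Node_Bottom, Sig_R)
       else if a = 3 \<and> b = 12 then Some (Or_Left, Sig_R) else None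
     else if a = 6 then
       if b = 0 then Some (Choose_Right, Sig_C)
       else if b = 1 then Some (And_Both, Sig_LW)
       else if b < 6 then Some (Or_Left, Sig_LW)
       else if b < 9 then Some (Or_Left, Sig_Hub)
       else if b = 9 then Some (And_Both, Sig_R)
       else if b = 10 then Some (Or_Left, Sig_R)
       else if b = 11 then Some (Node_Left, Sig_R) else None
     else if a < 10 then
       if b = 0 \<or> a = 9 \<and> b < 6 then Some (Or_Left, Sig_S)
       else if b = 6 then if a = 9 then Some (And_Both, Sig_B) else Some (Or_Left, Sig_Hub)
       else None
     else if b = 6 then
       if a = 10 then Some (Or_Left, Sig_B) else if a = 11 then Some (Node_Top, Sig_B) else None
     else if a = 11 \<and> 3 \<le> b \<and> b < 6 then Some (Node_Right, Sig_B)
     else if a = 12 \<and> b = 3 then Some (Or_Left, Sig_B) else None)"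

type_synonym choice = "nat \<times> nat \<Rightarrow> bool"

definition perm_s :: "block \<Rightarrow> choice \<Rightarrow> bool" where
  "perm_s B c = (\<not> c (if B = Source \<or> B = Start then (3, 3) else (6, 0)))"

definition perm_e :: "block \<Rightarrow> choice \<Rightarrow> bool" where
  "perm_e B c = c (if B = Source then (3, 3) else if B = Join then (0, 8) else (0, 6))"

fun sig_val :: "block \<Rightarrow> bool \<Rightarrow> bool \<Rightarrow> choice \<Rightarrow> sig \<Rightarrow> bool" where
  "sig_val B l t c Sig_L = l"
| "sig_val B l t c Sig_T = t"
| "sig_val B l t c Sig_S = perm_s B c"
| "sig_val B l t c Sig_E = perm_e B c"
| "sig_val B l t c Sig_LW = (l \<and> c (6, 0))"
| "sig_val B l t c Sig_TN = (t \<and> \<not> c (0, 6))"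
| "sig_val B l t c Sig_LT = (l \<and> t)"
| "sig_val B l t c Sig_X = (t \<and> (l \<or> \<not> c (0, 6)))"
| "sig_val B l t c Sig_Hub = (l \<and> c (6, 0) \<or> t \<and> (l \<or> \<not> c (0, 6)))"
| "sig_val B l t c Sig_R = ((l \<and> c (6, 0) \<or> t \<and> (l \<or> \<not> c (0, 6))) \<and> perm_e B c)"
| "sig_val B l t c Sig_B = ((l \<and> c (6, 0) \<or> t \<and> (l \<or> \<not> c (0, 6))) \<and> perm_s B c)"
| "sig_val B l t c Sig_C = False"

definition block_gate :: "block \<Rightarrow> nat \<times> nat \<Rightarrow> gate" where
  "block_gate B p = (case board B p of None \<Rightarrow> Blank | Some (k, _) \<Rightarrow> gate_of k)"

text \<open>The signals on the edges at the right of and below a gate. The edges of a \<open>Node\<close> all carry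
  the same signal, even if there is no gate at the other end.\<close>

definition edge ::
    "block \<Rightarrow> bool \<Rightarrow> bool \<Rightarrow> choice \<Rightarrow> bool \<Rightarrow> nat \<times> nat \<Rightarrow> nat \<times> nat \<Rightarrow> bool" where
  "edge B l t c r p q = (case board B p of
     None \<Rightarrow> (case board B q of None \<Rightarrow> False
               | Some (k, sg) \<Rightarrow> gate_of k = Node \<and> sig_val B l t c sg)
   | Some (k, sg) \<Rightarrow> if gate_of k = Choice then c p = r else sig_val B l t c sg)"

definition right_edge :: "block \<Rightarrow> bool \<Rightarrow> bool \<Rightarrow> choice \<Rightarrow> nat \<times> nat \<Rightarrow> bool" where
  "right_edge B l t c p = edge B l t c True p (fst p, snd p + 1)"

definition bottom_edge :: "block \<Rightarrow> bool \<Rightarrow> bool \<Rightarrow> choice \<Rightarrow> nat \<times> nat \<Rightarrow> bool" where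
  "bottom_edge B l t c p = edge B l t c False p (fst p + 1, snd p)"

definition left_edge :: "block \<Rightarrow> bool \<Rightarrow> bool \<Rightarrow> choice \<Rightarrow> nat \<times> nat \<Rightarrow> bool" where
  "left_edge B l t c p =
     (if snd p = 0 then fst p = 3 \<and> l else right_edge B l t c (fst p, snd p - 1))"

definition top_edge :: "block \<Rightarrow> bool \<Rightarrow> bool \<Rightarrow> choice \<Rightarrow> nat \<times> nat \<Rightarrow> bool" where
  "top_edge B l t c p =
     (if fst p = 0 then snd p = 3 \<and> t else bottom_edge B l t c (fst p - 1, snd p))"

text \<open>The conditions on the last row, the last column and the nodes keep blocks independent: a
  signal can cross the border of a block only in row 3 or column 3.\<close>

definition entry_ok :: "block \<Rightarrow> bool \<Rightarrow> bool \<Rightarrow> choice \<Rightarrow> nat \<times> nat \<Rightarrow> bool" where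
  "entry_ok B l t c p = (case board B p of None \<Rightarrow> True | Some (k, sg) \<Rightarrow>
     gate_ok (gate_of k) (left_edge B l t c p) (top_edge B l t c p)
       (right_edge B l t c p) (bottom_edge B l t c p) (c p) \<and>
     (snd p = 12 \<longrightarrow> fst p = 3) \<and> (fst p = 12 \<longrightarrow> snd p = 3) \<and>
     (gate_of k = Node \<longrightarrow> fst p \<noteq> 0 \<and> snd p \<noteq> 0))"

lemmas edge_simps = entry_ok_def left_edge_def top_edge_def right_edge_def bottom_edge_def edge_def
  perm_s_def perm_e_def

lemma upt_13: "[0..<13] = [0, 1, 2, 3, 4, 5, 6, 7, 8, 9, 10, 11, 12 :: nat]"
  by (simp add: upt_rec)

lemma less_13: "(\<forall>a < 13. P a) \<longleftrightarrow> list_all P [0..<13]" for P :: "nat \<Rightarrow> bool"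
  by (auto simp: list_all_iff)

text \<open>A check of the 169 positions with symbolic inputs and choices. It covers bad choices as
  well, as soundness requires; \<open>block_flow\<close> below treats only
  \<open>good_choice\<close>.\<close>

lemma block_ok:
  assumes "a < 13" "b < 13"
  shows "entry_ok B l t c (a, b)"
proof -
  have "\<forall>a < 13. \<forall>b < 13. entry_ok B l t c (a, b)"
    unfolding less_13 upt_13
    by (cases B; simp add: edge_simps; blast)
  then show ?thesis using assms by blast
qed

definition block_kind :: "block \<Rightarrow> bool \<Rightarrow> bool \<Rightarrow> choice \<Rightarrow> nat \<times> nat \<Rightarrow> kind option" where
  "block_kind B l t c p = (case board B p of
     None \<Rightarrow> None
   | Some (k, sg) \<Rightarrow>
       if gate_of k = Choice then Some (if c p then Choose_Right else Choose_Bottom)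
       else if \<not> sig_val B l t c sg then None
       else if gate_of k = Or then Some (if left_edge B l t c p then Or_Left else Or_Top)
       else Some k)"

text \<open>An order in which signals can be carried through the gates of a block: row by row, except
  for the final segments that lead up and left to the outputs.\<close>

fun position :: "nat \<times> nat \<Rightarrow> nat" where
  "position (a, b) =
    (if a < 6 \<and> b = 11 then 206 - a else if a < 6 \<and> b = 12 then 250 + a
     else if a = 11 \<and> b < 6 then 306 - b else if a = 12 \<and> b < 6 then 350 + b else 13 * a + b)"

text \<open>At (3, 3), \<open>d\<close> is the truth value that a \<open>Source\<close> sends to the
  right, and the default \<open>False\<close> lets \<open>Start\<close> send its signal down. The
  choice at (0, 8) grants \<open>e\<close> in a \<open>Join\<close>.\<close>

definition good_choice :: "block \<Rightarrow> bool \<Rightarrow> bool \<Rightarrow> bool \<Rightarrow> choice" where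
  "good_choice B l t d p = (if p = (6, 0) then l \<and> \<not> t else if p = (0, 6) then B = Cross \<and> l
     else if p = (0, 8) then True else B = Source \<and> d)"

fun step_to :: "side \<Rightarrow> nat \<times> nat \<Rightarrow> (nat \<times> nat) option" where
  "step_to L_side (a, b) = (if b = 0 then None else Some (a, b - 1))"
| "step_to T_side (a, b) = (if a = 0 then None else Some (a - 1, b))"
| "step_to R_side (a, b) = (if b = 12 then None else Some (a, b + 1))"
| "step_to B_side (a, b) = (if a = 12 then None else Some (a + 1, b))"

definition arrive_ok :: "block \<Rightarrow> bool \<Rightarrow> bool \<Rightarrow> choice \<Rightarrow> nat \<times> nat \<Rightarrow> side \<Rightarrow> bool" where
  "arrive_ok B l t c p s = (case step_to s p of
     None \<Rightarrow> s = L_side \<and> fst p = 3 \<and> l \<or> s = T_side \<and> snd p = 3 \<and> t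
   | Some q \<Rightarrow> (case block_kind B l t c q of None \<Rightarrow> False
       | Some k \<Rightarrow> opposite s \<in> ports k \<and> position q < position p))"

definition leave_ok :: "block \<Rightarrow> bool \<Rightarrow> bool \<Rightarrow> choice \<Rightarrow> nat \<times> nat \<Rightarrow> side \<Rightarrow> bool" where
  "leave_ok B l t c p s = (case step_to s p of
     None \<Rightarrow> s = R_side \<or> s = B_side
   | Some q \<Rightarrow> (case block_kind B l t c q of None \<Rightarrow> True
       | Some k \<Rightarrow> opposite s \<in> ports k \<longrightarrow> position p < position q))"

definition flow_ok :: "block \<Rightarrow> bool \<Rightarrow> bool \<Rightarrow> choice \<Rightarrow> nat \<times> nat \<Rightarrow> bool" where
  "flow_ok B l t c p = (case block_kind B l t c p of None \<Rightarrow> True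
     | Some k \<Rightarrow> (\<forall>s \<in> ins k. arrive_ok B l t c p s) \<and>
                 (\<forall>s \<in> outs k - ins k. leave_ok B l t c p s))"

lemmas flow_simps = flow_ok_def leave_ok_def arrive_ok_def good_choice_def
  block_kind_def left_edge_def right_edge_def edge_def perm_s_def perm_e_def

lemma block_flow:
  assumes "a < 13" "b < 13"
  shows "flow_ok B l t (good_choice B l t d) (a, b)"
proof -
  have "\<forall>a < 13. \<forall>b < 13. flow_ok B l t (good_choice B l t d) (a, b)"
    unfolding less_13 upt_13
    by (cases B; cases l; cases t; cases d; simp add: flow_simps insert_Diff_if)
  then show ?thesis using assms by blast
qed

lemma right_output:
  assumes "right_edge B l t c (3, 12)"
  obtains k where "block_kind B l t c (3, 12) = Some k" "R_side \<in> ports k"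
  using assms by (cases B; auto simp: right_edge_def edge_def block_kind_def)

lemma bottom_output:
  assumes "bottom_edge B l t c (12, 3)"
  obtains k where "block_kind B l t c (12, 3) = Some k" "B_side \<in> ports k"
  using assms by (cases B; auto simp: bottom_edge_def edge_def block_kind_def)

declare board.simps [simp del] position.simps [simp del]

section \<open>Grids of blocks\<close>

definition gates :: "(nat \<Rightarrow> nat \<Rightarrow> block) \<Rightarrow> nat \<Rightarrow> nat \<Rightarrow> gate" where
  "gates T i j = block_gate (T (i div 13) (j div 13)) (i mod 13, j mod 13)"

definition consistent_blocks ::
    "nat \<Rightarrow> (nat \<Rightarrow> nat \<Rightarrow> block) \<Rightarrow> (nat \<Rightarrow> nat \<Rightarrow> choice) \<Rightarrow> (nat \<Rightarrow> nat \<Rightarrow> bool) \<Rightarrow> (nat \<Rightarrow> nat \<Rightarrow> bool) \<Rightarrow> bool"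
  where "consistent_blocks m T c h v \<longleftrightarrow> (\<forall>I < m. \<forall>J < m.
    h I J = right_edge (T I J) (h I (prv m J)) (v (prv m I) J) (c I J) (3, 12) \<and>
    v I J = bottom_edge (T I J) (h I (prv m J)) (v (prv m I) J) (c I J) (12, 3))"

lemma prv_13:
  assumes "i < 13 * m"
  shows "prv (13 * m) i div 13 = (if i mod 13 = 0 then prv m (i div 13) else i div 13)"
    and "prv (13 * m) i mod 13 = (if i mod 13 = 0 then 12 else i mod 13 - 1)"
proof -
  define I a where "I = i div 13" and "a = i mod 13"
  have i: "i = 13 * I + a" and a: "a < 13" and I: "I < m"
    using assms by (auto simp: I_def a_def less_mult_imp_div_less mult.commute)
  have "prv (13 * m) i = (if a = 0 then 13 * prv m I + 12 else 13 * I + (a - 1))"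
  proof (cases "a = 0")
    case True
    then show ?thesis
      using i I by (cases "I = 0") (auto simp: prv_eq diff_mult_distrib2)
  next
    case False
    then show ?thesis
      using i I a by (simp add: prv_eq)
  qed
  then show "prv (13 * m) i div 13 = (if i mod 13 = 0 then prv m (i div 13) else i div 13)"
    "prv (13 * m) i mod 13 = (if i mod 13 = 0 then 12 else i mod 13 - 1)"
    using a by (cases a; simp flip: I_def a_def)+
qed

lemma nxt_13:
  assumes "i < 13 * m"
  shows "nxt (13 * m) i div 13 = (if i mod 13 = 12 then nxt m (i div 13) else i div 13)"
    and "nxt (13 * m) i mod 13 = (if i mod 13 = 12 then 0 else i mod 13 + 1)"
proof -
  define I a where "I = i div 13" and "a = i mod 13"
  have i: "i = 13 * I + a" and a: "a < 13" and I: "I < m"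
    using assms by (auto simp: I_def a_def less_mult_imp_div_less mult.commute)
  have "nxt (13 * m) i = (if a = 12 then 13 * nxt m I else 13 * I + (a + 1))"
  proof (cases "a = 12")
    case True
    then show ?thesis
      using i I by (cases "I = m - 1") (cases m; simp add: nxt_def)+
  next
    case False
    then show ?thesis
      using i I a by (simp add: nxt_def)
  qed
  then show "nxt (13 * m) i div 13 = (if i mod 13 = 12 then nxt m (i div 13) else i div 13)"
    "nxt (13 * m) i mod 13 = (if i mod 13 = 12 then 0 else i mod 13 + 1)"
    unfolding I_def[symmetric] a_def[symmetric] using a by (cases "a = 12"; simp)+
qed

lemma board_border:
  assumes "board B (a, b) = Some (k, sg)" "a < 13" "b < 13"
  shows "b = 12 \<Longrightarrow> a = 3" and "a = 12 \<Longrightarrow> b = 3" and "gate_of k = Node \<Longrightarrow> a \<noteq> 0 \<and> b \<noteq> 0"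
  using block_ok[OF assms(2,3), of B undefined undefined undefined]
  unfolding entry_ok_def assms(1) option.case prod.case fst_conv snd_conv by blast+

text \<open>At the border \<open>edge\<close> looks up a position with index 13, one step outside
  the block, where the table must be empty too.\<close>

lemma board_outside:
  assumes "a < 13" "a \<noteq> 3"
  shows "board B (a, 13) = None" and "board B (13, a) = None"
proof -
  have "(\<forall>a < 13. a \<noteq> 3 \<longrightarrow> board B (a, 13) = None) \<and> (\<forall>a < 13. a \<noteq> 3 \<longrightarrow> board B (13, a) = None)"
    unfolding less_13 upt_13 by (cases B; simp add: board.simps)
  then show "board B (a, 13) = None" "board B (13, a) = None"
    using assms by blast+
qed

lemma right_edge_border: "a < 13 \<Longrightarrow> a \<noteq> 3 \<Longrightarrow> \<not> right_edge B l t c (a, 12)"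
  using board_border(1)[of B a 12] unfolding right_edge_def edge_def fst_conv snd_conv
  by (auto simp: board_outside simp del: board.simps split: option.split)

lemma bottom_edge_border: "b < 13 \<Longrightarrow> b \<noteq> 3 \<Longrightarrow> \<not> bottom_edge B l t c (12, b)"
  using board_border(2)[of B 12 b] unfolding bottom_edge_def edge_def fst_conv snd_conv
  by (auto simp: board_outside simp del: board.simps split: option.split)

text \<open>A labelling of the edges between blocks extends to all edges between gates, since the
  edges inside a block are functions of its two inputs and its choices.\<close>

locale labelled_blocks =
  fixes m T c h v
  assumes cons: "consistent_blocks m T c h v"
begin

definition L where "L I J = h I (prv m J)"
definition U where "U I J = v (prv m I) J"

lemma h_eq: "I < m \<Longrightarrow> J < m \<Longrightarrow> h I J = right_edge (T I J) (L I J) (U I J) (c I J) (3, 12)"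
  and v_eq: "I < m \<Longrightarrow> J < m \<Longrightarrow> v I J = bottom_edge (T I J) (L I J) (U I J) (c I J) (12, 3)"
  using cons unfolding consistent_blocks_def L_def U_def by blast+

definition gh where
  "gh i j = right_edge (T (i div 13) (j div 13)) (L (i div 13) (j div 13)) (U (i div 13) (j div 13))
     (c (i div 13) (j div 13)) (i mod 13, j mod 13)"

definition gv where
  "gv i j = bottom_edge (T (i div 13) (j div 13)) (L (i div 13) (j div 13)) (U (i div 13) (j div 13))
     (c (i div 13) (j div 13)) (i mod 13, j mod 13)"

lemma gh_prv:
  assumes "i < 13 * m" "j < 13 * m"
  shows "gh i (prv (13 * m) j) = left_edge (T (i div 13) (j div 13)) (L (i div 13) (j div 13))
     (U (i div 13) (j div 13)) (c (i div 13) (j div 13)) (i mod 13, j mod 13)"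
proof (cases "j mod 13 = 0")
  case True
  have IJ: "i div 13 < m" "prv m (j div 13) < m"
    using assms by (simp_all add: less_mult_imp_div_less mult.commute)
  have "gh i (prv (13 * m) j) = (i mod 13 = 3 \<and> h (i div 13) (prv m (j div 13)))"
    unfolding gh_def prv_13[OF assms(2)] h_eq[OF IJ] using True right_edge_border[of "i mod 13"]
    by (cases "i mod 13 = 3") simp_all
  then show ?thesis
    using True by (simp add: left_edge_def L_def)
next
  case False
  then show ?thesis
    unfolding gh_def prv_13[OF assms(2)] by (simp add: left_edge_def)
qed

lemma gv_prv:
  assumes "i < 13 * m" "j < 13 * m"
  shows "gv (prv (13 * m) i) j = top_edge (T (i div 13) (j div 13)) (L (i div 13) (j div 13))
     (U (i div 13) (j div 13)) (c (i div 13) (j div 13)) (i mod 13, j mod 13)"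
proof (cases "i mod 13 = 0")
  case True
  have IJ: "prv m (i div 13) < m" "j div 13 < m"
    using assms by (simp_all add: less_mult_imp_div_less mult.commute)
  have "gv (prv (13 * m) i) j = (j mod 13 = 3 \<and> v (prv m (i div 13)) (j div 13))"
    unfolding gv_def prv_13[OF assms(1)] v_eq[OF IJ] using True bottom_edge_border[of "j mod 13"]
    by (cases "j mod 13 = 3") simp_all
  then show ?thesis
    using True by (simp add: top_edge_def U_def)
next
  case False
  then show ?thesis
    unfolding gv_def prv_13[OF assms(1)] by (simp add: top_edge_def)
qed

lemma consistent_gates:
  "consistent (13 * m) (gates T) gh gv (\<lambda>i j. c (i div 13) (j div 13) (i mod 13, j mod 13))"
  unfolding consistent_def
proof (intro allI impI)
  fix i j assume ij: "i < 13 * m" "j < 13 * m"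
  show "gate_ok (gates T i j) (gh i (prv (13 * m) j)) (gv (prv (13 * m) i) j) (gh i j) (gv i j)
     (c (i div 13) (j div 13) (i mod 13, j mod 13))"
    unfolding gh_prv[OF ij] gv_prv[OF ij] gates_def block_gate_def
    using block_ok[of "i mod 13" "j mod 13" "T (i div 13) (j div 13)"]
    by (auto simp: entry_ok_def gh_def gv_def split: option.splits)
qed

end

definition output_cell :: "nat \<Rightarrow> nat \<Rightarrow> cell" where
  "output_cell I J = (24 * (13 * I + 12) + 23, 24 * (13 * J + 3) + 17)"

theorem blocks_sound:
  assumes r: "reach (24 * (13 * m)) (pattern (gates T)) y"
  obtains c where "\<And>h v I J. consistent_blocks m T c h v \<Longrightarrow> I < m \<Longrightarrow> J < m \<Longrightarrow>
    y (output_cell I J) \<Longrightarrow> v I J"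
proof -
  obtain ch where ch: "\<And>h v i j. consistent (13 * m) (gates T) h v ch \<Longrightarrow> i < 13 * m \<Longrightarrow> j < 13 * m \<Longrightarrow>
      y (24 * i + 23, 24 * j + 17) \<Longrightarrow> v i j"
    using gates_sound[OF r] by blast
  define c where "c = (\<lambda>I J p. case p of (a, b) \<Rightarrow> ch (13 * I + a) (13 * J + b))"
  have c: "(\<lambda>i j. c (i div 13) (j div 13) (i mod 13, j mod 13)) = ch"
    by (simp add: c_def fun_eq_iff)
  have "v I J" if "consistent_blocks m T c h v" "I < m" "J < m" "y (output_cell I J)" for h v I J
  proof -
    interpret labelled_blocks m T c h v
      by unfold_locales (rule that(1))
    have "gv (13 * I + 12) (13 * J + 3)"
    proof (rule ch)
      show "consistent (13 * m) (gates T) gh gv ch"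
        using consistent_gates unfolding c .
      show "13 * I + 12 < 13 * m" "13 * J + 3 < 13 * m"
        using that by simp_all
      show "y (24 * (13 * I + 12) + 23, 24 * (13 * J + 3) + 17)"
        using that(4) unfolding output_cell_def .
    qed
    then show "v I J"
      unfolding v_eq[OF that(2,3)] gv_def by simp
  qed
  then show ?thesis
    by (rule that)
qed

lemma position_inj:
  assumes "a < 13" "b < 13" "a' < 13" "b' < 13" "position (a, b) = position (a', b')"
  shows "a = a' \<and> b = b'"
proof -
  have *: "13 * a + b = 13 * a' + b' \<Longrightarrow> a = a' \<and> b = b'"
    using assms(2,4) by (metis div_mult_self4 mod_mult_self4 div_less mod_less add_0_right zero_neq_numeral)
  have "13 * a + b < 169" "13 * a' + b' < 169"
    using assms by auto
  then show ?thesis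
    using assms * by (auto simp: position.simps split: if_splits)
qed

lemma position_less: "a < 13 \<Longrightarrow> b < 13 \<Longrightarrow> position (a, b) < 1000"
  by (auto simp: position.simps)

lemma block_kind_Empty [simp]: "block_kind Empty l t c p = None"
  by (cases p) (simp add: block_kind_def board.simps)

lemma arrive_okE:
  assumes "arrive_ok B l t c (a, b) p"
  obtains (inside) q k where "step_to p (a, b) = Some q" "block_kind B l t c q = Some k"
      "opposite p \<in> ports k" "position q < position (a, b)"
    | (left) "p = L_side" "a = 3" "b = 0" "l"
    | (top) "p = T_side" "b = 3" "a = 0" "t"
proof (cases "step_to p (a, b)")
  case None
  then show ?thesis
    using assms that(2,3) unfolding arrive_ok_def by (cases p) (auto split: if_splits)
next
  case (Some q)
  then show ?thesis
    using assms that(1) unfolding arrive_ok_def by (auto split: option.splits)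
qed

lemma step_to_Some:
  assumes "i < 13 * m" "j < 13 * m" "adjacent (13 * m) p (i, j) = (i', j')"
    and "step_to p (i mod 13, j mod 13) = Some (a', b')"
  shows "i' div 13 = i div 13" "i' mod 13 = a'" "j' div 13 = j div 13" "j' mod 13 = b'"
  using assms by (cases p; auto simp: prv_13 nxt_13 split: if_splits)+

text \<open>Signals pass between blocks only to the right and down. \<open>no_wrap\<close> and
  \<open>empty_top\<close> exclude dependencies around the torus, so that row-major order of the
  blocks, refined by \<open>position\<close> within a block, is a valid schedule.\<close>

theorem blocks_complete:
  fixes m :: nat and T :: "nat \<Rightarrow> nat \<Rightarrow> block" and d h v :: "nat \<Rightarrow> nat \<Rightarrow> bool"
  defines "c \<equiv> (\<lambda>h v I J. good_choice (T I J) (h I (prv m J)) (v (prv m I) J) (d I J))"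
  assumes m: "2 \<le> m" and cons: "consistent_blocks m T (c h v) h v"
    and no_wrap: "\<And>I. I < m \<Longrightarrow> \<not> h I (m - 1)" and empty_top: "\<And>J. J < m \<Longrightarrow> T 0 J = Empty"
  shows "\<exists>y. reach (24 * (13 * m)) (pattern (gates T)) y \<and>
    (\<forall>I < m. \<forall>J < m. v I J \<longrightarrow> y (output_cell I J))"
proof -
  interpret labelled_blocks m T "c h v" h v
    by unfold_locales (rule cons)
  let ?g = "13 * m"
  define bk where "bk = (\<lambda>I J. block_kind (T I J) (L I J) (U I J) (c h v I J))"
  define \<kappa> where "\<kappa> = (\<lambda>i j. bk (i div 13) (j div 13) (i mod 13, j mod 13))"
  \<comment> \<open>Lexicographic order in one number: the factor 1000 exceeds every
    \<open>position\<close>.\<close>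
  define rk where "rk = (\<lambda>i j. ((i div 13) * m + j div 13) * 1000 + position (i mod 13, j mod 13))"
  have flow: "flow_ok (T I J) (L I J) (U I J) (c h v I J) (a, b)" if "a < 13" "b < 13" for I J a b
    using block_flow[OF that] by (simp add: c_def L_def U_def)
  have rk_less: "rk i j < rk i' j'"
    if "(i div 13) * m + j div 13 < (i' div 13) * m + j' div 13" for i j i' j'
  proof -
    have "rk i j < ((i div 13) * m + j div 13 + 1) * 1000"
      using position_less[of "i mod 13" "j mod 13"] by (simp add: rk_def)
    also have "\<dots> \<le> ((i' div 13) * m + j' div 13) * 1000"
      using that by (intro mult_le_mono1) simp
    finally show ?thesis by (simp add: rk_def)
  qed
  have div_less: "i div 13 < m" if "i < ?g" for i
    using that by (simp add: less_mult_imp_div_less mult.commute)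
  have edge_kind: "\<exists>k'. \<kappa> i' j' = Some k' \<and> opposite p \<in> ports k' \<and> rk i' j' < rk i j"
    if ij: "i < ?g" "j < ?g" and k: "\<kappa> i j = Some k" and p: "p \<in> ins k"
      and adj: "adjacent ?g p (i, j) = (i', j')" for i j k p i' j'
  proof -
    define I a J b where "I = i div 13" and "a = i mod 13" and "J = j div 13" and "b = j mod 13"
    have ab: "a < 13" "b < 13" and IJ: "I < m" "J < m"
      using ij div_less by (simp_all add: a_def b_def I_def J_def)
    have "arrive_ok (T I J) (L I J) (U I J) (c h v I J) (a, b) p"
      using flow[OF ab, of I J] k p unfolding flow_ok_def \<kappa>_def bk_def I_def J_def a_def b_def
      by simp
    then show ?thesis
    proof (cases rule: arrive_okE)
      case (inside q k')
      obtain a' b' where q: "q = (a', b')" by (cases q)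
      note ij' = step_to_Some[OF ij adj inside(1)[unfolded q a_def b_def]]
      have "\<kappa> i' j' = Some k'"
        using inside(2) by (simp add: \<kappa>_def bk_def ij' q flip: I_def J_def)
      moreover have "rk i' j' < rk i j"
        using inside(4) by (simp add: rk_def ij' q flip: I_def J_def a_def b_def)
      ultimately show ?thesis
        using inside(3) by blast
    next
      case left
      then have "J \<noteq> 0"
        using no_wrap[OF IJ(1)] IJ by (cases "J = 0") (auto simp: L_def prv_eq)
      have ij': "i' div 13 = I" "i' mod 13 = 3" "j' div 13 = J - 1" "j' mod 13 = 12"
        using left adj prv_13[OF ij(2)] \<open>J \<noteq> 0\<close> IJ unfolding I_def J_def a_def b_def
        by (auto simp: prv_eq split: if_splits)
      have "h I (J - 1)"
        using left IJ \<open>J \<noteq> 0\<close> by (simp add: L_def prv_eq)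
      then obtain k' where "bk I (J - 1) (3, 12) = Some k'" "R_side \<in> ports k'"
        using h_eq[of I "J - 1"] IJ right_output unfolding bk_def by (metis less_imp_diff_less)
      moreover have "rk i' j' < rk i j"
        using \<open>J \<noteq> 0\<close> by (intro rk_less) (simp add: ij' flip: I_def J_def)
      ultimately show ?thesis
        using left by (simp add: \<kappa>_def ij')
    next
      case top
      have "T I J \<noteq> Empty"
        using k unfolding \<kappa>_def bk_def I_def[symmetric] J_def[symmetric] by auto
      then have "I \<noteq> 0"
        using empty_top[OF IJ(2)] by metis
      have ij': "i' div 13 = I - 1" "i' mod 13 = 12" "j' div 13 = J" "j' mod 13 = 3"
        using top adj prv_13[OF ij(1)] \<open>I \<noteq> 0\<close> IJ unfolding I_def J_def a_def b_def
        by (auto simp: prv_eq split: if_splits)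
      have "v (I - 1) J"
        using top IJ \<open>I \<noteq> 0\<close> by (simp add: U_def prv_eq)
      then obtain k' where "bk (I - 1) J (12, 3) = Some k'" "B_side \<in> ports k'"
        using v_eq[of "I - 1" J] IJ bottom_output unfolding bk_def by (metis less_imp_diff_less)
      moreover have "rk i' j' < rk i j"
      proof (rule rk_less)
        have "(I - 1) * m + m = I * m"
          using \<open>I \<noteq> 0\<close> by (cases I) simp_all
        then show "(i' div 13) * m + j' div 13 < (i div 13) * m + j div 13"
          using m unfolding ij' I_def[symmetric] J_def[symmetric] by linarith
      qed
      ultimately show ?thesis
        using top by (simp add: \<kappa>_def ij')
    qed
  qed
  have leave: "rk i j < rk i' j'"
    if ij: "i < ?g" "j < ?g" and k: "\<kappa> i j = Some k" and p: "p \<in> outs k - ins k"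
      and adj: "adjacent ?g p (i, j) = (i', j')"
      and k': "\<kappa> i' j' = Some k'" "opposite p \<in> ports k'" for i j k p i' j' k'
  proof -
    define I a J b where "I = i div 13" and "a = i mod 13" and "J = j div 13" and "b = j mod 13"
    have ab: "a < 13" "b < 13" and IJ: "I < m" "J < m"
      using ij div_less by (simp_all add: a_def b_def I_def J_def)
    have *: "leave_ok (T I J) (L I J) (U I J) (c h v I J) (a, b) p"
      using flow[OF ab, of I J] k p unfolding flow_ok_def \<kappa>_def bk_def I_def J_def a_def b_def
      by simp
    show ?thesis
    proof (cases "step_to p (a, b)")
      case (Some q)
      obtain a' b' where q: "q = (a', b')" by (cases q)
      note ij' = step_to_Some[OF ij adj Some[unfolded q a_def b_def]]
      have "bk I J (a', b') = Some k'"
        using k' by (simp add: \<kappa>_def ij' flip: I_def J_def)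
      then have "position (a, b) < position (a', b')"
        using * k'(2) Some q unfolding leave_ok_def bk_def by auto
      then show ?thesis
        using ij' by (simp add: rk_def flip: I_def J_def a_def b_def)
    next
      case None
      then consider (right) "p = R_side" "b = 12" | (bottom) "p = B_side" "a = 12"
        using * unfolding leave_ok_def by (cases p) (auto split: if_splits)
      then show ?thesis
      proof cases
        case right
        have ij': "i' = i" "j' div 13 = nxt m J" "j' mod 13 = 0"
          using right adj nxt_13[OF ij(2)] unfolding J_def b_def by auto
        \<comment> \<open>Across the wrap-around, the gate in column 0 would use its left port. It
          cannot be an output at the edge of a block, so it would be an input fed by the last
          column, against \<open>no_wrap\<close>.\<close>
        have "nxt m J \<noteq> 0"
        proof
          assume "nxt m J = 0"
          then have J: "J = m - 1"
            using IJ by (auto simp: nxt_eq split: if_splits)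
          have "L_side \<in> ins k' \<or> L_side \<in> outs k' - ins k'"
            using k'(2) right by auto
          moreover have k'': "bk I 0 (a, 0) = Some k'"
            using k'(1) ij' \<open>nxt m J = 0\<close> by (simp add: \<kappa>_def I_def a_def)
          moreover have "\<not> leave_ok (T I 0) (L I 0) (U I 0) (c h v I 0) (a, 0) L_side"
            by (simp add: leave_ok_def)
          ultimately have "arrive_ok (T I 0) (L I 0) (U I 0) (c h v I 0) (a, 0) L_side"
            using flow[OF ab(1), of 0 I 0] unfolding flow_ok_def bk_def by auto
          then have "L I 0"
            by (simp add: arrive_ok_def)
          then show False
            using no_wrap[OF IJ(1)] m by (simp add: L_def prv_eq)
        qed
        then show ?thesis
          using IJ by (intro rk_less) (auto simp: ij' nxt_eq simp flip: I_def J_def split: if_splits)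
      next
        case bottom
        have ij': "i' div 13 = nxt m I" "j' = j"
          using bottom adj nxt_13[OF ij(1)] unfolding I_def a_def by auto
        have "T (i' div 13) (j' div 13) \<noteq> Empty"
          using k'(1) unfolding \<kappa>_def bk_def by auto
        then have "nxt m I \<noteq> 0"
          using empty_top[OF IJ(2)] unfolding ij' J_def by metis
        then have "nxt m I = I + 1"
          using IJ by (auto simp: nxt_eq split: if_splits)
        then show ?thesis
          using m by (intro rk_less) (simp add: ij' flip: I_def J_def)
      qed
    qed
  qed
  have "\<exists>y. reach (24 * ?g) (pattern (gates T)) y \<and>
    (\<forall>i < ?g. \<forall>j < ?g. \<forall>k. \<kappa> i j = Some k \<longrightarrow> (\<forall>p \<in> ports k. y (cell_at (i, j) (port p))))"
  proof (rule gates_complete[where rk = rk])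
    show "2 \<le> ?g" using m by simp
  next
    fix i j k assume "\<kappa> i j = Some k"
    then show "gates T i j = gate_of k"
      by (auto simp: \<kappa>_def bk_def block_kind_def gates_def block_gate_def split: option.splits if_splits)
  next
    fix i j i' j' k k'
    assume ij: "i < ?g" "j < ?g" "i' < ?g" "j' < ?g" and eq: "rk i j = rk i' j'"
    have "(i div 13) * m + j div 13 = (i' div 13) * m + j' div 13"
      using rk_less[of i j i' j'] rk_less[of i' j' i j] eq by (metis less_irrefl linorder_neqE_nat)
    moreover from this have "position (i mod 13, j mod 13) = position (i' mod 13, j' mod 13)"
      using eq unfolding rk_def by simp
    then have "i mod 13 = i' mod 13 \<and> j mod 13 = j' mod 13"
      by (intro position_inj) simp_all
    moreover have "i div 13 = i' div 13 \<and> j div 13 = j' div 13"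
      if "(i div 13) * m + j div 13 = (i' div 13) * m + j' div 13"
      using arg_cong[OF that, of "\<lambda>x. x div m"] arg_cong[OF that, of "\<lambda>x. x mod m"]
        div_less[OF ij(2)] div_less[OF ij(4)] by simp
    ultimately show "i = i' \<and> j = j'"
      by (metis mult_div_mod_eq)
  qed (use edge_kind leave in blast)+
  then obtain y where y: "reach (24 * ?g) (pattern (gates T)) y"
    "\<And>i j k p. i < ?g \<Longrightarrow> j < ?g \<Longrightarrow> \<kappa> i j = Some k \<Longrightarrow> p \<in> ports k \<Longrightarrow> y (cell_at (i, j) (port p))"
    by blast
  have "y (output_cell I J)" if IJ: "I < m" "J < m" and "v I J" for I J
  proof -
    obtain k where k: "bk I J (12, 3) = Some k" "B_side \<in> ports k"
      using \<open>v I J\<close> v_eq[OF IJ] bottom_output unfolding bk_def by metis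
    have "y (cell_at (13 * I + 12, 13 * J + 3) (port B_side))"
      using k IJ by (intro y(2)) (auto simp: \<kappa>_def)
    then show ?thesis
      by (simp add: output_cell_def)
  qed
  then show ?thesis
    using y(1) by blast
qed

section \<open>Satisfiability of a clause matrix\<close>

text \<open>
  Column \<open>J < J\<^sub>0\<close> carries a literal: the literals of variable \<open>k\<close> are in the columns \<open>2 * k\<close>
  (negative) and \<open>2 * k + 1\<close> (positive). Row \<open>r\<close> below the row \<open>t\<close> of sources is a clause: the
  literals \<open>J\<close> with \<open>occ r J\<close> are joined, and column \<open>J\<^sub>0\<close> collects the conjunction.
\<close>

definition matrix :: "nat \<Rightarrow> nat \<Rightarrow> (nat \<Rightarrow> nat \<Rightarrow> bool) \<Rightarrow> nat \<Rightarrow> nat \<Rightarrow> block" where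
  "matrix t J\<^sub>0 occ I J =
     (if I < t \<or> J\<^sub>0 < J then Empty
      else if I = t then (if J = J\<^sub>0 then Start else if even J then Source else Turn)
      else if J = J\<^sub>0 then Meet
      else if occ (I - t - 1) J then Join else Cross)"

text \<open>In \<open>Cross\<close>, leaving to the right needs \<open>e\<close>, that is
  \<open>c (0, 6)\<close>, which withholds \<open>n\<close>; then the hub is active only if
  \<open>l\<close> is. In \<open>Join\<close>, \<open>e\<close> has its own choice at (0, 8), so
  \<open>t\<close> may leave to the right as well. In both, leaving at the bottom needs
  \<open>s\<close>, which withholds \<open>w\<close>, so it requires \<open>t\<close>.\<close>

lemma right_edges:
  "right_edge Empty l t c (3, 12) \<longleftrightarrow> False"
  "right_edge Source l t c (3, 12) \<longleftrightarrow> c (3, 3)"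
  "right_edge Turn l t c (3, 12) \<longleftrightarrow> False"
  "right_edge Meet l t c (3, 12) \<longleftrightarrow> False"
  "right_edge Start l t c (3, 12) \<longleftrightarrow> False"
  "right_edge Cross l t c (3, 12) \<longleftrightarrow> (l \<and> c (6, 0) \<or> t \<and> (l \<or> \<not> c (0, 6))) \<and> c (0, 6)"
  "right_edge Join l t c (3, 12) \<longleftrightarrow> (l \<and> c (6, 0) \<or> t \<and> (l \<or> \<not> c (0, 6))) \<and> c (0, 8)"
  by (simp_all add: right_edge_def edge_def board.simps perm_e_def)

lemma bottom_edges:
  "bottom_edge Empty l t c (12, 3) \<longleftrightarrow> False"
  "bottom_edge Source l t c (12, 3) \<longleftrightarrow> \<not> c (3, 3)"
  "bottom_edge Turn l t c (12, 3) \<longleftrightarrow> l"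
  "bottom_edge Meet l t c (12, 3) \<longleftrightarrow> l \<and> t"
  "bottom_edge Start l t c (12, 3) \<longleftrightarrow> \<not> c (3, 3)"
  "bottom_edge Cross l t c (12, 3) \<longleftrightarrow> (l \<and> c (6, 0) \<or> t \<and> (l \<or> \<not> c (0, 6))) \<and> \<not> c (6, 0)"
  "bottom_edge Join l t c (12, 3) \<longleftrightarrow> (l \<and> c (6, 0) \<or> t \<and> (l \<or> \<not> c (0, 6))) \<and> \<not> c (6, 0)"
  by (simp_all add: bottom_edge_def edge_def board.simps perm_s_def)

text \<open>The choices determine all signals, by recursion from the top left corner, because blocks
  transmit only to the right and down. No signal enters from outside.\<close>

fun label :: "(nat \<Rightarrow> nat \<Rightarrow> block) \<Rightarrow> (nat \<Rightarrow> nat \<Rightarrow> choice) \<Rightarrow> nat \<Rightarrow> nat \<Rightarrow> bool \<times> bool" where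
  "label T c I J =
     (let l = (case J of 0 \<Rightarrow> False | Suc J' \<Rightarrow> fst (label T c I J'));
          t = (case I of 0 \<Rightarrow> False | Suc I' \<Rightarrow> snd (label T c I' J))
      in (right_edge (T I J) l t (c I J) (3, 12), bottom_edge (T I J) l t (c I J) (12, 3)))"

declare label.simps [simp del]

lemma consistent_label:
  assumes "2 \<le> m" and no_wrap: "\<And>I. I < m \<Longrightarrow> \<not> fst (label T c I (m - 1))"
    and empty_top: "\<And>J. J < m \<Longrightarrow> T 0 J = Empty"
  shows "consistent_blocks m T c (\<lambda>I J. fst (label T c I J)) (\<lambda>I J. snd (label T c I J))"
  unfolding consistent_blocks_def
proof (intro allI impI)
  fix I J assume IJ: "I < m" "J < m"
  show "fst (label T c I J) = right_edge (T I J) (fst (label T c I (prv m J)))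
        (snd (label T c (prv m I) J)) (c I J) (3, 12) \<and>
     snd (label T c I J) = bottom_edge (T I J) (fst (label T c I (prv m J)))
        (snd (label T c (prv m I) J)) (c I J) (12, 3)"
  proof (cases "I = 0")
    case True
    then show ?thesis
      unfolding label.simps[of T c I J] using empty_top[OF IJ(2)]
      by (simp add: right_edges bottom_edges)
  next
    case False
    moreover have "(case J of 0 \<Rightarrow> False | Suc J' \<Rightarrow> fst (label T c I J')) = fst (label T c I (prv m J))"
      using no_wrap[OF IJ(1)] IJ by (cases J) (simp_all add: prv_eq)
    moreover have "(case I of 0 \<Rightarrow> False | Suc I' \<Rightarrow> snd (label T c I' J)) = snd (label T c (prv m I) J)"
      using False IJ by (cases I) (simp_all add: prv_eq)
    ultimately show ?thesis
      unfolding label.simps[of T c I J] by (simp add: Let_def)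
  qed
qed

text \<open>From a run, three invariants follow: a signal in a literal column means a true literal,
  a signal in a clause row means a true literal of the clause so far, and a signal in column
  \<open>J\<^sub>0\<close> means that all clauses above are satisfied. Conversely a satisfying
  assignment gives signals that are consistent with good choices. Evenness of
  \<open>J\<^sub>0\<close> makes the pairs of \<open>Source\<close> and \<open>Turn\<close>
  complete.\<close>

theorem matrix_unstable_iff:
  assumes t: "1 \<le> t" "t + 1 < m" and J0: "J\<^sub>0 + 1 < m" "even J\<^sub>0"
  shows "async_unstable S22 (312 * m) (pattern (gates (matrix t J\<^sub>0 occ))) (output_cell (m - 1) J\<^sub>0) \<longleftrightarrow>
    (\<exists>\<beta>. \<forall>r < m - t - 1. \<exists>J < J\<^sub>0. occ r J \<and> (odd J \<longleftrightarrow> \<beta> (J div 2)))"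
    (is "?L \<longleftrightarrow> ?R")
proof -
  let ?T = "matrix t J\<^sub>0 occ" and ?u = "output_cell (m - 1) J\<^sub>0"
  have m: "2 \<le> m" "24 * (13 * m) = 312 * m" using t by auto
  have u: "?u \<in> torus (312 * m)"
    using t J0 by (auto simp: output_cell_def torus_def)
  have "\<not> bit (active_rows (gates ?T (13 * (m - 1) + 12) (13 * J\<^sub>0 + 3)) ! 23) 17"
    by (rule port_inactive[of B_side]) simp
  then have "\<not> pattern (gates ?T) ?u"
    unfolding pattern_def output_cell_def by (subst paint_cell) simp_all
  then have L: "?L \<longleftrightarrow> (\<exists>y. reach (24 * (13 * m)) (pattern (gates ?T)) y \<and> y ?u)"
    unfolding m(2) async_unstable_iff_reach[OF u] by simp
  show ?thesis
  proof
    assume ?L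
    then obtain y where y: "reach (24 * (13 * m)) (pattern (gates ?T)) y" "y ?u"
      using L by blast
    obtain c where c: "\<And>h v I J. consistent_blocks m ?T c h v \<Longrightarrow> I < m \<Longrightarrow> J < m \<Longrightarrow>
        y (output_cell I J) \<Longrightarrow> v I J"
      using blocks_sound[OF y(1)] by blast
    define h v where "h = (\<lambda>I J. fst (label ?T c I J))" and "v = (\<lambda>I J. snd (label ?T c I J))"
    have h: "h I J = right_edge (?T I J) (case J of 0 \<Rightarrow> False | Suc J' \<Rightarrow> h I J')
        (case I of 0 \<Rightarrow> False | Suc I' \<Rightarrow> v I' J) (c I J) (3, 12)"
      and v: "v I J = bottom_edge (?T I J) (case J of 0 \<Rightarrow> False | Suc J' \<Rightarrow> h I J')
        (case I of 0 \<Rightarrow> False | Suc I' \<Rightarrow> v I' J) (c I J) (12, 3)" for I J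
      unfolding h_def v_def by (subst label.simps, simp add: Let_def)+
    have "J\<^sub>0 < m - 1"
      using J0 by simp
    then have "?T I (m - 1) = Empty" for I
      by (simp add: matrix_def)
    then have "\<not> h I (m - 1)" for I
      using h[of I "m - 1"] by (simp add: right_edges)
    then have no_wrap: "\<not> fst (label ?T c I (m - 1))" for I
      by (simp add: h_def)
    have "consistent_blocks m ?T c h v"
      unfolding h_def v_def
    proof (rule consistent_label[OF m(1)])
      show "\<not> fst (label ?T c I (m - 1))" for I
        by (rule no_wrap)
      show "?T 0 J = Empty" for J
        using t by (simp add: matrix_def)
    qed
    then have vt: "v (m - 1) J\<^sub>0"
      using c[of h v "m - 1" J\<^sub>0] y(2) t J0 by simp
    \<comment> \<open>The choice at the source of variable \<open>k\<close>: to the right it feeds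
      the \<open>Turn\<close> of the positive literal, downwards the column of the negative
      one.\<close>
    define \<beta> where "\<beta> = (\<lambda>k. c t (2 * k) (3, 3))"
    define lit where "lit = (\<lambda>J. odd J \<longleftrightarrow> \<beta> (J div 2))"
    have lit: "v (t + r) J \<Longrightarrow> J < J\<^sub>0 \<Longrightarrow> lit J" for r J
    proof (induction r)
      case 0
      show ?case
      proof (cases "even J")
        case True
        then show ?thesis
          using 0 v[of t J] by (auto simp: matrix_def bottom_edges lit_def \<beta>_def)
      next
        case False
        then obtain k where k: "J = Suc (2 * k)" by (auto elim!: oddE)
        then have "h t (2 * k)"
          using 0 v[of t J] by (simp add: matrix_def bottom_edges)
        then have "\<beta> k"
          using 0 k h[of t "2 * k"] by (simp add: matrix_def right_edges \<beta>_def)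
        then show ?thesis using k by (simp add: lit_def)
      qed
    next
      case (Suc r)
      then have "v (t + r) J"
        using v[of "t + Suc r" J] by (auto simp: matrix_def bottom_edges split: if_splits)
      then show ?case using Suc by blast
    qed
    have row: "h (t + Suc r) J \<Longrightarrow> J < J\<^sub>0 \<Longrightarrow> \<exists>J' < J\<^sub>0. occ r J' \<and> lit J'" for r J
    proof (induction J)
      case 0
      then show ?case
        using h[of "t + Suc r" 0] lit[of r 0] by (auto simp: matrix_def right_edges split: if_splits)
    next
      case (Suc J)
      show ?case
      proof (cases "h (t + Suc r) J")
        case True
        then show ?thesis using Suc by simp
      next
        case False
        then show ?thesis
          using Suc.prems h[of "t + Suc r" "Suc J"] lit[of r "Suc J"]
          by (auto simp: matrix_def right_edges split: if_splits)
      qed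
    qed
    have col: "v (t + s) J\<^sub>0 \<Longrightarrow> r < s \<Longrightarrow> \<exists>J < J\<^sub>0. occ r J \<and> lit J" for r s
    proof (induction s)
      case 0
      then show ?case by simp
    next
      case (Suc s)
      have "v (t + s) J\<^sub>0" and hs: "case J\<^sub>0 of 0 \<Rightarrow> False | Suc J' \<Rightarrow> h (t + Suc s) J'"
        using Suc.prems(1) v[of "t + Suc s" J\<^sub>0] by (simp_all add: matrix_def bottom_edges)
      show ?case
      proof (cases "r = s")
        case True
        obtain J' where "J\<^sub>0 = Suc J'" using hs by (cases J\<^sub>0) auto
        then show ?thesis using True hs row[of s J'] by simp
      next
        case False
        then show ?thesis using Suc \<open>v (t + s) J\<^sub>0\<close> by simp
      qed
    qed
    have "v (t + (m - 1 - t)) J\<^sub>0" using vt t by simp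
    then show ?R
      using col[of "m - 1 - t"] by (intro exI[of _ \<beta>]) (auto simp: lit_def)
  next
    assume ?R
    then obtain \<beta> where \<beta>: "\<And>r. r < m - t - 1 \<Longrightarrow> \<exists>J < J\<^sub>0. occ r J \<and> (odd J \<longleftrightarrow> \<beta> (J div 2))"
      by blast
    define lit where "lit = (\<lambda>J. odd J \<longleftrightarrow> \<beta> (J div 2))"
    \<comment> \<open>In the intended run the row of a clause carries the disjunction of its
      literals up to column \<open>J\<close>, and \<open>v\<close> carries exactly the true literals
      and the conjunction.\<close>
    define h where "h = (\<lambda>I J. if I < t \<or> J\<^sub>0 \<le> J then False else if I = t then even J \<and> \<beta> (J div 2)
      else \<exists>J' \<le> J. occ (I - t - 1) J' \<and> lit J')"
    define v where "v = (\<lambda>I J. t \<le> I \<and> (J < J\<^sub>0 \<and> lit J \<or> J = J\<^sub>0))"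
    define d where "d = (\<lambda>(I :: nat) J. \<beta> (J div 2))"
    have "J\<^sub>0 \<le> m - 1"
      using J0 by simp
    then have wrap: "\<not> h I (m - 1)" for I
      by (simp add: h_def)
    have "\<exists>y. reach (24 * (13 * m)) (pattern (gates ?T)) y \<and> (\<forall>I < m. \<forall>J < m. v I J \<longrightarrow> y (output_cell I J))"
    proof (rule blocks_complete[OF m(1), where d = d and h = h])
      show "\<not> h I (m - 1)" for I by (rule wrap)
      show "?T 0 J = Empty" for J using t by (simp add: matrix_def)
      show "consistent_blocks m ?T
         (\<lambda>I J. good_choice (?T I J) (h I (prv m J)) (v (prv m I) J) (d I J)) h v"
        unfolding consistent_blocks_def
      proof (intro allI impI)
        fix I J assume IJ: "I < m" "J < m"
        let ?l = "h I (prv m J)" and ?t = "v (prv m I) J"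
        have l: "?l \<longleftrightarrow> J \<noteq> 0 \<and> h I (J - 1)"
          using wrap IJ by (simp add: prv_eq)
        consider (empty) "I < t \<or> J\<^sub>0 < J" | (source) "I = t" "J < J\<^sub>0" "even J"
          | (turn) "I = t" "J < J\<^sub>0" "odd J" | (start) "I = t" "J = J\<^sub>0"
          | (meet) "t < I" "J = J\<^sub>0" | (join) "t < I" "J < J\<^sub>0" "occ (I - t - 1) J"
          | (cross) "t < I" "J < J\<^sub>0" "\<not> occ (I - t - 1) J"
          by linarith
        then show "h I J = right_edge (?T I J) ?l ?t (good_choice (?T I J) ?l ?t (d I J)) (3, 12) \<and>
           v I J = bottom_edge (?T I J) ?l ?t (good_choice (?T I J) ?l ?t (d I J)) (12, 3)"
        proof cases
          case empty
          then show ?thesis by (auto simp: matrix_def right_edges bottom_edges h_def v_def)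
        next
          case source
          then show ?thesis
            by (auto simp: matrix_def right_edges bottom_edges h_def v_def good_choice_def d_def lit_def)
        next
          case turn
          then obtain k where k: "J = Suc (2 * k)"
            by (auto elim!: oddE)
          then have "?l \<longleftrightarrow> \<beta> (J div 2)"
            using turn unfolding l by (simp add: h_def)
          then show ?thesis
            using turn by (auto simp: matrix_def right_edges bottom_edges h_def v_def lit_def)
        next
          case start
          then show ?thesis
            by (auto simp: matrix_def right_edges bottom_edges h_def v_def good_choice_def)
        next
          case meet
          have "I - t - 1 < m - t - 1"
            using meet IJ by linarith
          then obtain J' where J': "J' < J\<^sub>0" "occ (I - t - 1) J'" "lit J'"
            using \<beta>[of "I - t - 1"] unfolding lit_def by blast
          then have "J \<noteq> 0" "\<not> J\<^sub>0 \<le> J - 1" "J' \<le> J - 1"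
            using meet by auto
          then have "?l"
            using meet J' unfolding l by (auto simp: h_def)
          moreover have "?t"
            using meet IJ by (auto simp: v_def prv_eq)
          ultimately show ?thesis
            using meet by (auto simp: matrix_def right_edges bottom_edges h_def v_def)
        next
          case join
          have t': "?t \<longleftrightarrow> lit J"
            using join IJ by (auto simp: v_def prv_eq)
          have h': "h I J \<longleftrightarrow> ?l \<or> lit J"
            using join unfolding l by (cases J) (auto simp: h_def le_Suc_eq)
          show ?thesis
            using join t' h' by (auto simp: matrix_def right_edges bottom_edges v_def good_choice_def)
        next
          case cross
          have t': "?t \<longleftrightarrow> lit J"
            using cross IJ by (auto simp: v_def prv_eq)
          have h': "h I J \<longleftrightarrow> ?l"
            using cross unfolding l by (cases J) (auto simp: h_def le_Suc_eq)
          show ?thesis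
            using cross t' h' by (auto simp: matrix_def right_edges bottom_edges v_def good_choice_def)
        qed
      qed
    qed
    moreover have "v (m - 1) J\<^sub>0" using t by (simp add: v_def)
    ultimately show ?L
      unfolding L using t J0 by (metis add_lessD1 diff_less m(1) zero_less_one less_le_trans pos2)
  qed
qed

section \<open>Structured programs for Turing machines\<close>

text \<open>
  A state assigns a tape to every number; a program that is compiled for \<open>k\<close> tapes uses the
  tapes \<open>0, \<dots>, k - 1\<close> only. \<open>Op i g\<close> writes a symbol and moves the head on tape \<open>i\<close>, depending on all
  symbols that are read.
\<close>

datatype prog =
    Op nat "(nat \<Rightarrow> nat) \<Rightarrow> nat \<times> move"
  | Seq prog prog (infixr ";;" 60)
  | If_then "(nat \<Rightarrow> nat) \<Rightarrow> bool" prog prog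
  | While "(nat \<Rightarrow> nat) \<Rightarrow> bool" prog

type_synonym state = "nat \<Rightarrow> tape"

definition rd :: "state \<Rightarrow> nat \<Rightarrow> nat" where
  "rd \<sigma> i = read (\<sigma> i)"

inductive exec :: "prog \<Rightarrow> state \<Rightarrow> nat \<Rightarrow> state \<Rightarrow> bool" where
  exec_Op: "exec (Op i g) \<sigma> 1 (\<sigma>(i := act (g (rd \<sigma>)) (\<sigma> i)))"
| exec_Seq: "exec p \<sigma> m \<sigma>' \<Longrightarrow> exec q \<sigma>' n \<sigma>'' \<Longrightarrow> exec (p ;; q) \<sigma> (m + n) \<sigma>''"
| exec_If: "exec (if c (rd \<sigma>) then p else q) \<sigma> n \<sigma>' \<Longrightarrow> exec (If_then c p q) \<sigma> (n + 1) \<sigma>'"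
| exec_While_False: "\<not> c (rd \<sigma>) \<Longrightarrow> exec (While c p) \<sigma> 1 \<sigma>"
| exec_While_True: "c (rd \<sigma>) \<Longrightarrow> exec p \<sigma> m \<sigma>' \<Longrightarrow> exec (While c p) \<sigma>' n \<sigma>'' \<Longrightarrow>
    exec (While c p) \<sigma> (1 + m + n) \<sigma>''"

fun wf_prog :: "nat \<Rightarrow> nat \<Rightarrow> prog \<Rightarrow> bool" where
  "wf_prog k S (Op i g) \<longleftrightarrow> i < k \<and> (\<forall>r. (\<forall>j. r j < S) \<longrightarrow> fst (g r) < S)"
| "wf_prog k S (p ;; q) \<longleftrightarrow> wf_prog k S p \<and> wf_prog k S q"
| "wf_prog k S (If_then c p q) \<longleftrightarrow> wf_prog k S p \<and> wf_prog k S q"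
| "wf_prog k S (While c p) \<longleftrightarrow> wf_prog k S p"

fun psize :: "prog \<Rightarrow> nat" where
  "psize (Op i g) = 1"
| "psize (p ;; q) = psize p + psize q"
| "psize (If_then c p q) = 1 + psize p + psize q"
| "psize (While c p) = 1 + psize p"

definition stay :: "nat list \<Rightarrow> (nat \<times> move) list" where
  "stay s = map (\<lambda>a. (a, Stay)) s"

definition look :: "nat list \<Rightarrow> nat \<Rightarrow> nat" where
  "look s i = (if i < length s then s ! i else 0)"

text \<open>\<open>code p s e\<close> is the transition function of \<open>p\<close> with the states \<open>s, \<dots>, s + psize p - 1\<close>,
  initial state \<open>s\<close> and exit state \<open>e\<close>.\<close>

fun code :: "prog \<Rightarrow> nat \<Rightarrow> nat \<Rightarrow> nat \<Rightarrow> nat list \<Rightarrow> nat \<times> (nat \<times> move) list" where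
  "code (Op i g) s e q w = (e, (stay w)[i := g (look w)])"
| "code (p ;; p') s e q w = (if q < s + psize p then code p s (s + psize p) q w else code p' (s + psize p) e q w)"
| "code (If_then c p p') s e q w =
    (if q = s then (if c (look w) then s + 1 else s + 1 + psize p, stay w)
     else if q < s + 1 + psize p then code p (s + 1) e q w
     else code p' (s + 1 + psize p) e q w)"
| "code (While c p) s e q w =
    (if q = s then (if c (look w) then s + 1 else e, stay w) else code p (s + 1) s q w)"

lemma psize_pos: "psize p > 0"
  by (induction p) auto

lemma code_wf:
  assumes "wf_prog k S p" "length w = k" "set w \<subseteq> {..<S}" "0 < S" "s \<le> q" "q < s + psize p"
  shows "case code p s e q w of (q', acts) \<Rightarrow>
    q' \<le> max e (s + psize p) \<and> length acts = k \<and> (\<forall>(a, d) \<in> set acts. a < S)"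
  using assms
proof (induction p arbitrary: s e q)
  case (Op i g)
  have "look w j < S" for j
    using Op.prems by (auto simp: look_def subset_iff)
  then have g: "fst (g (look w)) < S"
    using Op.prems(1) by simp
  have "a < S" if "(a, d) \<in> set ((stay w)[i := g (look w)])" for a d
  proof -
    have "(a, d) \<in> insert (g (look w)) (set (stay w))"
      using that set_update_subset_insert by fast
    then show ?thesis
      using g Op.prems(3) by (cases "g (look w)") (auto simp: stay_def)
  qed
  then show ?case
    using Op.prems by (auto simp: stay_def)
next
  case (Seq p p')
  show ?case
  proof (cases "q < s + psize p")
    case True
    then show ?thesis
      using Seq.IH(1)[of s q "s + psize p"] Seq.prems by (auto split: prod.splits)
  next
    case False
    then show ?thesis
      using Seq.IH(2)[of "s + psize p" q e] Seq.prems by (auto split: prod.splits simp: add.assoc)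
  qed
next
  case (If_then c p p')
  consider "q = s" | "s + 1 \<le> q" "q < s + 1 + psize p" | "s + 1 + psize p \<le> q" 
    using If_then.prems by linarith
  then show ?case
  proof cases
    case 1
    then show ?thesis using If_then.prems by (auto simp: stay_def)
  next
    case 2
    then show ?thesis
      using If_then.IH(1)[of "s + 1" q e] If_then.prems by (auto split: prod.splits)
  next
    case 3
    then show ?thesis
      using If_then.IH(2)[of "s + 1 + psize p" q e] If_then.prems by (auto split: prod.splits)
  qed
next
  case (While c p)
  show ?case
  proof (cases "q = s")
    case True
    then show ?thesis using While.prems by (auto simp: stay_def)
  next
    case False
    then show ?thesis
      using While.IH[of "s + 1" q s] While.prems by (auto split: prod.splits)
  qed
qed

text \<open>Tapes from \<open>k\<close> on read as blank, which matches the default 0 of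
  \<open>look\<close>; thus tests evaluated on a list of \<open>k\<close> symbols agree with tests
  on the state.\<close>

definition valid_state :: "nat \<Rightarrow> nat \<Rightarrow> state \<Rightarrow> bool" where
  "valid_state k S \<sigma> \<longleftrightarrow> (\<forall>i z. fst (\<sigma> i) z < S) \<and> (\<forall>i \<ge> k. read (\<sigma> i) = 0)"

abbreviation tapes_of :: "nat \<Rightarrow> state \<Rightarrow> tape list" where
  "tapes_of k \<sigma> \<equiv> map \<sigma> [0..<k]"

lemma exec_valid: "exec p \<sigma> n \<sigma>' \<Longrightarrow> wf_prog k S p \<Longrightarrow> valid_state k S \<sigma> \<Longrightarrow> valid_state k S \<sigma>'"
proof (induction rule: exec.induct)
  case (exec_Op i g \<sigma>)
  obtain a d where g: "g (rd \<sigma>) = (a, d)" by (cases "g (rd \<sigma>)")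
  have "\<forall>j. rd \<sigma> j < S"
    using exec_Op by (auto simp: valid_state_def rd_def read_def)
  then have "a < S"
    using exec_Op g by (metis fst_conv wf_prog.simps(1))
  then show ?case
    using exec_Op g by (cases "\<sigma> i") (auto simp: valid_state_def, metis fst_conv)
qed (auto split: if_splits)

lemma act_stay: "act (read tp, Stay) tp = tp"
  by (cases tp) (simp add: read_def)

lemma map2_act_stay: "map2 act (stay (map read ts)) ts = ts"
  by (induction ts) (simp_all add: stay_def act_stay)

lemma look_read: "valid_state k S \<sigma> \<Longrightarrow> look (map read (tapes_of k \<sigma>)) = rd \<sigma>"
  by (auto simp: look_def rd_def valid_state_def fun_eq_iff)

lemma map2_act_update:
  assumes "i < k"
  shows "map2 act ((stay (map read (tapes_of k \<sigma>)))[i := x]) (tapes_of k \<sigma>) =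
    tapes_of k (\<sigma>(i := act x (\<sigma> i)))"
  using assms by (intro nth_equalityI) (auto simp: stay_def nth_list_update act_stay)

lemma step_delta:
  assumes "delta M q (map read ts) = (q', acts)" "q < states M" "map2 act acts ts = ts'"
  shows "step M (q, ts) = (q', ts')"
  using assms by simp

lemma code_correct:
  assumes "exec p \<sigma> n \<sigma>'" and "wf_prog k S p" and "valid_state k S \<sigma>"
    and "\<And>q w. s \<le> q \<Longrightarrow> q < s + psize p \<Longrightarrow> delta M q w = code p s e q w"
    and "s + psize p \<le> states M"
  shows "(step M ^^ n) (s, tapes_of k \<sigma>) = (e, tapes_of k \<sigma>')"
  using assms
proof (induction arbitrary: s e rule: exec.induct)
  case (exec_Op i g \<sigma>)
  have "delta M s (map read (tapes_of k \<sigma>)) = (e, (stay (map read (tapes_of k \<sigma>)))[i := g (rd \<sigma>)])"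
    using exec_Op look_read[OF exec_Op.prems(2)] by simp
  then have "step M (s, tapes_of k \<sigma>) = (e, tapes_of k (\<sigma>(i := act (g (rd \<sigma>)) (\<sigma> i))))"
    by (rule step_delta) (use exec_Op.prems in \<open>auto intro: map2_act_update simp del: map_map\<close>)
  then show ?case by simp
next
  case (exec_Seq p \<sigma> m \<sigma>' q n \<sigma>'')
  have "(step M ^^ m) (s, tapes_of k \<sigma>) = (s + psize p, tapes_of k \<sigma>')"
    using exec_Seq.prems by (intro exec_Seq.IH(1)) (auto simp: psize_pos)
  moreover have "(step M ^^ n) (s + psize p, tapes_of k \<sigma>') = (e, tapes_of k \<sigma>'')"
    using exec_Seq.prems exec_valid[OF exec_Seq.hyps(1)]
    by (intro exec_Seq.IH(2)) (auto simp: add.assoc)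
  ultimately show ?case
    by (simp add: add.commute[of m n] funpow_add)
next
  case (exec_If c \<sigma> p q n \<sigma>')
  let ?s = "if c (rd \<sigma>) then s + 1 else s + 1 + psize p"
  have "delta M s (map read (tapes_of k \<sigma>)) = (?s, stay (map read (tapes_of k \<sigma>)))"
    using exec_If.prems look_read[OF exec_If.prems(2)] by simp
  then have "step M (s, tapes_of k \<sigma>) = (?s, tapes_of k \<sigma>)"
    by (rule step_delta) (use exec_If.prems in \<open>auto intro: map2_act_stay simp del: map_map\<close>)
  moreover have "(step M ^^ n) (?s, tapes_of k \<sigma>) = (e, tapes_of k \<sigma>')"
    using exec_If.prems by (intro exec_If.IH) (auto split: if_splits)
  ultimately show ?case
    by (simp add: funpow_swap1)
next
  case (exec_While_False c \<sigma> p)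
  have "delta M s (map read (tapes_of k \<sigma>)) = (e, stay (map read (tapes_of k \<sigma>)))"
    using exec_While_False look_read[OF exec_While_False.prems(2)] by simp
  then have "step M (s, tapes_of k \<sigma>) = (e, tapes_of k \<sigma>)"
    by (rule step_delta) (use exec_While_False.prems in \<open>auto intro: map2_act_stay simp del: map_map\<close>)
  then show ?case by simp
next
  case (exec_While_True c \<sigma> p m \<sigma>' n \<sigma>'')
  have "delta M s (map read (tapes_of k \<sigma>)) = (s + 1, stay (map read (tapes_of k \<sigma>)))"
    using exec_While_True look_read[OF exec_While_True.prems(2)] by simp
  then have 1: "step M (s, tapes_of k \<sigma>) = (s + 1, tapes_of k \<sigma>)"
    by (rule step_delta) (use exec_While_True.prems in \<open>auto intro: map2_act_stay simp del: map_map\<close>)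
  have 2: "(step M ^^ m) (s + 1, tapes_of k \<sigma>) = (s, tapes_of k \<sigma>')"
    using exec_While_True.prems by (intro exec_While_True.IH(1)) auto
  have 3: "(step M ^^ n) (s, tapes_of k \<sigma>') = (e, tapes_of k \<sigma>'')"
    using exec_While_True.prems exec_valid[OF exec_While_True.hyps(2)]
    by (intro exec_While_True.IH(2)) auto
  have "(step M ^^ (1 + m + n)) (s, tapes_of k \<sigma>) =
      (step M ^^ (n + (m + 1))) (s, tapes_of k \<sigma>)"
    by (simp only: ac_simps)
  also have "\<dots> = (step M ^^ n) ((step M ^^ m) (step M (s, tapes_of k \<sigma>)))"
    by (simp only: funpow_add o_apply funpow_0 funpow.simps(2) One_nat_def funpow.simps(1) id_apply)
  finally show ?case
    by (simp only: 1 2 3)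
qed

lemma compile:
  assumes "wf_prog k S p" "3 \<le> S"
  obtains M where "wf_tm M" "tapes M = k" "symbols M = S"
    "\<And>\<sigma> n \<sigma>' t. exec p \<sigma> n \<sigma>' \<Longrightarrow> valid_state k S \<sigma> \<Longrightarrow> n \<le> t \<Longrightarrow>
      (step M ^^ t) (0, tapes_of k \<sigma>) = (states M, tapes_of k \<sigma>')"
proof -
  define M where "M = \<lparr>tapes = k, symbols = S, states = psize p, delta = code p 0 (psize p)\<rparr>"
  have "wf_tm M"
    using assms code_wf[OF assms(1), of _ 0 _ "psize p"] by (simp add: wf_tm_def M_def)
  moreover have "(step M ^^ t) (0, tapes_of k \<sigma>) = (states M, tapes_of k \<sigma>')"
    if "exec p \<sigma> n \<sigma>'" "valid_state k S \<sigma>" "n \<le> t" for \<sigma> n \<sigma>' t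
  proof -
    have *: "(step M ^^ n) (0, tapes_of k \<sigma>) = (states M, tapes_of k \<sigma>')"
      using that assms by (intro code_correct[where p = p]) (auto simp: M_def)
    have halt: "(step M ^^ i) (states M, ts) = (states M, ts)" for i ts
      by (induction i) simp_all
    obtain i where "t = i + n" using \<open>n \<le> t\<close> by (metis le_add_diff_inverse2)
    then show ?thesis
      using * halt by (simp add: funpow_add)
  qed
  ultimately show ?thesis
    using that[of M] by (simp add: M_def)
qed

subsection \<open>Running time\<close>

text \<open>A bound on the number of steps if every loop makes at most \<open>L\<close> iterations.\<close>

fun cost :: "prog \<Rightarrow> nat \<Rightarrow> nat" where
  "cost (Op i g) L = 1"
| "cost (p ;; q) L = cost p L + cost q L"
| "cost (If_then c p q) L = 1 + cost p L + cost q L"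
| "cost (While c p) L = L * (cost p L + 1) + 1"

lemma cost_poly: "\<exists>P :: nat poly. \<forall>L. cost p L = poly P L"
proof (induction p)
  case (Op i g)
  show ?case by (intro exI[of _ 1]) simp
next
  case (Seq p q)
  then obtain P Q :: "nat poly" where "\<forall>L. cost p L = poly P L" "\<forall>L. cost q L = poly Q L" by blast
  then show ?case by (intro exI[of _ "P + Q"]) simp
next
  case (If_then c p q)
  then obtain P Q :: "nat poly" where "\<forall>L. cost p L = poly P L" "\<forall>L. cost q L = poly Q L" by blast
  then show ?case by (intro exI[of _ "1 + P + Q"]) simp
next
  case (While c p)
  then obtain P :: "nat poly" where "\<forall>L. cost p L = poly P L" by blast
  then show ?case by (intro exI[of _ "[:0, 1:] * (P + 1) + 1"]) simp
qed

definition runs :: "nat \<Rightarrow> prog \<Rightarrow> state \<Rightarrow> state \<Rightarrow> bool" where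
  "runs L p \<sigma> \<sigma>' \<longleftrightarrow> (\<exists>n \<le> cost p L. exec p \<sigma> n \<sigma>')"

lemma runs_Op: "\<sigma>' = \<sigma>(i := act (g (rd \<sigma>)) (\<sigma> i)) \<Longrightarrow> runs L (Op i g) \<sigma> \<sigma>'"
  unfolding runs_def using exec_Op by (intro exI[of _ 1]) simp

lemma runs_Seq: "runs L p \<sigma> \<sigma>' \<Longrightarrow> runs L q \<sigma>' \<sigma>'' \<Longrightarrow> runs L (p ;; q) \<sigma> \<sigma>''"
  unfolding runs_def cost.simps using exec_Seq add_mono by blast

lemma runs_If:
  assumes "c (rd \<sigma>) \<Longrightarrow> runs L p \<sigma> \<sigma>'" "\<not> c (rd \<sigma>) \<Longrightarrow> runs L q \<sigma> \<sigma>'"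
  shows "runs L (If_then c p q) \<sigma> \<sigma>'"
proof -
  obtain n where "n \<le> cost p L + cost q L" "exec (if c (rd \<sigma>) then p else q) \<sigma> n \<sigma>'"
    using assms unfolding runs_def by (cases "c (rd \<sigma>)") (auto intro: trans_le_add1 trans_le_add2)
  then show ?thesis
    unfolding runs_def using exec_If by (intro exI[of _ "n + 1"]) auto
qed

lemma runs_While:
  assumes "N \<le> L" "\<And>i. i < N \<Longrightarrow> c (rd (f i)) \<and> runs L p (f i) (f (Suc i))"
    and "\<not> c (rd (f N))" "f 0 = \<sigma>" "f N = \<sigma>'"
  shows "runs L (While c p) \<sigma> \<sigma>'"
proof -
  have "\<exists>n \<le> N * (cost p L + 1) + 1. exec (While c p) (f 0) n (f N)"
    using assms(2,3)
  proof (induction N arbitrary: f)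
    case 0
    then show ?case
      using exec_While_False by (intro exI[of _ 1]) auto
  next
    case (Suc N)
    have "\<exists>n \<le> N * (cost p L + 1) + 1. exec (While c p) (f (Suc 0)) n (f (Suc N))"
      using Suc.prems by (intro Suc.IH[of "\<lambda>i. f (Suc i)"]) auto
    then obtain n where n: "n \<le> N * (cost p L + 1) + 1" "exec (While c p) (f (Suc 0)) n (f (Suc N))"
      by blast
    obtain m where m: "m \<le> cost p L" "exec p (f 0) m (f (Suc 0))"
      using Suc.prems(1)[of 0] unfolding runs_def by auto
    have "exec (While c p) (f 0) (1 + m + n) (f (Suc N))"
      using Suc.prems(1)[of 0] m n by (intro exec_While_True) auto
    then show ?case
      using m n by (intro exI[of _ "1 + m + n"]) (auto simp: algebra_simps)
  qed
  moreover have "N * (cost p L + 1) \<le> L * (cost p L + 1)"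
    using assms(1) by (rule mult_le_mono1)
  ultimately show ?thesis
    unfolding runs_def assms(4)[symmetric] assms(5)[symmetric] cost.simps by (meson add_le_mono1 le_trans)
qed

definition start :: "bool list list \<Rightarrow> state" where
  "start ws i = input_tape (if i < length ws then ws ! i else [])"

lemma init_config_start: "length ws \<le> tapes M \<Longrightarrow> init_config M ws = (0, tapes_of (tapes M) (start ws))"
  unfolding init_config_def
  by (auto simp: start_def nth_append intro!: nth_equalityI)

lemma valid_start:
  assumes "length ws \<le> k" "3 \<le> S"
  shows "valid_state k S (start ws)"
  using assms by (auto simp: valid_state_def start_def input_tape_def read_def bit_symbol_def)

text \<open>\<open>l\<close> bounds the iterations of every loop by the input length, and
  \<open>cost\<close> turns a loop bound into a number of steps by a polynomial; the running time is
  their composition.\<close>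

lemma poly_time:
  assumes "wf_prog k S p" "3 \<le> S" "m \<le> k"
    and "\<And>ws. length ws = m \<Longrightarrow> \<exists>\<sigma>'. runs (poly l (sum_list (map length ws))) p (start ws) \<sigma>' \<and>
      outputs (tapes_of k \<sigma>') (f ws)"
  obtains M and P :: "nat poly" where "wf_tm M"
    "\<And>ws. length ws = m \<Longrightarrow> computes_within M ws (f ws) (poly P (sum_list (map length ws)))"
proof -
  obtain M where M: "wf_tm M" "tapes M = k" "symbols M = S"
    "\<And>\<sigma> n \<sigma>' t. exec p \<sigma> n \<sigma>' \<Longrightarrow> valid_state k S \<sigma> \<Longrightarrow> n \<le> t \<Longrightarrow>
      (step M ^^ t) (0, tapes_of k \<sigma>) = (states M, tapes_of k \<sigma>')"
    using compile[OF assms(1,2)] by blast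
  obtain P :: "nat poly" where P: "\<And>L. cost p L = poly P L"
    using cost_poly by blast
  have "computes_within M ws (f ws) (poly (pcompose P l) (sum_list (map length ws)))"
    if "length ws = m" for ws
  proof -
    obtain \<sigma>' where \<sigma>': "runs (poly l (sum_list (map length ws))) p (start ws) \<sigma>'"
      "outputs (tapes_of k \<sigma>') (f ws)"
      using assms(4) \<open>length ws = m\<close> by blast
    have "(step M ^^ poly (pcompose P l) (sum_list (map length ws))) (0, tapes_of k (start ws)) =
        (states M, tapes_of k \<sigma>')"
      using \<sigma>'(1) M(4) valid_start[of ws k S] assms that
      unfolding runs_def P poly_pcompose by blast
    then show ?thesis
      using \<sigma>' that M(2) assms(3) init_config_start[of ws M]
      by (simp add: computes_within_def)
  qed
  then show ?thesis
    using that M(1) by blast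
qed

lemma poly_time_computableI:
  assumes "wf_prog k S p" "3 \<le> S" "1 \<le> k"
    and "\<And>x. \<exists>\<sigma>'. runs (poly l (length x)) p (start [x]) \<sigma>' \<and> outputs (tapes_of k \<sigma>') (f x)"
  shows "poly_time_computable f"
proof -
  have "\<exists>\<sigma>'. runs (poly l (sum_list (map length ws))) p (start ws) \<sigma>' \<and>
      outputs (tapes_of k \<sigma>') (f (hd ws))" if "length ws = 1" for ws
    using that assms(4) by (cases ws) auto
  then obtain M and P :: "nat poly" where M: "wf_tm M"
    "\<And>ws. length ws = 1 \<Longrightarrow> computes_within M ws (f (hd ws)) (poly P (sum_list (map length ws)))"
    using poly_time[OF assms(1-3), of l "\<lambda>ws. f (hd ws)"] by blast
  have "computes_within M [x] (f x) (poly P (length x))" for x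
    using M(2)[of "[x]"] by simp
  then show ?thesis
    unfolding poly_time_computable_def using M(1) by blast
qed

lemma poly_time_decidable2I:
  assumes "wf_prog k S p" "3 \<le> S" "2 \<le> k"
    and "\<And>x c. \<exists>\<sigma>'. runs (poly l (length x + length c)) p (start [x, c]) \<sigma>' \<and>
      outputs (tapes_of k \<sigma>') [V x c]"
  shows "poly_time_decidable2 V"
proof -
  have "\<exists>\<sigma>'. runs (poly l (sum_list (map length ws))) p (start ws) \<sigma>' \<and>
      outputs (tapes_of k \<sigma>') [V (ws ! 0) (ws ! 1)]" if "length ws = 2" for ws
  proof -
    obtain x c where "ws = [x, c]"
      using \<open>length ws = 2\<close> by (auto simp: length_Suc_conv numeral_2_eq_2)
    then show ?thesis using assms(4) by simp
  qed
  then obtain M and P :: "nat poly" where M: "wf_tm M"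
    "\<And>ws. length ws = 2 \<Longrightarrow>
      computes_within M ws [V (ws ! 0) (ws ! 1)] (poly P (sum_list (map length ws)))"
    using poly_time[OF assms(1-3), of l "\<lambda>ws. [V (ws ! 0) (ws ! 1)]"] by blast
  have "computes_within M [x, c] [V x c] (poly P (length x + length c))" for x c
    using M(2)[of "[x, c]"] by simp
  then show ?thesis
    unfolding poly_time_decidable2_def using M(1) by blast
qed

subsection \<open>Loops over words\<close>

definition W :: "nat list \<Rightarrow> int \<Rightarrow> tape" where
  "W xs z = ((\<lambda>i. if 0 \<le> i \<and> i < int (length xs) then xs ! nat i else 0), z)"

abbreviation E :: "nat list \<Rightarrow> tape" where
  "E xs \<equiv> W xs (int (length xs))"

definition symb :: "nat list \<Rightarrow> int \<Rightarrow> nat" where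
  "symb xs z = (if 0 \<le> z \<and> z < int (length xs) then xs ! nat z else 0)"

lemma read_W [simp]: "read (W xs z) = symb xs z"
  by (simp add: W_def read_def symb_def)

lemma symb_nat [simp]: "i < length xs \<Longrightarrow> symb xs (int i) = xs ! i"
  by (simp add: symb_def)

lemma input_tape_W: "input_tape w = W (map bit_symbol w) 0"
  by (auto simp: input_tape_def W_def fun_eq_iff)

lemma act_W_same: "act (symb xs z, d) (W xs z) = W xs (z + offset d)"
  by (auto simp: W_def symb_def fun_eq_iff)

lemma act_W_end: "act (s, d) (E xs) = W (xs @ [s]) (int (length xs) + offset d)"
  by (auto simp: W_def fun_eq_iff nth_append nat_eq_iff)

lemma act_W_update:
  "i < length xs \<Longrightarrow> act (s, d) (W xs (int i)) = W (xs[i := s]) (int i + offset d)"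
  by (auto simp: W_def fun_eq_iff nth_list_update nat_eq_iff)

definition mv :: "nat \<Rightarrow> move \<Rightarrow> prog" where
  "mv a d = Op a (\<lambda>r. (r a, d))"

definition push :: "nat \<Rightarrow> ((nat \<Rightarrow> nat) \<Rightarrow> nat) \<Rightarrow> prog" where
  "push a s = Op a (\<lambda>r. (s r, Right))"

text \<open>The step to the left comes first because the head may already stand on the blank behind
  the word.\<close>

definition rewind :: "nat \<Rightarrow> prog" where
  "rewind a = mv a Left ;; While (\<lambda>r. r a \<noteq> 0) (mv a Left) ;; mv a Right"

definition For :: "nat \<Rightarrow> prog \<Rightarrow> prog" where
  "For a p = While (\<lambda>r. r a \<noteq> 0) (p ;; mv a Right) ;; rewind a"

lemma runs_mv:
  "\<sigma> a = W xs z \<Longrightarrow> \<sigma>' = \<sigma>(a := W xs (z + offset d)) \<Longrightarrow> runs L (mv a d) \<sigma> \<sigma>'"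
  unfolding mv_def by (intro runs_Op) (simp add: rd_def act_W_same)

lemma runs_push:
  "\<sigma> a = E xs \<Longrightarrow> \<sigma>' = \<sigma>(a := E (xs @ [s (rd \<sigma>)])) \<Longrightarrow> runs L (push a s) \<sigma> \<sigma>'"
  unfolding push_def by (intro runs_Op) (simp add: act_W_end add.commute)

lemma runs_rewind:
  assumes "\<sigma> a = W xs (int z)" "z \<le> length xs" "0 \<notin> set xs" "length xs \<le> L"
    and "\<sigma>' = \<sigma>(a := W xs 0)"
  shows "runs L (rewind a) \<sigma> \<sigma>'"
  unfolding rewind_def
proof (intro runs_Seq)
  show "runs L (mv a Left) \<sigma> (\<sigma>(a := W xs (int z - 1)))"
    using assms(1) by (intro runs_mv[where xs = xs and z = "int z"]) auto
  show "runs L (While (\<lambda>r. r a \<noteq> 0) (mv a Left)) (\<sigma>(a := W xs (int z - 1))) (\<sigma>(a := W xs (- 1)))"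
  proof (rule runs_While[where N = z and f = "\<lambda>i. \<sigma>(a := W xs (int z - 1 - int i))"])
    fix i assume "i < z"
    then have "symb xs (int z - 1 - int i) \<in> set xs"
      using assms(2) by (auto simp: symb_def)
    then have "symb xs (int z - 1 - int i) \<noteq> 0"
      using assms(3) by metis
    then show "rd (\<sigma>(a := W xs (int z - 1 - int i))) a \<noteq> 0 \<and>
        runs L (mv a Left) (\<sigma>(a := W xs (int z - 1 - int i))) (\<sigma>(a := W xs (int z - 1 - int (Suc i))))"
      by (auto simp: rd_def intro!: runs_mv)
  qed (use assms in \<open>auto simp: rd_def symb_def\<close>)
  show "runs L (mv a Right) (\<sigma>(a := W xs (- 1))) \<sigma>'"
    using assms by (intro runs_mv) auto
qed

text \<open>\<open>f i\<close> describes the tapes other than \<open>a\<close>; tape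
  \<open>a\<close> is overridden by the word with its head at \<open>i\<close>, so the body has to
  leave it as it found it. The loop ends at the symbol 0, hence the restriction to words without
  0.\<close>

lemma runs_For:
  assumes "length xs \<le> L" "0 \<notin> set xs"
    and "\<And>i. i < length xs \<Longrightarrow> runs L p ((f i)(a := W xs (int i))) ((f (Suc i))(a := W xs (int i)))"
    and "\<sigma> = (f 0)(a := W xs 0)" "\<sigma>' = (f (length xs))(a := W xs 0)"
  shows "runs L (For a p) \<sigma> \<sigma>'"
  unfolding For_def
proof (rule runs_Seq)
  show "runs L (While (\<lambda>r. r a \<noteq> 0) (p ;; mv a Right)) \<sigma> ((f (length xs))(a := E xs))"
  proof (rule runs_While[where N = "length xs" and f = "\<lambda>i. (f i)(a := W xs (int i))"])
    fix i assume i: "i < length xs"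
    have "runs L (mv a Right) ((f (Suc i))(a := W xs (int i))) ((f (Suc i))(a := W xs (int (Suc i))))"
      by (intro runs_mv[where xs = xs and z = "int i"]) (auto simp: add.commute)
    moreover have "xs ! i \<noteq> 0"
      using assms(2) i by (metis nth_mem)
    ultimately show "rd ((f i)(a := W xs (int i))) a \<noteq> 0 \<and>
        runs L (p ;; mv a Right) ((f i)(a := W xs (int i))) ((f (Suc i))(a := W xs (int (Suc i))))"
      using runs_Seq[OF assms(3)[OF i]] i by (auto simp: rd_def)
  qed (use assms in \<open>auto simp: rd_def symb_def\<close>)
  show "runs L (rewind a) ((f (length xs))(a := E xs)) \<sigma>'"
    using assms by (intro runs_rewind[where xs = xs and z = "length xs"]) auto
qed

section \<open>From tilings to instances\<close>

text \<open>The sites of a helical tiling are numbered row by row; the right neighbour of site \<open>s\<close> is \<open>s + 1\<close>,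
  also at the end of a row, and the lower one is \<open>s + N\<close>. The colour of \<open>s\<close> is restricted by its class.\<close>

locale tiling =
  fixes K :: nat and A :: "nat \<Rightarrow> nat set" and H V :: "nat \<Rightarrow> nat \<Rightarrow> bool"
begin

text \<open>The universal conditions at the end of the strip mirror the clauses: if the neighbouring
  site does not exist, only the literal of \<open>s\<close> remains in the clause for a forbidden
  pair, so every colour in a forbidden pair is excluded.\<close>

definition tiles :: "nat \<Rightarrow> nat list \<Rightarrow> (nat \<Rightarrow> nat) \<Rightarrow> bool" where
  "tiles N cls \<chi> \<longleftrightarrow> (\<forall>s < length cls. \<chi> s < K \<and> \<chi> s \<in> A (cls ! s) \<and>
     (if s + 1 < length cls then H (\<chi> s) (\<chi> (s + 1)) else \<forall>k < K. H (\<chi> s) k) \<and>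
     (if s + N < length cls then V (\<chi> s) (\<chi> (s + N)) else \<forall>k < K. V (\<chi> s) k))"

text \<open>Rows 1 to \<open>K\<^sup>2\<close> of a site are for the horizontal pairs of colours and
  the next \<open>K\<^sup>2\<close> for the vertical ones. Row 0 and the last row, like the rows of
  permitted pairs, demand an allowed colour. An even \<open>Q\<close> keeps the two literals of a
  variable together.\<close>

definition Q :: nat where "Q = 2 * K\<^sup>2 + 2"

text \<open>Every site contributes \<open>Q\<close> rows (clauses) and \<open>Q\<close> columns (literals); the literals that
  occur are \<open>\<not> x\<^sub>k\<close> at \<open>2 k\<close> and \<open>x\<^sub>k\<close> at \<open>2 k + 1\<close>, for the colours \<open>k < K\<close>.
  The relation between the sites of the row and of the column is encoded by a number:
  1 for the same site, 2 for the right neighbour and 3 for the lower one.\<close>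

definition clause :: "nat \<Rightarrow> nat \<Rightarrow> nat \<Rightarrow> nat \<Rightarrow> bool \<Rightarrow> bool" where
  "clause c rel q k pos =
    (let k1 = (q - 1) mod K\<^sup>2 div K; k2 = (q - 1) mod K\<^sup>2 mod K in
     if 1 \<le> q \<and> q \<le> K\<^sup>2 \<and> \<not> H k1 k2 then \<not> pos \<and> (rel = 1 \<and> k = k1 \<or> rel = 2 \<and> k = k2)
     else if K\<^sup>2 < q \<and> q \<le> 2 * K\<^sup>2 \<and> \<not> V k1 k2 then \<not> pos \<and> (rel = 1 \<and> k = k1 \<or> rel = 3 \<and> k = k2)
     else rel = 1 \<and> pos \<and> k \<in> A c)"

definition occurs :: "nat \<Rightarrow> nat \<Rightarrow> nat \<Rightarrow> nat \<Rightarrow> bool" where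
  "occurs c rel q y \<longleftrightarrow> y < 2 * K \<and> clause c rel q (y div 2) (odd y)"

definition relation :: "nat \<Rightarrow> nat \<Rightarrow> nat \<Rightarrow> nat" where
  "relation N s s' = (if s' = s then 1 else if s' = s + 1 then 2 else if s' = s + N then 3 else 0)"

definition incidence :: "nat \<Rightarrow> nat list \<Rightarrow> nat \<Rightarrow> nat \<Rightarrow> bool" where
  "incidence N cls r J \<longleftrightarrow> occurs (cls ! (r div Q)) (relation N (r div Q) (J div Q)) (r mod Q) (J mod Q)"

lemma Q_pos: "Q > 0" and Q_even: "even Q"
  by (simp_all add: Q_def)

lemma K_le_Q: "2 * K \<le> Q" "2 * K\<^sup>2 < Q"
proof -
  have "K \<le> K\<^sup>2" by (simp add: power2_eq_square)
  then show "2 * K \<le> Q" "2 * K\<^sup>2 < Q" by (simp_all add: Q_def)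
qed

text \<open>No clause forbids several colours at one site: any true allowed colour can be selected,
  because the pair clauses hold for all true variables. \<open>1 < N\<close> keeps the right and the
  lower neighbour apart in \<open>relation\<close>.\<close>

lemma satisfiable_iff:
  assumes "1 < N"
  shows "(\<exists>\<beta>. \<forall>r < Q * length cls. \<exists>J < Q * length cls. incidence N cls r J \<and> (odd J \<longleftrightarrow> \<beta> (J div 2))) \<longleftrightarrow>
    (\<exists>\<chi>. tiles N cls \<chi>)" (is "?L \<longleftrightarrow> ?R")
proof
  let ?M = "length cls"
  define var where "var s k = s * (Q div 2) + k" for s k
  have div2: "(Q * s + y) div 2 = var s (y div 2)" "odd (Q * s + y) = odd y" for s y
    using Q_even by (auto simp: var_def div_plus_div_distrib_dvd_left elim!: evenE)
  have in_range: "Q * s + y < Q * ?M" if "s < ?M" "y < Q" for s y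
  proof -
    have "Q * s + y < Q * (s + 1)" using that by simp
    also have "\<dots> \<le> Q * ?M" using that by (intro mult_le_mono) auto
    finally show ?thesis .
  qed
  have from_range: "J div Q < ?M \<and> J mod Q < Q \<and> J = Q * (J div Q) + J mod Q" if "J < Q * ?M" for J
    using that Q_pos by (simp add: less_mult_imp_div_less mult.commute)
  {
    assume ?L
    then obtain \<beta> where \<beta>:
      "\<And>r. r < Q * ?M \<Longrightarrow> \<exists>J < Q * ?M. incidence N cls r J \<and> (odd J \<longleftrightarrow> \<beta> (J div 2))" by blast
    have lit: "\<exists>s' y. s' < ?M \<and> occurs (cls ! s) (relation N s s') q y \<and> (odd y \<longleftrightarrow> \<beta> (var s' (y div 2)))"
      if "s < ?M" "q < Q" for s q
    proof -
      obtain J where J: "J < Q * ?M" "incidence N cls (Q * s + q) J" "odd J \<longleftrightarrow> \<beta> (J div 2)"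
        using \<beta> in_range \<open>s < ?M\<close> \<open>q < Q\<close> by blast
      show ?thesis
        using J from_range[OF J(1)] \<open>q < Q\<close> div2[of "J div Q" "J mod Q"]
        by (intro exI[of _ "J div Q"] exI[of _ "J mod Q"]) (simp add: incidence_def)
    qed
    have "\<exists>k < K. k \<in> A (cls ! s) \<and> \<beta> (var s k)" if "s < ?M" for s
    proof -
      obtain s' y where "occurs (cls ! s) (relation N s s') 0 y" "odd y \<longleftrightarrow> \<beta> (var s' (y div 2))"
        using lit[OF \<open>s < ?M\<close>] Q_pos by blast
      then show ?thesis
        by (intro exI[of _ "y div 2"]) (auto simp: occurs_def clause_def relation_def split: if_splits)
    qed
    then obtain \<chi> where \<chi>: "\<And>s. s < ?M \<Longrightarrow> \<chi> s < K \<and> \<chi> s \<in> A (cls ! s) \<and> \<beta> (var s (\<chi> s))"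
      by metis
    have pair: "k1 * K + k2 < K\<^sup>2" "(k1 * K + k2) div K = k1" "(k1 * K + k2) mod K = k2" if "k1 < K" "k2 < K" for k1 k2
    proof -
      have "k1 * K + k2 < (k1 + 1) * K" using that by simp
      also have "\<dots> \<le> K * K" using that by (intro mult_le_mono) auto
      finally show "k1 * K + k2 < K\<^sup>2" by (simp add: power2_eq_square)
    qed (use that in auto)
    have "H (\<chi> s) k" if s: "s < ?M" "k < K" and k: "s + 1 < ?M \<Longrightarrow> k = \<chi> (s + 1)" for s k
    proof (rule ccontr)
      assume "\<not> H (\<chi> s) k"
      have "1 + (\<chi> s * K + k) < Q"
        using pair[of "\<chi> s" k] \<chi>[of s] s K_le_Q by auto
      then obtain s' y where y: "s' < ?M" "occurs (cls ! s) (relation N s s') (1 + (\<chi> s * K + k)) y"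
        "odd y \<longleftrightarrow> \<beta> (var s' (y div 2))"
        using lit[OF s(1)] by blast
      have "even y" "s' = s \<and> y div 2 = \<chi> s \<or> s' = s + 1 \<and> y div 2 = k"
        using y(2) pair[of "\<chi> s" k] \<chi>[of s] s \<open>\<not> H (\<chi> s) k\<close>
        by (auto simp: occurs_def clause_def relation_def Let_def split: if_splits)
      then show False
        using y \<chi>[of s] \<chi>[of "s + 1"] s k by auto
    qed
    moreover have "V (\<chi> s) k" if s: "s < ?M" "k < K" and k: "s + N < ?M \<Longrightarrow> k = \<chi> (s + N)" for s k
    proof (rule ccontr)
      assume "\<not> V (\<chi> s) k"
      have "1 + K\<^sup>2 + (\<chi> s * K + k) < Q"
        using pair[of "\<chi> s" k] \<chi>[of s] s by (auto simp: Q_def)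
      then obtain s' y where y: "s' < ?M" "occurs (cls ! s) (relation N s s') (1 + K\<^sup>2 + (\<chi> s * K + k)) y"
        "odd y \<longleftrightarrow> \<beta> (var s' (y div 2))"
        using lit[OF s(1)] by blast
      have "even y" "s' = s \<and> y div 2 = \<chi> s \<or> s' = s + N \<and> y div 2 = k"
        using y(2) pair[of "\<chi> s" k] \<chi>[of s] s \<open>\<not> V (\<chi> s) k\<close> assms
        by (auto simp: occurs_def clause_def relation_def Let_def split: if_splits)
      then show False
        using y \<chi>[of s] \<chi>[of "s + N"] s k by auto
    qed
    ultimately have "tiles N cls \<chi>"
      using \<chi> unfolding tiles_def by auto
    then show ?R by blast
  }
  {
    assume ?R
    then obtain \<chi> where \<chi>: "tiles N cls \<chi>" by blast
    \<comment> \<open>Each site owns \<open>Q div 2\<close> variables, of which the first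
      \<open>K\<close> are its colours.\<close>
    define \<beta> where "\<beta> v \<longleftrightarrow> v mod (Q div 2) = \<chi> (v div (Q div 2))" for v
    have \<beta>: "\<beta> (var s k) \<longleftrightarrow> k = \<chi> s" if "k < K" for s k
      using that K_le_Q(1) by (simp add: \<beta>_def var_def)
    have "\<exists>J < Q * ?M. incidence N cls r J \<and> (odd J \<longleftrightarrow> \<beta> (J div 2))" if r: "r < Q * ?M" for r
    proof -
      define s where "s = r div Q"
      define q where "q = r mod Q"
      have s: "s < ?M" using from_range[OF r] by (simp add: s_def)
      have main: ?thesis if "s' < ?M" "k < K" "clause (cls ! s) (relation N s s') q k pos" "pos \<longleftrightarrow> k = \<chi> s'" for s' k pos
      proof -
        define y where "y = 2 * k + (if pos then 1 else 0)"
        have y: "y < 2 * K" "y div 2 = k" "odd y = pos"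
          using \<open>k < K\<close> by (auto simp: y_def)
        have yQ: "y < Q" using y K_le_Q by simp
        show ?thesis
          using in_range[OF \<open>s' < ?M\<close> yQ] that y yQ div2[of s' y] \<beta>[OF \<open>k < K\<close>, of s']
          by (intro exI[of _ "Q * s' + y"])
            (simp add: incidence_def occurs_def s_def[symmetric] q_def[symmetric])
      qed
      define k1 where "k1 = (q - 1) mod K\<^sup>2 div K"
      define k2 where "k2 = (q - 1) mod K\<^sup>2 mod K"
      have "\<chi> s < K" using \<chi> s unfolding tiles_def by blast
      then have "0 < K" by simp
      have k: "k1 < K" "k2 < K"
        using \<open>0 < K\<close> by (simp_all add: k1_def k2_def power2_eq_square less_mult_imp_div_less)
      consider (H) "1 \<le> q \<and> q \<le> K\<^sup>2" "\<not> H k1 k2" | (V) "K\<^sup>2 < q \<and> q \<le> 2 * K\<^sup>2" "\<not> V k1 k2"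
        | (A) "\<not> (1 \<le> q \<and> q \<le> K\<^sup>2 \<and> \<not> H k1 k2)" "\<not> (K\<^sup>2 < q \<and> q \<le> 2 * K\<^sup>2 \<and> \<not> V k1 k2)"
        by blast
      then show ?thesis
      proof cases
        case H
        have c: "clause (cls ! s) 1 q k1 False" "clause (cls ! s) 2 q k2 False"
          using H unfolding clause_def Let_def k1_def k2_def by auto
        have "\<chi> s \<noteq> k1 \<or> (s + 1 < ?M \<and> \<chi> (s + 1) \<noteq> k2)"
          using \<chi> s H k unfolding tiles_def by metis
        then show ?thesis
          using main[of s k1 False] main[of "s + 1" k2 False] s k c by (auto simp: relation_def)
      next
        case V
        have c: "clause (cls ! s) 1 q k1 False" "clause (cls ! s) 3 q k2 False"
          using V unfolding clause_def Let_def k1_def k2_def by auto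
        have "\<chi> s \<noteq> k1 \<or> (s + N < ?M \<and> \<chi> (s + N) \<noteq> k2)"
          using \<chi> s V k unfolding tiles_def by metis
        then show ?thesis
          using main[of s k1 False] main[of "s + N" k2 False] s k c assms by (auto simp: relation_def)
      next
        case A
        have "\<chi> s \<in> A (cls ! s)" using \<chi> s unfolding tiles_def by blast
        then have "clause (cls ! s) 1 q (\<chi> s) True"
          using A unfolding clause_def Let_def k1_def k2_def by auto
        then show ?thesis
          using main[of s "\<chi> s" True] s \<open>\<chi> s < K\<close> by (auto simp: relation_def)
      qed
    qed
    then show ?L by blast
  }
qed

text \<open>A pair of sites occupies a square of side \<open>D\<close>; a first row of squares is added for the literals and a last
  column for the conjunction.\<close>

definition D :: nat where "D = 312 * Q"

definition block_bit :: "block \<Rightarrow> nat \<Rightarrow> nat \<Rightarrow> bool" where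
  "block_bit B a b = bit (active_rows (block_gate B (a div 24 mod 13, b div 24 mod 13)) ! (a mod 24)) (b mod 24)"

definition site_bit :: "nat \<Rightarrow> nat \<Rightarrow> nat \<Rightarrow> nat \<Rightarrow> bool" where
  "site_bit c rel a b = block_bit (if occurs c rel (a div 312) (b div 312) then Join else Cross) a b"

text \<open>The first strip is as high as the others so that the board splits into equal squares.
  Only its last row of blocks, \<open>t = Q - 1\<close>, holds sources; the empty rows above also
  separate them from the bottom of the torus.\<close>

definition literal_bit :: "nat \<Rightarrow> nat \<Rightarrow> bool" where
  "literal_bit a b = block_bit (if a div 312 + 1 < Q then Empty else if even (b div 312) then Source else Turn) a b"

definition last_bit :: "bool \<Rightarrow> nat \<Rightarrow> nat \<Rightarrow> bool" where
  "last_bit first a b = block_bit (if b div 312 \<noteq> 0 \<or> first \<and> a div 312 + 1 < Q then Empty else if first then Start else Meet) a b"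

definition board_pattern :: "nat \<Rightarrow> nat list \<Rightarrow> configuration" where
  "board_pattern N cls = pattern (gates (matrix (Q - 1) (Q * length cls) (incidence N cls)))"

lemma pattern_gates: "pattern (gates T) (r, c) = block_bit (T (r div 312) (c div 312)) r c"
proof -
  have "r div 24 div 13 = r div 312" "c div 24 div 13 = c div 312"
    by (simp_all add: div_mult2_eq[symmetric])
  then show ?thesis
    by (simp add: pattern_def paint_def gates_def block_bit_def)
qed

lemma block_bit_shift: "block_bit B (D * i + a) (D * j + b) = block_bit B a b"
proof -
  have *: "(D * i + a) mod 24 = a mod 24" "(D * i + a) div 24 mod 13 = a div 24 mod 13" for i a
  proof -
    have D: "D * i + a = a + 24 * (13 * (Q * i))" by (simp add: D_def)
    show "(D * i + a) mod 24 = a mod 24"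
      unfolding D by (rule mod_mult_self2)
    have "(D * i + a) div 24 = a div 24 + 13 * (Q * i)"
      unfolding D by (simp add: div_mult_self2)
    then show "(D * i + a) div 24 mod 13 = a div 24 mod 13"
      by simp
  qed
  show ?thesis by (simp add: block_bit_def *)
qed

text \<open>The state of a cell depends only on its place in the square, on the class of the row
  site and on the relation of the two sites: this locality is what allows a machine to write the
  board.\<close>

lemma board_pattern:
  assumes "a < D" "b < D"
  shows "board_pattern N cls (D * i + a, D * j + b) =
    (if i = 0 then if j < length cls then literal_bit a b else if j = length cls then last_bit True a b else block_bit Empty a b
     else if j < length cls then site_bit (cls ! (i - 1)) (relation N (i - 1) j) a b
     else if j = length cls then last_bit False a b else block_bit Empty a b)"
proof -
  let ?M = "length cls"
  define q where "q = a div 312"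
  define y where "y = b div 312"
  have q: "q < Q" "y < Q"
    using assms by (simp_all add: q_def y_def D_def less_mult_imp_div_less mult.commute)
  have IJ: "(D * i + a) div 312 = Q * i + q" "(D * j + b) div 312 = Q * j + y"
    by (simp_all add: D_def q_def y_def mult.assoc)
  have j: "Q * ?M < Q * j + y \<longleftrightarrow> ?M < j \<or> j = ?M \<and> y \<noteq> 0" "Q * j + y = Q * ?M \<longleftrightarrow> j = ?M \<and> y = 0"
  proof -
    have "Q * j + y < Q * ?M" if "j < ?M"
    proof -
      have "Q * j + y < Q * (j + 1)" using q by simp
      also have "\<dots> \<le> Q * ?M" using that by (intro mult_le_mono) auto
      finally show ?thesis .
    qed
    moreover have "Q * ?M < Q * j + y" if "?M < j"
    proof -
      have "Q * ?M < Q * j" using that Q_pos by simp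
      then show ?thesis by (rule trans_less_add1)
    qed
    ultimately show "Q * ?M < Q * j + y \<longleftrightarrow> ?M < j \<or> j = ?M \<and> y \<noteq> 0" "Q * j + y = Q * ?M \<longleftrightarrow> j = ?M \<and> y = 0"
      by (metis nat_neq_iff add_0_right less_add_same_cancel1 neq0_conv order_less_imp_not_less)+
  qed
  have i: "Q * i + q < Q - 1 \<longleftrightarrow> i = 0 \<and> q + 1 < Q" "Q * i + q = Q - 1 \<longleftrightarrow> i = 0 \<and> q + 1 = Q"
  proof -
    have "Q \<le> Q * i + q" if "i \<noteq> 0"
      using that by (cases i) auto
    then show "Q * i + q < Q - 1 \<longleftrightarrow> i = 0 \<and> q + 1 < Q" "Q * i + q = Q - 1 \<longleftrightarrow> i = 0 \<and> q + 1 = Q"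
      using q by (cases "i = 0"; fastforce)+
  qed
  have inc: "incidence N cls (Q * i + q - (Q - 1) - 1) (Q * j + y) =
      occurs (cls ! (i - 1)) (relation N (i - 1) j) q y" if "i \<noteq> 0"
  proof -
    have "Q * i + q - (Q - 1) - 1 = Q * (i - 1) + q"
      using that Q_pos by (cases i) auto
    then show ?thesis
      using q by (simp add: incidence_def)
  qed
  have "even (Q * j + y) = even y" using Q_even by simp
  then show ?thesis
    unfolding board_pattern_def pattern_gates IJ block_bit_shift matrix_def i j
    using q inc
    by (auto simp: site_bit_def literal_bit_def last_bit_def q_def[symmetric] y_def[symmetric])
qed

text \<open>The target is the bottom port of the lowest block in the conjunction column: 89 = 24 * 3
  + 17 is gate column 3, port column 17.\<close>

definition instance_word :: "nat \<Rightarrow> nat list \<Rightarrow> bool list" where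
  "instance_word N cls = encode_instance (D * (length cls + 1)) (board_pattern N cls)
     (D * (length cls + 1) - 1, D * length cls + 89)"

theorem tiles_iff_unstable:
  assumes "1 < N" "cls \<noteq> []"
  shows "(\<exists>\<chi>. tiles N cls \<chi>) \<longleftrightarrow> async_unstable S22 (D * (length cls + 1)) (board_pattern N cls)
    (D * (length cls + 1) - 1, D * length cls + 89)"
proof -
  let ?M = "length cls"
  have Q2: "2 \<le> Q" by (simp add: Q_def)
  have m: "312 * (Q * (?M + 1)) = D * (?M + 1)" "Q * (?M + 1) - (Q - 1) - 1 = Q * ?M"
    using Q2 by (simp_all add: D_def)
  have u: "output_cell (Q * (?M + 1) - 1) (Q * ?M) = (D * (?M + 1) - 1, D * ?M + 89)"
  proof -
    obtain x where "Q * (?M + 1) = Suc x" using Q2 by (cases "Q * (?M + 1)") auto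
    then show ?thesis
      using m(1) by (simp add: output_cell_def D_def)
  qed
  have "0 < Q * ?M" using assms Q_pos by simp
  then have "1 \<le> Q - 1" "Q - 1 + 1 < Q * (?M + 1)" "Q * ?M + 1 < Q * (?M + 1)" "even (Q * ?M)"
    using Q2 Q_even by auto
  then show ?thesis
    using matrix_unstable_iff[of "Q - 1" "Q * (?M + 1)" "Q * ?M" "incidence N cls"]
      satisfiable_iff[OF assms(1), of cls]
    unfolding board_pattern_def m u by blast
qed

definition row_word :: "(nat \<Rightarrow> nat \<Rightarrow> bool) \<Rightarrow> (nat \<Rightarrow> bool) \<Rightarrow> nat \<Rightarrow> bool list" where
  "row_word f g M = concat (map (\<lambda>j. map (f j) [0..<D]) [0..<M]) @ map g [0..<D]"

lemma upt_blocks: "[0..<d * k] = concat (map (\<lambda>j. map (\<lambda>b. d * j + b) [0..<d]) [0..<k])"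
proof (induction k)
  case (Suc k)
  have "[0..<d * k + d] = [0..<d * k] @ [d * k..<d * k + d]"
    by (rule upt_add_eq_append) simp
  also have "[d * k..<d * k + d] = map (\<lambda>b. d * k + b) [0..<d]"
    using map_add_upt[of "d * k" d] by (simp add: add.commute)
  finally show ?case using Suc by (simp add: add.commute[of d])
qed simp

lemma concat_concat: "concat (concat xss) = concat (map concat xss)"
  by (induction xss) simp_all

text \<open>The word in the order of the loops that write it. The ranges of length \<open>D\<close>
  are constant and will be unrolled into the program; only the loops over the sites \<open>i\<close>
  and \<open>j\<close> depend on the input.\<close>

lemma instance_word:
  "instance_word N cls = unary (D * (length cls + 1)) @
     concat (map (\<lambda>a. row_word (\<lambda>j. literal_bit a) (last_bit True a) (length cls)) [0..<D]) @
     concat (map (\<lambda>i. concat (map (\<lambda>a. row_word (\<lambda>j. site_bit (cls ! i) (relation N i j) a) (last_bit False a) (length cls)) [0..<D])) [0..<length cls]) @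
     unary (D * (length cls + 1) - 1) @ unary (D * length cls + 89)"
proof -
  let ?M = "length cls"
  have row: "map (\<lambda>c. board_pattern N cls (D * i + a, c)) [0..<D * (?M + 1)] =
      (if i = 0 then row_word (\<lambda>j. literal_bit a) (last_bit True a) ?M
       else row_word (\<lambda>j. site_bit (cls ! (i - 1)) (relation N (i - 1) j) a) (last_bit False a) ?M)"
    if "a < D" for i a
  proof -
    have "map (\<lambda>c. board_pattern N cls (D * i + a, c)) [0..<D * (?M + 1)] =
        concat (map (\<lambda>j. map (\<lambda>b. board_pattern N cls (D * i + a, D * j + b)) [0..<D]) [0..<?M + 1])"
      unfolding upt_blocks by (simp add: map_concat o_def)
    also have "\<dots> = concat (map (\<lambda>j. map (\<lambda>b. if i = 0 then literal_bit a b else site_bit (cls ! (i - 1)) (relation N (i - 1) j) a b) [0..<D]) [0..<?M])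
        @ map (\<lambda>b. last_bit (i = 0) a b) [0..<D]"
      using that by (auto simp: board_pattern intro!: arg_cong[where f = concat])
    finally show ?thesis by (simp add: row_word_def)
  qed
  have "concat (map (\<lambda>r. map (\<lambda>c. board_pattern N cls (r, c)) [0..<D * (?M + 1)]) [0..<D * (?M + 1)]) =
      concat (map (\<lambda>i. concat (map (\<lambda>a. map (\<lambda>c. board_pattern N cls (D * i + a, c)) [0..<D * (?M + 1)]) [0..<D])) [0..<?M + 1])"
    by (subst (2) upt_blocks) (simp add: map_concat o_def concat_concat)
  also have "\<dots> = concat (map (\<lambda>i. concat (map (\<lambda>a. (if i = 0 then row_word (\<lambda>j. literal_bit a) (last_bit True a) ?M
       else row_word (\<lambda>j. site_bit (cls ! (i - 1)) (relation N (i - 1) j) a) (last_bit False a) ?M)) [0..<D])) [0..<?M + 1])"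
    by (intro arg_cong[where f = concat] map_cong refl row) simp
  also have "[0..<?M + 1] = 0 # map Suc [0..<?M]"
    by (simp add: map_Suc_upt upt_conv_Cons del: upt_Suc)
  finally show ?thesis
    by (simp add: instance_word_def o_def del: upt_Suc)
qed

end

subsection \<open>Appending to a tape\<close>

text \<open>Tape \<open>b\<close> is overridden on both sides, so the growing output stays out of
  the states and sequential composition just concatenates the words.\<close>

definition appends :: "nat \<Rightarrow> nat \<Rightarrow> prog \<Rightarrow> state \<Rightarrow> state \<Rightarrow> nat list \<Rightarrow> bool" where
  "appends L b p \<sigma> \<sigma>' w \<longleftrightarrow> (\<forall>ys. runs L p (\<sigma>(b := E ys)) (\<sigma>'(b := E (ys @ w))))"

definition emits :: "nat \<Rightarrow> ((nat \<Rightarrow> nat) \<Rightarrow> nat) list \<Rightarrow> prog" where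
  "emits b fs = foldr (\<lambda>s p. push b s ;; p) fs (mv b Stay)"

definition seqs :: "nat \<Rightarrow> prog list \<Rightarrow> prog" where
  "seqs b ps = foldr Seq ps (mv b Stay)"

lemma appends_Seq: "appends L b p \<sigma> \<sigma>' v \<Longrightarrow> appends L b q \<sigma>' \<sigma>'' w \<Longrightarrow> appends L b (p ;; q) \<sigma> \<sigma>'' (v @ w)"
  unfolding appends_def using runs_Seq by (metis append_assoc)

lemma appends_Stay: "appends L b (mv b Stay) \<sigma> \<sigma> []"
  unfolding appends_def by (auto intro: runs_mv)

lemma appends_mv:
  "a \<noteq> b \<Longrightarrow> \<sigma> a = W xs z \<Longrightarrow> \<sigma>' = \<sigma>(a := W xs (z + offset d)) \<Longrightarrow> appends L b (mv a d) \<sigma> \<sigma>' []"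
  unfolding appends_def by (auto intro!: runs_mv simp: fun_upd_twist)

lemma appends_push:
  assumes "\<And>t. s (rd (\<sigma>(b := t))) = v"
  shows "appends L b (push b s) \<sigma> \<sigma> [v]"
  unfolding appends_def
proof
  fix ys
  show "runs L (push b s) (\<sigma>(b := E ys)) (\<sigma>(b := E (ys @ [v])))"
    by (rule runs_push[where xs = ys]) (simp_all add: assms)
qed

lemma appends_emits:
  assumes "\<And>s t. s \<in> set fs \<Longrightarrow> s (rd (\<sigma>(b := t))) = s (rd \<sigma>)" "w = map (\<lambda>s. s (rd \<sigma>)) fs"
  shows "appends L b (emits b fs) \<sigma> \<sigma> w"
  using assms
proof (induction fs arbitrary: w)
  case Nil
  then show ?case by (simp add: emits_def appends_Stay)
next
  case (Cons s fs)
  have "appends L b (push b s) \<sigma> \<sigma> [s (rd \<sigma>)]"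
    by (intro appends_push Cons.prems(1)) simp
  moreover have "appends L b (emits b fs) \<sigma> \<sigma> (map (\<lambda>s. s (rd \<sigma>)) fs)"
    by (intro Cons.IH Cons.prems(1)) auto
  ultimately show ?case
    using appends_Seq Cons.prems(2) by (fastforce simp: emits_def)
qed

lemma appends_seqs:
  assumes "\<And>i. i < length ps \<Longrightarrow> appends L b (ps ! i) \<sigma> \<sigma> (w i)"
    and "v = concat (map w [0..<length ps])"
  shows "appends L b (seqs b ps) \<sigma> \<sigma> v"
  using assms
proof (induction ps arbitrary: w v)
  case Nil
  then show ?case by (simp add: seqs_def appends_Stay)
next
  case (Cons p ps)
  have "appends L b p \<sigma> \<sigma> (w 0)"
    using Cons.prems(1)[of 0] by simp
  moreover have "appends L b (seqs b ps) \<sigma> \<sigma> (concat (map (\<lambda>i. w (Suc i)) [0..<length ps]))"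
    using Cons.prems(1)[of "Suc _"] by (intro Cons.IH) auto
  ultimately have "appends L b (p ;; seqs b ps) \<sigma> \<sigma> (w 0 @ concat (map (\<lambda>i. w (Suc i)) [0..<length ps]))"
    by (rule appends_Seq)
  then show ?case
    using Cons.prems(2) by (simp add: seqs_def upt_conv_Cons map_Suc_upt[symmetric] o_def del: upt_Suc)
qed

lemma appends_For:
  assumes "length xs \<le> L" "0 \<notin> set xs" "a \<noteq> b"
    and "\<And>i. i < length xs \<Longrightarrow>
      appends L b p ((f i)(a := W xs (int i))) ((f (Suc i))(a := W xs (int i))) (w i)"
    and "\<sigma> = (f 0)(a := W xs 0)" "\<sigma>' = (f (length xs))(a := W xs 0)"
    and "v = concat (map w [0..<length xs])"
  shows "appends L b (For a p) \<sigma> \<sigma>' v"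
  unfolding appends_def
proof
  fix ys
  let ?f = "\<lambda>i. (f i)(b := E (ys @ concat (map w [0..<i])))"
  show "runs L (For a p) (\<sigma>(b := E ys)) (\<sigma>'(b := E (ys @ v)))"
  proof (rule runs_For[where xs = xs and f = ?f])
    fix i assume "i < length xs"
    then have "runs L p ((f i)(a := W xs (int i), b := E (ys @ concat (map w [0..<i]))))
        ((f (Suc i))(a := W xs (int i), b := E ((ys @ concat (map w [0..<i])) @ w i)))"
      using assms(4) unfolding appends_def by blast
    then show "runs L p ((?f i)(a := W xs (int i))) ((?f (Suc i))(a := W xs (int i)))"
      using assms(3) by (simp add: fun_upd_twist)
  qed (use assms in \<open>auto simp: fun_upd_twist\<close>)
qed

lemma appends_For_same:
  assumes "\<sigma> a = W xs 0" "length xs \<le> L" "0 \<notin> set xs" "a \<noteq> b"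
    and "\<And>i. i < length xs \<Longrightarrow> appends L b p (\<sigma>(a := W xs (int i))) (\<sigma>(a := W xs (int i))) (w i)"
    and "v = concat (map w [0..<length xs])"
  shows "appends L b (For a p) \<sigma> \<sigma> v"
  using assms by (intro appends_For[where f = "\<lambda>_. \<sigma>" and xs = xs and w = w]) auto

lemma runs_appends:
  "appends L b p \<sigma> \<sigma>' w \<Longrightarrow> \<sigma> b = E ys \<Longrightarrow> runs L p \<sigma> (\<sigma>'(b := E (ys @ w)))"
  unfolding appends_def by (metis fun_upd_triv)

lemma runs_build:
  assumes "appends L b p \<sigma> \<sigma> w" "\<sigma> b = W [] 0" "0 \<notin> set w" "length w \<le> L" "\<sigma>' = \<sigma>(b := W w 0)"
  shows "runs L (p ;; rewind b) \<sigma> \<sigma>'"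
proof (rule runs_Seq)
  show "runs L p \<sigma> (\<sigma>(b := E w))"
    using runs_appends[OF assms(1), of "[]"] assms(2) by simp
  show "runs L (rewind b) (\<sigma>(b := E w)) \<sigma>'"
    using assms by (intro runs_rewind[where xs = w and z = "length w"]) auto
qed

lemma W_zeros: "W (replicate n 0) z = W [] z"
  by (auto simp: W_def fun_eq_iff)

lemma concat_map_const: "concat (map (\<lambda>_. xs) [0..<n]) = concat (replicate n xs)"
  by (simp add: map_replicate_const)

lemma concat_replicate_single: "concat (replicate n [x]) = replicate n x"
  by (induction n) simp_all

lemma concat_replicate_replicate: "concat (replicate n (replicate m x)) = replicate (n * m) x"
  by (induction n) (simp_all add: replicate_add)

lemma concat_replicate_Nil: "concat (replicate n []) = []"
  by (induction n) simp_all

lemmas concat_replicates = concat_map_const concat_replicate_single concat_replicate_replicate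
  concat_replicate_Nil

abbreviation one :: "(nat \<Rightarrow> nat) \<Rightarrow> nat" where "one \<equiv> \<lambda>_. 1"

lemma appends_count:
  assumes "\<sigma> a = W xs 0" "length xs \<le> L" "0 \<notin> set xs" "a \<noteq> b"
  shows "appends L b (For a (push b (\<lambda>_. c))) \<sigma> \<sigma> (replicate (length xs) c)"
  using assms
  by (intro appends_For_same[where w = "\<lambda>_. [c]"] appends_push) (auto simp: concat_replicates map_replicate_const)

subsection \<open>Evaluation of polynomials\<close>

text \<open>The tapes after \<open>b\<close> hold the intermediate results of Horner's scheme.\<close>

fun horner :: "nat \<Rightarrow> nat \<Rightarrow> nat list \<Rightarrow> prog" where
  "horner a b [] = mv b Stay"
| "horner a b (c # cs) = horner a (b + 1) cs ;;
     ((For (b + 1) (For a (push b one)) ;; emits b (replicate c one)) ;; rewind b)"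

lemma poly_mono_nat: "x \<le> y \<Longrightarrow> poly (P :: nat poly) x \<le> poly P y"
  by (induction P) (auto intro: add_mono mult_le_mono)

text \<open>The loop bound uses the value at \<open>length xs + 1\<close>: a positive argument makes
  it dominate all intermediate values of the scheme, also when \<open>xs\<close> is empty.\<close>

lemma runs_horner:
  assumes "\<sigma> a = W xs 0" "0 \<notin> set xs" "a < b" "\<forall>i \<ge> b. \<sigma> i = W [] 0" "length xs \<le> L"
    and "poly (Poly cs) (length xs + 1) \<le> L"
  shows "\<exists>\<sigma>'. runs L (horner a b cs) \<sigma> \<sigma>' \<and> \<sigma>' b = W (replicate (poly (Poly cs) (length xs)) 1) 0 \<and>
    (\<forall>i. i < b \<or> b + length cs < i \<longrightarrow> \<sigma>' i = \<sigma> i)"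
  using assms
proof (induction cs arbitrary: b)
  case Nil
  then have "runs L (mv b Stay) \<sigma> \<sigma>" by (intro runs_mv[of _ _ "[]" 0]) auto
  then show ?case using Nil by auto
next
  case (Cons c cs)
  let ?n = "length xs"
  let ?v = "poly (Poly cs) ?n"
  have tail: "poly (Poly cs) (?n + 1) \<le> L"
    using Cons.prems(6) by simp
  have L: "?v \<le> L" "?v * ?n + c \<le> L"
    using poly_mono_nat[of ?n "?n + 1" "Poly cs"] poly_mono_nat[of ?n "?n + 1" "Poly (c # cs)"] Cons.prems(6) tail
    by (auto simp: algebra_simps)
  obtain \<tau> where \<tau>: "runs L (horner a (b + 1) cs) \<sigma> \<tau>" "\<tau> (b + 1) = W (replicate ?v 1) 0"
    "\<forall>i. i < b + 1 \<or> b + 1 + length cs < i \<longrightarrow> \<tau> i = \<sigma> i"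
    using Cons.IH[of "b + 1"] Cons.prems tail by auto
  have "appends L b (For (b + 1) (For a (push b one)) ;; emits b (replicate c one)) \<tau> \<tau>
      (replicate (?v * ?n) 1 @ replicate c 1)"
  proof (rule appends_Seq)
    show "appends L b (For (b + 1) (For a (push b one))) \<tau> \<tau> (replicate (?v * ?n) 1)"
      using Cons.prems \<tau> L
      by (intro appends_For_same[where w = "\<lambda>_. replicate ?n 1" and xs = "replicate ?v 1"] appends_count)
        (auto simp: concat_replicates)
  qed (auto intro: appends_emits)
  then have "runs L ((For (b + 1) (For a (push b one)) ;; emits b (replicate c one)) ;; rewind b) \<tau>
      (\<tau>(b := W (replicate (?v * ?n + c) 1) 0))"
    using Cons.prems \<tau> L by (intro runs_build) (auto simp: replicate_add)
  then have "runs L (horner a b (c # cs)) \<sigma> (\<tau>(b := W (replicate (?v * ?n + c) 1) 0))"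
    using \<tau>(1) unfolding horner.simps by (rule runs_Seq[rotated])
  moreover have "poly (Poly (c # cs)) ?n = ?v * ?n + c"
    by simp
  ultimately show ?case
    using \<tau>(3) by (intro exI[of _ "\<tau>(b := W (replicate (?v * ?n + c) 1) 0)"] conjI) (assumption, simp_all only:, auto)
qed

subsection \<open>The program of the reduction\<close>

text \<open>An injective code of the three data by the symbols 5 to 16, decoded by division in
  \<open>allowed\<close>. The two \<open>min\<close> keep the value in this range whatever symbols
  are read.\<close>

definition init_class :: "nat \<Rightarrow> nat \<Rightarrow> nat \<Rightarrow> nat" where
  "init_class h x c = 5 + 6 * h + 2 * min x 2 + min c 1"

text \<open>Room for the input, for the certificate and for heads that travel at most
  \<open>T + 1\<close> cells in \<open>T + 1\<close> steps. With a wall and \<open>T + 1\<close>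
  cells to the left of cell 0, a row of the tiling has length
  \<open>width n q T + T + 2\<close>.\<close>

definition width :: "nat \<Rightarrow> nat \<Rightarrow> nat \<Rightarrow> nat" where
  "width n q T = n + q + T + 2"

text \<open>The classes are 1 for the wall on the left of a row, 2 for a cell of a configuration, 3 for the last
  row, and, in the first row, 4 for the cells on the left of the inputs and \<open>init_class h x c\<close> for the others,
  where \<open>h\<close> marks the cell 0, \<open>x\<close> is the input symbol and \<open>c\<close> marks the \<open>q\<close> cells that may
  hold the certificate.\<close>

definition classes :: "bool list \<Rightarrow> nat \<Rightarrow> nat \<Rightarrow> nat list" where
  "classes x q T =
    (let l = width (length x) q T; N = l + T + 2 in
     1 # replicate (T + 1) 4 @
     map (\<lambda>i. init_class (if i = 0 then 1 else 0) (symb (map bit_symbol x) (int i)) (symb (replicate q 1) (int i))) [0..<l] @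
     concat (replicate (T + 1) (1 # replicate (N - 1) 2)) @ replicate N 3)"

lemma length_classes:
  "length (classes x q T) = (width (length x) q T + T + 2) * (T + 3)"
  by (simp add: classes_def Let_def length_concat sum_list_replicate algebra_simps)

text \<open>Read at position \<open>j - i\<close>, this word gives \<open>relation N i j\<close>;
  negative positions and positions beyond \<open>N\<close> are blank, that is, unrelated.\<close>

definition template :: "nat \<Rightarrow> nat list" where
  "template N = ([1, 2] @ replicate (N - 1) 0)[N := 3]"

locale tiling_reduction = tiling K A H V for K A H V +
  fixes p q :: "nat poly"
begin

definition qt :: nat where "qt = 9"
definition Tt :: nat where "Tt = 10 + length (coeffs q)"
definition number_of_tapes :: nat where "number_of_tapes = Tt + length (coeffs p) + 1"

text \<open>The input is moved from tape 0, which receives the output, to tape 1. Tapes \<open>qt\<close> and \<open>Tt\<close> hold the values of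
  the polynomials, tape 5 the width of a row minus one, tape 6 the classes, and tape 7 as many ones as there are
  sites. Tape 8 holds the relation to the other sites; its head is at \<open>j - i\<close> in row \<open>i\<close> and column \<open>j\<close>.\<close>

definition prepare_input :: prog where
  "prepare_input = (For 0 (push 1 (\<lambda>r. r 0)) ;; rewind 1) ;;
     (For 1 (Op 0 (\<lambda>_. (0, Right))) ;; For 1 (mv 0 Left))"

definition prepare_numbers :: prog where
  "prepare_numbers = horner 1 qt (coeffs q) ;;
     ((For 1 (push 3 one) ;; For qt (push 3 one)) ;; rewind 3) ;;
     horner 3 Tt (coeffs p) ;;
     ((For 3 (push 4 one) ;; For Tt (push 4 one) ;; push 4 one) ;; rewind 4) ;;
     ((For Tt (push 5 one) ;; For 4 (push 5 one) ;; push 5 one ;; push 5 one) ;; rewind 5)"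

definition push_init :: "nat \<Rightarrow> prog" where
  "push_init h = push 6 (\<lambda>r. init_class h (r 1) (r qt)) ;; mv 1 Right ;; mv qt Right"

definition push_row :: "nat \<Rightarrow> nat \<Rightarrow> prog" where
  "push_row c c' = push 6 (\<lambda>_. c) ;; For 5 (push 6 (\<lambda>_. c'))"

text \<open>The heads of tapes 1 and \<open>qt\<close> run in parallel over a whole width, past the
  ends of their words. Blanks make \<open>rewind\<close> unusable there, so they return by counting:
  tape 4 holds the width minus one, and one further step is made separately.\<close>

definition prepare_classes :: prog where
  "prepare_classes =
     ((push 6 one ;; For Tt (push 6 (\<lambda>_. 4)) ;; push 6 (\<lambda>_. 4)) ;;
      (push_init 1 ;; For 4 (push_init 0) ;; (mv 1 Left ;; mv qt Left) ;; For 4 (mv 1 Left ;; mv qt Left)) ;;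
      For Tt (push_row 1 2) ;; push_row 1 2 ;; push_row 3 3) ;; rewind 6"

definition prepare_template :: prog where
  "prepare_template = (For 6 (push 7 one) ;; rewind 7) ;;
     (push 8 one ;; push 8 (\<lambda>_. 2) ;; For 5 (push 8 (\<lambda>_. 0))) ;;
     mv 8 Left ;; Op 8 (\<lambda>_. (3, Stay)) ;; For 5 (mv 8 Left) ;; mv 8 Left"

definition emit_ones :: "nat \<Rightarrow> prog" where
  "emit_ones k = For 7 (emits 0 (replicate D (\<lambda>_. 2))) ;; emits 0 (replicate k (\<lambda>_. 2)) ;; push 0 one"

definition emit_bits :: "((nat \<Rightarrow> nat) \<Rightarrow> nat \<Rightarrow> bool) \<Rightarrow> prog" where
  "emit_bits f = emits 0 (map (\<lambda>b r. bit_symbol (f r b)) [0..<D])"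

definition emit_literals :: prog where
  "emit_literals = seqs 0 (map (\<lambda>a. For 7 (emit_bits (\<lambda>_. literal_bit a)) ;; emit_bits (\<lambda>_. last_bit True a)) [0..<D])"

definition emit_site :: prog where
  "emit_site = seqs 0 (map (\<lambda>a. For 7 (emit_bits (\<lambda>r. site_bit (r 6) (r 8) a) ;; mv 8 Right) ;;
     emit_bits (\<lambda>_. last_bit False a) ;; For 7 (mv 8 Left)) [0..<D])"

definition reduction :: prog where
  "reduction = prepare_input ;; prepare_numbers ;; prepare_classes ;; prepare_template ;;
     emit_ones D ;; emit_literals ;; For 6 (emit_site ;; mv 8 Left) ;; emit_ones (D - 1) ;; emit_ones 89"

end

abbreviation U :: "nat \<Rightarrow> tape" where "U n \<equiv> W (replicate n 1) 0"

lemma symb_outside: "i < 0 \<or> int (length xs) \<le> i \<Longrightarrow> symb xs i = 0"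
  by (auto simp: symb_def)

lemma nonzero_classes: "0 \<notin> set (classes x q T)"
  by (auto simp: classes_def Let_def init_class_def split: if_splits)

context tiling_reduction
begin

lemma start_input: "start [x] = (\<lambda>_. W [] 0)(0 := W (map bit_symbol x) 0)"
  by (auto simp: start_def input_tape_W fun_eq_iff)

lemma prepare_input:
  assumes "length x \<le> L"
  shows "runs L prepare_input (start [x]) ((\<lambda>_. W [] 0)(1 := W (map bit_symbol x) 0))"
proof -
  define xs where "xs = map bit_symbol x"
  have xs: "0 \<notin> set xs" "length xs \<le> L"
    using assms by (auto simp: xs_def bit_symbol_def)
  define \<sigma> :: "tape \<Rightarrow> state" where "\<sigma> t = (\<lambda>_. W [] 0)(1 := W xs 0, 0 := t)" for t
  have "appends L 1 (For 0 (push 1 (\<lambda>r. r 0))) (start [x]) (start [x]) xs"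
    unfolding start_input xs_def[symmetric] using xs
    by (intro appends_For_same[where w = "\<lambda>i. [xs ! i]" and xs = xs] appends_push)
      (auto simp: rd_def map_nth)
  then have 1: "runs L (For 0 (push 1 (\<lambda>r. r 0)) ;; rewind 1) (start [x]) (\<sigma> (W xs 0))"
    using xs by (intro runs_build) (auto simp: \<sigma>_def start_input xs_def fun_upd_twist)
  have 2: "runs L (For 1 (Op 0 (\<lambda>_. (0, Right)))) (\<sigma> (W xs 0)) (\<sigma> (W [] (int (length xs))))"
  proof (rule runs_For[where xs = xs and f = "\<lambda>i. \<sigma> (W (replicate i 0 @ drop i xs) (int i))"])
    fix i assume i: "i < length xs"
    have "(replicate i 0 @ drop i xs)[i := 0] = replicate (Suc i) 0 @ drop (Suc i) xs"
      using i by (simp add: list_update_append Cons_nth_drop_Suc[symmetric] replicate_append_same)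
    then show "runs L (Op 0 (\<lambda>_. (0, Right))) ((\<sigma> (W (replicate i 0 @ drop i xs) (int i)))(1 := W xs (int i)))
        ((\<sigma> (W (replicate (Suc i) 0 @ drop (Suc i) xs) (int (Suc i))))(1 := W xs (int i)))"
      using i by (intro runs_Op) (auto simp: \<sigma>_def act_W_update fun_upd_twist add.commute)
  qed (use xs in \<open>auto simp: \<sigma>_def W_zeros fun_upd_twist\<close>)
  have 3: "runs L (For 1 (mv 0 Left)) (\<sigma> (W [] (int (length xs)))) (\<sigma> (W [] 0))"
  proof (rule runs_For[where xs = xs and f = "\<lambda>i. \<sigma> (W [] (int (length xs) - int i))"])
    fix i assume "i < length xs"
    show "runs L (mv 0 Left) ((\<sigma> (W [] (int (length xs) - int i)))(1 := W xs (int i)))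
        ((\<sigma> (W [] (int (length xs) - int (Suc i))))(1 := W xs (int i)))"
      by (intro runs_mv[where xs = "[]" and z = "int (length xs) - int i"]) (auto simp: \<sigma>_def fun_upd_twist algebra_simps)
  qed (use xs in \<open>auto simp: \<sigma>_def fun_upd_twist\<close>)
  have "\<sigma> (W [] 0) = (\<lambda>_. W [] 0)(1 := W xs 0)"
    by (auto simp: \<sigma>_def)
  then show ?thesis
    unfolding prepare_input_def using 1 2 3 by (metis runs_Seq xs_def)
qed

definition prepared :: "state \<Rightarrow> bool list \<Rightarrow> nat \<Rightarrow> nat \<Rightarrow> bool" where
  "prepared \<sigma> x qv T \<longleftrightarrow> \<sigma> 0 = W [] 0 \<and> \<sigma> 1 = W (map bit_symbol x) 0 \<and> \<sigma> qt = U qv \<and> \<sigma> Tt = U T \<and>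
    \<sigma> 4 = U (width (length x) qv T - 1) \<and> \<sigma> 5 = U (width (length x) qv T + T + 1) \<and>
    \<sigma> 6 = W [] 0 \<and> \<sigma> 7 = W [] 0 \<and> \<sigma> 8 = W [] 0"

lemma prepare_numbers:
  assumes "qv = poly q (length x)" "T = poly p (length x + qv)"
    and "poly q (length x + 1) \<le> L" "poly p (length x + qv + 1) \<le> L"
    and "width (length x) qv T + T + 2 \<le> L"
  obtains \<sigma> where "runs L prepare_numbers ((\<lambda>_. W [] 0)(1 := W (map bit_symbol x) 0)) \<sigma>"
    "prepared \<sigma> x qv T"
proof -
  let ?n = "length x" and ?l = "width (length x) qv T" and ?\<sigma> = "(\<lambda>_. W [] 0)(1 := W (map bit_symbol x) 0)"
  have n: "?n \<le> L" "?n + qv \<le> L" "T \<le> L" "qv \<le> L"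
    using assms(5) by (simp_all add: width_def)
  have x: "0 \<notin> set (map bit_symbol x)"
    by (auto simp: bit_symbol_def)
  obtain \<sigma>1 where \<sigma>1: "runs L (horner 1 qt (coeffs q)) ?\<sigma> \<sigma>1" "\<sigma>1 qt = U qv"
    "\<forall>i. i < qt \<or> qt + length (coeffs q) < i \<longrightarrow> \<sigma>1 i = ?\<sigma> i"
    using runs_horner[of ?\<sigma> 1 "map bit_symbol x" qt L "coeffs q"] assms(1,3) n x
    by (auto simp: qt_def)
  define \<sigma>2 where "\<sigma>2 = \<sigma>1(3 := U (?n + qv))"
  have \<sigma>1': "\<sigma>1 1 = W (map bit_symbol x) 0" "\<sigma>1 3 = W [] 0"
    using \<sigma>1(3) by (simp_all add: qt_def)
  have "appends L 3 (For 1 (push 3 one) ;; For qt (push 3 one)) \<sigma>1 \<sigma>1 (replicate ?n 1 @ replicate qv 1)"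
    using appends_count[of \<sigma>1 1 "map bit_symbol x" L 3 1] appends_count[of \<sigma>1 qt "replicate qv 1" L 3 1] \<sigma>1 \<sigma>1' x n
    by (intro appends_Seq) (auto simp: qt_def)
  then have r2: "runs L ((For 1 (push 3 one) ;; For qt (push 3 one)) ;; rewind 3) \<sigma>1 \<sigma>2"
    using \<sigma>1' n by (intro runs_build) (auto simp: \<sigma>2_def replicate_add)
  have "\<exists>\<sigma>'. runs L (horner 3 Tt (coeffs p)) \<sigma>2 \<sigma>' \<and> \<sigma>' Tt = U (poly (Poly (coeffs p)) (length (replicate (?n + qv) (1::nat)))) \<and>
    (\<forall>i. i < Tt \<or> Tt + length (coeffs p) < i \<longrightarrow> \<sigma>' i = \<sigma>2 i)"
    using n assms(4) \<sigma>1(3)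
    by (intro runs_horner) (auto simp: \<sigma>2_def Tt_def qt_def)
  then obtain \<sigma>3 where \<sigma>3: "runs L (horner 3 Tt (coeffs p)) \<sigma>2 \<sigma>3" "\<sigma>3 Tt = U T"
    "\<forall>i < Tt. \<sigma>3 i = \<sigma>2 i"
    using assms(2) by auto
  have \<sigma>3': "\<sigma>3 0 = W [] 0" "\<sigma>3 1 = W (map bit_symbol x) 0" "\<sigma>3 3 = U (?n + qv)" "\<sigma>3 4 = W [] 0"
    "\<sigma>3 5 = W [] 0" "\<sigma>3 6 = W [] 0" "\<sigma>3 7 = W [] 0" "\<sigma>3 8 = W [] 0" "\<sigma>3 qt = U qv"
    using \<sigma>3(3) \<sigma>1 by (simp_all add: \<sigma>2_def Tt_def qt_def)
  have T: "Tt \<noteq> 4" "Tt \<noteq> 5" "Tt \<noteq> qt" "qt \<noteq> 4" "qt \<noteq> 5"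
    by (simp_all add: Tt_def qt_def)
  define \<sigma>4 where "\<sigma>4 = \<sigma>3(4 := U (?l - 1))"
  have "appends L 4 (For 3 (push 4 one) ;; For Tt (push 4 one) ;; push 4 one) \<sigma>3 \<sigma>3
      (replicate (?n + qv) 1 @ replicate T 1 @ [1])"
    using appends_count[of \<sigma>3 3 "replicate (?n + qv) 1" L 4 1] appends_count[of \<sigma>3 Tt "replicate T 1" L 4 1]
      \<sigma>3(2) \<sigma>3' n T
    by (intro appends_Seq[where \<sigma>' = \<sigma>3] appends_push) auto
  moreover have "replicate (?n + qv) 1 @ replicate T 1 @ [1] = replicate (?l - 1) (1::nat)"
  proof -
    have "?l - 1 = (?n + qv) + (T + 1)" by (simp add: width_def)
    then show ?thesis by (simp only: replicate_add) simp
  qed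
  ultimately have r4: "runs L ((For 3 (push 4 one) ;; For Tt (push 4 one) ;; push 4 one) ;; rewind 4) \<sigma>3 \<sigma>4"
    using \<sigma>3' assms(5) by (intro runs_build[where w = "replicate (?l - 1) 1"]) (auto simp: \<sigma>4_def)
  define \<sigma>5 where "\<sigma>5 = \<sigma>4(5 := U (?l + T + 1))"
  have "appends L 5 (For Tt (push 5 one) ;; For 4 (push 5 one) ;; push 5 one ;; push 5 one) \<sigma>4 \<sigma>4
      (replicate T 1 @ replicate (?l - 1) 1 @ [1] @ [1])"
    using appends_count[of \<sigma>4 Tt "replicate T 1" L 5 1] appends_count[of \<sigma>4 4 "replicate (?l - 1) 1" L 5 1]
      \<sigma>3(2) T n assms(5)
    by (intro appends_Seq[where \<sigma>' = \<sigma>4] appends_push) (auto simp: \<sigma>4_def)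
  moreover have "replicate T 1 @ replicate (?l - 1) 1 @ [1] @ [1] = replicate (?l + T + 1) (1::nat)"
  proof -
    have "?l + T + 1 = T + ((?l - 1) + (1 + 1))" by (simp add: width_def)
    then show ?thesis by (simp only: replicate_add) simp
  qed
  ultimately have r5: "runs L ((For Tt (push 5 one) ;; For 4 (push 5 one) ;; push 5 one ;; push 5 one) ;; rewind 5) \<sigma>4 \<sigma>5"
    using \<sigma>3' assms(5) by (intro runs_build[where w = "replicate (?l + T + 1) 1"]) (auto simp: \<sigma>4_def \<sigma>5_def)
  have "runs L prepare_numbers ?\<sigma> \<sigma>5"
    unfolding prepare_numbers_def
    by (rule runs_Seq[OF \<sigma>1(1) runs_Seq[OF r2 runs_Seq[OF \<sigma>3(1) runs_Seq[OF r4 r5]]]])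
  moreover have "prepared \<sigma>5 x qv T"
    using \<sigma>3' \<sigma>3(2) T by (simp add: prepared_def \<sigma>5_def \<sigma>4_def)
  ultimately show ?thesis using that by blast
qed

lemma prepare_classes:
  assumes "prepared \<sigma> x qv T" "(width (length x) qv T + T + 2) * (T + 3) \<le> L"
  shows "runs L prepare_classes \<sigma> (\<sigma>(6 := W (classes x qv T) 0))"
proof -
  let ?l = "width (length x) qv T"
  let ?N = "?l + T + 2"
  define xs where "xs = map bit_symbol x"
  define qs where "qs = replicate qv (1 :: nat)"
  have "?N * 1 \<le> ?N * (T + 3)" by (rule mult_le_mono2) simp
  then have N: "?N \<le> L" using le_trans[OF _ assms(2)] by simp
  have \<sigma>: "\<sigma> 1 = W xs 0" "\<sigma> qt = W qs 0" "\<sigma> Tt = U T" "\<sigma> 4 = U (?l - 1)" "\<sigma> 5 = U (?N - 1)" "\<sigma> 6 = W [] 0"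
    using assms(1) by (simp_all add: prepared_def xs_def qs_def)
  have t: "Tt \<noteq> 4" "Tt \<noteq> 5" "Tt \<noteq> 6" "Tt \<noteq> qt" "qt \<noteq> 4" "qt \<noteq> 5" "qt \<noteq> 6" "qt \<noteq> 1"
    by (simp_all add: Tt_def qt_def)
  define g where "g h z = init_class h (symb xs z) (symb qs z)" for h z
  define \<tau> where "\<tau> z = \<sigma>(1 := W xs z, qt := W qs z)" for z
  have init: "appends L 6 (push_init h) ((\<tau> z)(4 := t)) ((\<tau> (z + 1))(4 := t)) [g h z]" for h z t
  proof -
    have "appends L 6 (push_init h) ((\<tau> z)(4 := t)) ((\<tau> (z + 1))(4 := t)) ([g h z] @ [] @ [])"
      unfolding push_init_def
    proof (intro appends_Seq)
      show "appends L 6 (push 6 (\<lambda>r. init_class h (r 1) (r qt))) ((\<tau> z)(4 := t)) ((\<tau> z)(4 := t)) [g h z]"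
        using \<open>qt \<noteq> 4\<close> \<open>qt \<noteq> 6\<close> \<open>qt \<noteq> 1\<close> by (intro appends_push) (simp add: rd_def \<tau>_def g_def)
      show "appends L 6 (mv 1 Right) ((\<tau> z)(4 := t)) (\<sigma>(1 := W xs (z + 1), qt := W qs z, 4 := t)) []"
        using t by (intro appends_mv[where xs = xs and z = z]) (auto simp: \<tau>_def fun_upd_twist)
      show "appends L 6 (mv qt Right) (\<sigma>(1 := W xs (z + 1), qt := W qs z, 4 := t)) ((\<tau> (z + 1))(4 := t)) []"
        using t by (intro appends_mv[where xs = qs and z = z]) (auto simp: \<tau>_def fun_upd_twist)
    qed
    then show ?thesis by simp
  qed
  have lefts: "appends L 6 (mv 1 Left ;; mv qt Left) ((\<tau> z)(4 := t)) ((\<tau> (z - 1))(4 := t)) []" for z t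
  proof -
    have "appends L 6 (mv 1 Left ;; mv qt Left) ((\<tau> z)(4 := t)) ((\<tau> (z - 1))(4 := t)) ([] @ [])"
    proof (intro appends_Seq)
      show "appends L 6 (mv 1 Left) ((\<tau> z)(4 := t)) (\<sigma>(1 := W xs (z - 1), qt := W qs z, 4 := t)) []"
        using t by (intro appends_mv[where xs = xs and z = z]) (auto simp: \<tau>_def fun_upd_twist)
      show "appends L 6 (mv qt Left) (\<sigma>(1 := W xs (z - 1), qt := W qs z, 4 := t)) ((\<tau> (z - 1))(4 := t)) []"
        using t by (intro appends_mv[where xs = qs and z = z]) (auto simp: \<tau>_def fun_upd_twist)
    qed
    then show ?thesis by simp
  qed
  have \<tau>4: "(\<tau> z)(4 := U (?l - 1)) = \<tau> z" for z
    using \<sigma> t by (auto simp: \<tau>_def fun_eq_iff)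
  have \<tau>0: "\<tau> 0 = \<sigma>"
    using \<sigma> by (auto simp: \<tau>_def fun_eq_iff)
  have 1: "appends L 6 (push 6 one ;; For Tt (push 6 (\<lambda>_. 4)) ;; push 6 (\<lambda>_. 4)) \<sigma> \<sigma>
      ([1] @ replicate T 4 @ [4])"
    using appends_count[of \<sigma> Tt "replicate T 1" L 6 4] \<sigma> N t
    by (intro appends_Seq[where \<sigma>' = \<sigma>] appends_push) auto
  have 2: "appends L 6 (push_init 1 ;; For 4 (push_init 0) ;; (mv 1 Left ;; mv qt Left) ;; For 4 (mv 1 Left ;; mv qt Left)) \<sigma> \<sigma>
      ([g 1 0] @ map (\<lambda>i. g 0 (int i + 1)) [0..<?l - 1] @ [] @ [])"
  proof (intro appends_Seq)
    show "appends L 6 (push_init 1) \<sigma> (\<tau> 1) [g 1 0]"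
      using init[of 1 0 "U (?l - 1)"] unfolding \<tau>4 unfolding \<tau>0 by simp
    show "appends L 6 (For 4 (push_init 0)) (\<tau> 1) (\<tau> (int ?l)) (map (\<lambda>i. g 0 (int i + 1)) [0..<?l - 1])"
    proof (rule appends_For[where f = "\<lambda>i. \<tau> (int i + 1)" and xs = "replicate (?l - 1) 1" and w = "\<lambda>i. [g 0 (int i + 1)]"])
      fix i
      show "appends L 6 (push_init 0) ((\<tau> (int i + 1))(4 := W (replicate (?l - 1) 1) (int i)))
          ((\<tau> (int (Suc i) + 1))(4 := W (replicate (?l - 1) 1) (int i))) [g 0 (int i + 1)]"
        using init[of 0 "int i + 1"] by (simp add: add.commute)
    next
      show "\<tau> (int ?l) = (\<tau> (int (length (replicate (?l - 1) 1)) + 1))(4 := U (?l - 1))"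
        unfolding \<tau>4 by (simp add: width_def)
    next
      show "\<tau> 1 = (\<tau> (int 0 + 1))(4 := U (?l - 1))"
        unfolding \<tau>4 by simp
    qed (use N in auto)
    show "appends L 6 (mv 1 Left ;; mv qt Left) (\<tau> (int ?l)) (\<tau> (int ?l - 1)) []"
      using lefts[of "int ?l" "U (?l - 1)"] unfolding \<tau>4 .
    show "appends L 6 (For 4 (mv 1 Left ;; mv qt Left)) (\<tau> (int ?l - 1)) \<sigma> []"
    proof (rule appends_For[where f = "\<lambda>i. \<tau> (int ?l - 1 - int i)" and xs = "replicate (?l - 1) 1" and w = "\<lambda>i. []"])
      fix i
      show "appends L 6 (mv 1 Left ;; mv qt Left) ((\<tau> (int ?l - 1 - int i))(4 := W (replicate (?l - 1) 1) (int i)))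
          ((\<tau> (int ?l - 1 - int (Suc i)))(4 := W (replicate (?l - 1) 1) (int i))) []"
        using lefts[of "int ?l - 1 - int i"] by (simp add: algebra_simps)
    next
      show "\<sigma> = (\<tau> (int ?l - 1 - int (length (replicate (?l - 1) 1))))(4 := U (?l - 1))"
        unfolding \<tau>4 by (simp add: width_def \<tau>0)
    next
      show "\<tau> (int ?l - 1) = (\<tau> (int ?l - 1 - int 0))(4 := U (?l - 1))"
        unfolding \<tau>4 by simp
    qed (use N in \<open>auto simp: concat_replicates\<close>)
  qed
  have row: "appends L 6 (push_row c c') \<rho> \<rho> (c # replicate (?N - 1) c')" if "\<rho> 5 = U (?N - 1)" for \<rho> c c'
  proof -
    have "appends L 6 (push_row c c') \<rho> \<rho> ([c] @ replicate (?N - 1) c')"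
      unfolding push_row_def
      using appends_count[of \<rho> 5 "replicate (?N - 1) 1" L 6 c'] that N
      by (intro appends_Seq[where \<sigma>' = \<rho>] appends_push) auto
    then show ?thesis by simp
  qed
  have 3: "appends L 6 (For Tt (push_row 1 2) ;; push_row 1 2 ;; push_row 3 3) \<sigma> \<sigma>
      (concat (replicate T (1 # replicate (?N - 1) 2)) @ (1 # replicate (?N - 1) 2) @ (3 # replicate (?N - 1) 3))"
  proof (intro appends_Seq[where \<sigma>' = \<sigma>] row)
    show "appends L 6 (For Tt (push_row 1 2)) \<sigma> \<sigma> (concat (replicate T (1 # replicate (?N - 1) 2)))"
      using \<sigma> t N
      by (intro appends_For_same[where xs = "replicate T 1" and w = "\<lambda>_. 1 # replicate (?N - 1) 2"] row)
        (auto simp: concat_map_const)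
  qed (use \<sigma> in auto)
  have "[0..<?l] = 0 # map Suc [0..<?l - 1]"
    by (simp add: width_def map_Suc_upt upt_conv_Cons del: upt_Suc)
  then have i: "map (\<lambda>i. g (if i = 0 then 1 else 0) (int i)) [0..<?l] = g 1 0 # map (\<lambda>i. g 0 (int i + 1)) [0..<?l - 1]"
    by (simp add: o_def add.commute)
  have c: "replicate ?N 3 = 3 # replicate (?N - 1) (3 :: nat)"
    by simp
  have "appends L 6 ((push 6 one ;; For Tt (push 6 (\<lambda>_. 4)) ;; push 6 (\<lambda>_. 4)) ;;
      (push_init 1 ;; For 4 (push_init 0) ;; (mv 1 Left ;; mv qt Left) ;; For 4 (mv 1 Left ;; mv qt Left)) ;;
      For Tt (push_row 1 2) ;; push_row 1 2 ;; push_row 3 3) \<sigma> \<sigma> (([1] @ replicate T 4 @ [4]) @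
      ([g 1 0] @ map (\<lambda>i. g 0 (int i + 1)) [0..<?l - 1] @ [] @ []) @
      concat (replicate T (1 # replicate (?N - 1) 2)) @ (1 # replicate (?N - 1) 2) @ (3 # replicate (?N - 1) 3))"
    by (rule appends_Seq[OF 1 appends_Seq[OF 2 3]])
  also have "([1] @ replicate T 4 @ [4]) @
      ([g 1 0] @ map (\<lambda>i. g 0 (int i + 1)) [0..<?l - 1] @ [] @ []) @
      concat (replicate T (1 # replicate (?N - 1) 2)) @ (1 # replicate (?N - 1) 2) @ (3 # replicate (?N - 1) 3) = classes x qv T"
  proof -
    have r: "concat (replicate (T + 1) (1 # replicate (?N - 1) 2)) =
        concat (replicate T (1 # replicate (?N - 1) 2)) @ (1 # replicate (?N - 1) 2)"
      by (simp only: replicate_add concat_append) simp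
    show ?thesis
      unfolding classes_def Let_def r c i[unfolded g_def xs_def qs_def]
      by (simp add: g_def xs_def qs_def replicate_append_same)
  qed
  finally show ?thesis
    unfolding prepare_classes_def
    by (rule runs_build) (use \<sigma>(6) assms(2) nonzero_classes in \<open>simp_all only: length_classes not_False_eq_True\<close>)
qed

lemma prepare_template:
  assumes "\<sigma> 5 = U (N - 1)" "\<sigma> 6 = W cls 0" "\<sigma> 7 = W [] 0" "\<sigma> 8 = W [] 0"
    and "2 \<le> N" "N \<le> L" "length cls \<le> L" "0 \<notin> set cls"
  shows "runs L prepare_template \<sigma> (\<sigma>(7 := U (length cls), 8 := W (template N) 0))"
proof -
  let ?M = "length cls"
  define \<tau> where "\<tau> t = \<sigma>(7 := U ?M, 8 := t)" for t
  have \<tau>: "\<tau> t 5 = U (N - 1)" "\<tau> t 6 = W cls 0" "\<tau> t 8 = t" "(\<tau> t)(8 := t') = \<tau> t'" for t t'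
    using assms by (auto simp: \<tau>_def)
  have 1: "runs L (For 6 (push 7 one) ;; rewind 7) \<sigma> (\<tau> (W [] 0))"
    using assms by (intro runs_build[where w = "replicate ?M 1"] appends_count) (auto simp: \<tau>_def fun_eq_iff)
  define w where "w = [1, 2] @ replicate (N - 1) (0 :: nat)"
  have w: "length w = N + 1" using assms by (simp add: w_def)
  have "appends L 8 (push 8 one ;; push 8 (\<lambda>_. 2) ;; For 5 (push 8 (\<lambda>_. 0))) (\<tau> (W [] 0)) (\<tau> (W [] 0))
     ([1] @ [2] @ replicate (N - 1) 0)"
    using appends_count[of "\<tau> (W [] 0)" 5 "replicate (N - 1) 1" L 8 0] \<tau> assms
    by (intro appends_Seq[where \<sigma>' = "\<tau> (W [] 0)"] appends_push) auto
  then have 2: "runs L (push 8 one ;; push 8 (\<lambda>_. 2) ;; For 5 (push 8 (\<lambda>_. 0))) (\<tau> (W [] 0)) (\<tau> (W w (int N + 1)))"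
    using runs_appends[of L 8 _ "\<tau> (W [] 0)" "\<tau> (W [] 0)" _ "[]"] \<tau> w by (fastforce simp: w_def add.commute)
  have 3: "runs L (mv 8 Left) (\<tau> (W w (int N + 1))) (\<tau> (W w (int N)))"
    using \<tau> by (intro runs_mv) auto
  have 4: "runs L (Op 8 (\<lambda>_. (3, Stay))) (\<tau> (W w (int N))) (\<tau> (W (template N) (int N)))"
    using w \<tau> by (intro runs_Op) (auto simp: act_W_update template_def w_def)
  have 5: "runs L (For 5 (mv 8 Left)) (\<tau> (W (template N) (int N))) (\<tau> (W (template N) 1))"
  proof (rule runs_For[where xs = "replicate (N - 1) 1" and f = "\<lambda>i. \<tau> (W (template N) (int N - int i))"])
    fix i
    show "runs L (mv 8 Left) ((\<tau> (W (template N) (int N - int i)))(5 := W (replicate (N - 1) 1) (int i)))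
        ((\<tau> (W (template N) (int N - int (Suc i))))(5 := W (replicate (N - 1) 1) (int i)))"
      by (intro runs_mv[where xs = "template N" and z = "int N - int i"]) (auto simp: \<tau>_def fun_upd_twist algebra_simps)
  qed (use assms \<tau> in \<open>auto simp: fun_eq_iff\<close>)
  have 6: "runs L (mv 8 Left) (\<tau> (W (template N) 1)) (\<tau> (W (template N) 0))"
    using \<tau> by (intro runs_mv) auto
  have "runs L prepare_template \<sigma> (\<tau> (W (template N) 0))"
    unfolding prepare_template_def
    by (rule runs_Seq[OF 1 runs_Seq[OF 2 runs_Seq[OF 3 runs_Seq[OF 4 runs_Seq[OF 5 6]]]]])
  then show ?thesis by (simp add: \<tau>_def)
qed

end

lemma wf_mv: "wf_prog k S (mv a d) \<longleftrightarrow> a < k"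
  by (simp add: mv_def)

lemma wf_push: "wf_prog k S (push a s) \<longleftrightarrow> a < k \<and> (\<forall>r. (\<forall>j. r j < S) \<longrightarrow> s r < S)"
  by (simp add: push_def)

lemma wf_rewind: "wf_prog k S (rewind a) \<longleftrightarrow> a < k"
  by (simp add: rewind_def wf_mv)

lemma wf_For: "wf_prog k S (For a p) \<longleftrightarrow> a < k \<and> wf_prog k S p"
  by (auto simp: For_def wf_mv wf_rewind)

lemma wf_emits: "wf_prog k S (emits b fs) \<longleftrightarrow> b < k \<and> (\<forall>s \<in> set fs. \<forall>r. (\<forall>j. r j < S) \<longrightarrow> s r < S)"
  by (induction fs) (auto simp: emits_def wf_mv wf_push)

lemma wf_seqs: "wf_prog k S (seqs b ps) \<longleftrightarrow> b < k \<and> (\<forall>p \<in> set ps. wf_prog k S p)"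
  by (induction ps) (auto simp: seqs_def wf_mv)

lemma wf_horner: "a < k \<Longrightarrow> b + length cs < k \<Longrightarrow> 1 < S \<Longrightarrow> wf_prog k S (horner a b cs)"
  by (induction cs arbitrary: b) (auto simp: wf_mv wf_push wf_For wf_emits wf_rewind)

lemmas wf_simps = wf_mv wf_push wf_rewind wf_For wf_emits wf_seqs

definition bits :: "bool list \<Rightarrow> nat list" where "bits = map bit_symbol"

lemma bits_append: "bits (u @ v) = bits u @ bits v"
  by (simp add: bits_def)

context tiling_reduction
begin

lemma appends_ones:
  assumes "\<sigma> 7 = U M" "M \<le> L"
  shows "appends L 0 (emit_ones k) \<sigma> \<sigma> (bits (unary (D * M + k)))"
proof -
  have "appends L 0 (emit_ones k) \<sigma> \<sigma> (replicate (M * D) 2 @ replicate k 2 @ [1])"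
    unfolding emit_ones_def
  proof (intro appends_Seq[where \<sigma>' = \<sigma>] appends_push)
    show "appends L 0 (For 7 (emits 0 (replicate D (\<lambda>_. 2)))) \<sigma> \<sigma> (replicate (M * D) 2)"
      using assms
      by (intro appends_For_same[where xs = "replicate M 1" and w = "\<lambda>_. replicate D 2"] appends_emits)
        (auto simp: concat_replicates)
  qed (auto intro: appends_emits)
  then show ?thesis
    by (simp add: bits_def unary_def replicate_add bit_symbol_def mult.commute)
qed

lemma appends_bits:
  assumes "\<And>t. f (rd (\<sigma>(0 := t))) = g"
  shows "appends L 0 (emit_bits f) \<sigma> \<sigma> (bits (map g [0..<D]))"
proof -
  have "f (rd \<sigma>) = g"
    using assms[of "\<sigma> 0"] by simp
  then show ?thesis
    unfolding emit_bits_def using assms by (intro appends_emits) (auto simp: bits_def)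
qed

lemma bits_concat: "bits (concat (map f xs)) = concat (map (\<lambda>x. bits (f x)) xs)"
  by (simp add: bits_def map_concat o_def)

lemma appends_literals:
  assumes "\<sigma> 7 = U M" "M \<le> L"
  shows "appends L 0 emit_literals \<sigma> \<sigma>
    (bits (concat (map (\<lambda>a. row_word (\<lambda>j. literal_bit a) (last_bit True a) M) [0..<D])))"
  unfolding emit_literals_def
proof (rule appends_seqs[where w = "\<lambda>a. bits (row_word (\<lambda>j. literal_bit a) (last_bit True a) M)"])
  have "appends L 0 (For 7 (emit_bits (\<lambda>_. literal_bit a)) ;; emit_bits (\<lambda>_. last_bit True a)) \<sigma> \<sigma>
      (concat (map (\<lambda>j. bits (map (literal_bit a) [0..<D])) [0..<M]) @ bits (map (last_bit True a) [0..<D]))" for a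
    using assms
    by (intro appends_Seq[where \<sigma>' = \<sigma>] appends_bits
        appends_For_same[where xs = "replicate M 1" and w = "\<lambda>_. bits (map (literal_bit a) [0..<D])"]) auto
  then show "appends L 0 (map (\<lambda>a. For 7 (emit_bits (\<lambda>_. literal_bit a)) ;; emit_bits (\<lambda>_. last_bit True a)) [0..<D] ! i) \<sigma> \<sigma>
      (bits (row_word (\<lambda>j. literal_bit i) (last_bit True i) M))"
    if "i < length (map (\<lambda>a. For 7 (emit_bits (\<lambda>_. literal_bit a)) ;; emit_bits (\<lambda>_. last_bit True a)) [0..<D])" for i
    using that by (simp add: row_word_def bits_concat bits_append)
qed (simp add: bits_concat)

lemma template_relation:
  assumes "2 \<le> N"
  shows "symb (template N) (int j - int s) = relation N s j"
proof -
  have l: "length (template N) = N + 1"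
    unfolding template_def length_list_update using assms by simp
  have n: "template N ! i = (if i = N then 3 else if i = 0 then 1 else if i = 1 then 2 else 0)" if "i \<le> N" for i
  proof (cases "i = N")
    case True
    then show ?thesis
      using assms nth_list_update_eq[of N "[1, 2] @ replicate (N - 1) 0" "3 :: nat"] unfolding template_def True by simp
  next
    case False
    then show ?thesis
      unfolding template_def nth_list_update_neq[OF False[symmetric]] using that by (auto simp: nth_Cons')
  qed
  show ?thesis
  proof (cases "s \<le> j \<and> j - s \<le> N")
    case True
    then show ?thesis
      using assms by (auto simp: symb_def l n relation_def of_nat_diff[symmetric] simp del: of_nat_diff)
  next
    case False
    then show ?thesis
      using assms by (auto simp: symb_def l relation_def)
  qed
qed

text \<open>For each of the \<open>D\<close> rows of cells, the head of tape 8 runs along with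
  \<open>j\<close> from position \<open>- s\<close> and is moved back \<open>M\<close> steps, so the
  next row sees the same offsets.\<close>

lemma appends_site:
  assumes "\<sigma> 6 = W cls (int s)" "\<sigma> 7 = U M" "\<sigma> 8 = W (template N) (- int s)" "M \<le> L" "s < length cls" "2 \<le> N"
  shows "appends L 0 emit_site \<sigma> \<sigma>
    (bits (concat (map (\<lambda>a. row_word (\<lambda>j. site_bit (cls ! s) (relation N s j) a) (last_bit False a) M) [0..<D])))"
  unfolding emit_site_def
proof (rule appends_seqs[where w = "\<lambda>a. bits (row_word (\<lambda>j. site_bit (cls ! s) (relation N s j) a) (last_bit False a) M)"])
  define \<tau> where "\<tau> z = \<sigma>(8 := W (template N) z)" for z
  have "appends L 0 (For 7 (emit_bits (\<lambda>r. site_bit (r 6) (r 8) a) ;; mv 8 Right) ;;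
       emit_bits (\<lambda>_. last_bit False a) ;; For 7 (mv 8 Left)) (\<tau> (- int s)) (\<tau> (- int s))
      (concat (map (\<lambda>j. bits (map (site_bit (cls ! s) (relation N s j) a) [0..<D])) [0..<M]) @
        bits (map (last_bit False a) [0..<D]) @ [])" for a
  proof (intro appends_Seq)
    show "appends L 0 (For 7 (emit_bits (\<lambda>r. site_bit (r 6) (r 8) a) ;; mv 8 Right)) (\<tau> (- int s)) (\<tau> (int M - int s))
        (concat (map (\<lambda>j. bits (map (site_bit (cls ! s) (relation N s j) a) [0..<D])) [0..<M]))"
    proof (rule appends_For[where xs = "replicate M 1" and f = "\<lambda>j. \<tau> (int j - int s)"
          and w = "\<lambda>j. bits (map (site_bit (cls ! s) (relation N s j) a) [0..<D])"])
      fix j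
      have "appends L 0 (emit_bits (\<lambda>r. site_bit (r 6) (r 8) a)) ((\<tau> (int j - int s))(7 := W (replicate M 1) (int j)))
          ((\<tau> (int j - int s))(7 := W (replicate M 1) (int j))) (bits (map (site_bit (cls ! s) (relation N s j) a) [0..<D]))"
        using assms by (intro appends_bits) (simp add: rd_def \<tau>_def template_relation)
      moreover have "appends L 0 (mv 8 Right) ((\<tau> (int j - int s))(7 := W (replicate M 1) (int j)))
          ((\<tau> (int (Suc j) - int s))(7 := W (replicate M 1) (int j))) []"
        by (intro appends_mv[where xs = "template N" and z = "int j - int s"]) (auto simp: \<tau>_def fun_upd_twist algebra_simps)
      ultimately show "appends L 0 (emit_bits (\<lambda>r. site_bit (r 6) (r 8) a) ;; mv 8 Right)
          ((\<tau> (int j - int s))(7 := W (replicate M 1) (int j)))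
          ((\<tau> (int (Suc j) - int s))(7 := W (replicate M 1) (int j))) (bits (map (site_bit (cls ! s) (relation N s j) a) [0..<D]))"
        using appends_Seq by fastforce
    qed (use assms in \<open>auto simp: \<tau>_def fun_eq_iff\<close>)
    show "appends L 0 (emit_bits (\<lambda>_. last_bit False a)) (\<tau> (int M - int s)) (\<tau> (int M - int s)) (bits (map (last_bit False a) [0..<D]))"
      by (rule appends_bits) simp
    show "appends L 0 (For 7 (mv 8 Left)) (\<tau> (int M - int s)) (\<tau> (- int s)) []"
    proof (rule appends_For[where xs = "replicate M 1" and f = "\<lambda>j. \<tau> (int M - int j - int s)" and w = "\<lambda>_. []"])
      fix j
      show "appends L 0 (mv 8 Left) ((\<tau> (int M - int j - int s))(7 := W (replicate M 1) (int j)))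
          ((\<tau> (int M - int (Suc j) - int s))(7 := W (replicate M 1) (int j))) []"
        by (intro appends_mv[where xs = "template N" and z = "int M - int j - int s"]) (auto simp: \<tau>_def fun_upd_twist algebra_simps)
    qed (use assms in \<open>auto simp: \<tau>_def fun_eq_iff concat_replicates\<close>)
  qed
  moreover have "\<tau> (- int s) = \<sigma>"
    using assms(3) by (auto simp: \<tau>_def fun_eq_iff)
  ultimately show "appends L 0 (map (\<lambda>a. For 7 (emit_bits (\<lambda>r. site_bit (r 6) (r 8) a) ;; mv 8 Right) ;;
       emit_bits (\<lambda>_. last_bit False a) ;; For 7 (mv 8 Left)) [0..<D] ! i) \<sigma> \<sigma>
      (bits (row_word (\<lambda>j. site_bit (cls ! s) (relation N s j) i) (last_bit False i) M))"
    if "i < length (map (\<lambda>a. For 7 (emit_bits (\<lambda>r. site_bit (r 6) (r 8) a) ;; mv 8 Right) ;;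
       emit_bits (\<lambda>_. last_bit False a) ;; For 7 (mv 8 Left)) [0..<D])" for i
    using that by (simp add: row_word_def bits_concat bits_append)
qed (simp add: bits_concat)

lemma appends_sites:
  assumes "\<sigma> 6 = W cls 0" "\<sigma> 7 = U (length cls)" "\<sigma> 8 = W (template N) 0" "length cls \<le> L" "2 \<le> N" "0 \<notin> set cls"
  shows "appends L 0 (For 6 (emit_site ;; mv 8 Left)) \<sigma> (\<sigma>(8 := W (template N) (- int (length cls))))
    (bits (concat (map (\<lambda>i. concat (map (\<lambda>a. row_word (\<lambda>j. site_bit (cls ! i) (relation N i j) a) (last_bit False a) (length cls)) [0..<D])) [0..<length cls])))"
  unfolding bits_concat
proof (rule appends_For[where xs = cls and f = "\<lambda>i. \<sigma>(8 := W (template N) (- int i))" and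
      w = "\<lambda>i. concat (map (\<lambda>a. bits (row_word (\<lambda>j. site_bit (cls ! i) (relation N i j) a) (last_bit False a) (length cls))) [0..<D])"])
  fix i assume i: "i < length cls"
  have "appends L 0 (emit_site ;; mv 8 Left) (\<sigma>(8 := W (template N) (- int i), 6 := W cls (int i)))
     (\<sigma>(8 := W (template N) (- int (Suc i)), 6 := W cls (int i)))
     (bits (concat (map (\<lambda>a. row_word (\<lambda>j. site_bit (cls ! i) (relation N i j) a) (last_bit False a) (length cls)) [0..<D])) @ [])"
  proof (rule appends_Seq)
    show "appends L 0 emit_site (\<sigma>(8 := W (template N) (- int i), 6 := W cls (int i))) (\<sigma>(8 := W (template N) (- int i), 6 := W cls (int i)))
     (bits (concat (map (\<lambda>a. row_word (\<lambda>j. site_bit (cls ! i) (relation N i j) a) (last_bit False a) (length cls)) [0..<D])))"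
      using assms i by (intro appends_site) auto
    show "appends L 0 (mv 8 Left) (\<sigma>(8 := W (template N) (- int i), 6 := W cls (int i))) (\<sigma>(8 := W (template N) (- int (Suc i)), 6 := W cls (int i))) []"
      by (intro appends_mv[where xs = "template N" and z = "- int i"]) (auto simp: fun_upd_twist algebra_simps)
  qed
  then show "appends L 0 (emit_site ;; mv 8 Left) (\<sigma>(8 := W (template N) (- int i), 6 := W cls (int i)))
     (\<sigma>(8 := W (template N) (- int (Suc i)), 6 := W cls (int i)))
     (concat (map (\<lambda>a. bits (row_word (\<lambda>j. site_bit (cls ! i) (relation N i j) a) (last_bit False a) (length cls))) [0..<D]))"
    by (simp add: bits_concat)
qed (use assms in \<open>auto simp: fun_eq_iff\<close>)

definition reduce :: "bool list \<Rightarrow> bool list" where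
  "reduce x = (let qv = poly q (length x); T = poly p (length x + qv)
     in instance_word (width (length x) qv T + T + 2) (classes x qv T))"

text \<open>The first summand is the number of sites, which dominates all words used in the loops;
  the other two are the values at a shifted argument required by \<open>runs_horner\<close>.\<close>

definition loop_bound :: "nat poly" where
  "loop_bound =
     (let X = [:0, 1:]; T = pcompose p (X + q) in
      (X + q + 2 * T + 4) * (T + 3) + pcompose q (X + 1) + pcompose p (X + q + 1))"

lemma runs_reduction:
  "\<exists>\<sigma>'. runs (poly loop_bound (length x)) reduction (start [x]) \<sigma>' \<and> \<sigma>' 0 = E (bits (reduce x))"
proof -
  let ?n = "length x" and ?L = "poly loop_bound (length x)"
  define qv where "qv = poly q ?n"
  define T where "T = poly p (?n + qv)"
  define N where "N = width ?n qv T + T + 2"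
  define cls where "cls = classes x qv T"
  let ?M = "length cls"
  have L: "N * (T + 3) \<le> ?L" "poly q (?n + 1) \<le> ?L" "poly p (?n + qv + 1) \<le> ?L"
    by (simp_all add: loop_bound_def Let_def poly_pcompose N_def width_def qv_def T_def algebra_simps)
  have M: "?M \<le> ?L" "0 \<notin> set cls" "?M = N * (T + 3)"
    using L(1) nonzero_classes by (simp_all only: cls_def length_classes N_def not_False_eq_True)
  have "N * 1 \<le> N * (T + 3)" by (rule mult_le_mono2) simp
  then have N: "2 \<le> N" "N \<le> ?L"
    using le_trans[OF _ L(1)] by (simp_all add: N_def)
  have n: "?n \<le> ?L" using N(2) by (simp add: N_def width_def)
  obtain \<sigma>1 where r2: "runs ?L prepare_numbers ((\<lambda>_. W [] 0)(1 := W (map bit_symbol x) 0)) \<sigma>1"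
    and p1: "prepared \<sigma>1 x qv T"
    using prepare_numbers[OF qv_def T_def L(2,3)] N(2) unfolding N_def by blast
  define \<sigma>2 where "\<sigma>2 = \<sigma>1(6 := W cls 0)"
  have r3: "runs ?L prepare_classes \<sigma>1 \<sigma>2"
    unfolding \<sigma>2_def cls_def using L(1) by (intro prepare_classes p1) (simp add: N_def)
  define \<sigma>3 where "\<sigma>3 = \<sigma>2(7 := U ?M, 8 := W (template N) 0)"
  have r4: "runs ?L prepare_template \<sigma>2 \<sigma>3"
    unfolding \<sigma>3_def using p1 M N by (intro prepare_template) (auto simp: \<sigma>2_def prepared_def N_def)
  define \<sigma>4 where "\<sigma>4 = \<sigma>3(8 := W (template N) (- int ?M))"
  have \<sigma>3: "\<sigma>3 0 = W [] 0" "\<sigma>3 6 = W cls 0" "\<sigma>3 7 = U ?M" "\<sigma>3 8 = W (template N) 0" "\<sigma>4 7 = U ?M"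
    using p1 by (simp_all add: \<sigma>4_def \<sigma>3_def \<sigma>2_def prepared_def)
  have a: "appends ?L 0 (emit_ones D ;; emit_literals ;; For 6 (emit_site ;; mv 8 Left) ;; emit_ones (D - 1) ;; emit_ones 89) \<sigma>3 \<sigma>4
    (bits (unary (D * ?M + D)) @ bits (concat (map (\<lambda>a. row_word (\<lambda>j. literal_bit a) (last_bit True a) ?M) [0..<D])) @
     bits (concat (map (\<lambda>i. concat (map (\<lambda>a. row_word (\<lambda>j. site_bit (cls ! i) (relation N i j) a) (last_bit False a) ?M) [0..<D])) [0..<?M])) @
     bits (unary (D * ?M + (D - 1))) @ bits (unary (D * ?M + 89)))" (is "appends ?L 0 ?p \<sigma>3 \<sigma>4 ?w")
    using appends_sites[OF \<sigma>3(2,3,4) M(1) N(1) M(2)] \<sigma>3 M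
    by (intro appends_Seq[OF appends_ones] appends_Seq[OF appends_literals] appends_Seq[where \<sigma>' = \<sigma>4] appends_ones)
      (auto simp: \<sigma>4_def)
  have "D * ?M + (D - 1) = D * (?M + 1) - 1" "D * ?M + D = D * (?M + 1)"
    using Q_pos by (simp_all add: D_def)
  then have w: "?w = bits (reduce x)"
    unfolding reduce_def Let_def qv_def[symmetric] T_def[symmetric] N_def[symmetric] cls_def[symmetric] instance_word
    by (simp add: bits_def add.commute)
  have r5: "runs ?L ?p \<sigma>3 (\<sigma>4(0 := E ([] @ ?w)))"
    using \<sigma>3(1) by (intro runs_appends[OF a]) simp
  have "runs ?L reduction (start [x]) (\<sigma>4(0 := E ([] @ ?w)))"
    unfolding reduction_def
    by (rule runs_Seq[OF prepare_input[OF n] runs_Seq[OF r2 runs_Seq[OF r3 runs_Seq[OF r4 r5]]]])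
  then show ?thesis
    unfolding w by (intro exI[of _ "\<sigma>4(0 := E ([] @ bits (reduce x)))"]) simp
qed

text \<open>Seventeen symbols suffice because the largest one written is
  \<open>init_class 1 2 1 = 16\<close>.\<close>

lemma wf_reduction: "wf_prog number_of_tapes 17 reduction"
proof -
  have k: "10 < number_of_tapes" "qt < number_of_tapes" "Tt < number_of_tapes"
    "qt + length (coeffs q) < number_of_tapes" "Tt + length (coeffs p) < number_of_tapes"
    by (simp_all add: number_of_tapes_def Tt_def qt_def)
  have "init_class h x c < 17" if "h \<le> 1" for h x c
    using that by (simp add: init_class_def)
  then have 1: "wf_prog number_of_tapes 17 prepare_classes"
    using k by (simp add: prepare_classes_def push_init_def push_row_def wf_simps)
  have 2: "wf_prog number_of_tapes 17 prepare_numbers"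
    using k by (simp add: prepare_numbers_def wf_simps wf_horner)
  have 3: "wf_prog number_of_tapes 17 prepare_input" "wf_prog number_of_tapes 17 prepare_template"
    using k by (simp_all add: prepare_input_def prepare_template_def wf_simps)
  have b: "wf_prog number_of_tapes 17 (emit_bits f)" for f
    using k by (auto simp: emit_bits_def wf_simps bit_symbol_def)
  have 4: "wf_prog number_of_tapes 17 emit_literals" "wf_prog number_of_tapes 17 emit_site"
    using k b by (auto simp: emit_literals_def emit_site_def wf_simps)
  have 5: "wf_prog number_of_tapes 17 (emit_ones j)" for j
    using k by (auto simp: emit_ones_def wf_simps)
  show ?thesis
    using 1 2 3 4 5 k by (simp add: reduction_def wf_simps)
qed

theorem poly_time_reduce: "poly_time_computable reduce"
proof (rule poly_time_computableI[OF wf_reduction])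
  fix x
  obtain \<sigma>' where \<sigma>': "runs (poly loop_bound (length x)) reduction (start [x]) \<sigma>'" "\<sigma>' 0 = E (bits (reduce x))"
    using runs_reduction by blast
  have "fst (\<sigma>' 0) (int i) = bit_symbol (reduce x ! i)" if "i < length (reduce x)" for i
    using that \<sigma>'(2) by (simp add: W_def bits_def)
  moreover have "fst (\<sigma>' 0) (int (length (reduce x))) = 0"
    using \<sigma>'(2) by (simp add: W_def bits_def)
  moreover have "tapes_of number_of_tapes \<sigma>' ! 0 = \<sigma>' 0"
    by (subst nth_map) (simp_all add: number_of_tapes_def del: upt_Suc)
  ultimately show "\<exists>\<sigma>'. runs (poly loop_bound (length x)) reduction (start [x]) \<sigma>' \<and>
      outputs (tapes_of number_of_tapes \<sigma>') (reduce x)"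
    using \<sigma>'(1) by (intro exI[of _ \<sigma>']) (simp add: outputs_def)
qed (simp_all add: number_of_tapes_def)

end

section \<open>Tilings from the computations of a verifier\<close>

text \<open>A row is a configuration of the machine. Every cell of a row knows the state, the symbols that are read, and, for every tape, its content and
  the sign of its position relative to the head. The first flag marks the first row, the second one the cell 0.\<close>

datatype colour = Wall | Final | Cell bool bool nat "nat list" "(nat \<times> int) list"

text \<open>In the halting state the configuration is repeated, so computations of different lengths
  fill the same number of rows.\<close>

definition next_action :: "tm \<Rightarrow> nat \<Rightarrow> nat list \<Rightarrow> nat \<times> (nat \<times> move) list" where
  "next_action M q rs = (if q = states M then (q, stay rs) else delta M q rs)"

lemma step_next_action:
  "step M (q, ts) = (case next_action M q (map read ts) of (q', acts) \<Rightarrow> (q', map2 act acts ts))"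
  by (simp add: next_action_def map2_act_stay)

text \<open>Positions relative to a head are unbounded, but a finite set of colours can store their
  signs. Local compatibility of signs is enough, since a single sign 0 in a row fixes all
  others.\<close>

definition consecutive :: "int \<Rightarrow> int \<Rightarrow> bool" where
  "consecutive s s' \<longleftrightarrow> (\<exists>y :: int. s = sgn y \<and> s' = sgn (y + 1))"

definition moved :: "int \<Rightarrow> move \<Rightarrow> int \<Rightarrow> bool" where
  "moved s d s' \<longleftrightarrow> (\<exists>y. s = sgn y \<and> s' = sgn (y - offset d))"

text \<open>The symbols \<open>rs\<close> are a guess of what the heads read. The last condition
  checks the guess at the cell under the head, and \<open>horizontal\<close> spreads the same guess
  over the row.\<close>

definition colours :: "tm \<Rightarrow> colour set" where
  "colours M = {Wall, Final} \<union> {Cell b g q rs es | b g q rs es. q \<le> states M \<and>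
     length rs = tapes M \<and> set rs \<subseteq> {..<symbols M} \<and>
     length es = tapes M \<and> set es \<subseteq> {..<symbols M} \<times> {- 1, 0, 1} \<and>
     (\<forall>t < tapes M. snd (es ! t) = 0 \<longrightarrow> fst (es ! t) = rs ! t)}"

text \<open>The last condition makes blanks on tape 1 of the first row propagate to the right, so
  that the guessed certificate has no gaps. The step into cell 0, marked by \<open>g'\<close>, is
  exempt because the cells to its left are blank.\<close>

fun horizontal :: "tm \<Rightarrow> colour \<Rightarrow> colour \<Rightarrow> bool" where
  "horizontal M (Cell b g q rs es) (Cell b' g' q' rs' es') \<longleftrightarrow> b = b' \<and> q = q' \<and> rs = rs' \<and>
     (\<forall>t < tapes M. consecutive (snd (es ! t)) (snd (es' ! t))) \<and>
     (b \<and> \<not> g' \<and> fst (es ! 1) = 0 \<longrightarrow> fst (es' ! 1) = 0)"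
| "horizontal M _ _ \<longleftrightarrow> True"

text \<open>The 2 demanded above \<open>Final\<close> is \<open>bit_symbol True\<close>: the
  verifier has accepted. It is demanded only in cell 0, where the output starts.\<close>

fun vertical :: "tm \<Rightarrow> colour \<Rightarrow> colour \<Rightarrow> bool" where
  "vertical M (Cell b g q rs es) (Cell b' g' q' rs' es') \<longleftrightarrow> g = g' \<and>
     q' = fst (next_action M q rs) \<and>
     (\<forall>t < tapes M. fst (es' ! t) = (if snd (es ! t) = 0 then fst (snd (next_action M q rs) ! t) else fst (es ! t)) \<and>
        moved (snd (es ! t)) (snd (snd (next_action M q rs) ! t)) (snd (es' ! t)))"
| "vertical M (Cell b g q rs es) Final \<longleftrightarrow> q = states M \<and> (g \<longrightarrow> fst (es ! 0) = 2)"
| "vertical M _ _ \<longleftrightarrow> True"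

definition initial :: "tm \<Rightarrow> nat \<Rightarrow> nat \<Rightarrow> nat \<Rightarrow> colour set" where
  "initial M h x c = {Cell True (h = 1) 0 rs es | rs es.
     fst (es ! 0) = x \<and> fst (es ! 1) \<in> (if c = 1 then {0, 1, 2} else {0}) \<and>
     (\<forall>t < tapes M. 2 \<le> t \<longrightarrow> fst (es ! t) = 0) \<and> (h = 1 \<longrightarrow> (\<forall>t < tapes M. snd (es ! t) = 0))}"

definition allowed :: "tm \<Rightarrow> nat \<Rightarrow> colour set" where
  "allowed M k =
     (if k = 1 then {Wall} else if k = 2 then {Cell False g q rs es | g q rs es. True}
      else if k = 3 then {Final} else if k = 4 then initial M 0 0 0
      else initial M ((k - 5) div 6) ((k - 5) mod 6 div 2) ((k - 5) mod 2))"

lemma finite_colours: "finite (colours M)"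
proof -
  have "colours M \<subseteq> {Wall, Final} \<union> (\<lambda>(b, g, q, rs, es). Cell b g q rs es) `
      (UNIV \<times> UNIV \<times> {..states M} \<times> {rs. set rs \<subseteq> {..<symbols M} \<and> length rs = tapes M} \<times>
       {es. set es \<subseteq> {..<symbols M} \<times> {- 1, 0, 1} \<and> length es = tapes M})"
    by (auto simp: colours_def image_iff)
  moreover have "finite \<dots>"
    by (intro finite_UnI finite_imageI finite_cartesian_product finite_lists_length_eq) auto
  ultimately show ?thesis
    by (rule finite_subset)
qed

lemma allowed_init_class:
  assumes "h \<le> 1" "x \<le> 2"
  shows "allowed M (init_class h x c) = initial M h x (min c 1)"
proof -
  have "h = 0 \<or> h = 1" "x = 0 \<or> x = 1 \<or> x = 2" "min c 1 = 0 \<or> min c 1 = 1"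
    using assms by linarith+
  then show ?thesis
    by (elim disjE) (simp_all add: allowed_def init_class_def)
qed

definition encodes :: "tm \<Rightarrow> (nat \<Rightarrow> colour) \<Rightarrow> bool" where
  "encodes M col \<longleftrightarrow> bij_betw col {..<card (colours M)} (colours M)"

lemma ex_encodes: "\<exists>col. encodes M col"
  using ex_bij_betw_nat_finite[OF finite_colours] by (simp add: encodes_def atLeast0LessThan)

definition tiling_of :: "tm \<Rightarrow> nat \<Rightarrow> nat list \<Rightarrow> (nat \<Rightarrow> colour) \<Rightarrow> bool" where
  "tiling_of M N cls \<kappa> \<longleftrightarrow> (\<forall>s < length cls. \<kappa> s \<in> colours M \<and> \<kappa> s \<in> allowed M (cls ! s) \<and>
     (if s + 1 < length cls then horizontal M (\<kappa> s) (\<kappa> (s + 1)) else \<forall>k \<in> colours M. horizontal M (\<kappa> s) k) \<and>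
     (if s + N < length cls then vertical M (\<kappa> s) (\<kappa> (s + N)) else \<forall>k \<in> colours M. vertical M (\<kappa> s) k))"

lemma tiles_iff_tiling_of:
  assumes "encodes M col"
  shows "(\<exists>\<chi>. tiling.tiles (card (colours M)) (\<lambda>c. {k. col k \<in> allowed M c})
      (\<lambda>k k'. horizontal M (col k) (col k')) (\<lambda>k k'. vertical M (col k) (col k')) N cls \<chi>) \<longleftrightarrow>
    (\<exists>\<kappa>. tiling_of M N cls \<kappa>)" (is "?L \<longleftrightarrow> ?R")
proof
  have col: "(\<forall>k < card (colours M). P (col k)) \<longleftrightarrow> (\<forall>k \<in> colours M. P k)" for P
    using assms unfolding encodes_def bij_betw_def by (metis imageE imageI lessThan_iff)
  have in_colours: "col k \<in> colours M" if "k < card (colours M)" for k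
    using assms that unfolding encodes_def bij_betw_def by blast
  {
    assume ?L
    then obtain \<chi> where "tiling.tiles (card (colours M)) (\<lambda>c. {k. col k \<in> allowed M c})
      (\<lambda>k k'. horizontal M (col k) (col k')) (\<lambda>k k'. vertical M (col k) (col k')) N cls \<chi>" by blast
    then have "tiling_of M N cls (\<lambda>s. col (\<chi> s))"
      unfolding tiling.tiles_def tiling_of_def
        col[of "\<lambda>k. horizontal M (col (\<chi> s)) k" for s] col[of "\<lambda>k. vertical M (col (\<chi> s)) k" for s]
      using in_colours by (auto cong: if_cong)
    then show ?R by blast
  }
  {
    assume ?R
    then obtain \<kappa> where \<kappa>: "tiling_of M N cls \<kappa>" by blast
    have "\<exists>k. s < length cls \<longrightarrow> k < card (colours M) \<and> col k = \<kappa> s" for s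
      using \<kappa> assms unfolding tiling_of_def encodes_def bij_betw_def by (metis imageE lessThan_iff)
    then obtain \<chi> where \<chi>: "\<And>s. s < length cls \<Longrightarrow> \<chi> s < card (colours M) \<and> col (\<chi> s) = \<kappa> s"
      by metis
    have "tiling.tiles (card (colours M)) (\<lambda>c. {k. col k \<in> allowed M c})
      (\<lambda>k k'. horizontal M (col k) (col k')) (\<lambda>k k'. vertical M (col k) (col k')) N cls \<chi>"
      unfolding tiling.tiles_def
    proof (intro allI impI)
      fix s assume s: "s < length cls"
      show "\<chi> s < card (colours M) \<and> \<chi> s \<in> {k. col k \<in> allowed M (cls ! s)} \<and>
        (if s + 1 < length cls then horizontal M (col (\<chi> s)) (col (\<chi> (s + 1)))
         else \<forall>k<card (colours M). horizontal M (col (\<chi> s)) (col k)) \<and>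
        (if s + N < length cls then vertical M (col (\<chi> s)) (col (\<chi> (s + N)))
         else \<forall>k<card (colours M). vertical M (col (\<chi> s)) (col k))"
        using \<kappa> s \<chi>[OF s] \<chi>[of "s + 1"] \<chi>[of "s + N"] in_colours unfolding tiling_of_def by auto
    qed
    then show ?L by blast
  }
qed

section \<open>The word of classes arranged in rows\<close>

lemma concat_replicate_nth:
  "i < m \<Longrightarrow> j < length xs \<Longrightarrow> concat (replicate m xs) ! (i * length xs + j) = xs ! j"
proof (induction m arbitrary: i)
  case (Suc m)
  then show ?case
    by (cases i) (auto simp: nth_append add.assoc)
qed simp

lemma class_at:
  fixes x :: "bool list" and q T :: nat
  defines "N \<equiv> width (length x) q T + T + 2"
  assumes "j < N" "r < T + 3"
  shows "classes x q T ! (r * N + j) =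
    (if r = T + 2 then 3 else if j = 0 then 1 else if 0 < r then 2 else if j < T + 2 then 4
     else init_class (if j = T + 2 then 1 else 0) (symb (map bit_symbol x) (int (j - (T + 2))))
       (symb (replicate q 1) (int (j - (T + 2)))))"
proof -
  let ?l = "width (length x) q T"
  define R0 where "R0 = 1 # replicate (T + 1) 4 @
     map (\<lambda>i. init_class (if i = 0 then 1 else 0) (symb (map bit_symbol x) (int i)) (symb (replicate q 1) (int i))) [0..<?l]"
  define R1 where "R1 = (1 :: nat) # replicate (N - 1) 2"
  have cls: "classes x q T = R0 @ concat (replicate (T + 1) R1) @ replicate N 3"
    by (simp add: classes_def R0_def R1_def Let_def N_def)
  have l: "length R0 = N" "length R1 = N" "length (concat (replicate (T + 1) R1)) = (T + 1) * N"
    by (auto simp: R0_def R1_def N_def length_concat sum_list_replicate)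
  consider "r = 0" | r' where "r = Suc r'" "r' < T + 1" | "r = T + 2"
    using assms(3) by (cases r) force+
  then show ?thesis
  proof cases
    case 1
    then have "classes x q T ! (r * N + j) = R0 ! j"
      using assms(2) l by (simp add: cls nth_append)
    also have "\<dots> = (if j = 0 then 1 else if j < T + 2 then 4
     else init_class (if j = T + 2 then 1 else 0) (symb (map bit_symbol x) (int (j - (T + 2))))
       (symb (replicate q 1) (int (j - (T + 2)))))"
      using assms(2) by (auto simp: R0_def nth_Cons' nth_append N_def)
    finally show ?thesis using 1 by simp
  next
    case 2
    have "r' * N + j < (T + 1) * N"
    proof -
      have "r' * N + j < (r' + 1) * N" using assms(2) by simp
      also have "\<dots> \<le> (T + 1) * N" using 2 by (intro mult_le_mono1) simp
      finally show ?thesis .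
    qed
    moreover have e: "r * N + j = length R0 + (r' * N + j)"
      using 2 l(1) by simp
    ultimately have "classes x q T ! (r * N + j) = concat (replicate (T + 1) R1) ! (r' * length R1 + j)"
      unfolding cls e nth_append_length_plus by (simp only: nth_append l if_True)
    also have "\<dots> = R1 ! j"
      using 2 l assms(2) by (intro concat_replicate_nth) auto
    finally show ?thesis
      using 2 assms(2) by (auto simp: R1_def nth_Cons')
  next
    case 3
    have e: "r * N + j = N + ((T + 1) * N + j)"
      by (simp add: 3 algebra_simps)
    show ?thesis
      unfolding e cls using 3 l assms(2) by (simp add: nth_append)
  qed
qed

section \<open>Rows of colours and machine configurations\<close>

lemma consecutive_right: "consecutive (sgn (int i)) s \<Longrightarrow> s = 1"
  by (auto simp: consecutive_def sgn_if split: if_splits)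

lemma consecutive_left: "consecutive s (sgn (- int i)) \<Longrightarrow> s = - 1"
  by (auto simp: consecutive_def sgn_if split: if_splits)

text \<open>A 0 can only be followed by 1, and 1 only by 1; towards the left the same holds with
  -1.\<close>

lemma consecutive_signs:
  assumes "\<And>z. a \<le> z \<Longrightarrow> z < b \<Longrightarrow> consecutive (s z) (s (z + 1))" "a \<le> h" "h \<le> b" "s h = 0" "a \<le> z" "z \<le> b"
  shows "s z = sgn (z - h :: int)"
proof -
  have right: "s (h + int i) = sgn (int i)" if "h + int i \<le> b" for i
    using that
  proof (induction i)
    case (Suc i)
    have "consecutive (s (h + int i)) (s (h + int i + 1))"
      using assms(1)[of "h + int i"] assms(2) Suc.prems by simp
    moreover have "s (h + int i) = sgn (int i)"
      using Suc by simp
    ultimately have "s (h + int i + 1) = 1"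
      using consecutive_right by metis
    then show ?case
      by (simp add: ac_simps)
  qed (use assms in simp)
  have left: "s (h - int i) = sgn (- int i)" if "a \<le> h - int i" for i
    using that
  proof (induction i)
    case (Suc i)
    have "consecutive (s (h - int (Suc i))) (s (h - int i))"
      using assms(1)[of "h - int (Suc i)"] assms(3) Suc.prems by simp
    moreover have "s (h - int i) = sgn (- int i)"
      using Suc by simp
    ultimately have "s (h - int (Suc i)) = - 1"
      using consecutive_left by metis
    then show ?case
      by simp
  qed (use assms in simp)
  show ?thesis
    using left[of "nat (h - z)"] right[of "nat (z - h)"] assms by (cases "z \<le> h") auto
qed

definition symbols_ok :: "tm \<Rightarrow> nat \<Rightarrow> tm_config \<Rightarrow> bool" where
  "symbols_ok M r cfg \<longleftrightarrow> fst cfg \<le> states M \<and> length (snd cfg) = tapes M \<and>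
     (\<forall>t < tapes M. (\<forall>z. fst (snd cfg ! t) z < symbols M) \<and> \<bar>snd (snd cfg ! t)\<bar> \<le> int r)"

lemma next_action_wf:
  assumes "wf_tm M" "q \<le> states M" "length rs = tapes M" "set rs \<subseteq> {..<symbols M}" "next_action M q rs = (q', acts)"
  shows "q' \<le> states M \<and> length acts = tapes M \<and> (\<forall>t < tapes M. fst (acts ! t) < symbols M)"
proof (cases "q = states M")
  case True
  then have "q' = q" "acts = stay rs"
    using assms(5) by (auto simp: next_action_def)
  then show ?thesis
    using True assms by (auto simp: stay_def subset_iff)
next
  case False
  then have "delta M q rs = (q', acts)" "q < states M"
    using assms(2,5) by (auto simp: next_action_def)
  then have "q' \<le> states M \<and> length acts = tapes M \<and> (\<forall>(a, d) \<in> set acts. a < symbols M)"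
    using assms(1,3,4) unfolding wf_tm_def by fastforce
  then show ?thesis
    by (metis (no_types, lifting) case_prod_beta nth_mem)
qed

lemma symbols_ok_read:
  assumes "symbols_ok M r cfg"
  shows "set (map read (snd cfg)) \<subseteq> {..<symbols M}"
proof -
  have ts: "length (snd cfg) = tapes M"
    using assms by (simp add: symbols_ok_def)
  have "read (snd cfg ! t) < symbols M" if "t < tapes M" for t
    using assms that by (simp add: symbols_ok_def read_def)
  then show ?thesis
    using ts by (metis (no_types, lifting) in_set_conv_nth length_map lessThan_iff nth_map subsetI)
qed

lemma symbols_ok_step:
  assumes "wf_tm M" "symbols_ok M r cfg"
  shows "symbols_ok M (Suc r) (step M cfg)"
proof -
  obtain q ts where cfg: "cfg = (q, ts)" by fastforce
  obtain q' acts where n: "next_action M q (map read ts) = (q', acts)" by fastforce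
  have ts: "q \<le> states M" "length ts = tapes M" "\<And>t z. t < tapes M \<Longrightarrow> fst (ts ! t) z < symbols M"
    "\<And>t. t < tapes M \<Longrightarrow> \<bar>snd (ts ! t)\<bar> \<le> int r"
    using assms(2) by (auto simp: symbols_ok_def cfg)
  have "set (map read ts) \<subseteq> {..<symbols M}"
    using symbols_ok_read[OF assms(2)] by (simp add: cfg)
  then have w: "q' \<le> states M" "length acts = tapes M" "\<And>t. t < tapes M \<Longrightarrow> fst (acts ! t) < symbols M"
    using next_action_wf[OF assms(1) ts(1) _ _ n] ts(2) by auto
  have "(\<forall>z. fst (act (acts ! t) (ts ! t)) z < symbols M) \<and> \<bar>snd (act (acts ! t) (ts ! t))\<bar> \<le> int (Suc r)"
    if "t < tapes M" for t
  proof -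
    obtain a d where a: "acts ! t = (a, d)" by fastforce
    obtain f h where f: "ts ! t = (f, h)" by fastforce
    have "a < symbols M" "\<And>z. f z < symbols M" "\<bar>h\<bar> \<le> int r"
      using w(3)[OF that] ts(3,4)[OF that] a f by auto
    moreover have "\<bar>offset d\<bar> \<le> 1" by (cases d) auto
    ultimately show ?thesis by (auto simp: a f)
  qed
  then show ?thesis
    using w ts by (simp add: cfg step_next_action n symbols_ok_def del: step.simps)
qed

definition cell_of :: "bool \<Rightarrow> tm_config \<Rightarrow> int \<Rightarrow> colour" where
  "cell_of b cfg z = Cell b (z = 0) (fst cfg) (map read (snd cfg)) (map (\<lambda>tp. (fst tp z, sgn (z - snd tp))) (snd cfg))"

lemma symbols_ok_init:
  assumes "3 \<le> symbols M" "2 \<le> tapes M"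
  shows "symbols_ok M 0 (init_config M [x, c])"
  using assms by (auto simp: symbols_ok_def init_config_def input_tape_def nth_append nth_Cons' bit_symbol_def)

lemma symbols_ok_steps:
  assumes "wf_tm M" "2 \<le> tapes M"
  shows "symbols_ok M r ((step M ^^ r) (init_config M [x, c]))"
  using assms by (induction r) (auto intro: symbols_ok_init symbols_ok_step simp: wf_tm_def simp del: step.simps)

lemma cell_of_colour:
  assumes "symbols_ok M r cfg"
  shows "cell_of b cfg z \<in> colours M"
proof -
  let ?ts = "snd cfg"
  have ts: "fst cfg \<le> states M" "length ?ts = tapes M"
    using assms by (simp_all add: symbols_ok_def)
  have mem: "fst tp y < symbols M" if "tp \<in> set ?ts" for tp y
    using assms that ts(2) unfolding symbols_ok_def by (metis in_set_conv_nth)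
  have sgn: "sgn y \<in> {- 1, 0, 1}" for y :: int
    by (simp add: sgn_if)
  have 1: "set (map read ?ts) \<subseteq> {..<symbols M}"
    using mem by (auto simp: read_def)
  have 2: "set (map (\<lambda>tp. (fst tp z, sgn (z - snd tp))) ?ts) \<subseteq> {..<symbols M} \<times> {- 1, 0, 1}"
  proof
    fix e assume "e \<in> set (map (\<lambda>tp. (fst tp z, sgn (z - snd tp))) ?ts)"
    then obtain tp where "tp \<in> set ?ts" "e = (fst tp z, sgn (z - snd tp))" by auto
    then show "e \<in> {..<symbols M} \<times> {- 1, 0, 1}"
      using mem sgn by simp
  qed
  have 3: "\<forall>t < tapes M. snd (map (\<lambda>tp. (fst tp z, sgn (z - snd tp))) ?ts ! t) = 0 \<longrightarrow>
      fst (map (\<lambda>tp. (fst tp z, sgn (z - snd tp))) ?ts ! t) = map read ?ts ! t"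
    using ts by (simp add: read_def sgn_0_0)
  show ?thesis
    unfolding colours_def cell_of_def
    by (intro UnI2 CollectI exI conjI refl) (use ts 1 2 3 in \<open>simp_all only: length_map\<close>)
qed

lemma cell_of_horizontal:
  assumes "length (snd cfg) = tapes M"
    and "b \<Longrightarrow> z \<noteq> - 1 \<Longrightarrow> fst (snd cfg ! 1) z = 0 \<Longrightarrow> fst (snd cfg ! 1) (z + 1) = 0" "2 \<le> tapes M"
  shows "horizontal M (cell_of b cfg z) (cell_of b cfg (z + 1))"
proof -
  have "consecutive (sgn (z - h)) (sgn (z + 1 - h))" for h :: int
    unfolding consecutive_def by (intro exI[of _ "z - h"]) (simp add: algebra_simps)
  then show ?thesis
    using assms by (auto simp: cell_of_def)
qed

lemma cell_of_vertical:
  assumes "wf_tm M" "symbols_ok M r cfg"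
  shows "vertical M (cell_of b cfg z) (cell_of b' (step M cfg) z)"
proof -
  obtain q ts where cfg: "cfg = (q, ts)" by fastforce
  obtain q' acts where n: "next_action M q (map read ts) = (q', acts)" by fastforce
  have ts: "q \<le> states M" "length ts = tapes M" "\<And>t z. t < tapes M \<Longrightarrow> fst (ts ! t) z < symbols M"
    using assms(2) by (auto simp: symbols_ok_def cfg)
  have "set (map read ts) \<subseteq> {..<symbols M}"
    using symbols_ok_read[OF assms(2)] by (simp add: cfg)
  then have l: "length acts = tapes M"
    using next_action_wf[OF assms(1) ts(1) _ _ n] ts(2) by auto
  have "fst (act (acts ! t) (ts ! t)) z = (if sgn (z - snd (ts ! t)) = 0 then fst (acts ! t) else fst (ts ! t) z) \<and>
      moved (sgn (z - snd (ts ! t))) (snd (acts ! t)) (sgn (z - snd (act (acts ! t) (ts ! t))))" for t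
  proof -
    obtain a d where a: "acts ! t = (a, d)" by fastforce
    obtain f h where f: "ts ! t = (f, h)" by fastforce
    have "moved (sgn (z - h)) d (sgn (z - (h + offset d)))"
      unfolding moved_def by (intro exI[of _ "z - h"]) (simp add: algebra_simps)
    then show ?thesis by (simp add: a f sgn_0_0)
  qed
  then show ?thesis
    using l ts by (simp add: cell_of_def cfg step_next_action n del: step.simps)
qed

text \<open>If every head lies in the window and has sign 0 there, the signs follow from
  \<open>consecutive_signs\<close>, and the guessed symbols are checked at the heads and equal along
  the row. Nothing in the row remains free.\<close>

lemma row_determined:
  assumes col: "\<And>z. a \<le> z \<Longrightarrow> z \<le> b \<Longrightarrow> \<kappa> z \<in> colours M \<and>
      \<kappa> z = Cell i (z = 0) (fst cfg) (rs z) (es z) \<and>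
      (\<forall>t < tapes M. fst (es z ! t) = fst (snd cfg ! t) z)"
    and hor: "\<And>z. a \<le> z \<Longrightarrow> z < b \<Longrightarrow> horizontal M (\<kappa> z) (\<kappa> (z + 1))"
    and head: "\<And>t. t < tapes M \<Longrightarrow> a \<le> snd (snd cfg ! t) \<and> snd (snd cfg ! t) \<le> b \<and>
      snd (es (snd (snd cfg ! t)) ! t) = 0"
    and len: "length (snd cfg) = tapes M" and z: "a \<le> z" "z \<le> b"
  shows "\<kappa> z = cell_of i cfg z"
proof -
  have len': "length (rs z) = tapes M" "length (es z) = tapes M"
    "\<forall>t < tapes M. snd (es z ! t) = 0 \<longrightarrow> fst (es z ! t) = rs z ! t" if "a \<le> z" "z \<le> b" for z
    using col[OF that] by (auto simp: colours_def)
  have adj: "rs z = rs (z + 1) \<and> (\<forall>t < tapes M. consecutive (snd (es z ! t)) (snd (es (z + 1) ! t)))"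
    if "a \<le> z" "z < b" for z
    using hor[OF that] col[of z] col[of "z + 1"] that by auto
  have signs: "snd (es z ! t) = sgn (z - snd (snd cfg ! t))" if "t < tapes M" for t
    using consecutive_signs[of a b "\<lambda>z. snd (es z ! t)" "snd (snd cfg ! t)" z] adj head[OF that] z that by auto
  have rs_eq: "rs (a + int i) = rs a" if "a + int i \<le> b" for i
    using that
  proof (induction i)
    case (Suc i)
    then show ?case using adj[of "a + int i"] by (simp add: ac_simps)
  qed simp
  have rs_all: "rs y = rs a" if "a \<le> y" "y \<le> b" for y
    using rs_eq[of "nat (y - a)"] that by simp
  have "rs z = map read (snd cfg)"
  proof (rule nth_equalityI)
    show "length (rs z) = length (map read (snd cfg))"
      using len' z len by simp
    fix t assume "t < length (rs z)"
    then have t: "t < tapes M" using len' z by simp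
    let ?h = "snd (snd cfg ! t)"
    have "rs ?h ! t = fst (es ?h ! t)"
      using len'(3)[of ?h] head[OF t] t by simp
    then show "rs z ! t = map read (snd cfg) ! t"
      using rs_all[OF z] rs_all[of ?h] head[OF t] col[of ?h] t len by (simp add: read_def)
  qed
  moreover have "es z = map (\<lambda>tp. (fst tp z, sgn (z - snd tp))) (snd cfg)"
    using len' z len col[OF z] signs by (intro nth_equalityI) (auto simp: prod_eq_iff)
  ultimately show ?thesis
    using col[OF z] by (simp add: cell_of_def)
qed

lemma moved_sign:
  assumes "moved (sgn y) d s"
  shows "sgn y = 0 \<Longrightarrow> s = - offset d" "y = 1 \<Longrightarrow> s \<noteq> - 1" "y = - 1 \<Longrightarrow> s \<noteq> 1"
  using assms by (cases d; auto simp: moved_def sgn_if split: if_splits)+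

text \<open>That the new row has a sign 0 at all must be derived. After a move to the left, cell
  \<open>h\<close> gets sign 1 while \<open>h - 1\<close>, which had -1, cannot get 1; adjacency
  with \<open>h\<close> leaves only 0. The strict bounds keep the new head inside the
  window.\<close>

lemma moved_head:
  assumes "\<And>z. a \<le> z \<Longrightarrow> z \<le> b \<Longrightarrow> moved (sgn (z - h)) d (s z)"
    and "\<And>z. a \<le> z \<Longrightarrow> z < b \<Longrightarrow> consecutive (s z) (s (z + 1))"
    and "a < h" "h < b"
  shows "s (h + offset d) = (0 :: int)"
proof (cases d)
  case Left
  have 1: "s h = 1"
    using moved_sign(1)[OF assms(1)[of h]] assms(3,4) Left by simp
  have "moved (sgn (- 1)) d (s (h - 1))"
    using assms(1)[of "h - 1"] assms(3,4) by simp
  then have 2: "s (h - 1) \<noteq> 1"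
    using moved_sign(3) by blast
  have "consecutive (s (h - 1)) (s h)"
    using assms(2)[of "h - 1"] assms(3,4) by simp
  then show ?thesis
    using 1 2 Left by (auto simp: consecutive_def sgn_if split: if_splits)
next
  case Stay
  then show ?thesis
    using moved_sign(1)[OF assms(1)[of h]] assms(3,4) by simp
next
  case Right
  have 1: "s h = - 1"
    using moved_sign(1)[OF assms(1)[of h]] assms(3,4) Right by simp
  have "moved (sgn 1) d (s (h + 1))"
    using assms(1)[of "h + 1"] assms(3,4) by simp
  then have 2: "s (h + 1) \<noteq> - 1"
    using moved_sign(2) by blast
  have "consecutive (s h) (s (h + 1))"
    using assms(2)[of h] assms(3,4) by simp
  then show ?thesis
    using 1 2 Right by (auto simp: consecutive_def sgn_if split: if_splits)
qed

lemma row_bound: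
  assumes "r < R" "j < N"
  shows "r * N + j < N * (R :: nat)"
proof -
  have "r * N + j < (r + 1) * N" using assms by simp
  also have "\<dots> \<le> R * N" using assms by (intro mult_le_mono1) simp
  finally show ?thesis by (simp add: mult.commute)
qed

lemma tiling_of_grid:
  assumes "length cls = N * R"
  shows "tiling_of M N cls \<kappa> \<longleftrightarrow>
    (\<forall>r < R. \<forall>j < N. \<kappa> (r * N + j) \<in> colours M \<and> \<kappa> (r * N + j) \<in> allowed M (cls ! (r * N + j)) \<and>
      (if j + 1 < N then horizontal M (\<kappa> (r * N + j)) (\<kappa> (r * N + (j + 1)))
       else if r + 1 < R then horizontal M (\<kappa> (r * N + j)) (\<kappa> ((r + 1) * N + 0))
       else \<forall>k \<in> colours M. horizontal M (\<kappa> (r * N + j)) k) \<and>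
      (if r + 1 < R then vertical M (\<kappa> (r * N + j)) (\<kappa> ((r + 1) * N + j))
       else \<forall>k \<in> colours M. vertical M (\<kappa> (r * N + j)) k))"
    (is "_ \<longleftrightarrow> (\<forall>r < R. \<forall>j < N. ?P r j)")
proof -
  let ?Q = "\<lambda>s. \<kappa> s \<in> colours M \<and> \<kappa> s \<in> allowed M (cls ! s) \<and>
     (if s + 1 < length cls then horizontal M (\<kappa> s) (\<kappa> (s + 1)) else \<forall>k \<in> colours M. horizontal M (\<kappa> s) k) \<and>
     (if s + N < length cls then vertical M (\<kappa> s) (\<kappa> (s + N)) else \<forall>k \<in> colours M. vertical M (\<kappa> s) k)"
  have eq: "?Q (r * N + j) = ?P r j" if rj: "r < R" "j < N" for r j
  proof -
    have 1: "r * N + 2 * N \<le> length cls" if "r + 1 < R"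
      using that mult_le_mono1[of "r + 2" R N] by (simp only: assms mult.commute[of N R]) (simp add: add_mult_distrib)
    have 2: "length cls = r * N + N" if "\<not> r + 1 < R"
    proof -
      have "R = r + 1" using that rj by simp
      then show ?thesis by (simp add: assms)
    qed
    have iffs: "r * N + j + 1 < length cls \<longleftrightarrow> j + 1 < N \<or> r + 1 < R" "r * N + j + N < length cls \<longleftrightarrow> r + 1 < R"
      using rj 1 2 by (cases "r + 1 < R"; linarith)+
    have right: "j + 1 < N \<Longrightarrow> r * N + j + 1 = r * N + (j + 1)" "\<not> j + 1 < N \<Longrightarrow> r * N + j + 1 = (r + 1) * N + 0"
      and below: "r * N + j + N = (r + 1) * N + j"
      using rj by auto
    show ?thesis
      unfolding iffs unfolding below
      by (cases "j + 1 < N"; cases "r + 1 < R"; simp only: right if_True if_False simp_thms)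
  qed
  have "tiling_of M N cls \<kappa> \<longleftrightarrow> (\<forall>s < N * R. ?Q s)"
    by (simp add: tiling_of_def assms)
  also have "\<dots> \<longleftrightarrow> (\<forall>r < R. \<forall>j < N. ?Q (r * N + j))"
  proof (intro iffI allI impI)
    fix r j assume "\<forall>s < N * R. ?Q s" "r < R" "j < N"
    then show "?Q (r * N + j)" using row_bound by blast
  next
    fix s assume *: "\<forall>r < R. \<forall>j < N. ?Q (r * N + j)" "s < N * R"
    then have "0 < N" by (cases N) auto
    then have "s div N < R" "s mod N < N"
      using *(2) by (simp_all add: less_mult_imp_div_less mult.commute)
    then have "?Q (s div N * N + s mod N)" using *(1) by blast
    then show "?Q s" unfolding div_mult_mod_eq .
  qed
  also have "\<dots> \<longleftrightarrow> (\<forall>r < R. \<forall>j < N. ?P r j)"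
    using eq by blast
  finally show ?thesis .
qed

text \<open>Walls cut the helix into rows: the right neighbour of the last cell of a row is the wall
  of the next one. The \<open>Final\<close> row in turn satisfies the universal conditions at the
  end of the strip.\<close>

lemma horizontal_trivial [simp]:
  "horizontal M Wall k" "horizontal M Final k" "horizontal M k Wall" "horizontal M k Final"
  by (cases k; simp)+

lemma vertical_trivial [simp]: "vertical M Wall k" "vertical M Final k"
  by (cases k; simp)+

lemma init_config_tapes:
  "snd (init_config M [x, c]) = input_tape x # input_tape c # replicate (tapes M - 2) (input_tape [])"
  "fst (init_config M [x, c]) = 0"
  by (simp_all add: init_config_def)

lemma init_config_nth:
  assumes "t < tapes M"
  shows "snd (init_config M [x, c]) ! t = input_tape (if t = 0 then x else if t = 1 then c else [])"
  using assms by (auto simp: init_config_tapes nth_Cons')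

lemma input_tape_symb: "fst (input_tape w) z = symb (map bit_symbol w) z"
  by (simp add: input_tape_W W_def symb_def)

lemma initial_cell:
  assumes "2 \<le> tapes M" "length c \<le> q"
  shows "cell_of True (init_config M [x, c]) z \<in>
    initial M (if z = 0 then 1 else 0) (symb (map bit_symbol x) z) (symb (replicate q 1) z)"
proof -
  have "symb (map bit_symbol c) z \<in> (if symb (replicate q 1) z = 1 then {0, 1, 2} else {0})"
    using assms(2) by (auto simp: symb_def bit_symbol_def)
  moreover have "length (snd (init_config M [x, c])) = tapes M"
    using assms(1) by (simp add: init_config_tapes)
  ultimately show ?thesis
    using assms(1) init_config_nth[of _ M x c]
    by (auto simp: initial_def cell_of_def input_tape_symb symb_outside, simp_all add: symb_def input_tape_def init_config_tapes(2))
qed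

context
  fixes M :: tm and Ver :: "bool list \<Rightarrow> bool list \<Rightarrow> bool" and x :: "bool list" and q T N :: nat and cls :: "nat list"
  assumes wf: "wf_tm M" and two_tapes: "2 \<le> tapes M"
    and computes: "\<And>c. length c \<le> q \<Longrightarrow> \<exists>t \<le> T. computes_within M [x, c] [Ver x c] t"
  defines "N \<equiv> width (length x) q T + T + 2" and "cls \<equiv> classes x q T"
begin

definition cfg :: "bool list \<Rightarrow> nat \<Rightarrow> tm_config" where
  "cfg c r = (step M ^^ r) (init_config M [x, c])"

lemma cfg_ok: "symbols_ok M r (cfg c r)"
  unfolding cfg_def using symbols_ok_steps[OF wf two_tapes] .

lemma cfg_length: "length (snd (cfg c r)) = tapes M"
  using cfg_ok by (simp add: symbols_ok_def)

lemma cfg_last: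
  assumes "length c \<le> q"
  shows "fst (cfg c (T + 1)) = states M" "fst (snd (cfg c (T + 1)) ! 0) 0 = bit_symbol (Ver x c)"
proof -
  obtain t where t: "t \<le> T" "computes_within M [x, c] [Ver x c] t"
    using computes[OF assms] by blast
  obtain ts where ts: "cfg c t = (states M, ts)" "outputs ts [Ver x c]"
    using t(2) by (auto simp: computes_within_def cfg_def split: prod.splits)
  have "(step M ^^ i) (states M, ts) = (states M, ts)" for i
    by (induction i) simp_all
  then have "cfg c (T + 1) = (states M, ts)"
    using funpow_add[of "T + 1 - t" t "step M"] t(1) ts(1) by (simp add: cfg_def)
  then show "fst (cfg c (T + 1)) = states M" "fst (snd (cfg c (T + 1)) ! 0) 0 = bit_symbol (Ver x c)"
    using ts(2) by (auto simp: outputs_def)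
qed

lemma length_cls: "length cls = N * (T + 3)"
  by (simp only: cls_def length_classes N_def)

lemma class_cell:
  assumes "j < N" "r < T + 3"
  shows "allowed M (cls ! (r * N + j)) =
    (if r = T + 2 then {Final} else if j = 0 then {Wall}
     else if 0 < r then {Cell False g q rs es | g q rs es. True}
     else initial M (if j = T + 2 then 1 else 0) (symb (map bit_symbol x) (int j - int (T + 2)))
       (symb (replicate q 1) (int j - int (T + 2))))"
proof -
  have x: "symb (map bit_symbol x) z \<le> 2" for z
    by (auto simp: symb_def bit_symbol_def)
  have q: "min (symb (replicate q 1) z) 1 = symb (replicate q 1) z" for z
    by (auto simp: symb_def)
  have "allowed M 1 = {Wall}" "allowed M 2 = {Cell False g q rs es | g q rs es. True}" "allowed M 3 = {Final}"
    "allowed M 4 = initial M 0 0 0"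
    by (simp_all add: allowed_def)
  note al = this
  have neg: "initial M 0 0 0 = initial M (if j = T + 2 then 1 else 0) (symb (map bit_symbol x) (int j - int (T + 2)))
       (symb (replicate q 1) (int j - int (T + 2)))" if "j < T + 2"
    using that by (simp add: symb_outside)
  have pos: "allowed M (init_class (if j = T + 2 then 1 else 0) (symb (map bit_symbol x) (int (j - (T + 2))))
       (symb (replicate q 1) (int (j - (T + 2))))) = initial M (if j = T + 2 then 1 else 0) (symb (map bit_symbol x) (int j - int (T + 2)))
       (symb (replicate q 1) (int j - int (T + 2)))" if "\<not> j < T + 2"
  proof -
    have "int (j - (T + 2)) = int j - int (T + 2)" using that by simp
    then show ?thesis
      by (simp only:) (subst allowed_init_class, simp_all only: x q, simp)
  qed
  note cl = class_at[where j = j and r = r and x = x and q = q and T = T, folded N_def cls_def, OF assms]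
  show ?thesis
    unfolding cl if_distrib[of "allowed M"] al
    by (intro if_cong refl, cases "j < T + 2") (simp only: if_True neg, simp only: if_False, rule pos)
qed

lemma tiling_complete:
  assumes "length c \<le> q" "Ver x c"
  shows "\<exists>\<kappa>. tiling_of M N cls \<kappa>"
proof -
  define colour where "colour r j = (if r = T + 2 then Final else if j = 0 then Wall
    else cell_of (r = 0) (cfg c r) (int j - int (T + 2)))" for r j
  define \<kappa> where "\<kappa> s = colour (s div N) (s mod N)" for s
  have \<kappa>: "\<kappa> (r * N + j) = colour r j" if "j < N" for r j
    using that by (simp add: \<kappa>_def)
  have 1: "colour r j \<in> colours M" for r j
    using cell_of_colour[OF cfg_ok] by (auto simp: colour_def colours_def[of M])
  have 2: "colour r j \<in> allowed M (cls ! (r * N + j))" if "r < T + 3" "j < N" for r j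
  proof -
    have "cell_of True (cfg c 0) (int j - int (T + 2)) \<in>
        initial M (if j = T + 2 then 1 else 0) (symb (map bit_symbol x) (int j - int (T + 2)))
          (symb (replicate q 1) (int j - int (T + 2)))"
    proof -
      have "int j - int (T + 2) = 0 \<longleftrightarrow> j = T + 2" by auto
      moreover have "cfg c 0 = init_config M [x, c]" by (simp add: cfg_def)
      ultimately show ?thesis
        using initial_cell[OF two_tapes assms(1), of x "int j - int (T + 2)"] by (simp only:)
    qed
    moreover have "cell_of False d z \<in> {Cell False g q rs es | g q rs es. True}" for d z
      by (simp add: cell_of_def)
    ultimately show ?thesis
      unfolding class_cell[OF that(2,1)] colour_def by simp
  qed
  have 3: "horizontal M (colour r j) (colour r (j + 1))" for r j
  proof -
    have "horizontal M (cell_of (r = 0) (cfg c r) z) (cell_of (r = 0) (cfg c r) (z + 1))" for z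
    proof (rule cell_of_horizontal[OF cfg_length _ two_tapes])
      assume "r = 0" "z \<noteq> - 1" "fst (snd (cfg c r) ! 1) z = 0"
      then show "fst (snd (cfg c r) ! 1) (z + 1) = 0"
        using init_config_nth[of 1 M x c] two_tapes
        by (auto simp: cfg_def input_tape_symb symb_def bit_symbol_def split: if_splits)
    qed
    from this[of "int j - int (T + 2)"] show ?thesis
      by (simp add: colour_def algebra_simps)
  qed
  have 4: "horizontal M (colour r j) (colour (r + 1) 0)" for r j
    by (simp add: colour_def)
  have 5: "vertical M (colour r j) (colour (r + 1) j)" for r j
  proof (cases "r + 1 = T + 2")
    case True
    then have "r = T + 1" by simp
    then show ?thesis
      using cfg_last[OF assms(1)] assms(2) two_tapes cfg_length[of c "T + 1"]
      by (simp add: colour_def cell_of_def bit_symbol_def)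
  next
    case False
    have "cfg c (r + 1) = step M (cfg c r)"
      by (simp add: cfg_def)
    then show ?thesis
      using False cell_of_vertical[OF wf cfg_ok] by (simp add: colour_def)
  qed
  have "tiling_of M N cls \<kappa>"
    unfolding tiling_of_grid[OF length_cls]
  proof (intro allI impI)
    fix r j assume rj: "r < T + 3" "j < N"
    have \<kappa>s: "\<kappa> (r * N + j) = colour r j" "j + 1 < N \<Longrightarrow> \<kappa> (r * N + (j + 1)) = colour r (j + 1)"
      "\<kappa> ((r + 1) * N + 0) = colour (r + 1) 0" "\<kappa> ((r + 1) * N + j) = colour (r + 1) j"
      by (rule \<kappa>, use rj in simp)+
    have 6: "\<not> r + 1 < T + 3 \<Longrightarrow> colour r j = Final"
      using rj by (simp add: colour_def)
    show "\<kappa> (r * N + j) \<in> colours M \<and> \<kappa> (r * N + j) \<in> allowed M (cls ! (r * N + j)) \<and>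
      (if j + 1 < N then horizontal M (\<kappa> (r * N + j)) (\<kappa> (r * N + (j + 1)))
       else if r + 1 < T + 3 then horizontal M (\<kappa> (r * N + j)) (\<kappa> ((r + 1) * N + 0))
       else \<forall>k \<in> colours M. horizontal M (\<kappa> (r * N + j)) k) \<and>
      (if r + 1 < T + 3 then vertical M (\<kappa> (r * N + j)) (\<kappa> ((r + 1) * N + j))
       else \<forall>k \<in> colours M. vertical M (\<kappa> (r * N + j)) k)"
      using 1[of r j] 2[OF rj] 3[of r j] 4[of r j] 5[of r j]
      by (cases "j + 1 < N"; cases "r + 1 < T + 3";
          simp only: \<kappa>s if_True if_False 6 horizontal_trivial vertical_trivial simp_thms ball_triv)
  qed
  then show ?thesis by blast
qed

text \<open>The first row contains a certificate \<open>c\<close>; from there each row is forced to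
  be the next configuration of the run on \<open>x\<close> and \<open>c\<close>. Heads have moved at
  most \<open>r\<close> cells by row \<open>r\<close>, so they stay strictly inside the window as
  long as \<open>moved_head\<close> is applied.\<close>

lemma tiling_sound:
  assumes "tiling_of M N cls \<kappa>"
  shows "\<exists>c. length c \<le> q \<and> Ver x c"
proof -
  define a b where "a = - int (T + 1)" and "b = int (width (length x) q T) - 1"
  define \<rho> where "\<rho> r z = \<kappa> (r * N + nat (z + int (T + 2)))" for r z
  have grid: "\<rho> r z \<in> colours M"
    "r + 1 < T + 3 \<Longrightarrow> vertical M (\<rho> r z) (\<rho> (r + 1) z)"
    "z < b \<Longrightarrow> horizontal M (\<rho> r z) (\<rho> r (z + 1))"
    "\<rho> r z \<in> (if r = T + 2 then {Final} else if 0 < r then {Cell False g q rs es | g q rs es. True}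
     else initial M (if z = 0 then 1 else 0) (symb (map bit_symbol x) z) (symb (replicate q 1) z))"
    if z: "a \<le> z" "z \<le> b" and r: "r < T + 3" for r z
  proof -
    define j where "j = nat (z + int (T + 2))"
    have j: "j < N" "j \<noteq> 0" "j = T + 2 \<longleftrightarrow> z = 0" "int j - int (T + 2) = z" "nat (z + 1 + int (T + 2)) = j + 1"
      "z < b \<Longrightarrow> j + 1 < N"
      using z by (auto simp: j_def a_def b_def N_def nat_less_iff)
    note P = assms[unfolded tiling_of_grid[OF length_cls], rule_format, OF r j(1)]
    show "\<rho> r z \<in> colours M"
      "r + 1 < T + 3 \<Longrightarrow> vertical M (\<rho> r z) (\<rho> (r + 1) z)"
      "z < b \<Longrightarrow> horizontal M (\<rho> r z) (\<rho> r (z + 1))"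
      using P j(6) unfolding \<rho>_def j_def[symmetric] j(5) by (simp_all only: if_True)
    show "\<rho> r z \<in> (if r = T + 2 then {Final} else if 0 < r then {Cell False g q rs es | g q rs es. True}
     else initial M (if z = 0 then 1 else 0) (symb (map bit_symbol x) z) (symb (replicate q 1) z))"
      using P j(2) unfolding class_cell[OF j(1) r] j(3,4) \<rho>_def j_def[symmetric] by (simp only: if_False)
  qed
  have ab: "a \<le> - 1" "0 < b" "int q < b" "int T < b" "- int (T + 1) = a"
    by (auto simp: a_def b_def width_def)
  define R0 where "R0 z rs es \<longleftrightarrow> \<rho> 0 z = Cell True (z = 0) 0 rs es \<and>
     fst (es ! 0) = symb (map bit_symbol x) z \<and> fst (es ! 1) \<in> (if 0 \<le> z \<and> z < int q then {0, 1, 2} else {0}) \<and>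
     (\<forall>t < tapes M. 2 \<le> t \<longrightarrow> fst (es ! t) = 0) \<and> (z = 0 \<longrightarrow> (\<forall>t < tapes M. snd (es ! t) = 0))" for z rs es
  have "\<exists>rs es. a \<le> z \<and> z \<le> b \<longrightarrow> R0 z rs es" for z
  proof (cases "a \<le> z \<and> z \<le> b")
    case True
    have "\<rho> 0 z \<in> initial M (if z = 0 then 1 else 0) (symb (map bit_symbol x) z) (symb (replicate q 1) z)"
      using grid(4)[of z 0] True by simp
    then obtain rs es where e: "\<rho> 0 z = Cell True ((if z = 0 then 1 else 0 :: nat) = 1) 0 rs es"
      "fst (es ! 0) = symb (map bit_symbol x) z"
      "fst (es ! 1) \<in> (if symb (replicate q 1) z = 1 then {0, 1, 2} else {0})"
      "\<forall>t < tapes M. 2 \<le> t \<longrightarrow> fst (es ! t) = 0"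
      "(if z = 0 then 1 else 0 :: nat) = 1 \<longrightarrow> (\<forall>t < tapes M. snd (es ! t) = 0)"
      unfolding initial_def by blast
    have q: "symb (replicate q 1) z = 1 \<longleftrightarrow> 0 \<le> z \<and> z < int q"
      by (auto simp: symb_def)
    have z0: "(if z = 0 then 1 else 0 :: nat) = 1 \<longleftrightarrow> z = 0" by simp
    show ?thesis
      using e unfolding R0_def q z0 by blast
  qed blast
  then obtain rs es where "\<And>z. a \<le> z \<Longrightarrow> z \<le> b \<Longrightarrow> R0 z (rs z) (es z)"
    by metis
  have row0: "\<rho> 0 z = Cell True (z = 0) 0 (rs z) (es z) \<and>
     fst (es z ! 0) = symb (map bit_symbol x) z \<and> fst (es z ! 1) \<in> (if 0 \<le> z \<and> z < int q then {0, 1, 2} else {0}) \<and>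
     (\<forall>t < tapes M. 2 \<le> t \<longrightarrow> fst (es z ! t) = 0) \<and> (z = 0 \<longrightarrow> (\<forall>t < tapes M. snd (es z ! t) = 0))" if "a \<le> z" "z \<le> b" for z
    using \<open>\<And>z. a \<le> z \<Longrightarrow> z \<le> b \<Longrightarrow> R0 z (rs z) (es z)\<close>[OF that] unfolding R0_def by blast
  define w where "w z = fst (es z ! 1)" for z
  \<comment> \<open>Position \<open>q\<close> lies behind the cells reserved for the certificate and
    is blank, so a first blank exists and is at most \<open>q\<close>; \<open>horizontal\<close>
    keeps everything to its right blank.\<close>
  define m where "m = (LEAST i. w (int i) = 0)"
  have w0: "w (int q) = 0"
    using row0[of "int q"] ab by (simp add: w_def)
  then have m: "w (int m) = 0" "m \<le> q"
    unfolding m_def by (rule LeastI, rule Least_le)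
  have w_pos: "w (int i) \<in> {1, 2}" if "i < m" for i
  proof -
    have "w (int i) \<noteq> 0" using that not_less_Least unfolding m_def by blast
    moreover have "fst (es (int i) ! 1) \<in> {0, 1, 2}"
      using row0[of "int i"] that m(2) ab by auto
    ultimately show ?thesis by (auto simp: w_def)
  qed
  have w_zero: "w (int m + int i) = 0" if "int m + int i \<le> b" for i
    using that
  proof (induction i)
    case (Suc i)
    have "horizontal M (\<rho> 0 (int m + int i)) (\<rho> 0 (int m + int i + 1))"
      using grid(3)[of "int m + int i" 0] Suc.prems ab by simp
    then have "fst (es (int m + int i) ! 1) = 0 \<longrightarrow> fst (es (int m + int i + 1) ! 1) = 0"
      using row0[of "int m + int i"] row0[of "int m + int i + 1"] Suc.prems ab by simp
    then show ?case
      using Suc by (simp add: w_def ac_simps)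
  qed (use m in simp)
  define c where "c = map (\<lambda>i. w (int i) = 2) [0..<m]"
  have c: "length c \<le> q" "length c = m"
    using m(2) by (simp_all add: c_def)
  have w_c: "w z = symb (map bit_symbol c) z" if "a \<le> z" "z \<le> b" for z
  proof -
    consider "z < 0" | "0 \<le> z" "z < int m" | "int m \<le> z" by linarith
    then show ?thesis
    proof cases
      case 1
      then show ?thesis using row0[OF that] by (simp add: w_def symb_def)
    next
      case 2
      then show ?thesis using w_pos[of "nat z"] by (auto simp: symb_def c_def bit_symbol_def nat_less_iff)
    next
      case 3
      then show ?thesis using w_zero[of "nat (z - int m)"] that by (simp add: symb_def c_def)
    qed
  qed
  have rows: "r < T + 2 \<Longrightarrow> a \<le> z \<Longrightarrow> z \<le> b \<Longrightarrow> \<rho> r z = cell_of (r = 0) (cfg c r) z" for r z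
  proof (induction r arbitrary: z)
    case 0
    have cfg0: "cfg c 0 = init_config M [x, c]" by (simp add: cfg_def)
    have "\<rho> 0 z = cell_of True (cfg c 0) z"
    proof (rule row_determined[of a b])
      fix z assume z: "a \<le> z" "z \<le> b"
      have "fst (es z ! t) = fst (snd (cfg c 0) ! t) z" if t: "t < tapes M" for t
      proof -
        consider "t = 0" | "t = 1" | "2 \<le> t" by linarith
        then show ?thesis
          using row0[OF z] w_c[OF z] t init_config_nth[OF t, of x c]
          by cases (simp_all add: cfg0 input_tape_symb w_def, simp add: symb_def)
      qed
      then show "\<rho> 0 z \<in> colours M \<and> \<rho> 0 z = Cell True (z = 0) (fst (cfg c 0)) (rs z) (es z) \<and>
          (\<forall>t < tapes M. fst (es z ! t) = fst (snd (cfg c 0) ! t) z)"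
        using grid(1)[OF z, of 0] row0[OF z] init_config_tapes(2)[of M x c] by (simp add: cfg0)
    next
      fix z assume "a \<le> z" "z < b"
      then show "horizontal M (\<rho> 0 z) (\<rho> 0 (z + 1))" using grid(3) by simp
    next
      fix t assume t: "t < tapes M"
      have "snd (snd (cfg c 0) ! t) = 0"
        by (simp add: cfg0 init_config_nth[OF t] input_tape_def)
      then show "a \<le> snd (snd (cfg c 0) ! t) \<and> snd (snd (cfg c 0) ! t) \<le> b \<and>
          snd (es (snd (snd (cfg c 0) ! t)) ! t) = 0"
        using row0[of 0] ab t by simp
    qed (use 0 cfg_length in auto)
    then show ?case by simp
  next
    case (Suc r)
    obtain q0 ts where old: "cfg c r = (q0, ts)" by fastforce
    obtain q' acts where n: "next_action M q0 (map read ts) = (q', acts)" by fastforce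
    have new: "cfg c (Suc r) = (q', map2 act acts ts)"
      using step_next_action[of M q0 ts] old n by (simp add: cfg_def del: step.simps)
    have ts: "length ts = tapes M" "q0 \<le> states M" "\<And>t. t < tapes M \<Longrightarrow> \<bar>snd (ts ! t)\<bar> \<le> int r"
      using cfg_ok[of r c] by (auto simp: symbols_ok_def old)
    have acts: "length acts = tapes M"
      using symbols_ok_read[OF cfg_ok[of r c]] next_action_wf[OF wf ts(2) _ _ n] ts(1) by (simp add: old)
    have tape: "map2 act acts ts ! t = act (acts ! t) (ts ! t)" if "t < tapes M" for t
      using that ts acts by simp
    define R1 where "R1 z rs es \<longleftrightarrow> \<rho> (Suc r) z = Cell False (z = 0) q' rs es \<and>
        (\<forall>t < tapes M. fst (es ! t) = fst (act (acts ! t) (ts ! t)) z \<and>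
           moved (sgn (z - snd (ts ! t))) (snd (acts ! t)) (snd (es ! t)))" for z rs es
    have "\<exists>rs es. a \<le> z \<and> z \<le> b \<longrightarrow> R1 z rs es" for z
    proof (cases "a \<le> z \<and> z \<le> b")
      case True
      have IH: "\<rho> r z = cell_of (r = 0) (cfg c r) z"
        using Suc True by simp
      obtain g qq rs es where cell: "\<rho> (Suc r) z = Cell False g qq rs es"
        using grid(4)[of z "Suc r"] True Suc.prems(1) by auto
      have "vertical M (\<rho> r z) (\<rho> (Suc r) z)"
        using grid(2)[of z r] True Suc.prems(1) by simp
      then have "g = (z = 0)" "qq = q'" and v: "\<And>t. t < tapes M \<Longrightarrow>
          fst (es ! t) = (if z = snd (ts ! t) then fst (acts ! t) else fst (ts ! t) z) \<and>
          moved (sgn (z - snd (ts ! t))) (snd (acts ! t)) (snd (es ! t))"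
        using ts by (auto simp: IH cell cell_of_def old n sgn_0_0)
      moreover have "fst (act (acts ! t) (ts ! t)) z = (if z = snd (ts ! t) then fst (acts ! t) else fst (ts ! t) z)" for t
        by (cases "acts ! t"; cases "ts ! t") simp
      ultimately show ?thesis
        using cell unfolding R1_def by (intro exI[of _ rs] exI[of _ es]) simp
    qed blast
    then obtain rs es where "\<And>z. a \<le> z \<Longrightarrow> z \<le> b \<Longrightarrow> R1 z (rs z) (es z)"
      by metis
    have row: "\<rho> (Suc r) z = Cell False (z = 0) q' (rs z) (es z) \<and>
        (\<forall>t < tapes M. fst (es z ! t) = fst (act (acts ! t) (ts ! t)) z \<and>
           moved (sgn (z - snd (ts ! t))) (snd (acts ! t)) (snd (es z ! t)))" if "a \<le> z" "z \<le> b" for z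
      using \<open>\<And>z. a \<le> z \<Longrightarrow> z \<le> b \<Longrightarrow> R1 z (rs z) (es z)\<close>[OF that] unfolding R1_def by blast
    have hor: "horizontal M (\<rho> (Suc r) z) (\<rho> (Suc r) (z + 1))" if "a \<le> z" "z < b" for z
      using grid(3)[of z "Suc r"] that Suc.prems(1) by simp
    have "\<rho> (Suc r) z = cell_of False (cfg c (Suc r)) z"
    proof (rule row_determined[of a b])
      fix z assume z: "a \<le> z" "z \<le> b"
      show "\<rho> (Suc r) z \<in> colours M \<and> \<rho> (Suc r) z = Cell False (z = 0) (fst (cfg c (Suc r))) (rs z) (es z) \<and>
          (\<forall>t < tapes M. fst (es z ! t) = fst (snd (cfg c (Suc r)) ! t) z)"
        using grid(1)[OF z, of "Suc r"] row[OF z] Suc.prems(1) tape by (simp add: new)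
    next
      fix t assume t: "t < tapes M"
      let ?h = "snd (ts ! t)"
      have h: "a < ?h" "?h < b"
        using ts(3)[OF t] Suc.prems(1) ab by (auto simp: a_def)
      have "snd (es (?h + offset (snd (acts ! t))) ! t) = 0"
      proof (rule moved_head[of a b])
        fix z assume "a \<le> z" "z < b"
        then show "consecutive (snd (es z ! t)) (snd (es (z + 1) ! t))"
          using hor[of z] row[of z] row[of "z + 1"] t by simp
      qed (use row t h in auto)
      moreover have "snd (map2 act acts ts ! t) = ?h + offset (snd (acts ! t))"
        unfolding tape[OF t] by (cases "acts ! t"; cases "ts ! t") simp
      moreover have "\<bar>offset (snd (acts ! t))\<bar> \<le> 1"
        by (cases "snd (acts ! t)") auto
      ultimately show "a \<le> snd (snd (cfg c (Suc r)) ! t) \<and> snd (snd (cfg c (Suc r)) ! t) \<le> b \<and>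
          snd (es (snd (snd (cfg c (Suc r)) ! t)) ! t) = 0"
        using h unfolding new snd_conv by auto
    qed (use Suc.prems hor cfg_length in auto)
    then show ?case by simp
  qed
  have "\<rho> (T + 2) 0 = Final"
    using grid(4)[of 0 "T + 2"] ab by simp
  moreover have "\<rho> (T + 1) 0 = cell_of False (cfg c (T + 1)) 0"
    using rows[of "T + 1" 0] ab by simp
  moreover have "vertical M (\<rho> (T + 1) 0) (\<rho> (T + 2) 0)"
    using grid(2)[of 0 "T + 1"] ab by simp
  ultimately have "fst (snd (cfg c (T + 1)) ! 0) 0 = 2"
    using two_tapes cfg_length[of c "T + 1"] by (simp add: cell_of_def)
  then have "Ver x c"
    using cfg_last(2)[OF c(1)] by (simp add: bit_symbol_def split: if_splits)
  then show ?thesis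
    using c(1) by blast
qed

theorem tiling_iff_accepts: "(\<exists>\<kappa>. tiling_of M N cls \<kappa>) \<longleftrightarrow> (\<exists>c. length c \<le> q \<and> Ver x c)"
  using tiling_sound tiling_complete by blast

end

section \<open>Hardness\<close>

lemma unary_append_eq: "unary a @ xs = unary b @ ys \<longleftrightarrow> a = b \<and> xs = ys"
proof (induction a arbitrary: b)
  case 0
  then show ?case by (cases b) (auto simp: unary_def)
next
  case (Suc a)
  then show ?case by (cases b) (auto simp: unary_def)
qed

lemma encode_instance_eq:
  assumes "encode_instance n x u = encode_instance n' x' u'"
  shows "n' = n \<and> u' = u \<and> (\<forall>v \<in> torus n. x' v = x v)"
proof -
  obtain i j i' j' where u: "u = (i, j)" "u' = (i', j')" by (metis surj_pair)
  let ?g = "\<lambda>n x. map (\<lambda>r. map (\<lambda>c. x (r, c)) [0..<n]) [0..<n]"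
  have n: "n' = n" and rest: "concat (?g n x) @ unary i @ unary j = concat (?g n' x') @ unary i' @ unary j'"
    using assms by (auto simp: u unary_append_eq)
  have "length (concat (?g n x)) = length (concat (?g n x'))"
    by (simp add: length_concat o_def)
  then have *: "concat (?g n x) = concat (?g n x') \<and> unary i @ unary j = unary i' @ unary j'"
    using rest unfolding n by (intro append_eq_append_conv[THEN iffD1]) auto
  then have ij: "i = i'" "unary j @ [] = unary j' @ []"
    using unary_append_eq[of i "unary j" i' "unary j'"] by (auto simp: unary_append_eq)
  have "?g n x = ?g n x'"
    using * by (intro concat_injective) (auto simp: zip_map_map set_zip)
  then have "x (r, c) = x' (r, c)" if "r < n" "c < n" for r c
    using that by (simp add: map_eq_conv)
  then show ?thesis
    using n ij u unfolding unary_append_eq torus_def by auto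
qed

lemma neighbors_torus: "u \<in> torus n \<Longrightarrow> neighbors n u \<subseteq> torus n"
  by (cases u) (auto simp: torus_def)

lemma S22_cong:
  assumes "\<forall>v \<in> torus n. x' v = x v" "v \<in> torus n"
  shows "S22 n x' v = S22 n x v"
proof -
  have "{w \<in> neighbors n v. x' w} = {w \<in> neighbors n v. x w}"
    using assms neighbors_torus by blast
  then show ?thesis
    using assms by (simp add: S22_def)
qed

lemma async_unstable_cong:
  assumes "\<forall>v \<in> torus n. x' v = x v" "u \<in> torus n" "async_unstable S22 n x u"
  shows "async_unstable S22 n x' u"
proof -
  obtain \<sigma> T where \<sigma>: "sequential_update_scheme n \<sigma>" "T > 0" "async_orbit (S22 n) \<sigma> x T u \<noteq> x u"
    using assms(3) unfolding async_unstable_def by blast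
  have "\<forall>v \<in> torus n. async_orbit (S22 n) \<sigma> x' t v = async_orbit (S22 n) \<sigma> x t v" for t
  proof (induction t)
    case (Suc t)
    have "S22 n (async_orbit (S22 n) \<sigma> x' t) v = S22 n (async_orbit (S22 n) \<sigma> x t) v" if "v \<in> torus n" for v
      using Suc that by (rule S22_cong)
    then show ?case
      using Suc \<sigma>(1) by (simp add: sequential_update_scheme_def)
  qed (use assms in simp)
  then show ?thesis
    unfolding async_unstable_def using \<sigma> assms by metis
qed

lemma encode_in_AsyncUnstability:
  assumes "u \<in> torus n"
  shows "encode_instance n x u \<in> AsyncUnstability S22 \<longleftrightarrow> async_unstable S22 n x u"
proof
  assume "encode_instance n x u \<in> AsyncUnstability S22"
  then obtain n' x' u' where e: "encode_instance n x u = encode_instance n' x' u'"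
    and "u' \<in> torus n'" "async_unstable S22 n' x' u'"
    unfolding AsyncUnstability_def by auto
  then show "async_unstable S22 n x u"
    using encode_instance_eq[OF e] async_unstable_cong[of n x x' u] by simp
qed (use assms in \<open>unfold AsyncUnstability_def, blast\<close>)

text \<open>Polynomials over the naturals are monotone, so the value \<open>T\<close> for the
  longest certificate bounds the running time for all of them, and one height of the tiling serves
  all certificates.\<close>

theorem AsyncUnstability_hard:
  assumes "L \<in> NP"
  shows "poly_time_reducible L (AsyncUnstability S22)"
proof -
  obtain Ver and q :: "nat poly" where Ver: "poly_time_decidable2 Ver"
    "\<And>x. x \<in> L \<longleftrightarrow> (\<exists>c. length c \<le> poly q (length x) \<and> Ver x c)"
    using assms unfolding NP_def by blast
  obtain M and p :: "nat poly" where M: "wf_tm M"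
    "\<And>x c. computes_within M [x, c] [Ver x c] (poly p (length x + length c))"
    using Ver(1) unfolding poly_time_decidable2_def by blast
  have two: "2 \<le> tapes M"
    using M(2)[of "[]" "[]"] by (simp add: computes_within_def)
  obtain col where col: "encodes M col"
    using ex_encodes by blast
  interpret tiling_reduction "card (colours M)" "\<lambda>c. {k. col k \<in> allowed M c}"
    "\<lambda>k k'. horizontal M (col k) (col k')" "\<lambda>k k'. vertical M (col k) (col k')" p q .
  have "x \<in> L \<longleftrightarrow> reduce x \<in> AsyncUnstability S22" for x
  proof -
    define qv where "qv = poly q (length x)"
    define T where "T = poly p (length x + qv)"
    define N where "N = width (length x) qv T + T + 2"
    define cls where "cls = classes x qv T"
    have "computes_within M [x, c] [Ver x c] (poly p (length x + length c)) \<and> poly p (length x + length c) \<le> T"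
      if "length c \<le> qv" for c
      using M(2) that unfolding T_def by (auto intro: poly_mono_nat)
    then have "x \<in> L \<longleftrightarrow> (\<exists>\<kappa>. tiling_of M N cls \<kappa>)"
      unfolding N_def cls_def Ver(2) qv_def[symmetric]
      by (subst tiling_iff_accepts[OF M(1) two, where Ver = Ver]) blast+
    also have "\<dots> \<longleftrightarrow> (\<exists>\<chi>. tiles N cls \<chi>)"
      by (rule tiles_iff_tiling_of[OF col, symmetric])
    also have "\<dots> \<longleftrightarrow> async_unstable S22 (D * (length cls + 1)) (board_pattern N cls)
        (D * (length cls + 1) - 1, D * length cls + 89)"
      by (rule tiles_iff_unstable) (simp_all add: N_def cls_def classes_def Let_def)
    also have "\<dots> \<longleftrightarrow> instance_word N cls \<in> AsyncUnstability S22"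
    proof -
      have "89 < D" using Q_pos by (simp add: D_def)
      then have "(D * (length cls + 1) - 1, D * length cls + 89) \<in> torus (D * (length cls + 1))"
        by (simp add: torus_def)
      then show ?thesis
        unfolding instance_word_def by (rule encode_in_AsyncUnstability[symmetric])
    qed
    also have "instance_word N cls = reduce x"
      by (simp add: reduce_def Let_def N_def cls_def T_def qv_def)
    finally show ?thesis .
  qed
  then show ?thesis
    unfolding poly_time_reducible_def using poly_time_reduce by blast
qed

section \<open>Membership in NP\<close>

subsection \<open>Certificates\<close>

definition cell :: "nat \<Rightarrow> nat \<Rightarrow> cell" where
  "cell n p = (p div n, p mod n)"

text \<open>A certificate drives a pointer over the cells, which are numbered row by row: \<open>True\<close> updates the
  current cell, \<open>False\<close> moves on to the next one.\<close>

fun sim_step :: "nat \<Rightarrow> bool \<Rightarrow> configuration \<times> nat \<Rightarrow> configuration \<times> nat" where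
  "sim_step n b (y, p) = (if b then (y(cell n p := S22 n y (cell n p)), p) else (y, (p + 1) mod n\<^sup>2))"

definition simulate :: "nat \<Rightarrow> bool list \<Rightarrow> configuration \<times> nat \<Rightarrow> configuration \<times> nat" where
  "simulate n c s = fold (sim_step n) c s"

lemma cell_torus: "p < n\<^sup>2 \<Longrightarrow> cell n p \<in> torus n"
  by (cases "n = 0") (auto simp: cell_def torus_def power2_eq_square less_mult_imp_div_less)

lemma cell_number: "j < n \<Longrightarrow> cell n (i * n + j) = (i, j)"
  by (simp add: cell_def)

lemma number_less: "i < n \<Longrightarrow> j < n \<Longrightarrow> i * n + j < (n :: nat)\<^sup>2"
  using row_bound[of i n j n] by (simp add: power2_eq_square)

lemma simulate_reach:
  assumes "reach n x (fst s)" "snd s < n\<^sup>2"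
  shows "reach n x (fst (simulate n c s)) \<and> snd (simulate n c s) < n\<^sup>2"
  using assms
proof (induction c arbitrary: s)
  case (Cons b c)
  obtain y p where s: "s = (y, p)" by fastforce
  have "reach n x (y(cell n p := S22 n y (cell n p)))"
  proof (cases "y (cell n p)")
    case True
    then have "y(cell n p := S22 n y (cell n p)) = y"
      by (simp add: S22_def fun_upd_idem)
    then show ?thesis using Cons.prems s by simp
  next
    case y: False
    show ?thesis
    proof (cases "card {v \<in> neighbors n (cell n p). y v} = 2")
      case True
      then show ?thesis
        using Cons.prems s y reach_step[of n x y "cell n p"] cell_torus[of p n] by (simp add: S22_def)
    next
      case False
      then have "y(cell n p := S22 n y (cell n p)) = y"
        using y by (simp add: S22_def fun_upd_idem)
      then show ?thesis using Cons.prems s by simp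
    qed
  qed
  moreover have "(p + 1) mod n\<^sup>2 < n\<^sup>2"
    using Cons.prems by (cases "n\<^sup>2 = 0") (auto simp: s)
  ultimately have "reach n x (fst (sim_step n b s)) \<and> snd (sim_step n b s) < n\<^sup>2"
    using Cons.prems by (simp add: s)
  then show ?case
    using Cons.IH by (simp add: simulate_def)
qed (simp add: simulate_def)

lemma simulate_append: "simulate n (c @ d) s = simulate n d (simulate n c s)"
  by (simp add: simulate_def)

lemma simulate_moves: "p < n\<^sup>2 \<Longrightarrow> simulate n (replicate d False) (y, p) = (y, (p + d) mod n\<^sup>2)"
proof (induction d arbitrary: p)
  case (Suc d)
  have "(p + 1) mod n\<^sup>2 < n\<^sup>2"
    using Suc.prems by (cases "n\<^sup>2 = 0") auto
  then show ?case
    using Suc.IH[of "(p + 1) mod n\<^sup>2"] by (simp add: simulate_def mod_simps)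
qed (simp add: simulate_def)

text \<open>At most \<open>n\<^sup>2\<close> cells are activated, each once, and each costs fewer
  than \<open>n\<^sup>2\<close> moves of the pointer plus one update.\<close>

lemma simulate_complete:
  assumes "reach n x y" "y u" "p < n\<^sup>2"
  shows "\<exists>c. length c \<le> n\<^sup>2 * n\<^sup>2 \<and> fst (simulate n c (x, p)) u"
proof -
  obtain us where us: "distinct us" "set us \<subseteq> torus n" "\<And>u. y u \<longleftrightarrow> x u \<or> u \<in> set us"
    "\<And>u. u \<in> set us \<Longrightarrow> \<not> x u"
    "\<And>k. k < length us \<Longrightarrow> card {v \<in> neighbors n (us ! k). x v \<or> v \<in> set (take k us)} = 2"
    using reach_listE[OF assms(1)] by blast
  have "k \<le> length us \<Longrightarrow> \<exists>c p'. p' < n\<^sup>2 \<and> length c \<le> k * n\<^sup>2 \<and>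
      simulate n c (x, p) = ((\<lambda>u. x u \<or> u \<in> set (take k us)), p')" for k
  proof (induction k)
    case 0
    show ?case using assms(3) by (intro exI[of _ "[]"] exI[of _ p]) (simp add: simulate_def)
  next
    case (Suc k)
    then obtain c p' where c: "p' < n\<^sup>2" "length c \<le> k * n\<^sup>2"
      "simulate n c (x, p) = ((\<lambda>u. x u \<or> u \<in> set (take k us)), p')" by auto
    obtain i j where v: "us ! k = (i, j)" by fastforce
    have ij: "i < n" "j < n"
      using us(2) Suc.prems v nth_mem[of k us] by (auto simp: torus_def)
    define p'' where "p'' = i * n + j"
    have p'': "p'' < n\<^sup>2" "cell n p'' = us ! k"
      using number_less[OF ij] cell_number[OF ij(2)] by (simp_all add: p''_def v)
    define d where "d = (p'' + n\<^sup>2 - p') mod n\<^sup>2"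
    have "(p' + d) mod n\<^sup>2 = (p' + (p'' + n\<^sup>2 - p')) mod n\<^sup>2"
      by (simp add: d_def mod_simps)
    then have "(p' + d) mod n\<^sup>2 = p''"
      using c(1) p''(1) by simp
    then have 1: "simulate n (c @ replicate d False @ [True]) (x, p) = simulate n [True] (\<lambda>u. x u \<or> u \<in> set (take k us), p'')"
      by (simp only: simulate_append c(3) simulate_moves[OF c(1)])
    have "S22 n (\<lambda>u. x u \<or> u \<in> set (take k us)) (us ! k)"
      using us(5)[of k] Suc.prems by (simp add: S22_def)
    then have 2: "simulate n [True] (\<lambda>u. x u \<or> u \<in> set (take k us), p'') =
        ((\<lambda>u. x u \<or> u \<in> set (take k us))(us ! k := True), p'')"
      by (simp add: simulate_def p''(2))
    have 3: "(\<lambda>u. x u \<or> u \<in> set (take k us))(us ! k := True) = (\<lambda>u. x u \<or> u \<in> set (take (Suc k) us))"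
      using Suc.prems by (simp add: take_Suc_conv_app_nth fun_upd_def fun_eq_iff)
    have d: "d + 1 \<le> n\<^sup>2"
      using c(1) mod_less_divisor[of "n\<^sup>2" "p'' + n\<^sup>2 - p'"] unfolding d_def by linarith
    have "simulate n (c @ replicate d False @ [True]) (x, p) = ((\<lambda>u. x u \<or> u \<in> set (take (Suc k) us)), p'')"
      using 1 2 3 by (simp only:)
    moreover have "length (c @ replicate d False @ [True]) \<le> Suc k * n\<^sup>2"
      using c(2) d by simp
    ultimately show ?case using p''(1) by blast
  qed
  from this[of "length us"] obtain c p' where c: "length c \<le> length us * n\<^sup>2" "fst (simulate n c (x, p)) = (\<lambda>u. x u \<or> u \<in> set us)"
    by auto
  have "length us \<le> n\<^sup>2"
    using card_mono[OF finite_torus us(2)] us(1) by (simp add: distinct_card torus_def power2_eq_square)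
  then have "length us * n\<^sup>2 \<le> n\<^sup>2 * n\<^sup>2"
    by (rule mult_le_mono1)
  then show ?thesis
    using c us(3) assms(2) by (intro exI[of _ c]) auto
qed

subsection \<open>Parsing\<close>

definition ones :: "bool list \<Rightarrow> nat" where
  "ones x = length (takeWhile id x)"

definition size_of :: "bool list \<Rightarrow> nat" where "size_of x = ones x"
definition rest1 :: "bool list \<Rightarrow> bool list" where "rest1 x = drop (size_of x + 1) x"
definition rest2 :: "bool list \<Rightarrow> bool list" where "rest2 x = drop ((size_of x)\<^sup>2) (rest1 x)"
definition row_of :: "bool list \<Rightarrow> nat" where "row_of x = ones (rest2 x)"
definition rest3 :: "bool list \<Rightarrow> bool list" where "rest3 x = drop (row_of x + 1) (rest2 x)"
definition column_of :: "bool list \<Rightarrow> nat" where "column_of x = ones (rest3 x)"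
definition rest4 :: "bool list \<Rightarrow> bool list" where "rest4 x = drop (column_of x) (rest3 x)"

definition configuration_of :: "bool list \<Rightarrow> configuration" where
  "configuration_of x = (\<lambda>(r, c). rest1 x ! (r * size_of x + c))"

definition word_of :: "nat \<Rightarrow> configuration \<Rightarrow> bool list" where
  "word_of n y = map (\<lambda>p. y (cell n p)) [0..<n\<^sup>2]"

lemma word_of_rows: "concat (map (\<lambda>r. map (\<lambda>c. y (r, c)) [0..<n]) [0..<n]) = word_of n y"
proof -
  have "[0..<n\<^sup>2] = concat (map (\<lambda>r. map (\<lambda>c. r * n + c) [0..<n]) [0..<n])"
    by (simp add: power2_eq_square tiling.upt_blocks mult.commute)
  then have "word_of n y = concat (map (\<lambda>r. map (\<lambda>c. y (cell n (r * n + c))) [0..<n]) [0..<n])"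
    by (simp add: word_of_def map_concat o_def)
  also have "\<dots> = concat (map (\<lambda>r. map (\<lambda>c. y (r, c)) [0..<n]) [0..<n])"
    by (intro arg_cong[where f = concat] map_cong refl) (simp add: cell_number)
  finally show ?thesis ..
qed

lemma encode_instance_word: "encode_instance n y (i, j) = unary n @ word_of n y @ unary i @ unary j"
  by (simp add: word_of_rows)

lemma ones_unary: "ones (unary n @ x) = n" "drop (n + 1) (unary n @ x) = x"
  by (induction n) (auto simp: ones_def unary_def)

lemma unary_ones: "x = unary (ones x) @ drop (ones x + 1) x" if "drop (ones x) x \<noteq> []"
  using that
proof (induction x)
  case (Cons b x)
  then show ?case by (cases b) (auto simp: ones_def unary_def)
qed simp

lemma parse_encode:
  assumes "x = encode_instance n y (i, j)"
  shows "size_of x = n" "row_of x = i" "column_of x = j" "rest4 x = [False]"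
proof -
  have x: "x = unary n @ word_of n y @ unary i @ unary j"
    using assms by (simp only: encode_instance_word)
  have 1: "size_of x = n" "rest1 x = word_of n y @ unary i @ unary j"
    by (simp_all only: size_of_def rest1_def x ones_unary)
  have 2: "rest2 x = unary i @ unary j @ []"
    by (simp add: rest2_def 1 word_of_def)
  have 3: "row_of x = i" "rest3 x = unary j @ []"
    by (simp_all only: row_of_def rest3_def 2 ones_unary)
  have 4: "column_of x = j"
    by (simp only: column_of_def 3 ones_unary)
  have "rest4 x = drop j (unary j)"
    by (simp add: rest4_def 3 4)
  then show "size_of x = n" "row_of x = i" "column_of x = j" "rest4 x = [False]"
    using 1 3 4 by (simp_all add: unary_def)
qed

text \<open>A nonempty rest at the end shows that no earlier piece ran past the end of the word; by
  \<open>unary_ones\<close> every unary number was then properly terminated. So one test on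
  \<open>rest4\<close> recognises all well-formed words.\<close>

lemma encode_parse:
  assumes "rest4 x = [False]"
  shows "x = encode_instance (size_of x) (configuration_of x) (row_of x, column_of x)"
    and "take ((size_of x)\<^sup>2) (rest1 x) = word_of (size_of x) (configuration_of x)"
proof -
  let ?n = "size_of x"
  have 3: "rest3 x = unary (column_of x)"
  proof -
    have "rest3 x = take (column_of x) (rest3 x) @ [False]"
      using assms by (metis append_take_drop_id rest4_def)
    moreover have "drop (ones (rest3 x)) (rest3 x) \<noteq> []"
      using assms by (simp add: rest4_def column_of_def)
    moreover have "drop (column_of x + 1) (rest3 x) = drop 1 (rest4 x)"
      by (simp add: rest4_def)
    ultimately show ?thesis
      using unary_ones[of "rest3 x"] assms by (simp add: column_of_def)
  qed
  have ne: "unary k \<noteq> []" for k by (simp add: unary_def)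
  have "rest3 x \<noteq> []"
    using 3 ne by simp
  then have "drop (ones (rest2 x)) (rest2 x) \<noteq> []"
    by (simp add: rest3_def row_of_def)
  then have 2: "rest2 x = unary (row_of x) @ unary (column_of x)"
    using unary_ones[of "rest2 x"] 3 by (simp add: rest3_def row_of_def)
  have l: "?n\<^sup>2 < length (rest1 x)"
    using 2 ne by (metis append_is_Nil_conv drop_eq_Nil not_le rest2_def)
  then have "drop (ones x) x \<noteq> []"
    by (auto simp: rest1_def size_of_def)
  then have 1: "x = unary ?n @ rest1 x"
    using unary_ones[of x] by (simp add: rest1_def size_of_def)
  show w: "take (?n\<^sup>2) (rest1 x) = word_of ?n (configuration_of x)"
    using l by (intro nth_equalityI) (auto simp: word_of_def configuration_of_def cell_def)
  have "rest1 x = take (?n\<^sup>2) (rest1 x) @ rest2 x"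
    by (simp add: rest2_def)
  then show "x = encode_instance (size_of x) (configuration_of x) (row_of x, column_of x)"
    unfolding encode_instance_word using 1 2 w by simp
qed

definition verify :: "bool list \<Rightarrow> bool list \<Rightarrow> bool" where
  "verify x c \<longleftrightarrow> rest4 x = [False] \<and> row_of x < size_of x \<and> column_of x < size_of x \<and>
     \<not> configuration_of x (row_of x, column_of x) \<and>
     fst (simulate (size_of x) c (configuration_of x, row_of x * size_of x + column_of x)) (row_of x, column_of x)"

theorem AsyncUnstability_iff_certificate:
  "x \<in> AsyncUnstability S22 \<longleftrightarrow> (\<exists>c. length c \<le> poly ([:0, 1:] ^ 2) (length x) \<and> verify x c)"
proof
  let ?n = "size_of x" and ?y = "configuration_of x" and ?u = "(row_of x, column_of x)"
  let ?p = "row_of x * ?n + column_of x"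
  {
    assume "x \<in> AsyncUnstability S22"
    then obtain n y i j where x: "x = encode_instance n y (i, j)" "(i, j) \<in> torus n" "async_unstable S22 n y (i, j)"
      unfolding AsyncUnstability_def by (auto simp del: encode_instance.simps)
    note parse = parse_encode[OF x(1)]
    have "encode_instance n y (i, j) = encode_instance n ?y (i, j)"
      using encode_parse(1)[OF parse(4)] unfolding parse(1-3) x(1)[symmetric] .
    from encode_instance_eq[OF this] have "async_unstable S22 n ?y (i, j)"
      by (intro async_unstable_cong[OF _ x(2,3)]) (elim conjE)
    then have "\<not> ?y (i, j) \<and> (\<exists>z. reach n ?y z \<and> z (i, j))"
      by (rule async_unstable_iff_reach[OF x(2), THEN iffD1])
    then obtain z where z: "\<not> ?y (i, j)" "reach n ?y z" "z (i, j)"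
      by (elim conjE exE)
    have ij: "i < n" "j < n" using x(2) by (auto simp: torus_def)
    obtain c where c: "length c \<le> n\<^sup>2 * n\<^sup>2" "fst (simulate n c (?y, i * n + j)) (i, j)"
      using simulate_complete[OF z(2,3) number_less[OF ij]] by blast
    have "n\<^sup>2 \<le> length x"
      unfolding x(1) encode_instance_word by (simp add: word_of_def)
    then have "n\<^sup>2 * n\<^sup>2 \<le> length x * length x"
      by (intro mult_le_mono)
    then show "\<exists>c. length c \<le> poly ([:0, 1:] ^ 2) (length x) \<and> verify x c"
      using c ij z(1) parse by (intro exI[of _ c]) (auto simp: verify_def power2_eq_square)
  }
  {
    assume "\<exists>c. length c \<le> poly ([:0, 1:] ^ 2) (length x) \<and> verify x c"
    then obtain c where c: "verify x c" by blast
    then have u: "row_of x < ?n" "column_of x < ?n" "?u \<in> torus ?n"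
      by (auto simp: verify_def torus_def)
    have "reach ?n ?y (fst (simulate ?n c (?y, ?p)))"
      using simulate_reach[of ?n ?y "(?y, ?p)" c] number_less[OF u(1,2)] by (simp add: reach_refl)
    then have "async_unstable S22 ?n ?y ?u"
      using async_unstable_iff_reach[OF u(3)] c by (auto simp: verify_def)
    then show "x \<in> AsyncUnstability S22"
      using encode_parse(1)[of x] encode_in_AsyncUnstability[OF u(3), of ?y] c by (auto simp: verify_def)
  }
qed

subsection \<open>Moving a pointer on the torus\<close>

text \<open>Tape 3 holds the configuration, row by row, and its head is the pointer; the head of tape 11 follows the column of
  the pointer. Tapes 4 and 6 hold \<open>n\<close> and \<open>n\<^sup>2\<close>; tape 7 counts active neighbours.\<close>

definition skip :: prog where "skip = mv 0 Stay"

text \<open>Leaving the row is noticed by a blank on tape 11; then \<open>n\<close> moves in the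
  opposite direction complete the cyclic step. The same program with \<open>d\<close> and
  \<open>d'\<close> exchanged undoes it.\<close>

definition wrap_column :: "move \<Rightarrow> move \<Rightarrow> prog" where
  "wrap_column d d' = mv 3 d ;; mv 11 d ;; If_then (\<lambda>r. r 11 = 0) (For 4 (mv 3 d') ;; For 4 (mv 11 d')) skip"

definition wrap_row :: "move \<Rightarrow> move \<Rightarrow> prog" where
  "wrap_row d d' = For 4 (mv 3 d) ;; If_then (\<lambda>r. r 3 = 0) (For 6 (mv 3 d')) skip"

definition count :: prog where
  "count = If_then (\<lambda>r. r 3 = 2) (mv 7 Right) skip"

definition update_cell :: prog where
  "update_cell =
     (wrap_column Right Left ;; count ;; wrap_column Left Right) ;;
     (wrap_column Left Right ;; count ;; wrap_column Right Left) ;;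
     (wrap_row Right Left ;; count ;; wrap_row Left Right) ;;
     (wrap_row Left Right ;; count ;; wrap_row Right Left) ;;
     If_then (\<lambda>r. r 7 = 2) (Op 3 (\<lambda>_. (2, Stay))) skip ;; rewind 7"

definition next_cell :: prog where
  "next_cell = mv 3 Right ;; mv 11 Right ;; If_then (\<lambda>r. r 11 = 0) (For 4 (mv 11 Left)) skip ;;
     If_then (\<lambda>r. r 3 = 0) (For 6 (mv 3 Left)) skip"

definition follow :: prog where
  "follow = While (\<lambda>r. r 1 \<noteq> 0) (If_then (\<lambda>r. r 1 = 2) update_cell next_cell ;; mv 1 Right)"

text \<open>The counter is compared with 2, or with 4 if \<open>n \<le> 2\<close>, since then every neighbour is met twice.\<close>

definition counter :: "nat \<Rightarrow> nat list" where
  "counter n = (if n \<le> 2 then [1, 1, 1, 1, 2] else [1, 1, 2, 1, 1])"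

lemma runs_skip: "runs L skip \<sigma> \<sigma>"
  unfolding skip_def mv_def by (rule runs_Op) (simp add: rd_def act_stay)

lemma runs_shift:
  assumes "\<sigma> a = W xs 0" "0 \<notin> set xs" "length xs \<le> L" "a \<noteq> b" "\<sigma> b = W ys z"
    and "\<sigma>' = \<sigma>(b := W ys (z + int (length xs) * offset d))"
  shows "runs L (For a (mv b d)) \<sigma> \<sigma>'"
proof (rule runs_For[where xs = xs and f = "\<lambda>i. \<sigma>(b := W ys (z + int i * offset d))"])
  fix i assume "i < length xs"
  show "runs L (mv b d) ((\<sigma>(b := W ys (z + int i * offset d)))(a := W xs (int i)))
      ((\<sigma>(b := W ys (z + int (Suc i) * offset d)))(a := W xs (int i)))"
    using assms(4) by (intro runs_mv[where xs = ys and z = "z + int i * offset d"]) (auto simp: fun_upd_twist algebra_simps)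
qed (use assms in \<open>auto simp: fun_eq_iff\<close>)

lemma neighbors_2: "i = 0 \<or> i = 1 \<Longrightarrow> j = 0 \<or> j = 1 \<Longrightarrow> neighbors 2 (i, j) = {(1 - i, j), (i, 1 - j)}"
  by (elim disjE) auto

lemma card_pair:
  assumes "a \<noteq> b"
  shows "card {v \<in> {a, b}. P v} = of_bool (P a) + of_bool (P b)"
proof -
  have eq: "{v \<in> {a, b}. P v} = (if P a then {a} else {}) \<union> (if P b then {b} else {})" by auto
  show ?thesis
    unfolding eq using assms by simp
qed

text \<open>For \<open>n = 2\<close> each of the two neighbours is counted twice, so two active ones
  give 4. For \<open>n = 1\<close> the program meets only the cell itself, which is inactive, and
  counts 0.\<close>

lemma S22_counter:
  assumes "i < n" "j < n" "\<not> y (i, j)"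
  shows "S22 n y (i, j) \<longleftrightarrow> symb (counter n) (of_bool (y (i, nxt n j)) + of_bool (y (i, prv n j)) +
    of_bool (y (nxt n i, j)) + of_bool (y (prv n i, j))) = 2"
proof (cases "n \<le> 2")
  case True
  then consider "n = 1" "i = 0" "j = 0" | "n = 2" "i = 0 \<or> i = 1" "j = 0 \<or> j = 1"
    using assms by linarith
  then show ?thesis
  proof cases
    case 1
    then show ?thesis
      using assms(3) by (simp add: S22_def symb_def counter_def nxt_def prv_def)
  next
    case 2
    have c: "card {v \<in> neighbors 2 (i, j). y v} = of_bool (y (1 - i, j)) + of_bool (y (i, 1 - j))"
      unfolding neighbors_2[OF 2(2,3)] using 2(2) by (intro card_pair) auto
    have "nxt 2 i = 1 - i" "prv 2 i = 1 - i" "nxt 2 j = 1 - j" "prv 2 j = 1 - j"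
      using 2 by (auto simp: nxt_def prv_def)
    then show ?thesis
      unfolding S22_def 2(1) c using assms(3)
      by (cases "y (1 - i, j)"; cases "y (i, 1 - j)") (simp_all add: symb_def counter_def)
  qed
next
  case False
  then have c: "card {v \<in> neighbors n (i, j). y v} = of_bool (y (nxt n i, j)) + of_bool (y (prv n i, j)) +
      of_bool (y (i, nxt n j)) + of_bool (y (i, prv n j))"
    using card_neighbors[of n i j y] assms by (simp add: nxt_def prv_def)
  show ?thesis
    using False assms(3) unfolding S22_def c
    by (auto simp: symb_def counter_def of_bool_def)
qed

lemma word_of_update:
  assumes "p < n\<^sup>2"
  shows "(bits (word_of n y))[p := 2] = bits (word_of n (y(cell n p := True)))"
proof (rule nth_equalityI)
  fix p' assume "p' < length ((bits (word_of n y))[p := 2])"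
  then have "p' < n\<^sup>2" by (simp add: bits_def word_of_def)
  moreover have "cell n p' = cell n p \<longleftrightarrow> p' = p"
    unfolding cell_def by (metis div_mult_mod_eq prod.inject)
  ultimately show "(bits (word_of n y))[p := 2] ! p' = bits (word_of n (y(cell n p := True))) ! p'"
    by (auto simp: bits_def word_of_def bit_symbol_def nth_list_update)
qed (simp add: bits_def word_of_def)

lemma nonzero_bits: "0 \<notin> set (bits w)"
  by (auto simp: bits_def bit_symbol_def)

definition marks :: "nat \<Rightarrow> nat list" where "marks n = replicate n 1"

lemma symb_zero_iff:
  assumes "0 \<notin> set ws"
  shows "symb ws z = 0 \<longleftrightarrow> \<not> (0 \<le> z \<and> z < int (length ws))"
proof (cases "0 \<le> z \<and> z < int (length ws)")
  case True
  then have "ws ! nat z \<in> set ws" by (intro nth_mem) auto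
  then have "ws ! nat z \<noteq> 0" using assms by metis
  then show ?thesis using True by (simp add: symb_def)
qed (auto simp: symb_def)

lemma marks: "length (marks n) = n" "0 \<notin> set (marks n)"
  by (auto simp: marks_def)

lemma counter: "length (counter n) = 5" "0 \<notin> set (counter n)"
  by (auto simp: counter_def)

lemma symb_word:
  assumes "i < n" "j < n"
  shows "symb (bits (word_of n y)) (int (i * n + j)) = bit_symbol (y (i, j))"
  using number_less[OF assms] cell_number[OF assms(2)] by (simp add: bits_def word_of_def symb_def nat_add_distrib nat_mult_distrib del: of_nat_add of_nat_mult)

definition pointer :: "nat \<Rightarrow> state \<Rightarrow> nat list \<Rightarrow> int \<Rightarrow> int \<Rightarrow> int \<Rightarrow> state" where
  "pointer n \<sigma> ws p j k = \<sigma>(3 := W ws p, 11 := W (marks n) j, 7 := W (counter n) k)"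

context
  fixes L n :: nat and \<sigma> :: state
  assumes \<sigma>: "\<sigma> 4 = U n" "\<sigma> 6 = U (n\<^sup>2)" and L: "n \<le> L" "n\<^sup>2 \<le> L" "5 \<le> L"
begin

abbreviation pos :: "nat list \<Rightarrow> int \<Rightarrow> int \<Rightarrow> int \<Rightarrow> state" where
  "pos \<equiv> pointer n \<sigma>"

lemma pos_simps [simp]:
  "pos ws p j k 3 = W ws p" "pos ws p j k 11 = W (marks n) j" "pos ws p j k 7 = W (counter n) k"
  "pos ws p j k 4 = U n" "pos ws p j k 6 = U (n\<^sup>2)"
  "(pos ws p j k)(3 := W ws' p') = pos ws' p' j k" "(pos ws p j k)(11 := W (marks n) j') = pos ws p j' k"
  "(pos ws p j k)(7 := W (counter n) k') = pos ws p j k'"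
  using \<sigma> by (auto simp: pointer_def fun_eq_iff)

lemma pos_runs:
  "runs L (mv 3 d) (pos ws p j k) (pos ws (p + offset d) j k)"
  "runs L (mv 11 d) (pos ws p j k) (pos ws p (j + offset d) k)"
  "runs L (mv 7 d) (pos ws p j k) (pos ws p j (k + offset d))"
  "runs L (For 4 (mv 3 d)) (pos ws p j k) (pos ws (p + int n * offset d) j k)"
  "runs L (For 4 (mv 11 d)) (pos ws p j k) (pos ws p (j + int n * offset d) k)"
  "runs L (For 6 (mv 3 d)) (pos ws p j k) (pos ws (p + int (n\<^sup>2) * offset d) j k)"
proof -
  show "runs L (mv 3 d) (pos ws p j k) (pos ws (p + offset d) j k)"
    "runs L (mv 11 d) (pos ws p j k) (pos ws p (j + offset d) k)"
    "runs L (mv 7 d) (pos ws p j k) (pos ws p j (k + offset d))"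
    by (rule runs_mv[where xs = ws and z = p] runs_mv[where xs = "marks n" and z = j]
        runs_mv[where xs = "counter n" and z = k], simp_all)+
  show "runs L (For 4 (mv 3 d)) (pos ws p j k) (pos ws (p + int n * offset d) j k)"
    using L by (intro runs_shift[where xs = "replicate n 1" and ys = ws and z = p]) auto
  show "runs L (For 4 (mv 11 d)) (pos ws p j k) (pos ws p (j + int n * offset d) k)"
    using L by (intro runs_shift[where xs = "replicate n 1" and ys = "marks n" and z = j]) auto
  show "runs L (For 6 (mv 3 d)) (pos ws p j k) (pos ws (p + int (n\<^sup>2) * offset d) j k)"
    using L by (intro runs_shift[where xs = "replicate (n\<^sup>2) 1" and ys = ws and z = p]) auto
qed

lemma runs_wrap_column:
  assumes "c = (if 0 \<le> j + offset d \<and> j + offset d < int n then 0 else int n * offset d')"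
  shows "runs L (wrap_column d d') (pos ws p j k) (pos ws (p + offset d + c) (j + offset d + c) k)"
  unfolding wrap_column_def
proof (rule runs_Seq[OF pos_runs(1) runs_Seq[OF pos_runs(2) runs_If]])
  note z = symb_zero_iff[OF marks(2), unfolded marks(1)]
  show "runs L (For 4 (mv 3 d') ;; For 4 (mv 11 d')) (pos ws (p + offset d) (j + offset d) k)
      (pos ws (p + offset d + c) (j + offset d + c) k)" if "rd (pos ws (p + offset d) (j + offset d) k) 11 = 0"
  proof -
    have "\<not> (0 \<le> j + offset d \<and> j + offset d < int n)"
      using that by (simp only: rd_def pos_simps read_W z simp_thms)
    then have "c = int n * offset d'" using assms by (simp only: if_False)
    then show ?thesis using runs_Seq pos_runs by metis
  qed
  show "runs L skip (pos ws (p + offset d) (j + offset d) k)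
      (pos ws (p + offset d + c) (j + offset d + c) k)" if "rd (pos ws (p + offset d) (j + offset d) k) 11 \<noteq> 0"
  proof -
    have "0 \<le> j + offset d \<and> j + offset d < int n"
      using that by (simp only: rd_def pos_simps read_W z simp_thms)
    then have "c = 0" using assms by (simp only: simp_thms if_True)
    then show ?thesis by (simp add: runs_skip)
  qed
qed

lemma runs_wrap_row:
  assumes "length ws = n\<^sup>2" "0 \<notin> set ws"
    and "c = (if 0 \<le> p + int n * offset d \<and> p + int n * offset d < int (n\<^sup>2) then 0 else int (n\<^sup>2) * offset d')"
  shows "runs L (wrap_row d d') (pos ws p j k) (pos ws (p + int n * offset d + c) j k)"
  unfolding wrap_row_def
proof (intro runs_Seq runs_If)
  note z = symb_zero_iff[OF assms(2), unfolded assms(1)]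
  show "runs L (For 6 (mv 3 d')) (pos ws (p + int n * offset d) j k)
      (pos ws (p + int n * offset d + c) j k)" if "rd (pos ws (p + int n * offset d) j k) 3 = 0"
  proof -
    have "\<not> (0 \<le> p + int n * offset d \<and> p + int n * offset d < int (n\<^sup>2))"
      using that by (simp only: rd_def pos_simps read_W z simp_thms)
    then have "c = int (n\<^sup>2) * offset d'" using assms(3) by (simp only: if_False)
    then show ?thesis using pos_runs(6) by metis
  qed
  show "runs L skip (pos ws (p + int n * offset d) j k)
      (pos ws (p + int n * offset d + c) j k)" if "rd (pos ws (p + int n * offset d) j k) 3 \<noteq> 0"
  proof -
    have "0 \<le> p + int n * offset d \<and> p + int n * offset d < int (n\<^sup>2)"
      using that by (simp only: rd_def pos_simps read_W z simp_thms)
    then have "c = 0" using assms(3) by (simp only: simp_thms if_True)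
    then show ?thesis by (simp add: runs_skip)
  qed
qed (rule pos_runs)

abbreviation here :: "configuration \<Rightarrow> nat \<Rightarrow> nat \<Rightarrow> int \<Rightarrow> state" where
  "here y i j k \<equiv> pos (bits (word_of n y)) (int (i * n + j)) (int j) k"

lemma runs_neighbours:
  assumes "i < n" "j < n"
  shows "runs L (wrap_column Right Left) (here y i j k) (here y i (nxt n j) k)"
    "runs L (wrap_column Left Right) (here y i j k) (here y i (prv n j) k)"
    "runs L (wrap_row Right Left) (here y i j k) (here y (nxt n i) j k)"
    "runs L (wrap_row Left Right) (here y i j k) (here y (prv n i) j k)"
proof -
  have w: "length (bits (word_of n y)) = n\<^sup>2" "0 \<notin> set (bits (word_of n y))"
    by (simp_all add: nonzero_bits) (simp add: bits_def word_of_def)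
  let ?c = "if j = n - 1 then - int n else 0"
  have "runs L (wrap_column Right Left) (here y i j k)
      (pos (bits (word_of n y)) (int (i * n + j) + offset Right + ?c) (int j + offset Right + ?c) k)"
    using assms by (intro runs_wrap_column) auto
  moreover have "int (i * n + j) + offset Right + ?c = int (i * n + nxt n j)" "int j + offset Right + ?c = int (nxt n j)"
    using assms by (auto simp: nxt_eq)
  ultimately show "runs L (wrap_column Right Left) (here y i j k) (here y i (nxt n j) k)"
    by (simp only:)
  let ?c = "if j = 0 then int n else 0"
  have "runs L (wrap_column Left Right) (here y i j k)
      (pos (bits (word_of n y)) (int (i * n + j) + offset Left + ?c) (int j + offset Left + ?c) k)"
    using assms by (intro runs_wrap_column) auto
  moreover have "int (i * n + j) + offset Left + ?c = int (i * n + prv n j)" "int j + offset Left + ?c = int (prv n j)"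
    using assms by (auto simp: prv_eq)
  ultimately show "runs L (wrap_column Left Right) (here y i j k) (here y i (prv n j) k)"
    by (simp only:)
  have sq: "int (n\<^sup>2) = int n * int n" by (simp add: power2_eq_square)
  have less: "int i' * int n + int j < int n * int n" if "i' < n" for i'
    using number_less[OF that assms(2)] by (simp add: power2_eq_square flip: of_nat_mult of_nat_add)
  let ?c = "if i = n - 1 then - int (n\<^sup>2) else 0"
  have last: "int i * int n + int n = int n * int n" if "i = n - 1"
    using that assms by (cases n) (auto simp: algebra_simps)
  have next_less: "int i * int n + int j + int n < int n * int n" if "i \<noteq> n - 1"
    using less[of "i + 1"] that assms by (simp add: algebra_simps)
  have "runs L (wrap_row Right Left) (here y i j k)
      (pos (bits (word_of n y)) (int (i * n + j) + int n * offset Right + ?c) (int j) k)"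
    using last next_less by (intro runs_wrap_row w) (auto simp: power2_eq_square)
  moreover have "int (i * n + j) + int n * offset Right + ?c = int (nxt n i * n + j)"
    using assms last by (auto simp: nxt_eq power2_eq_square algebra_simps)
  ultimately show "runs L (wrap_row Right Left) (here y i j k) (here y (nxt n i) j k)"
    by (simp only:)
  let ?c = "if i = 0 then int (n\<^sup>2) else 0"
  have i0: "int n \<le> int i * int n + int j" if "i \<noteq> 0"
    using that by (cases i) (auto simp: algebra_simps)
  have "runs L (wrap_row Left Right) (here y i j k)
      (pos (bits (word_of n y)) (int (i * n + j) + int n * offset Left + ?c) (int j) k)"
    using assms i0 less[of i] by (intro runs_wrap_row w) (auto simp: power2_eq_square)
  moreover have "int (i * n + j) + int n * offset Left + ?c = int (prv n i * n + j)"
    using assms by (cases n; cases i) (auto simp: prv_eq power2_eq_square algebra_simps)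
  ultimately show "runs L (wrap_row Left Right) (here y i j k) (here y (prv n i) j k)"
    by (simp only:)
qed

lemma runs_count:
  assumes "i < n" "j < n"
  shows "runs L count (here y i j k) (here y i j (k + of_bool (y (i, j))))"
  unfolding count_def
proof (rule runs_If)
  have *: "rd (here y i j k) 3 = 2 \<longleftrightarrow> y (i, j)"
    using symb_word[OF assms, of y] by (simp add: rd_def bit_symbol_def)
  show "runs L (mv 7 Right) (here y i j k) (here y i j (k + of_bool (y (i, j))))" if "rd (here y i j k) 3 = 2"
    using that pos_runs(3)[of Right "bits (word_of n y)" "int (i * n + j)" "int j" k] unfolding * by simp
  show "runs L skip (here y i j k) (here y i j (k + of_bool (y (i, j))))" if "rd (here y i j k) 3 \<noteq> 2"
    using that runs_skip unfolding * by simp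
qed

lemma runs_update_cell:
  assumes "i < n" "j < n"
  shows "runs L update_cell (here y i j 0) (here (y((i, j) := S22 n y (i, j))) i j 0)"
proof -
  define k where "k = (of_bool (y (i, nxt n j)) + of_bool (y (i, prv n j)) +
    of_bool (y (nxt n i, j)) + of_bool (y (prv n i, j)) :: nat)"
  have 1: "runs L (wrap_column Right Left ;; count ;; wrap_column Left Right) (here y i j z) (here y i j (z + of_bool (y (i, nxt n j))))" for z
    using runs_neighbours(1)[OF assms] runs_count[OF assms(1) nxt_less[OF assms(2)]]
      runs_neighbours(2)[OF assms(1) nxt_less[OF assms(2)], of y, unfolded prv_nxt[OF assms(2)]] by (meson runs_Seq)
  have 2: "runs L (wrap_column Left Right ;; count ;; wrap_column Right Left) (here y i j z) (here y i j (z + of_bool (y (i, prv n j))))" for z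
    using runs_neighbours(2)[OF assms] runs_count[OF assms(1) prv_less[OF assms(2)]]
      runs_neighbours(1)[OF assms(1) prv_less[OF assms(2)], of y, unfolded nxt_prv[OF assms(2)]] by (meson runs_Seq)
  have 3: "runs L (wrap_row Right Left ;; count ;; wrap_row Left Right) (here y i j z) (here y i j (z + of_bool (y (nxt n i, j))))" for z
    using runs_neighbours(3)[OF assms] runs_count[OF nxt_less[OF assms(1)] assms(2)]
      runs_neighbours(4)[OF nxt_less[OF assms(1)] assms(2), of y, unfolded prv_nxt[OF assms(1)]] by (meson runs_Seq)
  have 4: "runs L (wrap_row Left Right ;; count ;; wrap_row Right Left) (here y i j z) (here y i j (z + of_bool (y (prv n i, j))))" for z
    using runs_neighbours(4)[OF assms] runs_count[OF prv_less[OF assms(1)] assms(2)]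
      runs_neighbours(3)[OF prv_less[OF assms(1)] assms(2), of y, unfolded nxt_prv[OF assms(1)]] by (meson runs_Seq)
  let ?y = "y((i, j) := S22 n y (i, j))"
  have c: "cell n (i * n + j) = (i, j)" "i * n + j < n\<^sup>2"
    using cell_number[OF assms(2)] number_less[OF assms] by auto
  have 5: "runs L (If_then (\<lambda>r. r 7 = 2) (Op 3 (\<lambda>_. (2, Stay))) skip) (here y i j (int k)) (here ?y i j (int k))"
  proof (rule runs_If)
    have *: "rd (here y i j (int k)) 7 = symb (counter n) (int k)" by (simp add: rd_def)
    have S: "S22 n y (i, j) \<longleftrightarrow> y (i, j) \<or> symb (counter n) (int k) = 2"
      using S22_counter[OF assms, of y] by (cases "y (i, j)") (simp_all add: k_def, simp add: S22_def)
    show "runs L (Op 3 (\<lambda>_. (2, Stay))) (here y i j (int k)) (here ?y i j (int k))" if "rd (here y i j (int k)) 7 = 2"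
    proof (rule runs_Op)
      have "?y = y((i, j) := True)" using S that * by simp
      then have "act (2, Stay) (W (bits (word_of n y)) (int (i * n + j))) = W (bits (word_of n ?y)) (int (i * n + j))"
        using c(2) word_of_update[OF c(2), of y] act_W_update[of "i * n + j" "bits (word_of n y)" 2 Stay]
        unfolding c(1) by (simp add: bits_def word_of_def)
      then show "here ?y i j (int k) = (here y i j (int k))(3 := act (2, Stay) (here y i j (int k) 3))"
        by simp
    qed
    show "runs L skip (here y i j (int k)) (here ?y i j (int k))" if "rd (here y i j (int k)) 7 \<noteq> 2"
    proof -
      have "?y = y" using S that * by (simp add: fun_upd_idem)
      then show ?thesis by (simp add: runs_skip)
    qed
  qed
  have 6: "runs L (rewind 7) (here ?y i j (int k)) (here ?y i j 0)"
  proof (rule runs_rewind[where xs = "counter n" and z = k])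
    show "k \<le> length (counter n)" by (simp add: counter k_def of_bool_def)
  qed (use L(3) in \<open>simp_all add: counter\<close>)
  have k: "0 + of_bool (y (i, nxt n j)) + of_bool (y (i, prv n j)) + of_bool (y (nxt n i, j)) + of_bool (y (prv n i, j)) = int k"
    by (simp add: k_def)
  show ?thesis
    unfolding update_cell_def
    by (rule runs_Seq[OF 1 runs_Seq[OF 2 runs_Seq[OF 3 runs_Seq[OF 4[of "0 + of_bool (y (i, nxt n j)) + of_bool (y (i, prv n j)) + of_bool (y (nxt n i, j))", unfolded k] runs_Seq[OF 5 6]]]]])
qed

end

definition located :: "nat \<Rightarrow> state \<Rightarrow> configuration \<Rightarrow> nat \<Rightarrow> state" where
  "located n \<sigma> y p = pointer n \<sigma> (bits (word_of n y)) (int p) (int (p mod n)) 0"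

context
  fixes L n :: nat and \<sigma> :: state
  assumes \<sigma>: "\<sigma> 4 = U n" "\<sigma> 6 = U (n\<^sup>2)" and L: "n \<le> L" "n\<^sup>2 \<le> L" "5 \<le> L"
begin

lemma runs_update:
  assumes "p < n\<^sup>2"
  shows "runs L update_cell (located n \<sigma> y p) (located n \<sigma> (y(cell n p := S22 n y (cell n p))) p)"
proof -
  have "p div n < n" "p mod n < n"
    using cell_torus[OF assms] by (auto simp: cell_def torus_def)
  then show ?thesis
    using runs_update_cell[OF \<sigma> L, of "p div n" "p mod n" y] by (simp add: located_def cell_def)
qed

lemma runs_next:
  assumes "p < n\<^sup>2"
  shows "runs L next_cell (located n \<sigma> y p) (located n \<sigma> y ((p + 1) mod n\<^sup>2))"
proof -
  let ?ws = "bits (word_of n y)"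
  define j where "j = p mod n"
  have n: "0 < n" using assms by (cases n) auto
  then have j: "j < n" by (simp add: j_def)
  have w: "length ?ws = n\<^sup>2" "0 \<notin> set ?ws"
    by (simp_all add: nonzero_bits) (simp add: bits_def word_of_def)
  note [simp] = pos_simps[OF \<sigma> L]
  note runs = pos_runs[OF \<sigma> L]
  have nxt: "((p + 1) mod n\<^sup>2) mod n = nxt n j"
    by (simp add: nxt_def j_def mod_simps power2_eq_square mod_mod_cancel)
  have 3: "runs L (If_then (\<lambda>r. r 11 = 0) (For 4 (mv 11 Left)) skip) (pointer n \<sigma> ?ws (int (p + 1)) (int (j + 1)) 0)
      (pointer n \<sigma> ?ws (int (p + 1)) (int (nxt n j)) 0)"
  proof (rule runs_If)
    have *: "rd (pointer n \<sigma> ?ws (int (p + 1)) (int (j + 1)) 0) 11 = 0 \<longleftrightarrow> j = n - 1"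
      using symb_zero_iff[OF marks(2)[of n], of "int (j + 1)"] j by (auto simp: rd_def marks)
    show "runs L (For 4 (mv 11 Left)) (pointer n \<sigma> ?ws (int (p + 1)) (int (j + 1)) 0) (pointer n \<sigma> ?ws (int (p + 1)) (int (nxt n j)) 0)"
      if "rd (pointer n \<sigma> ?ws (int (p + 1)) (int (j + 1)) 0) 11 = 0"
    proof -
      have "int (j + 1) + int n * offset Left = int (nxt n j)"
        using that j n unfolding * by (simp add: nxt_eq)
      then show ?thesis using runs(5)[of Left ?ws "int (p + 1)" "int (j + 1)" 0] by (simp only:)
    qed
    show "runs L skip (pointer n \<sigma> ?ws (int (p + 1)) (int (j + 1)) 0) (pointer n \<sigma> ?ws (int (p + 1)) (int (nxt n j)) 0)"
      if "rd (pointer n \<sigma> ?ws (int (p + 1)) (int (j + 1)) 0) 11 \<noteq> 0"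
      using that j runs_skip unfolding * by (simp add: nxt_eq)
  qed
  have 4: "runs L (If_then (\<lambda>r. r 3 = 0) (For 6 (mv 3 Left)) skip) (pointer n \<sigma> ?ws (int (p + 1)) (int (nxt n j)) 0)
      (pointer n \<sigma> ?ws (int ((p + 1) mod n\<^sup>2)) (int (nxt n j)) 0)"
  proof (rule runs_If)
    have *: "rd (pointer n \<sigma> ?ws (int (p + 1)) (int (nxt n j)) 0) 3 = 0 \<longleftrightarrow> p + 1 = n\<^sup>2"
      unfolding rd_def pos_simps(1)[OF \<sigma> L] read_W symb_zero_iff[OF w(2)] w(1) of_nat_less_iff using assms by auto
    show "runs L (For 6 (mv 3 Left)) (pointer n \<sigma> ?ws (int (p + 1)) (int (nxt n j)) 0) (pointer n \<sigma> ?ws (int ((p + 1) mod n\<^sup>2)) (int (nxt n j)) 0)"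
      if "rd (pointer n \<sigma> ?ws (int (p + 1)) (int (nxt n j)) 0) 3 = 0"
    proof -
      have "int (p + 1) + int (n\<^sup>2) * offset Left = int ((p + 1) mod n\<^sup>2)"
        using that unfolding * by simp
      then show ?thesis using runs(6)[of Left ?ws "int (p + 1)" "int (nxt n j)" 0] by (simp only:)
    qed
    show "runs L skip (pointer n \<sigma> ?ws (int (p + 1)) (int (nxt n j)) 0) (pointer n \<sigma> ?ws (int ((p + 1) mod n\<^sup>2)) (int (nxt n j)) 0)"
      if "rd (pointer n \<sigma> ?ws (int (p + 1)) (int (nxt n j)) 0) 3 \<noteq> 0"
    proof -
      have "(p + 1) mod n\<^sup>2 = p + 1" using that assms unfolding * by simp
      then show ?thesis by (simp add: runs_skip)
    qed
  qed
  have 1: "runs L (mv 3 Right) (pointer n \<sigma> ?ws (int p) (int j) 0) (pointer n \<sigma> ?ws (int (p + 1)) (int j) 0)"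
    using runs(1)[of Right ?ws "int p" "int j" 0] by (simp add: add.commute)
  have 2: "runs L (mv 11 Right) (pointer n \<sigma> ?ws (int (p + 1)) (int j) 0) (pointer n \<sigma> ?ws (int (p + 1)) (int (j + 1)) 0)"
    using runs(2)[of Right ?ws "int (p + 1)" "int j" 0] by (simp add: add.commute)
  show ?thesis
    unfolding next_cell_def located_def nxt j_def[symmetric]
    by (rule runs_Seq[OF 1 runs_Seq[OF 2 runs_Seq[OF 3 4]]])
qed

end

lemma located_upd: "a \<notin> {3, 7, 11} \<Longrightarrow> located n (\<sigma>(a := t)) y p = (located n \<sigma> y p)(a := t)"
  by (auto simp: located_def pointer_def fun_eq_iff)

lemma runs_follow:
  assumes \<sigma>: "\<sigma> 4 = U n" "\<sigma> 6 = U (n\<^sup>2)" "\<sigma> 1 = W (bits c) 0"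
    and L: "n \<le> L" "n\<^sup>2 \<le> L" "5 \<le> L" "length c \<le> L" and p: "p < n\<^sup>2"
  shows "\<exists>p' t. p' < n\<^sup>2 \<and> runs L follow (located n \<sigma> y p) ((located n \<sigma> (fst (simulate n c (y, p))) p')(1 := t))"
proof -
  define s where "s i = simulate n (take i c) (y, p)" for i
  define f where "f i = located n (\<sigma>(1 := W (bits c) (int i))) (fst (s i)) (snd (s i))" for i
  have s: "snd (s i) < n\<^sup>2" for i
    using simulate_reach[of n y "(y, p)" "take i c"] p by (simp add: s_def reach_refl)
  have s_Suc: "s (Suc i) = sim_step n (c ! i) (s i)" if "i < length c" for i
    using that by (simp add: s_def take_Suc_conv_app_nth simulate_append) (simp add: simulate_def)
  have rd1: "rd (f i) 1 = symb (bits c) (int i)" for i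
    by (simp add: f_def located_def pointer_def rd_def)
  have "runs L follow (f 0) (f (length c))"
    unfolding follow_def
  proof (rule runs_While[where N = "length c" and f = f])
    fix i assume i: "i < length c"
    let ?\<sigma> = "\<sigma>(1 := W (bits c) (int i))"
    have sym: "rd (f i) 1 = bit_symbol (c ! i)"
      unfolding rd1 using i by (simp add: bits_def)
    have "runs L (If_then (\<lambda>r. r 1 = 2) update_cell next_cell) (f i) (located n ?\<sigma> (fst (s (Suc i))) (snd (s (Suc i))))"
    proof (rule runs_If)
      assume "rd (f i) 1 = 2"
      then have "c ! i" using sym by (simp add: bit_symbol_def split: if_splits)
      then show "runs L update_cell (f i) (located n ?\<sigma> (fst (s (Suc i))) (snd (s (Suc i))))"
        unfolding f_def s_Suc[OF i] using runs_update[of ?\<sigma> n L "snd (s i)" "fst (s i)"] \<sigma> L s[of i]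
        by (cases "s i") auto
    next
      assume "rd (f i) 1 \<noteq> 2"
      then have "\<not> c ! i" using sym by (simp add: bit_symbol_def split: if_splits)
      then show "runs L next_cell (f i) (located n ?\<sigma> (fst (s (Suc i))) (snd (s (Suc i))))"
        unfolding f_def s_Suc[OF i] using runs_next[of ?\<sigma> n L "snd (s i)" "fst (s i)"] \<sigma> L s[of i]
        by (cases "s i") auto
    qed
    moreover have "runs L (mv 1 Right) (located n ?\<sigma> (fst (s (Suc i))) (snd (s (Suc i)))) (f (Suc i))"
      by (rule runs_mv[where xs = "bits c" and z = "int i"])
        (simp_all add: f_def located_upd, simp_all add: located_def pointer_def add.commute)
    ultimately show "rd (f i) 1 \<noteq> 0 \<and> runs L (If_then (\<lambda>r. r 1 = 2) update_cell next_cell ;; mv 1 Right) (f i) (f (Suc i))"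
      using runs_Seq sym by (auto simp: bit_symbol_def)
  next
    show "\<not> rd (f (length c)) 1 \<noteq> 0"
      unfolding rd1 by (simp add: symb_def bits_def)
  qed (use L in auto)
  moreover have "\<sigma>(1 := W (bits c) (int 0)) = \<sigma>"
    using \<sigma>(3) by (auto simp: fun_eq_iff)
  then have "f 0 = located n \<sigma> y p"
    by (simp add: f_def s_def simulate_def)
  moreover have "f (length c) = (located n \<sigma> (fst (simulate n c (y, p))) (snd (s (length c))))(1 := W (bits c) (int (length c)))"
    by (simp add: f_def located_upd, simp add: s_def)
  ultimately show ?thesis using s[of "length c"] by metis
qed

subsection \<open>The verifier\<close>

definition read_unary :: "nat \<Rightarrow> prog" where
  "read_unary a = While (\<lambda>r. r 2 = 2) (push a one ;; mv 2 Right) ;; rewind a"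

text \<open>\<open>max 1\<close> replaces the blanks read from an input that is too short by the
  symbol of an inactive cell, so that tape 3 contains no 0 and can be rewound for every
  input.\<close>

definition parse_input :: prog where
  "parse_input = (For 0 (push 2 (\<lambda>r. r 0)) ;; rewind 2) ;;
     read_unary 4 ;; mv 2 Right ;;
     (For 4 (push 10 one) ;; rewind 10) ;; (For 4 (push 11 one) ;; rewind 11) ;;
     (For 4 (For 11 (push 6 one)) ;; rewind 6) ;;
     (For 6 (push 3 (\<lambda>r. max 1 (r 2)) ;; mv 2 Right) ;; rewind 3) ;;
     read_unary 8 ;; mv 2 Right ;; read_unary 9"

definition go_to_cell :: prog where
  "go_to_cell = For 8 (For 4 (mv 3 Right)) ;; For 9 (mv 3 Right)"

definition prepare_counter :: prog where
  "prepare_counter = mv 4 Right ;; mv 4 Right ;;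
     If_then (\<lambda>r. r 4 = 0) (emits 7 [one, one, one, one, \<lambda>_. 2] ;; rewind 7) (emits 7 [one, one, \<lambda>_. 2, one, one] ;; rewind 7) ;;
     mv 4 Left ;; mv 4 Left"

text \<open>The output ends at the first blank, so a blank in cell 1 cuts off the remains of the
  input on tape 0.\<close>

definition answer :: "((nat \<Rightarrow> nat) \<Rightarrow> bool) \<Rightarrow> prog" where
  "answer c = Op 0 (\<lambda>r. (bit_symbol (c r), Right)) ;; Op 0 (\<lambda>_. (0, Stay))"

definition unless :: "((nat \<Rightarrow> nat) \<Rightarrow> bool) \<Rightarrow> prog \<Rightarrow> prog" where
  "unless c p = If_then c (answer (\<lambda>_. False)) p"

text \<open>A number is compared with \<open>n\<close> by moving a head that many cells along
  \<open>n\<close> marks and testing for a blank. For the column this is done on tape 11, which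
  leaves its head where \<open>follow\<close> expects it.\<close>

definition verifier :: prog where
  "verifier = parse_input ;; unless (\<lambda>r. r 2 \<noteq> 1) (mv 2 Right ;; unless (\<lambda>r. r 2 \<noteq> 0)
     (For 8 (mv 10 Right) ;; unless (\<lambda>r. r 10 = 0) (For 9 (mv 11 Right) ;; unless (\<lambda>r. r 11 = 0)
        (go_to_cell ;; unless (\<lambda>r. r 3 = 2)
          (prepare_counter ;; follow ;; rewind 3 ;; go_to_cell ;; answer (\<lambda>r. r 3 = 2))))))"

definition decides :: "nat \<Rightarrow> prog \<Rightarrow> state \<Rightarrow> bool \<Rightarrow> bool" where
  "decides L p \<sigma> b \<longleftrightarrow> (\<exists>\<sigma>'. runs L p \<sigma> \<sigma>' \<and> fst (\<sigma>' 0) 0 = bit_symbol b \<and> fst (\<sigma>' 0) 1 = 0)"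

lemma decides_Seq: "runs L p \<sigma> \<tau> \<Longrightarrow> decides L q \<tau> b \<Longrightarrow> decides L (p ;; q) \<sigma> b"
  unfolding decides_def using runs_Seq by blast

lemma decides_answer:
  assumes "snd (\<sigma> 0) = 0" "c (rd \<sigma>) = b"
  shows "decides L (answer c) \<sigma> b"
proof -
  obtain g where g: "\<sigma> 0 = (g, 0)" using assms(1) by (cases "\<sigma> 0") auto
  have 1: "runs L (Op 0 (\<lambda>r. (bit_symbol (c r), Right))) \<sigma> (\<sigma>(0 := act (bit_symbol b, Right) (\<sigma> 0)))"
    by (rule runs_Op) (simp add: assms(2))
  have 2: "runs L (Op 0 (\<lambda>_. (0, Stay))) (\<sigma>(0 := act (bit_symbol b, Right) (\<sigma> 0)))
      (\<sigma>(0 := act (0, Stay) (act (bit_symbol b, Right) (\<sigma> 0))))"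
    by (rule runs_Op) simp
  have "fst (act (0, Stay) (act (bit_symbol b, Right) (\<sigma> 0))) 0 = bit_symbol b"
    "fst (act (0, Stay) (act (bit_symbol b, Right) (\<sigma> 0))) 1 = 0"
    by (simp_all add: g)
  then show ?thesis
    using runs_Seq[OF 1 2] unfolding decides_def answer_def by (metis fun_upd_same)
qed

lemma decides_unless:
  assumes "snd (\<sigma> 0) = 0" "c (rd \<sigma>) \<Longrightarrow> \<not> b" "\<not> c (rd \<sigma>) \<Longrightarrow> decides L p \<sigma> b"
  shows "decides L (unless c p) \<sigma> b"
proof (cases "c (rd \<sigma>)")
  case True
  then have "decides L (answer (\<lambda>_. False)) \<sigma> b"
    using assms by (intro decides_answer) auto
  then show ?thesis
    using True runs_If[of c \<sigma> L] unfolding decides_def unless_def by metis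
next
  case False
  then show ?thesis
    using assms(3) runs_If[of c \<sigma> L] unfolding decides_def unless_def by metis
qed

text \<open>Beyond the end of the input all further symbols are blank, so that it suffices to check the last symbol.\<close>

definition remains :: "nat list \<Rightarrow> int \<Rightarrow> bool list \<Rightarrow> bool" where
  "remains xs z w \<longleftrightarrow> (\<forall>i. symb xs (z + int i) = symb (bits w) (int i))"

lemma remains_drop: "remains xs z w \<Longrightarrow> remains xs (z + int d) (drop d w)"
  unfolding remains_def
proof
  fix i assume "\<forall>i. symb xs (z + int i) = symb (bits w) (int i)"
  then have "symb xs (z + int (d + i)) = symb (bits w) (int (d + i))" by blast
  moreover have "symb (bits w) (int (d + i)) = symb (bits (drop d w)) (int i)"
    by (auto simp: symb_def bits_def nth_append nat_add_distrib)
  ultimately show "symb xs (z + int d + int i) = symb (bits (drop d w)) (int i)"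
    by (simp add: add.assoc)
qed

lemma remains_symb: "remains xs z w \<Longrightarrow> symb xs (z + int i) = symb (bits w) (int i)"
  by (simp add: remains_def)

lemma ones_symb:
  "i < ones w \<Longrightarrow> symb (bits w) (int i) = 2" "symb (bits w) (int (ones w)) \<noteq> 2" "ones w \<le> length w"
proof -
  show "ones w \<le> length w" by (simp add: ones_def length_takeWhile_le)
  show "symb (bits w) (int i) = 2" if "i < ones w" for i
  proof -
    have "i < length w" using that \<open>ones w \<le> length w\<close> by simp
    moreover have "w ! i"
      using that takeWhile_nth[of i id w] set_takeWhileD[of "w ! i" id w] nth_mem[of i "takeWhile id w"] by (auto simp: ones_def)
    ultimately show ?thesis by (simp add: bits_def bit_symbol_def)
  qed
  show "symb (bits w) (int (ones w)) \<noteq> 2"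
  proof (cases "ones w < length w")
    case True
    then have "\<not> w ! ones w" using nth_length_takeWhile[of id w] by (simp add: ones_def)
    then show ?thesis using True by (simp add: bits_def bit_symbol_def)
  qed (simp add: symb_def bits_def)
qed

lemma runs_read_unary:
  assumes "\<sigma> 2 = W xs z" "remains xs z w" "\<sigma> a = W [] 0" "a \<noteq> 2" "length w \<le> L"
    and "\<sigma>' = \<sigma>(a := U (ones w), 2 := W xs (z + int (ones w)))"
  shows "runs L (read_unary a) \<sigma> \<sigma>'"
  unfolding read_unary_def
proof (rule runs_Seq)
  define f where "f i = \<sigma>(a := E (replicate i 1), 2 := W xs (z + int i))" for i
  show "runs L (While (\<lambda>r. r 2 = 2) (push a one ;; mv 2 Right)) \<sigma> (f (ones w))"
  proof (rule runs_While[where N = "ones w" and f = f])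
    fix i assume i: "i < ones w"
    have "runs L (push a one) (f i) (\<sigma>(a := E (replicate (Suc i) 1), 2 := W xs (z + int i)))"
      using assms(4) by (intro runs_push[where xs = "replicate i 1"])
        (auto simp: f_def fun_upd_twist replicate_append_same)
    moreover have "runs L (mv 2 Right) (\<sigma>(a := E (replicate (Suc i) 1), 2 := W xs (z + int i))) (f (Suc i))"
      by (intro runs_mv[where xs = xs and z = "z + int i"]) (auto simp: f_def algebra_simps)
    moreover have "rd (f i) 2 = 2"
      using ones_symb(1)[OF i] remains_symb[OF assms(2), of i] by (simp add: f_def rd_def)
    ultimately show "rd (f i) 2 = 2 \<and> runs L (push a one ;; mv 2 Right) (f i) (f (Suc i))"
      using runs_Seq by blast
  next
    show "rd (f (ones w)) 2 \<noteq> 2"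
      using ones_symb(2)[of w] remains_symb[OF assms(2), of "ones w"] by (simp add: f_def rd_def)
  qed (use assms ones_symb(3)[of w] in \<open>auto simp: f_def fun_eq_iff\<close>)
  show "runs L (rewind a) (f (ones w)) \<sigma>'"
    using assms ones_symb(3)[of w]
    by (intro runs_rewind[where xs = "replicate (ones w) 1" and z = "ones w"]) (auto simp: f_def fun_upd_twist)
qed

lemma start_inputs: "start [x, c] = (\<lambda>_. W [] 0)(0 := W (bits x) 0, 1 := W (bits c) 0)"
  by (auto simp: start_def input_tape_W bits_def fun_eq_iff nth_Cons')

lemma length_rests:
  "size_of x \<le> length x" "length (rest2 x) \<le> length x" "length (rest3 x) \<le> length x"
  "row_of x \<le> length x" "column_of x \<le> length x"
  using ones_symb(3)[of x] ones_symb(3)[of "rest2 x"] ones_symb(3)[of "rest3 x"]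
  by (simp_all add: size_of_def rest1_def rest2_def rest3_def row_of_def column_of_def)

lemma runs_count_copy:
  assumes "\<sigma> a = U n" "\<sigma> b = W [] 0" "a \<noteq> b" "n \<le> L" "\<sigma>' = \<sigma>(b := U n)"
  shows "runs L (For a (push b one) ;; rewind b) \<sigma> \<sigma>'"
  using assms appends_count[of \<sigma> a "replicate n 1" L b 1] by (intro runs_build[where w = "replicate n 1"]) auto

lemma runs_parse_input:
  assumes "length x \<le> L" "(size_of x)\<^sup>2 \<le> L"
  shows "\<exists>\<sigma> v z. runs L parse_input (start [x, c]) \<sigma> \<and> \<sigma> 0 = W (bits x) 0 \<and> \<sigma> 1 = W (bits c) 0 \<and>
    \<sigma> 4 = U (size_of x) \<and> \<sigma> 6 = U ((size_of x)\<^sup>2) \<and> \<sigma> 7 = W [] 0 \<and> \<sigma> 8 = U (row_of x) \<and> \<sigma> 9 = U (column_of x) \<and>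
    \<sigma> 10 = U (size_of x) \<and> \<sigma> 11 = U (size_of x) \<and> \<sigma> 3 = W v 0 \<and>
    (rest4 x = [False] \<longrightarrow> v = bits (word_of (size_of x) (configuration_of x))) \<and>
    \<sigma> 2 = W (bits x) z \<and> remains (bits x) z (rest4 x)"
proof -
  let ?n = "size_of x" and ?xs = "bits x"
  define s0 where "s0 = start [x, c]"
  have s0: "s0 0 = W ?xs 0" "s0 1 = W (bits c) 0" "\<And>i. 2 \<le> i \<Longrightarrow> s0 i = W [] 0"
    by (auto simp: s0_def start_inputs)
  define v where "v = map (\<lambda>i. max 1 (symb (bits (rest1 x)) (int i))) [0..<?n\<^sup>2]"
  define z1 where "z1 = int ?n + 1"
  define z2 where "z2 = z1 + int (?n\<^sup>2)"
  define z3 where "z3 = z2 + int (row_of x) + 1"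
  define z4 where "z4 = z3 + int (column_of x)"
  have rem0: "remains ?xs 0 x" by (simp add: remains_def)
  have rem1: "remains ?xs z1 (rest1 x)"
    using remains_drop[OF rem0, of "?n + 1"] by (simp add: z1_def rest1_def add.commute)
  have rem2: "remains ?xs z2 (rest2 x)"
    using remains_drop[OF rem1, of "?n\<^sup>2"] by (simp add: z2_def rest2_def)
  have rem3: "remains ?xs z3 (rest3 x)"
    using remains_drop[OF rem2, of "row_of x + 1"] by (simp add: z3_def rest3_def add.commute add.left_commute)
  have rem4: "remains ?xs z4 (rest4 x)"
    using remains_drop[OF rem3, of "column_of x"] by (simp add: z4_def rest4_def)
  note len = length_rests[of x]
  have n: "?n \<le> L" using len assms by linarith
  define s1 where "s1 = s0(2 := W ?xs 0)"
  have 1: "runs L (For 0 (push 2 (\<lambda>r. r 0)) ;; rewind 2) s0 s1"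
  proof (rule runs_build)
    show "appends L 2 (For 0 (push 2 (\<lambda>r. r 0))) s0 s0 ?xs"
      using s0 assms nonzero_bits[of x]
      by (intro appends_For_same[where w = "\<lambda>i. [?xs ! i]" and xs = ?xs] appends_push)
        (auto simp: rd_def map_nth, simp_all add: bits_def)
  qed (use s0 assms nonzero_bits in \<open>auto simp: s1_def\<close>, simp_all add: bits_def)
  define s2 where "s2 = s1(4 := U ?n, 2 := W ?xs (int ?n))"
  have 2: "runs L (read_unary 4) s1 s2"
    using s0 assms by (intro runs_read_unary[OF _ rem0]) (auto simp: s1_def s2_def size_of_def)
  define s3 where "s3 = s1(4 := U ?n, 2 := W ?xs z1)"
  have 3: "runs L (mv 2 Right) s2 s3"
    by (rule runs_mv[where xs = ?xs and z = "int ?n"]) (auto simp: s2_def s3_def z1_def)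
  define s4 where "s4 = s3(10 := U ?n)"
  have 4: "runs L (For 4 (push 10 one) ;; rewind 10) s3 s4"
    using s0 n by (intro runs_count_copy) (auto simp: s1_def s3_def s4_def)
  define s5 where "s5 = s4(11 := U ?n)"
  have 5: "runs L (For 4 (push 11 one) ;; rewind 11) s4 s5"
    using s0 n by (intro runs_count_copy) (auto simp: s1_def s3_def s4_def s5_def)
  define s6 where "s6 = s5(6 := U (?n\<^sup>2))"
  have 6: "runs L (For 4 (For 11 (push 6 one)) ;; rewind 6) s5 s6"
  proof (rule runs_build)
    show "appends L 6 (For 4 (For 11 (push 6 one))) s5 s5 (replicate (?n\<^sup>2) 1)"
      using s0 n
      by (intro appends_For_same[where w = "\<lambda>_. replicate ?n 1" and xs = "replicate ?n 1"] appends_count[where xs = "replicate ?n 1", simplified])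
        (auto simp: s1_def s3_def s4_def s5_def concat_replicates power2_eq_square)
  qed (use s0 assms in \<open>auto simp: s1_def s3_def s4_def s5_def s6_def\<close>)
  define s7 where "s7 = s6(2 := W ?xs z2, 3 := W v 0)"
  have 7: "runs L (For 6 (push 3 (\<lambda>r. max 1 (r 2)) ;; mv 2 Right) ;; rewind 3) s6 s7"
  proof (rule runs_Seq)
    have s6: "s6 6 = U (?n\<^sup>2)" "s6 2 = W ?xs z1" "s6 3 = W [] 0"
      using s0 by (auto simp: s1_def s3_def s4_def s5_def s6_def)
    have "appends L 3 (For 6 (push 3 (\<lambda>r. max 1 (r 2)) ;; mv 2 Right)) s6 (s6(2 := W ?xs z2)) v"
    proof (rule appends_For[where xs = "replicate (?n\<^sup>2) 1" and f = "\<lambda>i. s6(2 := W ?xs (z1 + int i))"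
          and w = "\<lambda>i. [max 1 (symb (bits (rest1 x)) (int i))]"])
      fix i
      have "appends L 3 (push 3 (\<lambda>r. max 1 (r 2))) (s6(2 := W ?xs (z1 + int i), 6 := W (replicate (?n\<^sup>2) 1) (int i)))
          (s6(2 := W ?xs (z1 + int i), 6 := W (replicate (?n\<^sup>2) 1) (int i))) [max 1 (symb (bits (rest1 x)) (int i))]"
        using remains_symb[OF rem1, of i] by (intro appends_push) (simp add: rd_def)
      moreover have "appends L 3 (mv 2 Right) (s6(2 := W ?xs (z1 + int i), 6 := W (replicate (?n\<^sup>2) 1) (int i)))
          (s6(2 := W ?xs (z1 + int (Suc i)), 6 := W (replicate (?n\<^sup>2) 1) (int i))) []"
        by (intro appends_mv[where xs = ?xs and z = "z1 + int i"]) (auto simp: fun_upd_twist algebra_simps)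
      ultimately show "appends L 3 (push 3 (\<lambda>r. max 1 (r 2)) ;; mv 2 Right) ((s6(2 := W ?xs (z1 + int i)))(6 := W (replicate (?n\<^sup>2) 1) (int i)))
          ((s6(2 := W ?xs (z1 + int (Suc i))))(6 := W (replicate (?n\<^sup>2) 1) (int i))) [max 1 (symb (bits (rest1 x)) (int i))]"
        using appends_Seq by fastforce
    qed (use s6 assms in \<open>auto simp: fun_eq_iff z2_def v_def\<close>)
    then show "runs L (For 6 (push 3 (\<lambda>r. max 1 (r 2)) ;; mv 2 Right)) s6 (s6(2 := W ?xs z2, 3 := E ([] @ v)))"
      using s6 by (intro runs_appends) auto
    show "runs L (rewind 3) (s6(2 := W ?xs z2, 3 := E ([] @ v))) s7"
      using assms by (intro runs_rewind[where xs = v and z = "length v"]) (auto simp: s7_def v_def)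
  qed
  define s8 where "s8 = s7(8 := U (row_of x), 2 := W ?xs (z2 + int (row_of x)))"
  have 8: "runs L (read_unary 8) s7 s8"
    using s0 assms len by (intro runs_read_unary[OF _ rem2]) (auto simp: s1_def s3_def s4_def s5_def s6_def s7_def s8_def row_of_def)
  define s9 where "s9 = s7(8 := U (row_of x), 2 := W ?xs z3)"
  have 9: "runs L (mv 2 Right) s8 s9"
    by (rule runs_mv[where xs = ?xs and z = "z2 + int (row_of x)"]) (auto simp: s8_def s9_def z3_def)
  define s10 where "s10 = s9(9 := U (column_of x), 2 := W ?xs z4)"
  have 10: "runs L (read_unary 9) s9 s10"
    using s0 assms len by (intro runs_read_unary[OF _ rem3]) (auto simp: s1_def s3_def s4_def s5_def s6_def s7_def s9_def s10_def z4_def column_of_def)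
  have run: "runs L parse_input s0 s10"
    unfolding parse_input_def
    by (rule runs_Seq[OF 1 runs_Seq[OF 2 runs_Seq[OF 3 runs_Seq[OF 4 runs_Seq[OF 5 runs_Seq[OF 6
          runs_Seq[OF 7 runs_Seq[OF 8 runs_Seq[OF 9 10]]]]]]]]])
  have v: "v = bits (word_of ?n (configuration_of x))" if "rest4 x = [False]"
  proof -
    have w: "take (?n\<^sup>2) (rest1 x) = word_of ?n (configuration_of x)"
      using encode_parse(2)[OF that] .
    then have "?n\<^sup>2 \<le> length (rest1 x)"
      by (metis length_map length_take length_upt minus_nat.diff_0 min.absorb_iff2 word_of_def)
    then show ?thesis
      unfolding w[symmetric] by (intro nth_equalityI) (auto simp: v_def bits_def bit_symbol_def)
  qed
  show ?thesis
    using run s0 rem4 v unfolding s0_def[symmetric]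
    by (intro exI[of _ s10] exI[of _ v] exI[of _ z4]) (simp add: s10_def s9_def s7_def s6_def s5_def s4_def s3_def s1_def)
qed

lemma runs_go_to_cell:
  assumes "\<sigma> 4 = U n" "\<sigma> 8 = U i" "\<sigma> 9 = U j" "\<sigma> 3 = W ws 0" "n \<le> L" "i \<le> L" "j \<le> L"
    and "\<sigma>' = \<sigma>(3 := W ws (int (i * n + j)))"
  shows "runs L go_to_cell \<sigma> \<sigma>'"
  unfolding go_to_cell_def
proof (rule runs_Seq)
  show "runs L (For 8 (For 4 (mv 3 Right))) \<sigma> (\<sigma>(3 := W ws (int (i * n))))"
  proof (rule runs_For[where xs = "replicate i 1" and f = "\<lambda>k. \<sigma>(3 := W ws (int (k * n)))"])
    fix k
    show "runs L (For 4 (mv 3 Right)) ((\<sigma>(3 := W ws (int (k * n))))(8 := W (replicate i 1) (int k)))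
        ((\<sigma>(3 := W ws (int (Suc k * n))))(8 := W (replicate i 1) (int k)))"
      using assms by (intro runs_shift[where xs = "replicate n 1" and ys = ws and z = "int (k * n)"])
        (auto simp: fun_upd_twist algebra_simps)
  qed (use assms in \<open>auto simp: fun_eq_iff\<close>)
  show "runs L (For 9 (mv 3 Right)) (\<sigma>(3 := W ws (int (i * n)))) \<sigma>'"
    using assms by (intro runs_shift[where xs = "replicate j 1" and ys = ws and z = "int (i * n)"]) auto
qed

lemma runs_prepare_counter:
  assumes "\<sigma> 4 = U n" "\<sigma> 7 = W [] 0" "5 \<le> L" "\<sigma>' = \<sigma>(7 := W (counter n) 0)"
  shows "runs L prepare_counter \<sigma> \<sigma>'"
proof -
  define s where "s t z = \<sigma>(7 := t, 4 := W (replicate n 1) z)" for t z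
  have s: "s t z 4 = W (replicate n 1) z" "s t z 7 = t" "(s t z)(4 := W (replicate n 1) z') = s t z'" "(s t z)(7 := t') = s t' z" for t z t' z'
    by (auto simp: s_def fun_upd_twist)
  have m: "runs L (mv 4 d) (s t z) (s t (z + offset d))" for d t z
    by (rule runs_mv[where xs = "replicate n 1" and z = z]) (rule s, rule s(3)[symmetric])
  have test: "runs L (If_then (\<lambda>r. r 4 = 0) (emits 7 [one, one, one, one, \<lambda>_. 2] ;; rewind 7) (emits 7 [one, one, \<lambda>_. 2, one, one] ;; rewind 7))
      (s (W [] 0) 2) (s (W (counter n) 0) 2)"
  proof (rule runs_If)
    have *: "rd (s (W [] 0) 2) 4 = 0 \<longleftrightarrow> n \<le> 2"
      unfolding rd_def s(1) read_W by (subst symb_zero_iff) auto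
    have e: "runs L (emits 7 fs ;; rewind 7) (s (W [] 0) 2) (s (W (counter n) 0) 2)"
      if "counter n = map (\<lambda>g. g (\<lambda>_. 0)) fs" "\<forall>g \<in> set fs. \<forall>r. g r = g (\<lambda>_. 0)" for fs
    proof (rule runs_build)
      show "appends L 7 (emits 7 fs) (s (W [] 0) 2) (s (W [] 0) 2) (counter n)"
      proof (rule appends_emits)
        have "map (\<lambda>g. g (\<lambda>_. 0)) fs = map (\<lambda>g. g (rd (s (W [] 0) 2))) fs"
          using that(2) by (intro map_cong refl) metis
        then show "counter n = map (\<lambda>g. g (rd (s (W [] 0) 2))) fs"
          using that(1) by simp
      qed (use that(2) in metis)
    qed (use assms counter[of n] in \<open>simp_all add: s\<close>)
    show "runs L (emits 7 [one, one, one, one, \<lambda>_. 2] ;; rewind 7) (s (W [] 0) 2) (s (W (counter n) 0) 2)" if "rd (s (W [] 0) 2) 4 = 0"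
      using that unfolding * by (intro e) (auto simp: counter_def)
    show "runs L (emits 7 [one, one, \<lambda>_. 2, one, one] ;; rewind 7) (s (W [] 0) 2) (s (W (counter n) 0) 2)" if "rd (s (W [] 0) 2) 4 \<noteq> 0"
      using that unfolding * by (intro e) (auto simp: counter_def)
  qed
  have steps: "runs L (mv 4 Right) (s t 0) (s t 1)" "runs L (mv 4 Right) (s t 1) (s t 2)"
    "runs L (mv 4 Left) (s t 2) (s t 1)" "runs L (mv 4 Left) (s t 1) (s t 0)" for t
    using m[of Right t 0] m[of Right t 1] m[of Left t 2] m[of Left t 1] by simp_all
  have "s (W [] 0) 0 = \<sigma>" "s (W (counter n) 0) 0 = \<sigma>'"
    using assms by (auto simp: s_def fun_eq_iff)
  then show ?thesis
    using runs_Seq[OF steps(1) runs_Seq[OF steps(2) runs_Seq[OF test runs_Seq[OF steps(3,4)]]]]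
    unfolding prepare_counter_def by (simp only:)
qed

lemma rest_last:
  assumes "symb (bits w) 0 = 1" "symb (bits w) 1 = 0"
  shows "w = [False]"
proof (cases w)
  case (Cons b w')
  then show ?thesis
    using assms by (cases w') (auto simp: symb_def bits_def bit_symbol_def split: if_splits)
qed (use assms in \<open>simp add: symb_def bits_def\<close>)

lemma decides_Seq_unless:
  assumes "runs L p \<sigma> \<tau>" "snd (\<tau> 0) = 0" "c (rd \<tau>) \<Longrightarrow> \<not> b" "\<not> c (rd \<tau>) \<Longrightarrow> decides L q \<tau> b"
  shows "decides L (p ;; unless c q) \<sigma> b"
  using assms decides_Seq decides_unless by blast

lemma decides_verifier:
  assumes L: "length x \<le> L" "(size_of x)\<^sup>2 \<le> L" "length c \<le> L" "5 \<le> L"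
  shows "decides L verifier (start [x, c]) (verify x c)"
proof -
  let ?n = "size_of x" and ?i = "row_of x" and ?j = "column_of x" and ?y = "configuration_of x"
  let ?p = "?i * ?n + ?j"
  have len: "?n \<le> L" "?i \<le> L" "?j \<le> L"
    using length_rests[of x] L(1) by linarith+
  obtain \<sigma> v z where run: "runs L parse_input (start [x, c]) \<sigma>"
    and \<sigma>: "\<sigma> 0 = W (bits x) 0" "\<sigma> 1 = W (bits c) 0" "\<sigma> 4 = U ?n" "\<sigma> 6 = U (?n\<^sup>2)" "\<sigma> 7 = W [] 0" "\<sigma> 8 = U ?i" "\<sigma> 9 = U ?j"
      "\<sigma> 10 = U ?n" "\<sigma> 11 = U ?n" "\<sigma> 3 = W v 0" "\<sigma> 2 = W (bits x) z"
    and v: "rest4 x = [False] \<Longrightarrow> v = bits (word_of ?n ?y)"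
    and rem: "remains (bits x) z (rest4 x)"
    using runs_parse_input[OF L(1,2), of c] by blast
  define \<tau>1 where "\<tau>1 = \<sigma>(2 := W (bits x) (z + 1))"
  define \<tau>2 where "\<tau>2 = \<tau>1(10 := W (replicate ?n 1) (int ?i))"
  define \<tau>3 where "\<tau>3 = \<tau>2(11 := W (replicate ?n 1) (int ?j))"
  define \<tau>4 where "\<tau>4 = \<tau>3(3 := W v (int ?p))"
  define \<tau>5 where "\<tau>5 = \<tau>4(7 := W (counter ?n) 0)"
  have r1: "runs L (mv 2 Right) \<sigma> \<tau>1"
    using \<sigma> by (intro runs_mv[where xs = "bits x" and z = z]) (auto simp: \<tau>1_def)
  have r2: "runs L (For 8 (mv 10 Right)) \<tau>1 \<tau>2"
    using \<sigma> len by (intro runs_shift[where xs = "replicate ?i 1" and ys = "replicate ?n 1" and z = 0]) (auto simp: \<tau>1_def \<tau>2_def)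
  have r3: "runs L (For 9 (mv 11 Right)) \<tau>2 \<tau>3"
    using \<sigma> len by (intro runs_shift[where xs = "replicate ?j 1" and ys = "replicate ?n 1" and z = 0]) (auto simp: \<tau>1_def \<tau>2_def \<tau>3_def)
  have r4: "runs L go_to_cell \<tau>3 \<tau>4"
    using \<sigma> len by (intro runs_go_to_cell[where ws = v]) (auto simp: \<tau>1_def \<tau>2_def \<tau>3_def \<tau>4_def)
  have r5: "runs L prepare_counter \<tau>4 \<tau>5"
    using \<sigma> L by (intro runs_prepare_counter) (auto simp: \<tau>1_def \<tau>2_def \<tau>3_def \<tau>4_def \<tau>5_def)
  have head: "snd (\<sigma> 0) = 0" "snd (\<tau>1 0) = 0" "snd (\<tau>2 0) = 0" "snd (\<tau>3 0) = 0" "snd (\<tau>4 0) = 0"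
    using \<sigma>(1) by (auto simp: \<tau>1_def \<tau>2_def \<tau>3_def \<tau>4_def W_def)
  have rd: "rd \<sigma> 2 = symb (bits (rest4 x)) 0" "rd \<tau>1 2 = symb (bits (rest4 x)) 1"
    using remains_symb[OF rem, of 0] remains_symb[OF rem, of 1] \<sigma> by (simp_all add: rd_def \<tau>1_def)
  have rd2: "rd \<tau>2 10 = 0 \<longleftrightarrow> \<not> ?i < ?n" "rd \<tau>3 11 = 0 \<longleftrightarrow> \<not> ?j < ?n"
    by (simp_all add: rd_def \<tau>2_def \<tau>3_def symb_def)
  have last: "decides L (prepare_counter ;; follow ;; rewind 3 ;; go_to_cell ;; answer (\<lambda>r. r 3 = 2)) \<tau>4 (verify x c)"
    if good: "rest4 x = [False]" "?i < ?n" "?j < ?n" and inactive: "\<not> ?y (?i, ?j)"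
  proof -
    note v = v[OF good(1)]
    have p: "?p < ?n\<^sup>2" "?p mod ?n = ?j" using number_less[OF good(2,3)] good(3) by auto
    \<comment> \<open>The comparison with \<open>n\<close> has left the head of tape 11 at
      \<open>?j\<close>, which is \<open>?p mod ?n\<close>.\<close>
    have loc: "\<tau>5 = located ?n \<tau>5 ?y ?p"
      using p \<sigma> v by (auto simp: located_def pointer_def fun_eq_iff \<tau>1_def \<tau>2_def \<tau>3_def \<tau>4_def \<tau>5_def marks_def)
    have \<tau>5: "\<tau>5 0 = W (bits x) 0" "\<tau>5 4 = U ?n" "\<tau>5 6 = U (?n\<^sup>2)" "\<tau>5 1 = W (bits c) 0" "\<tau>5 8 = U ?i" "\<tau>5 9 = U ?j"
      using \<sigma> by (auto simp: \<tau>1_def \<tau>2_def \<tau>3_def \<tau>4_def \<tau>5_def)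
    let ?y' = "fst (simulate ?n c (?y, ?p))"
    obtain p' t where p': "p' < ?n\<^sup>2" "runs L follow \<tau>5 ((located ?n \<tau>5 ?y' p')(1 := t))"
      using runs_follow[OF \<tau>5(2,3,4) len(1) L(2,4,3) p(1), of ?y] loc by metis
    define \<tau>6 where "\<tau>6 = (located ?n \<tau>5 ?y' p')(1 := t)"
    have \<tau>6: "\<tau>6 0 = W (bits x) 0" "\<tau>6 4 = U ?n" "\<tau>6 8 = U ?i" "\<tau>6 9 = U ?j" "\<tau>6 3 = W (bits (word_of ?n ?y')) (int p')"
      using \<tau>5 by (auto simp: \<tau>6_def located_def pointer_def)
    define \<tau>7 where "\<tau>7 = \<tau>6(3 := W (bits (word_of ?n ?y')) 0)"
    define \<tau>8 where "\<tau>8 = \<tau>7(3 := W (bits (word_of ?n ?y')) (int ?p))"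
    have lw: "length (bits (word_of ?n ?y')) = ?n\<^sup>2" by (simp add: bits_def word_of_def)
    have r7: "runs L (rewind 3) \<tau>6 \<tau>7"
      using \<tau>6 p'(1) nonzero_bits L lw by (intro runs_rewind[where xs = "bits (word_of ?n ?y')" and z = p']) (auto simp: \<tau>7_def)
    have r8: "runs L go_to_cell \<tau>7 \<tau>8"
      using \<tau>6 len by (intro runs_go_to_cell) (auto simp: \<tau>7_def \<tau>8_def)
    have "rd \<tau>8 3 = bit_symbol (?y' (?i, ?j))"
      using symb_word[OF good(2,3), of ?y'] by (simp add: rd_def \<tau>8_def)
    then have ans: "(rd \<tau>8 3 = 2) = verify x c"
      using good inactive by (simp add: verify_def bit_symbol_def)
    have "snd (\<tau>8 0) = 0"
      using \<tau>6(1) by (simp add: \<tau>7_def \<tau>8_def W_def)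
    then have "decides L (answer (\<lambda>r. r 3 = 2)) \<tau>8 (verify x c)"
      using ans by (rule decides_answer)
    then show ?thesis
      using r5 p'(2) r7 r8 unfolding \<tau>6_def by (intro decides_Seq)
  qed
  show ?thesis
    unfolding verifier_def
  proof (rule decides_Seq_unless[OF run head(1)])
    show "\<not> verify x c" if "rd \<sigma> 2 \<noteq> 1"
      using that rd(1) by (auto simp: verify_def symb_def bits_def bit_symbol_def)
    assume c1: "\<not> rd \<sigma> 2 \<noteq> 1"
    show "decides L (mv 2 Right ;; unless (\<lambda>r. r 2 \<noteq> 0)
     (For 8 (mv 10 Right) ;; unless (\<lambda>r. r 10 = 0) (For 9 (mv 11 Right) ;; unless (\<lambda>r. r 11 = 0)
        (go_to_cell ;; unless (\<lambda>r. r 3 = 2)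
          (prepare_counter ;; follow ;; rewind 3 ;; go_to_cell ;; answer (\<lambda>r. r 3 = 2)))))) \<sigma> (verify x c)"
    proof (rule decides_Seq_unless[OF r1 head(2)])
      show "\<not> verify x c" if "rd \<tau>1 2 \<noteq> 0"
        using that rd(2) by (auto simp: verify_def symb_def bits_def)
      assume c2: "\<not> rd \<tau>1 2 \<noteq> 0"
      have good: "rest4 x = [False]"
        using c1 c2 rd rest_last by simp
      show "decides L (For 8 (mv 10 Right) ;; unless (\<lambda>r. r 10 = 0) (For 9 (mv 11 Right) ;; unless (\<lambda>r. r 11 = 0)
        (go_to_cell ;; unless (\<lambda>r. r 3 = 2)
          (prepare_counter ;; follow ;; rewind 3 ;; go_to_cell ;; answer (\<lambda>r. r 3 = 2))))) \<tau>1 (verify x c)"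
      proof (rule decides_Seq_unless[OF r2 head(3)])
        show "\<not> verify x c" if "rd \<tau>2 10 = 0"
          using that rd2(1) by (auto simp: verify_def)
        assume c3: "rd \<tau>2 10 \<noteq> 0"
        show "decides L (For 9 (mv 11 Right) ;; unless (\<lambda>r. r 11 = 0) (go_to_cell ;; unless (\<lambda>r. r 3 = 2)
          (prepare_counter ;; follow ;; rewind 3 ;; go_to_cell ;; answer (\<lambda>r. r 3 = 2)))) \<tau>2 (verify x c)"
        proof (rule decides_Seq_unless[OF r3 head(4)])
          show "\<not> verify x c" if "rd \<tau>3 11 = 0"
            using that rd2(2) by (auto simp: verify_def)
          assume c4: "rd \<tau>3 11 \<noteq> 0"
          have ij: "?i < ?n" "?j < ?n" using c3 c4 rd2 by auto
          have rd4: "rd \<tau>4 3 = bit_symbol (?y (?i, ?j))"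
            using symb_word[OF ij, of ?y] v[OF good] by (simp add: rd_def \<tau>4_def)
          show "decides L (go_to_cell ;; unless (\<lambda>r. r 3 = 2)
            (prepare_counter ;; follow ;; rewind 3 ;; go_to_cell ;; answer (\<lambda>r. r 3 = 2))) \<tau>3 (verify x c)"
          proof (rule decides_Seq_unless[OF r4 head(5)])
            show "\<not> verify x c" if "rd \<tau>4 3 = 2"
              using that rd4 by (auto simp: verify_def bit_symbol_def split: if_splits)
            assume "rd \<tau>4 3 \<noteq> 2"
            then show "decides L (prepare_counter ;; follow ;; rewind 3 ;; go_to_cell ;; answer (\<lambda>r. r 3 = 2)) \<tau>4 (verify x c)"
              using last[OF good ij] rd4 by (simp add: bit_symbol_def split: if_splits)
          qed
        qed
      qed
    qed
  qed
qed

lemma wf_verifier: "wf_prog 12 3 verifier"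
proof -
  have a: "wf_prog 12 3 (answer c)" for c
    by (simp add: answer_def bit_symbol_def)
  have u: "wf_prog 12 3 (unless c p) \<longleftrightarrow> wf_prog 12 3 p" for c p
    by (simp add: unless_def a)
  have "wf_prog 12 3 update_cell" "wf_prog 12 3 next_cell"
    by (simp_all add: update_cell_def next_cell_def wrap_column_def wrap_row_def count_def skip_def wf_simps)
  then show ?thesis
    by (simp add: verifier_def parse_input_def read_unary_def go_to_cell_def prepare_counter_def follow_def a u wf_simps)
qed

theorem verify_poly_time: "poly_time_decidable2 verify"
proof (rule poly_time_decidable2I[OF wf_verifier])
  fix x c :: "bool list"
  \<comment> \<open>The loop bound has to cover the \<open>(size_of x)\<^sup>2\<close> cells, both
    input words and the 5 symbols of the counter.\<close>
  let ?l = "length x + length c" and ?P = "[:0, 1:]\<^sup>2 + [:5, 1:] :: nat poly"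
  have "size_of x \<le> ?l" using length_rests(1)[of x] by simp
  then have 1: "(size_of x)\<^sup>2 \<le> ?l\<^sup>2" by (rule power_mono) simp
  have 2: "?l\<^sup>2 \<le> poly ?P ?l" by simp
  have "decides (poly ?P ?l) verifier (start [x, c]) (verify x c)"
    by (rule decides_verifier[OF _ le_trans[OF 1 2]]) simp_all
  then obtain \<sigma> where "runs (poly ?P ?l) verifier (start [x, c]) \<sigma>"
    "fst (\<sigma> 0) 0 = bit_symbol (verify x c)" "fst (\<sigma> 0) 1 = 0"
    unfolding decides_def by blast
  then show "\<exists>\<sigma>'. runs (poly ?P ?l) verifier (start [x, c]) \<sigma>' \<and> outputs (tapes_of 12 \<sigma>') [verify x c]"
    by (intro exI[of _ \<sigma>]) (simp add: outputs_def numeral_eq_Suc)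
qed simp_all

theorem AsyncUnstability_NP: "AsyncUnstability S22 \<in> NP"
  unfolding NP_def using verify_poly_time AsyncUnstability_iff_certificate by blast

theorem theorem6: "NP_complete (AsyncUnstability S22)"
  unfolding NP_complete_def using AsyncUnstability_NP AsyncUnstability_hard by blast

end
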